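(* Let $A,B,C$ be algebras and $R_1:B\otimes A\to A\otimes B$, $R_2:C\otimes B\to B\otimes C$, $R_3:C\otimes A\to A\otimes C$ be unital twisting maps satisfying the hexagon equation $$(A\otimes R_2)\circ(R_3\otimes B)\circ(C\otimes R_1)=(R_1\otimes C)\circ(B\otimes R_3)\circ(R_2\otimes A).$$ Then the extended twisting maps $\widetilde R_1:\Omega B\otimes\Omega A\to\Omega A\otimes\Omega B$, $\widetilde R_2:\Omega C\otimes\Omega B\to\Omega B\otimes\Omega C$, $\widetilde R_3:\Omega C\otimes\Omega A\to\Omega A\otimes\Omega C$ also satisfy the hexagon equation $$(\Omega A\otimes\widetilde R_2)\circ(\widetilde R_3\otimes\Omega B)\circ(\Omega C\otimes\widetilde R_1)=(\widetilde R_1\otimes\Omega C)\circ(\Omega B\otimes\widetilde R_3)\circ(\widetilde R_2\otimes\Omega A).$$ Moreover, $\Omega A\otimes_{\widetilde R_1}\Omega B\otimes_{\widetilde R_2}\Omega C$ is a differential graded algebra, with differential $$d=d_A\otimes\Omega B\otimes\Omega C+\varepsilon_A\otimes d_B\otimes\Omega C+\varepsilon_A\otimes\varepsilon_B\otimes d_C.$$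
   Context: Fix a field or commutative ring $k$; $\otimes=\otimes_k$; algebras are associative unital $k$-algebras and $\mu_A$ is the product of $A$. An object also denotes its identity map. A twisting map for algebras $A,B$ is a $k$-linear map $R:B\otimes A\to A\otimes B$ with $$R\circ(B\otimes\mu_A)=(\mu_A\otimes B)\circ(A\otimes R)\circ(R\otimes A),\qquad R\circ(\mu_B\otimes A)=(A\otimes\mu_B)\circ(R\otimes B)\circ(B\otimes R);$$ it is unital if $R(1\otimes a)=a\otimes1$, $R(b\otimes1)=1\otimes b$. $A\otimes_R B$ denotes $A\otimes B$ with product $(\mu_A\otimes\mu_B)\circ(A\otimes R\otimes B)$. If $R_1,R_2,R_3$ satisfy the hexagon equation then $A\otimes_{R_1}B\otimes_{R_2}C$ denotes the algebra $(A\otimes_{R_1}B)\otimes_{T_1}C$ with $T_1:=(A\otimes R_2)\circ(R_3\otimes B)$; the same notation is used for $\Omega A,\Omega B,\Omega C$ with the maps $\widetilde R_i$. $\Omega A=\bigoplus_{p\ge0}\Omega^pA$ is the differential graded algebra of universal differential forms on $A$ ($\Omega^0A=A$, generated as a graded differential algebra by $A$), with differential $d_A$; $\varepsilon_A$ is its grading map $\varepsilon_A(\omega)=(-1)^{|\omega|}\omega$ on homogeneous elements. Known fact/definition (Cap–Schichl–Vanžura): a unital twisting map $R:B\otimes A\to A\otimes B$ extends uniquely to a twisting map $\widetilde R:\Omega B\otimes\Omega A\to\Omega A\otimes\Omega B$ satisfying $$\widetilde R\circ(d_B\otimes\Omega A)=(\varepsilon_A\otimes d_B)\circ\widetilde R,\qquad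 \widetilde R\circ(\Omega B\otimes d_A)=(d_A\otimes\varepsilon_B)\circ\widetilde R,$$ and $\Omega A\otimes_{\widetilde R}\Omega B$ (with total degree) is a graded differential algebra with differential $d(\varphi\otimes\omega)=d_A\varphi\otimes\omega+(-1)^{|\varphi|}\varphi\otimes d_B\omega$. *)

theory Defs
  imports "HOL-Algebra.QuotRing" "HOL-Algebra.Module" "HOL.Hull"
begin

section \<open>Modules and algebras over a commutative ring\<close>

text \<open>The locale \<^locale>\<open>algebra\<close> of the library is restricted to commutative algebras;
  the following one is its counterpart for arbitrary associative unital algebras.\<close>

locale unital_algebra = module + ring M +
  assumes smult_mult_left:
      "\<lbrakk>a \<in> carrier R; x \<in> carrier M; y \<in> carrier M\<rbrakk> \<Longrightarrow>
        (a \<odot>\<^bsub>M\<^esub> x) \<otimes>\<^bsub>M\<^esub> y = a \<odot>\<^bsub>M\<^esub> (x \<otimes>\<^bsub>M\<^esub> y)"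
    and smult_mult_right:
      "\<lbrakk>a \<in> carrier R; x \<in> carrier M; y \<in> carrier M\<rbrakk> \<Longrightarrow>
        x \<otimes>\<^bsub>M\<^esub> (a \<odot>\<^bsub>M\<^esub> y) = a \<odot>\<^bsub>M\<^esub> (x \<otimes>\<^bsub>M\<^esub> y)"

definition linear_map :: "'k ring \<Rightarrow> ('k, 'a) module \<Rightarrow> ('k, 'b) module \<Rightarrow> ('a \<Rightarrow> 'b) \<Rightarrow> bool" where
  "linear_map k M N f \<longleftrightarrow>
     f \<in> carrier M \<rightarrow> carrier N \<and>
     (\<forall>x\<in>carrier M. \<forall>y\<in>carrier M. f (x \<oplus>\<^bsub>M\<^esub> y) = f x \<oplus>\<^bsub>N\<^esub> f y) \<and>
     (\<forall>r\<in>carrier k. \<forall>x\<in>carrier M. f (r \<odot>\<^bsub>M\<^esub> x) = r \<odot>\<^bsub>N\<^esub> f x)"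

definition submodule_span :: "'k ring \<Rightarrow> ('k, 'a) module \<Rightarrow> 'a set \<Rightarrow> 'a set" where
  "submodule_span k M S = (\<lambda>H. submodule H k M) hull S"

text \<open>The sign \<open>(-1)\<^sup>p x\<close>.\<close>

definition signed :: "('a, 'm) ring_scheme \<Rightarrow> nat \<Rightarrow> 'a \<Rightarrow> 'a" where
  "signed M p x = (if even p then x else \<ominus>\<^bsub>M\<^esub> x)"

text \<open>Quotients. For an algebra \<open>M\<close> and a two-sided ideal \<open>H\<close> this is the quotient algebra. For a
  module \<open>M\<close> and a submodule \<open>H\<close> it is the quotient module, the fields
  \<^const>\<open>mult\<close> and \<^const>\<open>one\<close> being meaningless in that case.\<close>

definition quotient_algebra :: "('k, 'a) module \<Rightarrow> 'a set \<Rightarrow> ('k, 'a set) module" where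
  "quotient_algebra M H =
     \<lparr>carrier = carrier (M Quot H), mult = mult (M Quot H), one = one (M Quot H),
      zero = zero (M Quot H), add = add (M Quot H),
      smult = (\<lambda>r X. \<Union>x\<in>X. H +>\<^bsub>M\<^esub> (r \<odot>\<^bsub>M\<^esub> x))\<rparr>"

text \<open>The map \<open>M/H \<rightarrow> M/H\<close> induced by an additive map \<open>f\<close> with \<open>f H \<subseteq> H\<close>.\<close>

definition quotient_map :: "('k, 'a) module \<Rightarrow> 'a set \<Rightarrow> ('a \<Rightarrow> 'a) \<Rightarrow> 'a set \<Rightarrow> 'a set" where
  "quotient_map M H f X = (\<Union>x\<in>X. H +>\<^bsub>M\<^esub> f x)"

section \<open>Free modules and free algebras\<close>

definition free_module :: "'k ring \<Rightarrow> 'x set \<Rightarrow> ('k, 'x \<Rightarrow> 'k) module" where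
  "free_module k X =
     \<lparr>carrier = {f. (\<forall>x. f x \<in> carrier k) \<and> (\<forall>x. x \<notin> X \<longrightarrow> f x = \<zero>\<^bsub>k\<^esub>) \<and>
                    finite {x. f x \<noteq> \<zero>\<^bsub>k\<^esub>}},
      mult = undefined, one = undefined,
      zero = (\<lambda>x. \<zero>\<^bsub>k\<^esub>), add = (\<lambda>f g x. f x \<oplus>\<^bsub>k\<^esub> g x),
      smult = (\<lambda>r f x. r \<otimes>\<^bsub>k\<^esub> f x)\<rparr>"

definition basis :: "'k ring \<Rightarrow> 'x \<Rightarrow> 'x \<Rightarrow> 'k" where
  "basis k x = (\<lambda>y. if y = x then \<one>\<^bsub>k\<^esub> else \<zero>\<^bsub>k\<^esub>)"

definition linear_extension :: "'k ring \<Rightarrow> ('k, 'a) module \<Rightarrow> ('x \<Rightarrow> 'a) \<Rightarrow> ('x \<Rightarrow> 'k) \<Rightarrow> 'a" where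
  "linear_extension k P f c = (\<Oplus>\<^bsub>P\<^esub>x\<in>{x. c x \<noteq> \<zero>\<^bsub>k\<^esub>}. c x \<odot>\<^bsub>P\<^esub> f x)"

text \<open>The free algebra \<open>k\<langle>X\<rangle>\<close>: words over \<open>X\<close> form a basis and the product is concatenation.\<close>

definition free_algebra :: "'k ring \<Rightarrow> 'x set \<Rightarrow> ('k, 'x list \<Rightarrow> 'k) module" where
  "free_algebra k X = (free_module k (lists X))
     \<lparr>mult := (\<lambda>f g w. \<Oplus>\<^bsub>k\<^esub>i\<in>{..length w}. f (take i w) \<otimes>\<^bsub>k\<^esub> g (drop i w)),
      one := basis k []\<rparr>"

section \<open>Tensor products\<close>

definition tensor_relations ::
  "'k ring \<Rightarrow> ('k, 'a) module \<Rightarrow> ('k, 'b) module \<Rightarrow> ('a \<times> 'b \<Rightarrow> 'k) set" where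
  "tensor_relations k M N =
     (let F = free_module k (carrier M \<times> carrier N); e = (\<lambda>x y. basis k (x, y)) in
      {e (x \<oplus>\<^bsub>M\<^esub> x') y \<ominus>\<^bsub>F\<^esub> (e x y \<oplus>\<^bsub>F\<^esub> e x' y) | x x' y.
         x \<in> carrier M \<and> x' \<in> carrier M \<and> y \<in> carrier N} \<union>
      {e x (y \<oplus>\<^bsub>N\<^esub> y') \<ominus>\<^bsub>F\<^esub> (e x y \<oplus>\<^bsub>F\<^esub> e x y') | x y y'.
         x \<in> carrier M \<and> y \<in> carrier N \<and> y' \<in> carrier N} \<union>
      {e (r \<odot>\<^bsub>M\<^esub> x) y \<ominus>\<^bsub>F\<^esub> r \<odot>\<^bsub>F\<^esub> e x y | r x y.
         r \<in> carrier k \<and> x \<in> carrier M \<and> y \<in> carrier N} \<union>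
      {e x (r \<odot>\<^bsub>N\<^esub> y) \<ominus>\<^bsub>F\<^esub> r \<odot>\<^bsub>F\<^esub> e x y | r x y.
         r \<in> carrier k \<and> x \<in> carrier M \<and> y \<in> carrier N})"

definition tensor_kernel ::
  "'k ring \<Rightarrow> ('k, 'a) module \<Rightarrow> ('k, 'b) module \<Rightarrow> ('a \<times> 'b \<Rightarrow> 'k) set" where
  "tensor_kernel k M N =
     submodule_span k (free_module k (carrier M \<times> carrier N)) (tensor_relations k M N)"

definition tensor ::
  "'k ring \<Rightarrow> ('k, 'a) module \<Rightarrow> ('k, 'b) module \<Rightarrow> ('k, ('a \<times> 'b \<Rightarrow> 'k) set) module" where
  "tensor k M N = quotient_algebra (free_module k (carrier M \<times> carrier N)) (tensor_kernel k M N)"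

definition pure ::
  "'k ring \<Rightarrow> ('k, 'a) module \<Rightarrow> ('k, 'b) module \<Rightarrow> 'a \<Rightarrow> 'b \<Rightarrow> ('a \<times> 'b \<Rightarrow> 'k) set" where
  "pure k M N x y =
     tensor_kernel k M N +>\<^bsub>free_module k (carrier M \<times> carrier N)\<^esub> basis k (x, y)"

text \<open>The linear map with values in \<open>P\<close> on a tensor product determined by a bilinear map \<open>f\<close>.
  The value does not depend on the chosen representative when \<open>f\<close> is bilinear.\<close>

definition tensor_lift ::
  "'k ring \<Rightarrow> ('k, 'c) module \<Rightarrow> ('a \<Rightarrow> 'b \<Rightarrow> 'c) \<Rightarrow> ('a \<times> 'b \<Rightarrow> 'k) set \<Rightarrow> 'c" where
  "tensor_lift k P f t = linear_extension k P (case_prod f) (SOME c. c \<in> t)"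

text \<open>\<open>f \<otimes> g\<close> for linear maps \<open>f\<close> into \<open>P\<close> and \<open>g\<close> into \<open>Q\<close>.\<close>

definition tensor_map ::
  "'k ring \<Rightarrow> ('k, 'c) module \<Rightarrow> ('k, 'd) module \<Rightarrow> ('a \<Rightarrow> 'c) \<Rightarrow> ('b \<Rightarrow> 'd) \<Rightarrow>
   ('a \<times> 'b \<Rightarrow> 'k) set \<Rightarrow> ('c \<times> 'd \<Rightarrow> 'k) set" where
  "tensor_map k P Q f g = tensor_lift k (tensor k P Q) (\<lambda>x y. pure k P Q (f x) (g y))"

text \<open>The canonical isomorphisms \<open>(M \<otimes> N) \<otimes> P \<rightarrow> M \<otimes> (N \<otimes> P)\<close> and back, which are implicit
  in the usual notation.\<close>

definition assoc_right ::
  "'k ring \<Rightarrow> ('k, 'a) module \<Rightarrow> ('k, 'b) module \<Rightarrow> ('k, 'c) module \<Rightarrow>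
   (('a \<times> 'b \<Rightarrow> 'k) set \<times> 'c \<Rightarrow> 'k) set \<Rightarrow> ('a \<times> ('b \<times> 'c \<Rightarrow> 'k) set \<Rightarrow> 'k) set" where
  "assoc_right k M N P =
     (let T = tensor k M (tensor k N P) in
      tensor_lift k T (\<lambda>t z.
        tensor_lift k T (\<lambda>x y. pure k M (tensor k N P) x (pure k N P y z)) t))"

definition assoc_left ::
  "'k ring \<Rightarrow> ('k, 'a) module \<Rightarrow> ('k, 'b) module \<Rightarrow> ('k, 'c) module \<Rightarrow>
   ('a \<times> ('b \<times> 'c \<Rightarrow> 'k) set \<Rightarrow> 'k) set \<Rightarrow> (('a \<times> 'b \<Rightarrow> 'k) set \<times> 'c \<Rightarrow> 'k) set" where
  "assoc_left k M N P =
     (let T = tensor k (tensor k M N) P in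
      tensor_lift k T (\<lambda>x t.
        tensor_lift k T (\<lambda>y z. pure k (tensor k M N) P (pure k M N x y) z) t))"

definition product_map :: "'k ring \<Rightarrow> ('k, 'a) module \<Rightarrow> ('a \<times> 'a \<Rightarrow> 'k) set \<Rightarrow> 'a" where
  "product_map k A = tensor_lift k A (\<lambda>x y. x \<otimes>\<^bsub>A\<^esub> y)"

section \<open>Twisting maps\<close>

text \<open>The types of the intermediate modules, with the associativity isomorphisms made explicit, are
  \<open>B \<otimes> (A \<otimes> A) \<rightarrow> (B \<otimes> A) \<otimes> A \<rightarrow> (A \<otimes> B) \<otimes> A \<rightarrow> A \<otimes> (B \<otimes> A) \<rightarrow> A \<otimes> (A \<otimes> B) \<rightarrow> (A \<otimes> A) \<otimes> B \<rightarrow> A \<otimes> B\<close>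
  for the first equation and
  \<open>(B \<otimes> B) \<otimes> A \<rightarrow> B \<otimes> (B \<otimes> A) \<rightarrow> B \<otimes> (A \<otimes> B) \<rightarrow> (B \<otimes> A) \<otimes> B \<rightarrow> (A \<otimes> B) \<otimes> B \<rightarrow> A \<otimes> (B \<otimes> B) \<rightarrow> A \<otimes> B\<close>
  for the second one.\<close>

definition twisting_map ::
  "'k ring \<Rightarrow> ('k, 'a) module \<Rightarrow> ('k, 'b) module \<Rightarrow>
   (('b \<times> 'a \<Rightarrow> 'k) set \<Rightarrow> ('a \<times> 'b \<Rightarrow> 'k) set) \<Rightarrow> bool" where
  "twisting_map k A B R \<longleftrightarrow>
     linear_map k (tensor k B A) (tensor k A B) R \<and>
     (\<forall>t\<in>carrier (tensor k B (tensor k A A)).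
        (R \<circ> tensor_map k B A id (product_map k A)) t =
        (tensor_map k A B (product_map k A) id \<circ> assoc_left k A A B \<circ>
         tensor_map k A (tensor k A B) id R \<circ> assoc_right k A B A \<circ>
         tensor_map k (tensor k A B) A R id \<circ> assoc_left k B A A) t) \<and>
     (\<forall>t\<in>carrier (tensor k (tensor k B B) A).
        (R \<circ> tensor_map k B A (product_map k B) id) t =
        (tensor_map k A B id (product_map k B) \<circ> assoc_right k A B B \<circ>
         tensor_map k (tensor k A B) B R id \<circ> assoc_left k B A B \<circ>
         tensor_map k B (tensor k A B) id R \<circ> assoc_right k B B A) t)"

definition unital_twisting_map ::
  "'k ring \<Rightarrow> ('k, 'a) module \<Rightarrow> ('k, 'b) module \<Rightarrow>
   (('b \<times> 'a \<Rightarrow> 'k) set \<Rightarrow> ('a \<times> 'b \<Rightarrow> 'k) set) \<Rightarrow> bool" where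
  "unital_twisting_map k A B R \<longleftrightarrow>
     twisting_map k A B R \<and>
     (\<forall>a\<in>carrier A. R (pure k B A \<one>\<^bsub>B\<^esub> a) = pure k A B a \<one>\<^bsub>B\<^esub>) \<and>
     (\<forall>b\<in>carrier B. R (pure k B A b \<one>\<^bsub>A\<^esub>) = pure k A B \<one>\<^bsub>A\<^esub> b)"

text \<open>The algebra \<open>A \<otimes>\<^sub>R B\<close>. Its product is the composite
  \<open>(A \<otimes> B) \<otimes> (A \<otimes> B) \<rightarrow> ((A \<otimes> B) \<otimes> A) \<otimes> B \<rightarrow> (A \<otimes> (B \<otimes> A)) \<otimes> B \<rightarrow> (A \<otimes> (A \<otimes> B)) \<otimes> B \<rightarrow>
   ((A \<otimes> A) \<otimes> B) \<otimes> B \<rightarrow> (A \<otimes> A) \<otimes> (B \<otimes> B) \<rightarrow> A \<otimes> B\<close>.\<close>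

definition twisted_tensor ::
  "'k ring \<Rightarrow> ('k, 'a) module \<Rightarrow> ('k, 'b) module \<Rightarrow>
   (('b \<times> 'a \<Rightarrow> 'k) set \<Rightarrow> ('a \<times> 'b \<Rightarrow> 'k) set) \<Rightarrow> ('k, ('a \<times> 'b \<Rightarrow> 'k) set) module" where
  "twisted_tensor k A B R = (tensor k A B)
     \<lparr>mult := (\<lambda>s t.
        (tensor_map k A B (product_map k A) (product_map k B) \<circ>
         assoc_right k (tensor k A A) B B \<circ>
         tensor_map k (tensor k (tensor k A A) B) B (assoc_left k A A B) id \<circ>
         tensor_map k (tensor k A (tensor k A B)) B (tensor_map k A (tensor k A B) id R) id \<circ>
         tensor_map k (tensor k A (tensor k B A)) B (assoc_right k A B A) id \<circ>
         assoc_left k (tensor k A B) A B)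
        (pure k (tensor k A B) (tensor k A B) s t)),
      one := pure k A B \<one>\<^bsub>A\<^esub> \<one>\<^bsub>B\<^esub>\<rparr>"

text \<open>The hexagon equation; both sides are maps \<open>C \<otimes> (B \<otimes> A) \<rightarrow> A \<otimes> (B \<otimes> C)\<close>.\<close>

definition hexagon ::
  "'k ring \<Rightarrow> ('k, 'a) module \<Rightarrow> ('k, 'b) module \<Rightarrow> ('k, 'c) module \<Rightarrow>
   (('b \<times> 'a \<Rightarrow> 'k) set \<Rightarrow> ('a \<times> 'b \<Rightarrow> 'k) set) \<Rightarrow>
   (('c \<times> 'b \<Rightarrow> 'k) set \<Rightarrow> ('b \<times> 'c \<Rightarrow> 'k) set) \<Rightarrow>
   (('c \<times> 'a \<Rightarrow> 'k) set \<Rightarrow> ('a \<times> 'c \<Rightarrow> 'k) set) \<Rightarrow> bool" where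
  "hexagon k A B C R1 R2 R3 \<longleftrightarrow>
     (\<forall>t\<in>carrier (tensor k C (tensor k B A)).
        (tensor_map k A (tensor k B C) id R2 \<circ> assoc_right k A C B \<circ>
         tensor_map k (tensor k A C) B R3 id \<circ> assoc_left k C A B \<circ>
         tensor_map k C (tensor k A B) id R1) t =
        (assoc_right k A B C \<circ> tensor_map k (tensor k A B) C R1 id \<circ>
         assoc_left k B A C \<circ> tensor_map k B (tensor k A C) id R3 \<circ>
         assoc_right k B C A \<circ> tensor_map k (tensor k B C) A R2 id \<circ>
         assoc_left k C B A) t)"

text \<open>The map \<open>T\<^sub>1 = (A \<otimes> R\<^sub>2) \<circ> (R\<^sub>3 \<otimes> B) : C \<otimes> (A \<otimes> B) \<rightarrow> (A \<otimes> B) \<otimes> C\<close> and the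
  algebra \<open>(A \<otimes> B) \<otimes> C\<close> built from it.\<close>

definition iterated_twist ::
  "'k ring \<Rightarrow> ('k, 'a) module \<Rightarrow> ('k, 'b) module \<Rightarrow> ('k, 'c) module \<Rightarrow>
   (('c \<times> 'b \<Rightarrow> 'k) set \<Rightarrow> ('b \<times> 'c \<Rightarrow> 'k) set) \<Rightarrow>
   (('c \<times> 'a \<Rightarrow> 'k) set \<Rightarrow> ('a \<times> 'c \<Rightarrow> 'k) set) \<Rightarrow>
   ('c \<times> ('a \<times> 'b \<Rightarrow> 'k) set \<Rightarrow> 'k) set \<Rightarrow> (('a \<times> 'b \<Rightarrow> 'k) set \<times> 'c \<Rightarrow> 'k) set" where
  "iterated_twist k A B C R2 R3 =
     assoc_left k A B C \<circ> tensor_map k A (tensor k B C) id R2 \<circ> assoc_right k A C B \<circ>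
     tensor_map k (tensor k A C) B R3 id \<circ> assoc_left k C A B"

definition iterated_twisted_tensor ::
  "'k ring \<Rightarrow> ('k, 'a) module \<Rightarrow> ('k, 'b) module \<Rightarrow> ('k, 'c) module \<Rightarrow>
   (('b \<times> 'a \<Rightarrow> 'k) set \<Rightarrow> ('a \<times> 'b \<Rightarrow> 'k) set) \<Rightarrow>
   (('c \<times> 'b \<Rightarrow> 'k) set \<Rightarrow> ('b \<times> 'c \<Rightarrow> 'k) set) \<Rightarrow>
   (('c \<times> 'a \<Rightarrow> 'k) set \<Rightarrow> ('a \<times> 'c \<Rightarrow> 'k) set) \<Rightarrow>
   ('k, (('a \<times> 'b \<Rightarrow> 'k) set \<times> 'c \<Rightarrow> 'k) set) module" where
  "iterated_twisted_tensor k A B C R1 R2 R3 =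
     twisted_tensor k (twisted_tensor k A B R1) C (iterated_twist k A B C R2 R3)"

section \<open>Differential graded algebras\<close>

locale dg_algebra = unital_algebra +
  fixes G :: "nat \<Rightarrow> 'c set" and d :: "'c \<Rightarrow> 'c"
  assumes grade_submodule: "submodule (G p) R M"
    and grade_decomposition:
      "x \<in> carrier M \<Longrightarrow>
        \<exists>!c. (\<forall>p. c p \<in> G p) \<and> finite {p. c p \<noteq> \<zero>\<^bsub>M\<^esub>} \<and>
             x = (\<Oplus>\<^bsub>M\<^esub>p\<in>{p. c p \<noteq> \<zero>\<^bsub>M\<^esub>}. c p)"
    and grade_one: "\<one>\<^bsub>M\<^esub> \<in> G 0"
    and grade_mult: "\<lbrakk>x \<in> G p; y \<in> G q\<rbrakk> \<Longrightarrow> x \<otimes>\<^bsub>M\<^esub> y \<in> G (p + q)"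
    and d_linear: "linear_map R M M d"
    and d_grade: "x \<in> G p \<Longrightarrow> d x \<in> G (Suc p)"
    and d_d: "x \<in> carrier M \<Longrightarrow> d (d x) = \<zero>\<^bsub>M\<^esub>"
    and d_mult:
      "\<lbrakk>x \<in> G p; y \<in> carrier M\<rbrakk> \<Longrightarrow>
        d (x \<otimes>\<^bsub>M\<^esub> y) = d x \<otimes>\<^bsub>M\<^esub> y \<oplus>\<^bsub>M\<^esub> signed M p (x \<otimes>\<^bsub>M\<^esub> d y)"

text \<open>The total grading on a tensor product of graded modules.\<close>

definition tensor_grading ::
  "'k ring \<Rightarrow> ('k, 'a) module \<Rightarrow> ('k, 'b) module \<Rightarrow> (nat \<Rightarrow> 'a set) \<Rightarrow> (nat \<Rightarrow> 'b set) \<Rightarrow>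
   nat \<Rightarrow> ('a \<times> 'b \<Rightarrow> 'k) set set" where
  "tensor_grading k M N G H n =
     submodule_span k (tensor k M N) {pure k M N x y | x y p q. x \<in> G p \<and> y \<in> H q \<and> p + q = n}"

section \<open>Universal differential forms\<close>

text \<open>\<open>\<Omega>A\<close> is presented as the algebra generated by symbols \<open>a\<close> (here \<open>Elt a\<close>) and \<open>da\<close> (here
  \<open>Dif a\<close>), for \<open>a \<in> A\<close>, subject to the relations which say that \<open>a \<mapsto> Elt a\<close> is a homomorphism of
  unital algebras and that \<open>a \<mapsto> Dif a\<close> is linear and satisfies the Leibniz rule. The degree of a
  word is its number of symbols \<open>Dif a\<close>.\<close>

datatype 'a form_symbol = Elt 'a | Dif 'a

definition form_words_algebra ::
  "'k ring \<Rightarrow> ('k, 'a) module \<Rightarrow> ('k, 'a form_symbol list \<Rightarrow> 'k) module" where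
  "form_words_algebra k A = free_algebra k (Elt ` carrier A \<union> Dif ` carrier A)"

definition form_relations ::
  "'k ring \<Rightarrow> ('k, 'a) module \<Rightarrow> ('a form_symbol list \<Rightarrow> 'k) set" where
  "form_relations k A =
     (let F = form_words_algebra k A;
          e = (\<lambda>a. basis k [Elt a]); d = (\<lambda>a. basis k [Dif a]) in
      {e \<one>\<^bsub>A\<^esub> \<ominus>\<^bsub>F\<^esub> \<one>\<^bsub>F\<^esub>} \<union>
      {e (a \<oplus>\<^bsub>A\<^esub> b) \<ominus>\<^bsub>F\<^esub> (e a \<oplus>\<^bsub>F\<^esub> e b) | a b. a \<in> carrier A \<and> b \<in> carrier A} \<union>
      {e (r \<odot>\<^bsub>A\<^esub> a) \<ominus>\<^bsub>F\<^esub> r \<odot>\<^bsub>F\<^esub> e a | r a. r \<in> carrier k \<and> a \<in> carrier A} \<union>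
      {e (a \<otimes>\<^bsub>A\<^esub> b) \<ominus>\<^bsub>F\<^esub> e a \<otimes>\<^bsub>F\<^esub> e b | a b. a \<in> carrier A \<and> b \<in> carrier A} \<union>
      {d (a \<oplus>\<^bsub>A\<^esub> b) \<ominus>\<^bsub>F\<^esub> (d a \<oplus>\<^bsub>F\<^esub> d b) | a b. a \<in> carrier A \<and> b \<in> carrier A} \<union>
      {d (r \<odot>\<^bsub>A\<^esub> a) \<ominus>\<^bsub>F\<^esub> r \<odot>\<^bsub>F\<^esub> d a | r a. r \<in> carrier k \<and> a \<in> carrier A} \<union>
      {d (a \<otimes>\<^bsub>A\<^esub> b) \<ominus>\<^bsub>F\<^esub> (d a \<otimes>\<^bsub>F\<^esub> e b \<oplus>\<^bsub>F\<^esub> e a \<otimes>\<^bsub>F\<^esub> d b) | a b.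
         a \<in> carrier A \<and> b \<in> carrier A})"

definition form_ideal ::
  "'k ring \<Rightarrow> ('k, 'a) module \<Rightarrow> ('a form_symbol list \<Rightarrow> 'k) set" where
  "form_ideal k A = Idl\<^bsub>form_words_algebra k A\<^esub> (form_relations k A)"

definition forms ::
  "'k ring \<Rightarrow> ('k, 'a) module \<Rightarrow> ('k, ('a form_symbol list \<Rightarrow> 'k) set) module" where
  "forms k A = quotient_algebra (form_words_algebra k A) (form_ideal k A)"

definition form_of ::
  "'k ring \<Rightarrow> ('k, 'a) module \<Rightarrow> 'a \<Rightarrow> ('a form_symbol list \<Rightarrow> 'k) set" where
  "form_of k A a = form_ideal k A +>\<^bsub>form_words_algebra k A\<^esub> basis k [Elt a]"

fun word_degree :: "'a form_symbol list \<Rightarrow> nat" where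
  "word_degree [] = 0"
| "word_degree (Elt a # w) = word_degree w"
| "word_degree (Dif a # w) = Suc (word_degree w)"

definition forms_grading ::
  "'k ring \<Rightarrow> ('k, 'a) module \<Rightarrow> nat \<Rightarrow> ('a form_symbol list \<Rightarrow> 'k) set set" where
  "forms_grading k A p =
     {form_ideal k A +>\<^bsub>form_words_algebra k A\<^esub> f | f.
        f \<in> carrier (form_words_algebra k A) \<and> (\<forall>w. f w \<noteq> \<zero>\<^bsub>k\<^esub> \<longrightarrow> word_degree w = p)}"

text \<open>The differential is determined by \<open>a \<mapsto> da\<close>, \<open>da \<mapsto> 0\<close> and the graded Leibniz rule.\<close>

fun word_diff ::
  "'k ring \<Rightarrow> ('k, 'a) module \<Rightarrow> 'a form_symbol list \<Rightarrow> 'a form_symbol list \<Rightarrow> 'k" where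
  "word_diff k A [] = \<zero>\<^bsub>form_words_algebra k A\<^esub>"
| "word_diff k A (Elt a # w) =
     basis k (Dif a # w) \<oplus>\<^bsub>form_words_algebra k A\<^esub>
     (basis k [Elt a] \<otimes>\<^bsub>form_words_algebra k A\<^esub> word_diff k A w)"
| "word_diff k A (Dif a # w) =
     \<ominus>\<^bsub>form_words_algebra k A\<^esub>
     (basis k [Dif a] \<otimes>\<^bsub>form_words_algebra k A\<^esub> word_diff k A w)"

definition forms_diff ::
  "'k ring \<Rightarrow> ('k, 'a) module \<Rightarrow>
   ('a form_symbol list \<Rightarrow> 'k) set \<Rightarrow> ('a form_symbol list \<Rightarrow> 'k) set" where
  "forms_diff k A =
     quotient_map (form_words_algebra k A) (form_ideal k A)
       (linear_extension k (form_words_algebra k A) (word_diff k A))"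

text \<open>The grading map \<open>\<epsilon>\<^sub>A\<close>, given by \<open>\<epsilon>\<^sub>A(\<omega>) = (-1)\<^sup>p \<omega>\<close> for \<open>\<omega>\<close> of degree \<open>p\<close>.\<close>

definition forms_sign ::
  "'k ring \<Rightarrow> ('k, 'a) module \<Rightarrow>
   ('a form_symbol list \<Rightarrow> 'k) set \<Rightarrow> ('a form_symbol list \<Rightarrow> 'k) set" where
  "forms_sign k A =
     quotient_map (form_words_algebra k A) (form_ideal k A)
       (\<lambda>f w. signed k (word_degree w) (f w))"

text \<open>\<open>S\<close> is the extension of the twisting map \<open>R : B \<otimes> A \<rightarrow> A \<otimes> B\<close> to differential forms.\<close>

definition forms_twisting_map ::
  "'k ring \<Rightarrow> ('k, 'a) module \<Rightarrow> ('k, 'b) module \<Rightarrow>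
   (('b \<times> 'a \<Rightarrow> 'k) set \<Rightarrow> ('a \<times> 'b \<Rightarrow> 'k) set) \<Rightarrow>
   ((('b form_symbol list \<Rightarrow> 'k) set \<times> ('a form_symbol list \<Rightarrow> 'k) set \<Rightarrow> 'k) set \<Rightarrow>
    (('a form_symbol list \<Rightarrow> 'k) set \<times> ('b form_symbol list \<Rightarrow> 'k) set \<Rightarrow> 'k) set) \<Rightarrow> bool" where
  "forms_twisting_map k A B R S \<longleftrightarrow>
     twisting_map k (forms k A) (forms k B) S \<and>
     (\<forall>t\<in>carrier (tensor k B A).
        S (tensor_map k (forms k B) (forms k A) (form_of k B) (form_of k A) t) =
        tensor_map k (forms k A) (forms k B) (form_of k A) (form_of k B) (R t)) \<and>
     (\<forall>t\<in>carrier (tensor k (forms k B) (forms k A)).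
        (S \<circ> tensor_map k (forms k B) (forms k A) (forms_diff k B) id) t =
        (tensor_map k (forms k A) (forms k B) (forms_sign k A) (forms_diff k B) \<circ> S) t) \<and>
     (\<forall>t\<in>carrier (tensor k (forms k B) (forms k A)).
        (S \<circ> tensor_map k (forms k B) (forms k A) id (forms_diff k A)) t =
        (tensor_map k (forms k A) (forms k B) (forms_diff k A) (forms_sign k B) \<circ> S) t)"

section \<open>The total structure on three algebras of forms\<close>

definition triple_forms_grading ::
  "'k ring \<Rightarrow> ('k, 'a) module \<Rightarrow> ('k, 'b) module \<Rightarrow> ('k, 'c) module \<Rightarrow> nat \<Rightarrow>
   ((('a form_symbol list \<Rightarrow> 'k) set \<times> ('b form_symbol list \<Rightarrow> 'k) set \<Rightarrow> 'k) set
     \<times> ('c form_symbol list \<Rightarrow> 'k) set \<Rightarrow> 'k) set set" where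
  "triple_forms_grading k A B C =
     tensor_grading k (tensor k (forms k A) (forms k B)) (forms k C)
       (tensor_grading k (forms k A) (forms k B) (forms_grading k A) (forms_grading k B))
       (forms_grading k C)"

definition triple_forms_diff ::
  "'k ring \<Rightarrow> ('k, 'a) module \<Rightarrow> ('k, 'b) module \<Rightarrow> ('k, 'c) module \<Rightarrow>
   ((('a form_symbol list \<Rightarrow> 'k) set \<times> ('b form_symbol list \<Rightarrow> 'k) set \<Rightarrow> 'k) set
     \<times> ('c form_symbol list \<Rightarrow> 'k) set \<Rightarrow> 'k) set \<Rightarrow>
   ((('a form_symbol list \<Rightarrow> 'k) set \<times> ('b form_symbol list \<Rightarrow> 'k) set \<Rightarrow> 'k) set
     \<times> ('c form_symbol list \<Rightarrow> 'k) set \<Rightarrow> 'k) set" where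
  "triple_forms_diff k A B C t =
     (let AB = tensor k (forms k A) (forms k B);
          map3 = (\<lambda>f g h. tensor_map k AB (forms k C) (tensor_map k (forms k A) (forms k B) f g) h) in
      map3 (forms_diff k A) id id t \<oplus>\<^bsub>tensor k AB (forms k C)\<^esub>
      map3 (forms_sign k A) (forms_diff k B) id t \<oplus>\<^bsub>tensor k AB (forms k C)\<^esub>
      map3 (forms_sign k A) (forms_sign k B) (forms_diff k C) t)"

end

theory Submission
  imports Defs
begin

text \<open>
  A linear map on a tensor product is determined by its values on pure tensors.  Writing \<open>\<Sum> f x y\<close>, summed over \<open>t = \<Sum> x \<otimes> y\<close>, for
  \<^term>\<open>tensor_lift k P f t\<close> (Sweedler notation), both sides of the hexagon equation become iterated
  sums, and the twisting axioms show that the equation passes from two triples of arguments to a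
  triple in which one argument is a product.  It also passes from \<open>\<omega>\<close> to \<open>d\<omega>\<close> in each argument,
  because the extended maps preserve the bidegree and hence commute with the signs \<open>\<epsilon>\<close>.  Since
  \<open>\<Omega>A\<close> is generated by \<open>A\<close> and \<open>dA\<close>, the hexagon equation for \<open>R\<^sub>1, R\<^sub>2, R\<^sub>3\<close> implies the one for
  the extended maps.  For any twisting map compatible with gradings and differentials the twisted
  tensor product is a differential graded algebra; by the hexagon equation this applies to
  \<open>\<Omega>A \<otimes> \<Omega>B\<close> and \<open>\<Omega>C\<close> with the iterated twisting map.
\<close>

section \<open>Linear maps, spans and quotients\<close>

text \<open>Two facts that carry the argument are not among the assumptions on the extended maps:
  that they preserve the bidegree and that they are unital. Both are inherited in degree zero from
  the given maps, and they spread from there because forms are generated by degree zero and its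
  differentials.

  The obstacle in the hexagon equation is that twisting \<open>c\<close> past \<open>b\<close>
  replaces both by the components of a tensor. An induction on one argument therefore calls for the
  equation at other values of the remaining arguments. Preservation of the bidegree controls these
  values: the components that replace a \<open>b\<close> or a \<open>c\<close> of degree zero can
  again be taken of degree zero. This dictates the order in which the arguments are freed:
  \<open>a\<close> while \<open>b\<close> and \<open>c\<close> have degree zero, \<open>b\<close>
  while \<open>c\<close> has degree zero and \<open>a\<close> is arbitrary, and \<open>c\<close>
  last.

  Since the equation has to be used in the middle of longer chains of sums, it is always applied
  after an arbitrary trilinear map, which stands for the rest of the chain.\<close>

lemma linear_mapI:
  assumes "\<And>x. x \<in> carrier M \<Longrightarrow> f x \<in> carrier N"
    and "\<And>x y. \<lbrakk>x \<in> carrier M; y \<in> carrier M\<rbrakk> \<Longrightarrow> f (x \<oplus>\<^bsub>M\<^esub> y) = f x \<oplus>\<^bsub>N\<^esub> f y"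
    and "\<And>r x. \<lbrakk>r \<in> carrier k; x \<in> carrier M\<rbrakk> \<Longrightarrow> f (r \<odot>\<^bsub>M\<^esub> x) = r \<odot>\<^bsub>N\<^esub> f x"
  shows "linear_map k M N f"
  using assms by (auto simp: linear_map_def)

lemma linear_mapD:
  assumes "linear_map k M N f"
  shows "x \<in> carrier M \<Longrightarrow> f x \<in> carrier N"
    and "\<lbrakk>x \<in> carrier M; y \<in> carrier M\<rbrakk> \<Longrightarrow> f (x \<oplus>\<^bsub>M\<^esub> y) = f x \<oplus>\<^bsub>N\<^esub> f y"
    and "\<lbrakk>r \<in> carrier k; x \<in> carrier M\<rbrakk> \<Longrightarrow> f (r \<odot>\<^bsub>M\<^esub> x) = r \<odot>\<^bsub>N\<^esub> f x"
  using assms by (auto simp: linear_map_def)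

lemma linear_map_cong:
  assumes "\<And>x. x \<in> carrier M \<Longrightarrow> f x = g x" and "linear_map k M N f" and "module k M"
  shows "linear_map k M N g"
proof -
  interpret M: module k M by fact
  show ?thesis using assms(1) linear_mapD[OF assms(2)]
    by (intro linear_mapI) (metis, metis M.add.m_closed, metis M.smult_closed)
qed

lemma linear_map_id: "linear_map k M M (\<lambda>x. x)"
  by (rule linear_mapI) auto

lemma linear_map_comp:
  assumes "linear_map k N P g" and "linear_map k M N f"
  shows "linear_map k M P (\<lambda>x. g (f x))"
  using linear_mapD[OF assms(1)] linear_mapD[OF assms(2)] by (intro linear_mapI) auto

lemma linear_map_0:
  assumes "module k M" and "module k N" and "linear_map k M N f"
  shows "f \<zero>\<^bsub>M\<^esub> = \<zero>\<^bsub>N\<^esub>"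
proof -
  interpret M: module k M by fact
  interpret N: module k N by fact
  have "f (\<zero>\<^bsub>k\<^esub> \<odot>\<^bsub>M\<^esub> \<zero>\<^bsub>M\<^esub>) = \<zero>\<^bsub>k\<^esub> \<odot>\<^bsub>N\<^esub> f \<zero>\<^bsub>M\<^esub>"
    by (rule linear_mapD(3)[OF assms(3)]) auto
  then show ?thesis using linear_mapD(1)[OF assms(3)] by simp
qed

lemma linear_map_uminus:
  assumes "module k M" and "module k N" and "linear_map k M N f" and "x \<in> carrier M"
  shows "f (\<ominus>\<^bsub>M\<^esub> x) = \<ominus>\<^bsub>N\<^esub> f x"
proof -
  interpret M: module k M by fact
  interpret N: module k N by fact
  have "f x \<oplus>\<^bsub>N\<^esub> f (\<ominus>\<^bsub>M\<^esub> x) = \<zero>\<^bsub>N\<^esub>"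
    using assms linear_map_0[OF assms(1-3)] linear_mapD(2)[OF assms(3), symmetric]
    by (simp add: M.r_neg)
  then show ?thesis using linear_mapD(1)[OF assms(3)] assms(4)
    by (metis M.a_inv_closed N.add.inv_equality N.a_comm)
qed

lemma linear_map_minus:
  assumes "module k M" and "module k N" and "linear_map k M N f"
    and "x \<in> carrier M" and "y \<in> carrier M"
  shows "f (x \<ominus>\<^bsub>M\<^esub> y) = f x \<ominus>\<^bsub>N\<^esub> f y"
proof -
  interpret M: module k M by fact
  interpret N: module k N by fact
  show ?thesis using assms linear_mapD[OF assms(3)] linear_map_uminus[OF assms(1-3)]
    by (simp add: a_minus_def)
qed

lemma linear_map_finsum:
  assumes "module k M" and "module k N" and "linear_map k M N f"
    and "finite I" and "\<And>i. i \<in> I \<Longrightarrow> g i \<in> carrier M"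
  shows "f (\<Oplus>\<^bsub>M\<^esub>i\<in>I. g i) = (\<Oplus>\<^bsub>N\<^esub>i\<in>I. f (g i))"
proof -
  interpret M: module k M by fact
  interpret N: module k N by fact
  show ?thesis using assms(4,5)
  proof (induction I rule: finite_induct)
    case empty show ?case using linear_map_0[OF assms(1-3)] by simp
  next
    case (insert i I)
    then show ?case using linear_mapD[OF assms(3)] by (simp add: Pi_def)
  qed
qed

lemma linear_map_zero:
  assumes "module k N" shows "linear_map k M N (\<lambda>x. \<zero>\<^bsub>N\<^esub>)"
proof -
  interpret N: module k N by fact
  show ?thesis by (intro linear_mapI) auto
qed

lemma linear_map_add:
  assumes "module k M" and "module k N" and "linear_map k M N f" and "linear_map k M N g"
  shows "linear_map k M N (\<lambda>x. f x \<oplus>\<^bsub>N\<^esub> g x)"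
proof -
  interpret M: module k M by fact
  interpret N: module k N by fact
  show ?thesis using linear_mapD[OF assms(3)] linear_mapD[OF assms(4)]
    by (intro linear_mapI) (auto simp: N.smult_r_distr N.a_ac)
qed

lemma linear_map_neg:
  assumes "module k M" and "module k N" and "linear_map k M N f"
  shows "linear_map k M N (\<lambda>x. \<ominus>\<^bsub>N\<^esub> f x)"
proof -
  interpret M: module k M by fact
  interpret N: module k N by fact
  show ?thesis using linear_mapD[OF assms(3)]
    by (intro linear_mapI) (auto simp: N.smult_r_minus N.minus_add)
qed

lemma linear_map_signed:
  assumes "module k M" and "module k N" and "linear_map k M N f"
  shows "linear_map k M N (\<lambda>x. signed N p (f x))"
  using linear_map_neg[OF assms] assms(3) by (cases "even p") (simp_all add: signed_def)

lemma linear_map_smult: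
  assumes "module k M" and "module k N" and "linear_map k M N f" and "r \<in> carrier k"
  shows "linear_map k M N (\<lambda>x. r \<odot>\<^bsub>N\<^esub> f x)"
proof -
  interpret M: module k M by fact
  interpret N: module k N by fact
  show ?thesis using linear_mapD[OF assms(3)] assms(4)
    by (intro linear_mapI)
      (auto simp: N.smult_r_distr N.smult_assoc1[symmetric] M.R.m_comm)
qed

lemma linear_map_finsum_maps:
  assumes "module k M" and "module k N" and "finite I"
    and "\<And>i. i \<in> I \<Longrightarrow> linear_map k M N (f i)"
  shows "linear_map k M N (\<lambda>x. \<Oplus>\<^bsub>N\<^esub>i\<in>I. f i x)"
  using assms(3,4)
proof (induction I rule: finite_induct)
  case empty
  interpret N: module k N by fact
  show ?case using linear_map_zero[OF assms(2)] by simp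
next
  case (insert i I)
  interpret M: module k M by fact
  interpret N: module k N by fact
  have *: "linear_map k M N (\<lambda>x. f i x \<oplus>\<^bsub>N\<^esub> (\<Oplus>\<^bsub>N\<^esub>i\<in>I. f i x))"
    by (rule linear_map_add) (use assms insert in auto)
  have "f j x \<in> carrier N" if "j \<in> insert i I" "x \<in> carrier M" for j x
    using linear_mapD(1)[OF insert.prems] that by blast
  then show ?case
    by (intro linear_map_cong[OF _ * assms(1)] N.finsum_insert[symmetric] insert.hyps) auto
qed

lemma submoduleI':
  assumes "module k M" and "H \<subseteq> carrier M" and "\<zero>\<^bsub>M\<^esub> \<in> H"
    and "\<And>x y. \<lbrakk>x \<in> H; y \<in> H\<rbrakk> \<Longrightarrow> x \<oplus>\<^bsub>M\<^esub> y \<in> H"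
    and "\<And>r x. \<lbrakk>r \<in> carrier k; x \<in> H\<rbrakk> \<Longrightarrow> r \<odot>\<^bsub>M\<^esub> x \<in> H"
  shows "submodule H k M"
proof -
  interpret M: module k M by fact
  \<comment> \<open>Negatives are the multiples by \<open>\<ominus> \<one>\<close>, so closure under
    scalars supplies them.\<close>
  have "\<ominus>\<^bsub>M\<^esub> x \<in> H" if "x \<in> H" for x
    using assms(2) assms(5)[of "\<ominus>\<^bsub>k\<^esub> \<one>\<^bsub>k\<^esub>" x] M.smult_l_minus[of "\<one>\<^bsub>k\<^esub>" x] that by auto
  with assms show ?thesis by (intro M.submoduleI) auto
qed

lemma submoduleD:
  assumes "submodule H k M"
  shows "x \<in> H \<Longrightarrow> x \<in> carrier M" and "\<zero>\<^bsub>M\<^esub> \<in> H"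
    and "\<lbrakk>x \<in> H; y \<in> H\<rbrakk> \<Longrightarrow> x \<oplus>\<^bsub>M\<^esub> y \<in> H"
    and "\<lbrakk>r \<in> carrier k; x \<in> H\<rbrakk> \<Longrightarrow> r \<odot>\<^bsub>M\<^esub> x \<in> H"
proof -
  interpret submodule H k M by fact
  show "x \<in> H \<Longrightarrow> x \<in> carrier M" using subset by auto
  show "\<zero>\<^bsub>M\<^esub> \<in> H" using one_closed by simp
  show "\<lbrakk>x \<in> H; y \<in> H\<rbrakk> \<Longrightarrow> x \<oplus>\<^bsub>M\<^esub> y \<in> H" using m_closed by simp
  show "\<lbrakk>r \<in> carrier k; x \<in> H\<rbrakk> \<Longrightarrow> r \<odot>\<^bsub>M\<^esub> x \<in> H" by simp
qed

lemma submodule_signed: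
  assumes "module k M" and "submodule H k M" and "x \<in> H"
  shows "signed M p x \<in> H"
  using module.submoduleE(3)[OF assms(1,2)] assms(3) by (auto simp: signed_def)

lemma submodule_carrier: "module k M \<Longrightarrow> submodule (carrier M) k M"
  by (rule module.carrier_is_submodule)

lemma submodule_zero: "module k M \<Longrightarrow> submodule {\<zero>\<^bsub>M\<^esub>} k M"
proof -
  assume "module k M"
  then interpret M: module k M .
  show ?thesis by (rule submoduleI'[OF M.module_axioms]) auto
qed

lemma submodule_vimage:
  assumes "module k M" and "module k N" and "linear_map k M N f" and "submodule H k N"
  shows "submodule {x \<in> carrier M. f x \<in> H} k M"
proof -
  interpret M: module k M by fact
  show ?thesis using linear_mapD[OF assms(3)] linear_map_0[OF assms(1-3)] submoduleD[OF assms(4)]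
    by (intro submoduleI' assms(1)) auto
qed

lemma submodule_equalizer:
  assumes "module k M" and "module k N" and "linear_map k M N f" and "linear_map k M N g"
  shows "submodule {x \<in> carrier M. f x = g x} k M"
proof -
  interpret M: module k M by fact
  show ?thesis using linear_mapD[OF assms(3)] linear_map_0[OF assms(1-3)]
     linear_mapD[OF assms(4)] linear_map_0[OF assms(1,2,4)]
    by (intro submoduleI' assms(1)) auto
qed

lemma submodule_Inter:
  assumes "module k M" and "\<And>H. H \<in> F \<Longrightarrow> submodule H k M" and "F \<noteq> {}"
  shows "submodule (\<Inter>F) k M"
proof (rule submoduleI'[OF assms(1)])
  obtain H where "H \<in> F" using assms(3) by blast
  then show "\<Inter>F \<subseteq> carrier M" using submoduleD(1)[OF assms(2)] by blast
qed (use submoduleD(2-)[OF assms(2)] in simp_all)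

text \<open>Arguments by generation carry a condition quantified over the remaining variables, and
  this keeps such a condition a submodule. The intersection with \<open>carrier M\<close> covers an
  empty index set; several variables are bundled into one index by taking pairs.\<close>

lemma submodule_Collect_ball:
  assumes "module k M" and "\<And>i. i \<in> I \<Longrightarrow> submodule {x \<in> carrier M. P i x} k M"
  shows "submodule {x \<in> carrier M. \<forall>i\<in>I. P i x} k M"
proof -
  interpret M: module k M by fact
  show ?thesis
    by (rule submoduleI'[OF assms(1)]) (use submoduleD[OF assms(2)] in auto)
qed

lemma submodule_Collect_conj:
  assumes "module k M" and "submodule H k M" and "submodule {x \<in> carrier M. Q x} k M"
  shows "submodule {x \<in> H. Q x} k M"
proof (rule submoduleI'[OF assms(1)])
  note H = submoduleD[OF assms(2)] and Q = submoduleD[OF assms(3), simplified]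
  show "{x \<in> H. Q x} \<subseteq> carrier M" using H(1) by blast
  show "\<zero>\<^bsub>M\<^esub> \<in> {x \<in> H. Q x}" using H(2) Q(2) by blast
  show "x \<oplus>\<^bsub>M\<^esub> y \<in> {x \<in> H. Q x}" if "x \<in> {x \<in> H. Q x}" "y \<in> {x \<in> H. Q x}" for x y
    using H(1,3) Q(3) that by blast
  show "r \<odot>\<^bsub>M\<^esub> x \<in> {x \<in> H. Q x}" if "r \<in> carrier k" "x \<in> {x \<in> H. Q x}" for r x
    using H(1,4) Q(4) that by blast
qed

lemma submodule_span:
  assumes "module k M" and "S \<subseteq> carrier M"
  shows "submodule (submodule_span k M S) k M"
  unfolding submodule_span_def hull_def
  by (rule submodule_Inter[OF assms(1)]) (use assms submodule_carrier in auto)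

lemma submodule_span_inc: "x \<in> S \<Longrightarrow> x \<in> submodule_span k M S"
  unfolding submodule_span_def by (rule hull_inc)

lemma submodule_span_minimal:
  assumes "S \<subseteq> H" and "submodule H k M"
  shows "submodule_span k M S \<subseteq> H"
  unfolding submodule_span_def by (rule hull_minimal) (use assms in auto)

section \<open>Cosets and quotients by a submodule\<close>

context
  fixes k :: "'k ring" and M :: "('k, 'a) module" and H
  assumes M: "module k M" and H: "submodule H k M"
begin

interpretation M: module k M by (rule M)

interpretation H: abelian_subgroup H M
  using H M.abelian_group_axioms by (intro abelian_subgroupI3 additive_subgroupI) (simp_all add:
      submodule_def)

lemma coset_eq_iff:
  assumes "x \<in> carrier M" and "y \<in> carrier M"
  shows "H +>\<^bsub>M\<^esub> x = H +>\<^bsub>M\<^esub> y \<longleftrightarrow> x \<ominus>\<^bsub>M\<^esub> y \<in> H"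
proof -
  have "H +>\<^bsub>M\<^esub> x = H +>\<^bsub>M\<^esub> y \<longleftrightarrow> x \<in> H +>\<^bsub>M\<^esub> y"
    using assms H.a_rcos_self M.a_repr_independence[OF _ _ H.a_subgroup] by metis
  then show ?thesis using H.a_rcos_module_minus[of y x] M.ring_axioms assms by (simp add:
      H.a_rcos_module a_minus_def)
qed

lemma coset_zero_iff:
  assumes "x \<in> carrier M"
  shows "H +>\<^bsub>M\<^esub> x = H \<longleftrightarrow> x \<in> H"
  using assms H.a_rcos_self M.a_coset_join2 H.a_subgroup by metis

lemma in_coset_imp:
  assumes "x \<in> carrier M" and "y \<in> H +>\<^bsub>M\<^esub> x"
  shows "y \<in> carrier M" and "H +>\<^bsub>M\<^esub> y = H +>\<^bsub>M\<^esub> x"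
  using assms M.a_r_coset_subset_G[OF H.a_subset] M.a_repr_independence[OF _ _ H.a_subgroup]
      by blast+

lemma quotient_carrier: "carrier (quotient_algebra M H) = (\<lambda>x. H +>\<^bsub>M\<^esub> x) ` carrier M"
  by (auto simp: quotient_algebra_def FactRing_def A_RCOSETS_def' a_r_coset_def')

lemma quotient_zero: "\<zero>\<^bsub>quotient_algebra M H\<^esub> = H"
  by (simp add: quotient_algebra_def FactRing_def)

lemma quotient_zero_coset: "\<zero>\<^bsub>quotient_algebra M H\<^esub> = H +>\<^bsub>M\<^esub> \<zero>\<^bsub>M\<^esub>"
  using H.a_subset by (simp add: quotient_zero)

lemma quotient_add:
  assumes "x \<in> carrier M" and "y \<in> carrier M"
  shows "(H +>\<^bsub>M\<^esub> x) \<oplus>\<^bsub>quotient_algebra M H\<^esub> (H +>\<^bsub>M\<^esub> y) = H +>\<^bsub>M\<^esub> (x \<oplus>\<^bsub>M\<^esub> y)"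
  using assms by (simp add: quotient_algebra_def FactRing_def H.a_rcos_sum)

text \<open>Scalar multiplication and induced maps on a quotient are defined without choosing a
  representative, as a union over the whole coset. All members of that union agree and the coset is
  nonempty, so the union collapses to one term.\<close>

lemma quotient_UN:
  assumes "x \<in> carrier M" and "\<And>y. y \<in> H +>\<^bsub>M\<^esub> x \<Longrightarrow> F y = F x"
  shows "(\<Union>y\<in>H +>\<^bsub>M\<^esub> x. F y) = F x"
proof -
  have "(\<Union>y\<in>H +>\<^bsub>M\<^esub> x. F y) = (\<Union>y\<in>H +>\<^bsub>M\<^esub> x. F x)" by (rule SUP_cong[OF refl assms(2)])
  then show ?thesis using H.a_rcos_self[OF assms(1)] by (metis SUP_const empty_iff)
qed

lemma quotient_smult:
  assumes "r \<in> carrier k" and "x \<in> carrier M"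
  shows "r \<odot>\<^bsub>quotient_algebra M H\<^esub> (H +>\<^bsub>M\<^esub> x) = H +>\<^bsub>M\<^esub> (r \<odot>\<^bsub>M\<^esub> x)"
proof -
  have "H +>\<^bsub>M\<^esub> (r \<odot>\<^bsub>M\<^esub> y) = H +>\<^bsub>M\<^esub> (r \<odot>\<^bsub>M\<^esub> x)" if "y \<in> H +>\<^bsub>M\<^esub> x" for y
  proof -
    note y = in_coset_imp[OF assms(2) that]
    have "r \<odot>\<^bsub>M\<^esub> y \<ominus>\<^bsub>M\<^esub> r \<odot>\<^bsub>M\<^esub> x = r \<odot>\<^bsub>M\<^esub> (y \<ominus>\<^bsub>M\<^esub> x)"
      using assms y by (simp add: a_minus_def M.smult_r_distr M.smult_r_minus)
    with y assms show ?thesis by (simp add: coset_eq_iff submoduleD(4)[OF H])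
  qed
  note quotient_UN[OF assms(2), of "\<lambda>y. H +>\<^bsub>M\<^esub> (r \<odot>\<^bsub>M\<^esub> y)", OF this]
  then show ?thesis by (simp only: quotient_algebra_def module.simps)
qed

lemma quotient_map_coset:
  assumes "linear_map k M M f" and "\<And>x. x \<in> H \<Longrightarrow> f x \<in> H" and "x \<in> carrier M"
  shows "quotient_map M H f (H +>\<^bsub>M\<^esub> x) = H +>\<^bsub>M\<^esub> f x"
proof -
  have "H +>\<^bsub>M\<^esub> f y = H +>\<^bsub>M\<^esub> f x" if "y \<in> H +>\<^bsub>M\<^esub> x" for y
  proof -
    note y = in_coset_imp[OF assms(3) that]
    have "f y \<ominus>\<^bsub>M\<^esub> f x = f (y \<ominus>\<^bsub>M\<^esub> x)"
      using linear_map_minus[OF M M assms(1)] assms y by simp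
    with y assms show ?thesis by (simp add: coset_eq_iff linear_mapD(1)[OF assms(1)])
  qed
  note quotient_UN[OF assms(3), of "\<lambda>y. H +>\<^bsub>M\<^esub> f y", OF this]
  then show ?thesis by (simp only: quotient_map_def)
qed

lemma module_quotient: "module k (quotient_algebra M H)"
proof (rule moduleI)
  let ?Q = "quotient_algebra M H"
  show "cring k" using M by (simp add: module_def)
  show "abelian_group ?Q"
  proof (rule abelian_groupI)
    show "\<exists>y\<in>carrier ?Q. y \<oplus>\<^bsub>?Q\<^esub> x = \<zero>\<^bsub>?Q\<^esub>" if "x \<in> carrier ?Q" for x
    proof -
      from that obtain x' where "x' \<in> carrier M" "x = H +>\<^bsub>M\<^esub> x'" by (auto simp: quotient_carrier)
      then show ?thesis
        by (intro bexI[of _ "H +>\<^bsub>M\<^esub> \<ominus>\<^bsub>M\<^esub> x'"])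
          (auto simp: quotient_add quotient_zero_coset quotient_carrier M.l_neg)
    qed
  qed (auto simp: quotient_carrier quotient_add quotient_zero_coset M.a_ac)
qed (auto simp: quotient_carrier quotient_smult quotient_add M.smult_r_distr M.smult_l_distr
    M.smult_assoc1)

lemma linear_map_coset: "linear_map k M (quotient_algebra M H) (\<lambda>x. H +>\<^bsub>M\<^esub> x)"
  by (rule linear_mapI) (auto simp: quotient_carrier quotient_smult quotient_add)

lemma linear_map_quotient_map:
  assumes "linear_map k M M f" and "\<And>x. x \<in> H \<Longrightarrow> f x \<in> H"
  shows "linear_map k (quotient_algebra M H) (quotient_algebra M H) (quotient_map M H f)"
  by (rule linear_mapI)
    (auto simp: quotient_carrier quotient_smult quotient_add quotient_map_coset[OF assms]
        linear_mapD[OF assms(1)])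

end

section \<open>Free modules\<close>

lemma module_cring: "module k M \<Longrightarrow> cring k"
  by (simp add: module_def)

lemma free_module_simps:
  "c \<in> carrier (free_module k X) \<longleftrightarrow>
     (\<forall>x. c x \<in> carrier k) \<and> (\<forall>x. x \<notin> X \<longrightarrow> c x = \<zero>\<^bsub>k\<^esub>) \<and> finite {x. c x \<noteq> \<zero>\<^bsub>k\<^esub>}"
  "\<zero>\<^bsub>free_module k X\<^esub> = (\<lambda>x. \<zero>\<^bsub>k\<^esub>)"
  "c \<oplus>\<^bsub>free_module k X\<^esub> c' = (\<lambda>x. c x \<oplus>\<^bsub>k\<^esub> c' x)"
  "r \<odot>\<^bsub>free_module k X\<^esub> c = (\<lambda>x. r \<otimes>\<^bsub>k\<^esub> c x)"
  by (auto simp: free_module_def)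

lemma module_free_module:
  assumes "cring k"
  shows "module k (free_module k X)"
proof -
  interpret k: cring k by fact
  have add: "c \<oplus>\<^bsub>free_module k X\<^esub> c' \<in> carrier (free_module k X)"
    if "c \<in> carrier (free_module k X)" "c' \<in> carrier (free_module k X)" for c c'
  proof -
    have "finite {x. c x \<oplus>\<^bsub>k\<^esub> c' x \<noteq> \<zero>\<^bsub>k\<^esub>}"
      by (rule finite_subset[of _ "{x. c x \<noteq> \<zero>\<^bsub>k\<^esub>} \<union> {x. c' x \<noteq> \<zero>\<^bsub>k\<^esub>}"])
        (use that in \<open>auto simp: free_module_simps\<close>)
    with that show ?thesis by (simp add: free_module_simps)
  qed
  have smult: "r \<odot>\<^bsub>free_module k X\<^esub> c \<in> carrier (free_module k X)"
    if "r \<in> carrier k" "c \<in> carrier (free_module k X)" for r c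
  proof -
    have "finite {x. r \<otimes>\<^bsub>k\<^esub> c x \<noteq> \<zero>\<^bsub>k\<^esub>}"
      by (rule finite_subset[of _ "{x. c x \<noteq> \<zero>\<^bsub>k\<^esub>}"])
        (use that in \<open>auto simp: free_module_simps\<close>)
    with that show ?thesis by (simp add: free_module_simps)
  qed
  show ?thesis
  proof (rule moduleI)
    show "abelian_group (free_module k X)"
    proof (rule abelian_groupI)
      fix c assume c: "c \<in> carrier (free_module k X)"
      show "\<exists>y\<in>carrier (free_module k X). y \<oplus>\<^bsub>free_module k X\<^esub> c = \<zero>\<^bsub>free_module k X\<^esub>"
        by (rule bexI[of _ "(\<ominus>\<^bsub>k\<^esub> \<one>\<^bsub>k\<^esub>) \<odot>\<^bsub>free_module k X\<^esub> c"])
          (use c smult[of "\<ominus>\<^bsub>k\<^esub> \<one>\<^bsub>k\<^esub>" c] in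
            \<open>simp_all add: free_module_simps(1,2) fun_eq_iff free_module_simps(3,4) k.l_minus
                k.l_neg\<close>)
    qed (use add in \<open>auto simp: free_module_simps fun_eq_iff k.a_ac\<close>)
  qed (use smult assms in \<open>auto simp: free_module_simps fun_eq_iff k.l_distr k.r_distr k.m_assoc\<close>)
qed

lemma basis_closed:
  assumes "cring k" and "x \<in> X"
  shows "basis k x \<in> carrier (free_module k X)"
proof -
  interpret k: cring k by fact
  have "finite {y. basis k x y \<noteq> \<zero>\<^bsub>k\<^esub>}" by (rule finite_subset[of _ "{x}"]) (auto simp: basis_def)
  then show ?thesis using assms(2) by (auto simp: free_module_simps basis_def)
qed

text \<open>Extra points of \<open>S\<close> have coefficient zero and contribute nothing. This
  allows two functions with different supports to be summed over a common index set, which is what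
  additivity requires.\<close>

lemma linear_extension_eq:
  assumes "module k P" and "c \<in> carrier (free_module k X)"
    and "\<And>x. x \<in> X \<Longrightarrow> f x \<in> carrier P"
    and "finite S" and "{x. c x \<noteq> \<zero>\<^bsub>k\<^esub>} \<subseteq> S" and "S \<subseteq> X"
  shows "linear_extension k P f c = (\<Oplus>\<^bsub>P\<^esub>x\<in>S. c x \<odot>\<^bsub>P\<^esub> f x)"
proof -
  interpret P: module k P by fact
  show ?thesis unfolding linear_extension_def
    by (rule P.add.finprod_mono_neutral_cong_left)
      (use assms in \<open>auto simp: free_module_simps\<close>)
qed

lemma linear_extension_basis:
  assumes "module k P" and "x \<in> X" and "\<And>x. x \<in> X \<Longrightarrow> f x \<in> carrier P"
  shows "linear_extension k P f (basis k x) = f x"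
proof -
  interpret P: module k P by fact
  have k: "cring k" using assms(1) by (simp add: module_def)
  have "linear_extension k P f (basis k x) = (\<Oplus>\<^bsub>P\<^esub>y\<in>{x}. basis k x y \<odot>\<^bsub>P\<^esub> f y)"
    by (rule linear_extension_eq[OF assms(1) basis_closed[OF k assms(2)] assms(3)])
      (use assms in \<open>auto simp: basis_def\<close>)
  then show ?thesis using assms by (simp add: basis_def P.add.finprod_insert)
qed

lemma linear_map_linear_extension:
  assumes "module k P" and "\<And>x. x \<in> X \<Longrightarrow> f x \<in> carrier P"
  shows "linear_map k (free_module k X) P (linear_extension k P f)"
proof -
  interpret P: module k P by fact
  have k: "cring k" using assms(1) by (simp add: module_def)
  interpret FP: module k "free_module k X" by (rule module_free_module[OF k])
  have eq: "linear_extension k P f c = (\<Oplus>\<^bsub>P\<^esub>x\<in>S. c x \<odot>\<^bsub>P\<^esub> f x)"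
    if "c \<in> carrier (free_module k X)" "finite S" "{x. c x \<noteq> \<zero>\<^bsub>k\<^esub>} \<subseteq> S" "S \<subseteq> X" for c S
    by (rule linear_extension_eq[OF assms(1) that(1) assms(2) that(2-)])
  have supp: "finite {x. c x \<noteq> \<zero>\<^bsub>k\<^esub>}" "{x. c x \<noteq> \<zero>\<^bsub>k\<^esub>} \<subseteq> X"
    and val: "c x \<in> carrier k" if "c \<in> carrier (free_module k X)" for c x
    using that by (auto simp: free_module_simps)
  have fX: "f x \<in> carrier P" if "x \<in> {x. c x \<noteq> \<zero>\<^bsub>k\<^esub>}" "c \<in> carrier (free_module k X)" for c x
    using that assms(2) supp(2) by blast
  show ?thesis
  proof (rule linear_mapI)
    fix c assume c: "c \<in> carrier (free_module k X)"
    show "linear_extension k P f c \<in> carrier P"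
      unfolding linear_extension_def by (rule P.finsum_closed) (use c fX val in auto)
    fix r assume r: "r \<in> carrier k"
    have "linear_extension k P f (r \<odot>\<^bsub>free_module k X\<^esub> c) =
        (\<Oplus>\<^bsub>P\<^esub>x\<in>{x. c x \<noteq> \<zero>\<^bsub>k\<^esub>}. (r \<otimes>\<^bsub>k\<^esub> c x) \<odot>\<^bsub>P\<^esub> f x)"
      by (subst eq[of _ "{x. c x \<noteq> \<zero>\<^bsub>k\<^esub>}"])
        (use c r supp[OF c] FP.smult_closed[OF r c] in \<open>auto simp: free_module_simps(4)\<close>)
    also have "\<dots> = (\<Oplus>\<^bsub>P\<^esub>x\<in>{x. c x \<noteq> \<zero>\<^bsub>k\<^esub>}. r \<odot>\<^bsub>P\<^esub> (c x \<odot>\<^bsub>P\<^esub> f x))"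
      by (rule P.finsum_cong') (use c r fX val in \<open>auto simp: P.smult_assoc1\<close>)
    also have "\<dots> = r \<odot>\<^bsub>P\<^esub> linear_extension k P f c"
      unfolding linear_extension_def
      by (rule P.finsum_smult_ldistr[symmetric]) (use c r fX val supp in auto)
    finally show "linear_extension k P f (r \<odot>\<^bsub>free_module k X\<^esub> c) = r \<odot>\<^bsub>P\<^esub> linear_extension k P f c"
        .
  next
    fix c c' assume c: "c \<in> carrier (free_module k X)" and c': "c' \<in> carrier (free_module k X)"
    let ?S = "{x. c x \<noteq> \<zero>\<^bsub>k\<^esub>} \<union> {x. c' x \<noteq> \<zero>\<^bsub>k\<^esub>}"
    have S: "finite ?S" "?S \<subseteq> X" using supp[OF c] supp[OF c'] by auto
    then have fS: "f x \<in> carrier P" if "x \<in> ?S" for x using that assms(2) by blast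
    have "linear_extension k P f (c \<oplus>\<^bsub>free_module k X\<^esub> c') =
        (\<Oplus>\<^bsub>P\<^esub>x\<in>?S. (c x \<oplus>\<^bsub>k\<^esub> c' x) \<odot>\<^bsub>P\<^esub> f x)"
      by (subst eq[OF _ S(1) _ S(2)])
        (use val[OF c] val[OF c'] FP.a_closed[OF c c'] in \<open>auto simp: free_module_simps(3)\<close>)
    also have "\<dots> = (\<Oplus>\<^bsub>P\<^esub>x\<in>?S. c x \<odot>\<^bsub>P\<^esub> f x \<oplus>\<^bsub>P\<^esub> c' x \<odot>\<^bsub>P\<^esub> f x)"
      by (rule P.finsum_cong') (use val[OF c] val[OF c'] fS in \<open>auto simp: P.smult_l_distr\<close>)
    also have "\<dots> = (\<Oplus>\<^bsub>P\<^esub>x\<in>?S. c x \<odot>\<^bsub>P\<^esub> f x) \<oplus>\<^bsub>P\<^esub> (\<Oplus>\<^bsub>P\<^esub>x\<in>?S. c' x \<odot>\<^bsub>P\<^esub> f x)"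
      by (rule P.finsum_addf) (use val[OF c] val[OF c'] fS in auto)
    also have "\<dots> = linear_extension k P f c \<oplus>\<^bsub>P\<^esub> linear_extension k P f c'"
      by (subst (1 2) eq[OF _ S(1) _ S(2)]) (use c c' in auto)
    finally show "linear_extension k P f (c \<oplus>\<^bsub>free_module k X\<^esub> c') =
      linear_extension k P f c \<oplus>\<^bsub>P\<^esub> linear_extension k P f c'" .
  qed
qed

text \<open>Induction on the size of the support. The set \<open>Y\<close> may be smaller than
  \<open>X\<close>: with \<open>Y\<close> the words of a fixed degree, this becomes the induction
  principle for homogeneous elements of the free algebra.\<close>

lemma free_module_subset_submodule:
  assumes "cring k" and "submodule H k (free_module k X)" and "\<And>x. x \<in> Y \<Longrightarrow> basis k x \<in> H"
    and "c \<in> carrier (free_module k X)" and "\<And>x. c x \<noteq> \<zero>\<^bsub>k\<^esub> \<Longrightarrow> x \<in> Y"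
  shows "c \<in> H"
proof -
  interpret k: cring k by fact
  note H = submoduleD[OF assms(2)]
  have "c \<in> H" if "finite S" "c \<in> carrier (free_module k X)" "{x. c x \<noteq> \<zero>\<^bsub>k\<^esub>} \<subseteq> S" "S \<subseteq> Y" for S c
    using that
  proof (induction S arbitrary: c rule: finite_induct)
    case empty
    then have "c = \<zero>\<^bsub>free_module k X\<^esub>" by (auto simp: free_module_simps)
    then show ?case using H(2) by simp
  next
    case (insert x S)
    have cx: "c x \<in> carrier k" using insert.prems by (simp add: free_module_simps)
    have fin: "finite {y. (c(x := \<zero>\<^bsub>k\<^esub>)) y \<noteq> \<zero>\<^bsub>k\<^esub>}"
      by (rule finite_subset[of _ S]) (use insert in auto)
    \<comment> \<open>Erasing one coefficient shrinks the support; the erased part is a multiple of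
      a basis element.\<close>
    have "c(x := \<zero>\<^bsub>k\<^esub>) \<in> H"
      by (rule insert.IH) (use insert.prems insert.hyps fin in \<open>auto simp: free_module_simps\<close>)
    moreover have "c x \<odot>\<^bsub>free_module k X\<^esub> basis k x \<in> H"
      by (rule H(4)[OF cx assms(3)]) (use insert.prems in auto)
    moreover have "c = c(x := \<zero>\<^bsub>k\<^esub>) \<oplus>\<^bsub>free_module k X\<^esub> c x \<odot>\<^bsub>free_module k X\<^esub> basis k x"
      using insert.prems(1) by (auto simp: free_module_simps basis_def fun_eq_iff)
    ultimately show ?case using H(3) by metis
  qed
  then show ?thesis using assms(4,5) by (auto simp: free_module_simps)
qed

lemma free_module_ext:
  assumes "module k P" and "linear_map k (free_module k X) P f" and "linear_map k (free_module k X)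
      P g"
    and "\<And>x. x \<in> X \<Longrightarrow> f (basis k x) = g (basis k x)" and "c \<in> carrier (free_module k X)"
  shows "f c = g c"
proof -
  have k: "cring k" using assms(1) by (simp add: module_def)
  have "c \<in> {c \<in> carrier (free_module k X). f c = g c}"
    by (rule free_module_subset_submodule[OF k submodule_equalizer[OF module_free_module[OF k]
        assms(1-3)], of X])
      (use assms(4,5) in \<open>simp_all add: basis_closed[OF k], auto simp: free_module_simps\<close>)
  then show ?thesis by simp
qed

section \<open>Tensor products\<close>

definition bilinear :: "'k ring \<Rightarrow> ('k, 'a) module \<Rightarrow> ('k, 'b) module \<Rightarrow> ('k, 'c) module \<Rightarrow>
    ('a \<Rightarrow> 'b \<Rightarrow> 'c) \<Rightarrow> bool" where
  "bilinear k M N P f \<longleftrightarrow>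
     (\<forall>x\<in>carrier M. linear_map k N P (f x)) \<and> (\<forall>y\<in>carrier N. linear_map k M P (\<lambda>x. f x y))"

lemma bilinearI:
  assumes "\<And>x. x \<in> carrier M \<Longrightarrow> linear_map k N P (\<lambda>y. f x y)"
    and "\<And>y. y \<in> carrier N \<Longrightarrow> linear_map k M P (\<lambda>x. f x y)"
  shows "bilinear k M N P f"
  using assms by (auto simp: bilinear_def)

lemma bilinearD:
  assumes "bilinear k M N P f"
  shows "x \<in> carrier M \<Longrightarrow> linear_map k N P (f x)"
    and "y \<in> carrier N \<Longrightarrow> linear_map k M P (\<lambda>x. f x y)"
    and "\<lbrakk>x \<in> carrier M; y \<in> carrier N\<rbrakk> \<Longrightarrow> f x y \<in> carrier P"
  using assms linear_mapD(1) by (fastforce simp: bilinear_def)+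

lemma bilinear_comp:
  assumes "linear_map k P Q h" and "bilinear k M N P f"
  shows "bilinear k M N Q (\<lambda>x y. h (f x y))"
  by (intro bilinearI linear_map_comp[OF assms(1)]) (rule bilinearD[OF assms(2)], assumption)+

context
  fixes k :: "'k ring" and M :: "('k, 'a) module" and N :: "('k, 'b) module"
  assumes M: "module k M" and N: "module k N"
begin

interpretation M: module k M by (rule M)
interpretation N: module k N by (rule N)

private abbreviation "FP \<equiv> free_module k (carrier M \<times> carrier N)"

private lemmas cring_k = module_cring[OF M]

interpretation FP: module k FP by (rule module_free_module[OF cring_k])

private lemma basis_F: "x \<in> carrier M \<Longrightarrow> y \<in> carrier N \<Longrightarrow> basis k (x, y) \<in> carrier FP"
  by (rule basis_closed[OF cring_k]) auto

private lemma relations_closed: "tensor_relations k M N \<subseteq> carrier FP"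
  unfolding tensor_relations_def Let_def by (auto simp: basis_F)

private lemma kernel_submodule: "submodule (tensor_kernel k M N) k FP"
  unfolding tensor_kernel_def by (rule submodule_span[OF FP.module_axioms relations_closed])

private lemma coset_eqI:
  assumes "x \<ominus>\<^bsub>FP\<^esub> y \<in> tensor_relations k M N" and "x \<in> carrier FP" and "y \<in> carrier FP"
  shows "tensor_kernel k M N +>\<^bsub>FP\<^esub> x = tensor_kernel k M N +>\<^bsub>FP\<^esub> y"
  using assms coset_eq_iff[OF FP.module_axioms kernel_submodule] submodule_span_inc
  by (metis tensor_kernel_def)

lemma module_tensor: "module k (tensor k M N)"
  unfolding tensor_def by (rule module_quotient[OF FP.module_axioms kernel_submodule])

lemma bilinear_pure: "bilinear k M N (tensor k M N) (pure k M N)"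
proof (rule bilinearI; rule linear_mapI)
  note rel = tensor_relations_def Let_def
  note cos = quotient_add[OF FP.module_axioms kernel_submodule]
    quotient_smult[OF FP.module_axioms kernel_submodule]
  show *: "pure k M N x y \<in> carrier (tensor k M N)" if "x \<in> carrier M" "y \<in> carrier N" for x y
    using that basis_F by (simp add: pure_def tensor_def quotient_carrier[OF FP.module_axioms
        kernel_submodule])
  show "pure k M N x y \<in> carrier (tensor k M N)" if "y \<in> carrier N" "x \<in> carrier M" for x y
    using * that by simp
  show "pure k M N x (y \<oplus>\<^bsub>N\<^esub> y') = pure k M N x y \<oplus>\<^bsub>tensor k M N\<^esub> pure k M N x y'"
    if "x \<in> carrier M" "y \<in> carrier N" "y' \<in> carrier N" for x y y'
    unfolding pure_def tensor_def using that
    by (simp add: cos basis_F, intro coset_eqI) (auto simp: basis_F rel)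
  show "pure k M N (x \<oplus>\<^bsub>M\<^esub> x') y = pure k M N x y \<oplus>\<^bsub>tensor k M N\<^esub> pure k M N x' y"
    if "y \<in> carrier N" "x \<in> carrier M" "x' \<in> carrier M" for x x' y
    unfolding pure_def tensor_def using that
    by (simp add: cos basis_F, intro coset_eqI) (auto simp: basis_F rel)
  show "pure k M N x (r \<odot>\<^bsub>N\<^esub> y) = r \<odot>\<^bsub>tensor k M N\<^esub> pure k M N x y"
    if "x \<in> carrier M" "r \<in> carrier k" "y \<in> carrier N" for x r y
    unfolding pure_def tensor_def using that
    by (simp add: cos basis_F, intro coset_eqI) (auto simp: basis_F rel)
  show "pure k M N (r \<odot>\<^bsub>M\<^esub> x) y = r \<odot>\<^bsub>tensor k M N\<^esub> pure k M N x y"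
    if "y \<in> carrier N" "r \<in> carrier k" "x \<in> carrier M" for x r y
    unfolding pure_def tensor_def using that
    by (simp add: cos basis_F, intro coset_eqI) (auto simp: basis_F rel)
qed

lemmas pure_closed = bilinearD(3)[OF bilinear_pure]

context
  fixes P :: "('k, 'c) module" and f
  assumes P: "module k P" and f: "bilinear k M N P f"
begin

interpretation P: module k P by (rule P)

private abbreviation "h \<equiv> linear_extension k P (case_prod f)"

private lemma h_linear: "linear_map k FP P h"
  by (rule linear_map_linear_extension[OF P]) (use bilinearD(3)[OF f] in auto)

private lemma h_basis: "x \<in> carrier M \<Longrightarrow> y \<in> carrier N \<Longrightarrow> h (basis k (x, y)) = f x y"
  by (subst linear_extension_basis[OF P, of _ "carrier M \<times> carrier N"]) (use bilinearD(3)[OF f]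
      in auto)

text \<open>Each relation is a difference whose two sides have the same image under a bilinear map;
  the four kinds of relation match the four laws of bilinearity.\<close>

private lemma h_relations: "c \<in> tensor_relations k M N \<Longrightarrow> h c = \<zero>\<^bsub>P\<^esub>"
proof -
  note D = linear_mapD[OF h_linear] linear_map_minus[OF FP.module_axioms P h_linear]
    linear_mapD(2-)[OF bilinearD(1)[OF f]] linear_mapD(2-)[OF bilinearD(2)[OF f]] bilinearD(3)[OF f]
  have e: "x = y \<Longrightarrow> x \<in> carrier P \<Longrightarrow> x \<ominus>\<^bsub>P\<^esub> y = \<zero>\<^bsub>P\<^esub>" for x y
    by (simp add: P.r_neg a_minus_def)
  assume "c \<in> tensor_relations k M N"
  then show ?thesis unfolding tensor_relations_def Let_def
    by (elim UnE CollectE exE conjE) (simp_all add: D basis_F h_basis e)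
qed

private lemma h_kernel: "c \<in> tensor_kernel k M N \<Longrightarrow> h c = \<zero>\<^bsub>P\<^esub>"
proof -
  have "tensor_kernel k M N \<subseteq> {c \<in> carrier FP. h c \<in> {\<zero>\<^bsub>P\<^esub>}}"
    unfolding tensor_kernel_def
    by (rule submodule_span_minimal)
      (use h_relations relations_closed submodule_vimage[OF FP.module_axioms P h_linear
          submodule_zero[OF P]] in auto)
  then show "c \<in> tensor_kernel k M N \<Longrightarrow> h c = \<zero>\<^bsub>P\<^esub>" by blast
qed

text \<open>\<open>tensor_lift\<close> evaluates at a representative picked by \<open>SOME\<close>.
  Any two representatives differ by an element of the tensor kernel, which \<open>h\<close>
  annihilates because it annihilates the generating relations.\<close>

private lemma lift_coset:
  assumes "c \<in> carrier FP"
  shows "tensor_lift k P f (tensor_kernel k M N +>\<^bsub>FP\<^esub> c) = h c"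
proof -
  let ?q = "\<lambda>c. tensor_kernel k M N +>\<^bsub>FP\<^esub> c"
  define c' where "c' = (SOME c'. c' \<in> ?q c)"
  interpret K: abelian_subgroup "tensor_kernel k M N" FP
    using kernel_submodule FP.abelian_group_axioms
    by (intro abelian_subgroupI3 additive_subgroupI) (simp_all add: submodule_def)
  have "c' \<in> ?q c" unfolding c'_def by (rule someI[of _ c]) (rule K.a_rcos_self[OF assms])
  then have c': "c' \<in> carrier FP" "?q c' = ?q c"
    using in_coset_imp[OF FP.module_axioms kernel_submodule assms] by auto
  then have "h (c' \<ominus>\<^bsub>FP\<^esub> c) = \<zero>\<^bsub>P\<^esub>"
    using coset_eq_iff[OF FP.module_axioms kernel_submodule] assms h_kernel by metis
  then have "h c' \<ominus>\<^bsub>P\<^esub> h c = \<zero>\<^bsub>P\<^esub>"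
    using linear_map_minus[OF FP.module_axioms P h_linear] c' assms by simp
  moreover have "h c' = (h c' \<ominus>\<^bsub>P\<^esub> h c) \<oplus>\<^bsub>P\<^esub> h c"
    using linear_mapD(1)[OF h_linear] c' assms by (simp add: a_minus_def P.a_assoc P.l_neg)
  ultimately have "h c' = h c" using linear_mapD(1)[OF h_linear] assms by simp
  then show ?thesis by (simp add: tensor_lift_def c'_def)
qed

lemma lift_pure:
  assumes "x \<in> carrier M" and "y \<in> carrier N"
  shows "tensor_lift k P f (pure k M N x y) = f x y"
  using assms by (simp add: pure_def lift_coset basis_F h_basis)

lemma linear_map_lift: "linear_map k (tensor k M N) P (tensor_lift k P f)"
proof (rule linear_mapI)
  note Q = quotient_carrier[OF FP.module_axioms kernel_submodule]
    quotient_add[OF FP.module_axioms kernel_submodule] quotient_smult[OF FP.module_axioms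
        kernel_submodule]
  note D = linear_mapD[OF h_linear]
  fix x assume "x \<in> carrier (tensor k M N)"
  then obtain c where c: "c \<in> carrier FP" "x = tensor_kernel k M N +>\<^bsub>FP\<^esub> c"
    by (auto simp: tensor_def Q)
  show "tensor_lift k P f x \<in> carrier P" using c D by (simp add: lift_coset)
  show "tensor_lift k P f (r \<odot>\<^bsub>tensor k M N\<^esub> x) = r \<odot>\<^bsub>P\<^esub> tensor_lift k P f x" if "r \<in> carrier k" for
      r
    using c D that by (simp add: lift_coset tensor_def Q)
  fix y assume "y \<in> carrier (tensor k M N)"
  then obtain c' where c': "c' \<in> carrier FP" "y = tensor_kernel k M N +>\<^bsub>FP\<^esub> c'"
    by (auto simp: tensor_def Q)
  show "tensor_lift k P f (x \<oplus>\<^bsub>tensor k M N\<^esub> y) = tensor_lift k P f x \<oplus>\<^bsub>P\<^esub> tensor_lift k P f y"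
    using c c' D by (simp add: lift_coset tensor_def Q)
qed

lemmas lift_closed = linear_mapD(1)[OF linear_map_lift]

end

lemma tensor_subset_submodule:
  assumes "submodule H k (tensor k M N)"
    and "\<And>x y. \<lbrakk>x \<in> carrier M; y \<in> carrier N\<rbrakk> \<Longrightarrow> pure k M N x y \<in> H"
    and "t \<in> carrier (tensor k M N)"
  shows "t \<in> H"
proof -
  let ?q = "\<lambda>c. tensor_kernel k M N +>\<^bsub>FP\<^esub> c"
  obtain c where c: "c \<in> carrier FP" "t = ?q c"
    using assms(3) by (auto simp: tensor_def quotient_carrier[OF FP.module_axioms kernel_submodule])
  have lin: "linear_map k FP (tensor k M N) ?q"
    unfolding tensor_def by (rule linear_map_coset[OF FP.module_axioms kernel_submodule])
  have "c \<in> {c \<in> carrier FP. ?q c \<in> H}"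
    by (rule free_module_subset_submodule[OF cring_k
          submodule_vimage[OF FP.module_axioms module_tensor lin assms(1)], of "carrier M \<times> carrier
              N"])
      (use assms(2) c basis_F in \<open>auto simp: pure_def free_module_simps\<close>)
  with c show ?thesis by simp
qed

lemma tensor_ext:
  assumes "module k P" and "linear_map k (tensor k M N) P f" and "linear_map k (tensor k M N) P g"
    and "\<And>x y. \<lbrakk>x \<in> carrier M; y \<in> carrier N\<rbrakk> \<Longrightarrow> f (pure k M N x y) = g (pure k M N x y)"
    and "t \<in> carrier (tensor k M N)"
  shows "f t = g t"
  using tensor_subset_submodule[OF submodule_equalizer[OF module_tensor assms(1-3)] _ assms(5)]
      assms(4)
    pure_closed by blast

end

lemma bilinear_cong:
  assumes "\<And>x y. \<lbrakk>x \<in> carrier M; y \<in> carrier N\<rbrakk> \<Longrightarrow> f x y = g x y"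
    and "bilinear k M N P f" and "module k M" and "module k N"
  shows "bilinear k M N P g"
proof (rule bilinearI)
  show "linear_map k N P (\<lambda>y. g x y)" if "x \<in> carrier M" for x
    by (rule linear_map_cong[OF _ bilinearD(1)[OF assms(2) that] assms(4)]) (use assms(1) that in
        simp)
  show "linear_map k M P (\<lambda>x. g x y)" if "y \<in> carrier N" for y
    by (rule linear_map_cong[OF _ bilinearD(2)[OF assms(2) that] assms(3)]) (use assms(1) that in
        simp)
qed

text \<open>Over a ring the map from X \<otimes> Y to M \<otimes> N need not be injective, so the
  claim that the components of a tensor can be taken in \<open>X\<close> and \<open>Y\<close> is
  expressed inside M \<otimes> N.\<close>

definition tensor_span ::
  "'k ring \<Rightarrow> ('k, 'a) module \<Rightarrow> ('k, 'b) module \<Rightarrow> 'a set \<Rightarrow> 'b set \<Rightarrow> ('a \<times> 'b \<Rightarrow> 'k) set set" where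
  "tensor_span k M N X Y = submodule_span k (tensor k M N) {pure k M N x y | x y. x \<in> X \<and> y \<in> Y}"

context
  fixes k :: "'k ring" and M :: "('k, 'a) module" and N :: "('k, 'b) module"
  assumes M: "module k M" and N: "module k N"
begin

lemma tensor_span_submodule:
  assumes "X \<subseteq> carrier M" and "Y \<subseteq> carrier N"
  shows "submodule (tensor_span k M N X Y) k (tensor k M N)"
  unfolding tensor_span_def
proof (rule submodule_span[OF module_tensor[OF M N]], rule subsetI)
  fix t assume "t \<in> {pure k M N x y |x y. x \<in> X \<and> y \<in> Y}"
  then obtain x y where "x \<in> X" "y \<in> Y" "t = pure k M N x y" by blast
  then show "t \<in> carrier (tensor k M N)" using assms pure_closed[OF M N] by (simp add: subset_iff)
qed

lemma tensor_span_pure: "x \<in> X \<Longrightarrow> y \<in> Y \<Longrightarrow> pure k M N x y \<in> tensor_span k M N X Y"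
  unfolding tensor_span_def by (rule submodule_span_inc) blast

lemma tensor_span_minimal:
  assumes "submodule H k (tensor k M N)" and "\<And>x y. \<lbrakk>x \<in> X; y \<in> Y\<rbrakk> \<Longrightarrow> pure k M N x y \<in> H"
    and "t \<in> tensor_span k M N X Y"
  shows "t \<in> H"
proof -
  have "{pure k M N x y | x y. x \<in> X \<and> y \<in> Y} \<subseteq> H" using assms(2) by auto
  then show ?thesis
    using submodule_span_minimal[OF _ assms(1)] assms(3) unfolding tensor_span_def by blast
qed

lemma tensor_span_carrier: "tensor_span k M N (carrier M) (carrier N) = carrier (tensor k M N)"
proof (intro equalityI subsetI)
  note sub = tensor_span_submodule[OF subset_refl subset_refl]
  show "t \<in> carrier (tensor k M N)" if "t \<in> tensor_span k M N (carrier M) (carrier N)" for t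
    by (rule submoduleD(1)[OF sub that])
  show "t \<in> tensor_span k M N (carrier M) (carrier N)" if "t \<in> carrier (tensor k M N)" for t
    by (rule tensor_subset_submodule[OF M N sub tensor_span_pure that])
qed

section \<open>Sums over the components of a tensor\<close>

context
  fixes P :: "('k, 'c) module"
  assumes P: "module k P"
begin

lemma lift_tensor_span:
  assumes "bilinear k M N P f" and "submodule H k P" and "\<And>x y. \<lbrakk>x \<in> X; y \<in> Y\<rbrakk> \<Longrightarrow> f x y \<in> H"
    and "X \<subseteq> carrier M" and "Y \<subseteq> carrier N" and "t \<in> tensor_span k M N X Y"
  shows "tensor_lift k P f t \<in> H"
proof -
  have "pure k M N x y \<in> {t \<in> carrier (tensor k M N). tensor_lift k P f t \<in> H}" if "x \<in> X" "y \<in> Y"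
      for x y
    using that assms(3-5) lift_pure[OF M N P assms(1)] pure_closed[OF M N] by (simp add: subset_iff)
  then show ?thesis
    using tensor_span_minimal[OF submodule_vimage[OF module_tensor[OF M N] P
          linear_map_lift[OF M N P assms(1)] assms(2)] _ assms(6)] by blast
qed

text \<open>When the components of \<open>t\<close> can be taken in \<open>X\<close> and
  \<open>Y\<close>, the summands have to agree only there. Through this rule, control over the
  degrees of a twisted tensor makes an equation known for restricted arguments usable inside a
  sum.\<close>

lemma lift_cong_span:
  assumes "bilinear k M N P f" and "bilinear k M N P g" and "\<And>x y. \<lbrakk>x \<in> X; y \<in> Y\<rbrakk> \<Longrightarrow> f x y = g x y"
    and "X \<subseteq> carrier M" and "Y \<subseteq> carrier N" and "t \<in> tensor_span k M N X Y"
  shows "tensor_lift k P f t = tensor_lift k P g t"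
proof -
  have "pure k M N x y \<in> {t \<in> carrier (tensor k M N). tensor_lift k P f t = tensor_lift k P g t}"
    if "x \<in> X" "y \<in> Y" for x y
    using that assms(3-5) lift_pure[OF M N P assms(1)] lift_pure[OF M N P assms(2)] pure_closed[OF M
        N]
    by (simp add: subset_iff)
  then show ?thesis
    using tensor_span_minimal[OF submodule_equalizer[OF module_tensor[OF M N] P
          linear_map_lift[OF M N P assms(1)] linear_map_lift[OF M N P assms(2)]] _ assms(6)]
              by blast
qed

lemma lift_cong:
  assumes "t \<in> carrier (tensor k M N)" and "bilinear k M N P f"
    and "\<And>x y. \<lbrakk>x \<in> carrier M; y \<in> carrier N\<rbrakk> \<Longrightarrow> f x y = g x y"
  shows "tensor_lift k P f t = tensor_lift k P g t"
  using lift_cong_span[OF assms(2) bilinear_cong[OF assms(3,2) M N] assms(3), of "carrier M"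
      "carrier N"]
    assms(1) tensor_span_carrier by simp

lemma linear_map_lift_arg:
  assumes "linear_map k Q (tensor k M N) t" and "bilinear k M N P f"
  shows "linear_map k Q P (\<lambda>x. tensor_lift k P f (t x))"
  by (rule linear_map_comp[OF linear_map_lift[OF M N P assms(2)] assms(1)])

text \<open>This is linearity in a parameter that occurs in the summand. For fixed values of the
  parameter both sides are linear in \<open>t\<close>, so \<open>t\<close> may be taken pure, and
  the claim reduces to linearity of the summand.\<close>

lemma linear_map_lift_fun:
  assumes "module k Q" and "t \<in> carrier (tensor k M N)"
    and "\<And>x. x \<in> carrier Q \<Longrightarrow> bilinear k M N P (f x)"
    and "\<And>a b. \<lbrakk>a \<in> carrier M; b \<in> carrier N\<rbrakk> \<Longrightarrow> linear_map k Q P (\<lambda>x. f x a b)"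
  shows "linear_map k Q P (\<lambda>x. tensor_lift k P (f x) t)"
proof (rule linear_mapI)
  interpret Q: module k Q by fact
  note T = module_tensor[OF M N] and pure = lift_pure[OF M N P assms(3)] and lin =
      linear_map_lift[OF M N P assms(3)]
  fix x assume x: "x \<in> carrier Q"
  show "tensor_lift k P (f x) t \<in> carrier P" using linear_mapD(1)[OF lin[OF x]] assms(2) .
  show "tensor_lift k P (f (r \<odot>\<^bsub>Q\<^esub> x)) t = r \<odot>\<^bsub>P\<^esub> tensor_lift k P (f x) t" if "r \<in> carrier k" for r
    by (rule tensor_ext[OF M N P _ _ _ assms(2)])
      (use x that in \<open>simp_all add: lin linear_map_smult[OF T P] pure linear_mapD(3)[OF assms(4)]\<close>)
  fix y assume y: "y \<in> carrier Q"
  show "tensor_lift k P (f (x \<oplus>\<^bsub>Q\<^esub> y)) t = tensor_lift k P (f x) t \<oplus>\<^bsub>P\<^esub> tensor_lift k P (f y) t"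
    by (rule tensor_ext[OF M N P _ _ _ assms(2)])
      (use x y in \<open>simp_all add: lin linear_map_add[OF T P] pure linear_mapD(2)[OF assms(4)]\<close>)
qed

lemma lift_linear_map:
  assumes "module k Q" and "linear_map k P Q h" and "bilinear k M N P f" and "t \<in> carrier (tensor k
      M N)"
  shows "h (tensor_lift k P f t) = tensor_lift k Q (\<lambda>x y. h (f x y)) t"
  by (rule tensor_ext[OF M N assms(1) linear_map_comp[OF assms(2) linear_map_lift[OF M N P
      assms(3)]]
        linear_map_lift[OF M N assms(1) bilinear_comp[OF assms(2,3)]] _ assms(4)])
    (simp add: lift_pure[OF M N P assms(3)] lift_pure[OF M N assms(1) bilinear_comp[OF assms(2,3)]])

text \<open>Opens an opaque tensor, such as a value of a twisting map: the linear map applied to it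
  becomes a sum in which the components have names.\<close>

lemma linear_map_eq_lift:
  assumes "linear_map k (tensor k M N) P h" and "t \<in> carrier (tensor k M N)"
  shows "h t = tensor_lift k P (\<lambda>x y. h (pure k M N x y)) t"
  by (rule tensor_ext[OF M N P assms(1) linear_map_lift[OF M N P bilinear_comp[OF assms(1)
      bilinear_pure[OF M N]]] _ assms(2)])
    (simp add: lift_pure[OF M N P bilinear_comp[OF assms(1) bilinear_pure[OF M N]]])

end

lemma lift_pure_id:
  assumes "t \<in> carrier (tensor k M N)"
  shows "tensor_lift k (tensor k M N) (pure k M N) t = t"
  using linear_map_eq_lift[OF module_tensor[OF M N] linear_map_id assms] by simp

lemma linear_map_pure_left:
  assumes "linear_map k Q M e" and "y \<in> carrier N"
  shows "linear_map k Q (tensor k M N) (\<lambda>x. pure k M N (e x) y)"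
  by (rule linear_map_comp[OF bilinearD(2)[OF bilinear_pure[OF M N] assms(2)] assms(1)])

lemma linear_map_pure_right:
  assumes "linear_map k Q N e" and "x \<in> carrier M"
  shows "linear_map k Q (tensor k M N) (\<lambda>y. pure k M N x (e y))"
  by (rule linear_map_comp[OF bilinearD(1)[OF bilinear_pure[OF M N] assms(2)] assms(1)])

end

text \<open>Moving a linear map under the sum and rewriting the resulting summand happen together
  here. Iterated, it evaluates a composite of linear maps on nested sums from the outside
  in.\<close>

lemma lift_push:
  assumes "t \<in> carrier (tensor k M N)" and "bilinear k M N P f" and "linear_map k P Q h"
    and "module k M" and "module k N" and "module k P" and "module k Q"
    and "\<And>x y. \<lbrakk>x \<in> carrier M; y \<in> carrier N\<rbrakk> \<Longrightarrow> h (f x y) = g x y"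
  shows "h (tensor_lift k P f t) = tensor_lift k Q g t"
  by (subst lift_linear_map[OF assms(4-7) assms(3,2,1)])
    (rule lift_cong[OF assms(4,5,7,1) bilinear_comp[OF assms(3,2)] assms(8)])

lemma lift_lift:
  assumes M: "module k M" "module k N" and M': "module k M'" "module k N'" and P: "module k P"
    and "bilinear k M' N' P g" and "bilinear k M N (tensor k M' N') f" and "t \<in> carrier (tensor k M
        N)"
  shows "tensor_lift k P g (tensor_lift k (tensor k M' N') f t) = tensor_lift k P (\<lambda>x y. tensor_lift
      k P g (f x y)) t"
  by (rule lift_linear_map[OF M module_tensor[OF M'] P linear_map_lift[OF M' P assms(6)]
      assms(7,8)])

text \<open>Fubini for two sums over independent tensors: both sides are linear in \<open>t\<close>,
  and for a pure \<open>t\<close> the sum over it is a mere evaluation.\<close>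

lemma lift_swap:
  assumes M: "module k M" "module k N" and M': "module k M'" "module k N'" and P: "module k P"
    and "t \<in> carrier (tensor k M N)" and "s \<in> carrier (tensor k M' N')"
    and "\<And>x y. \<lbrakk>x \<in> carrier M; y \<in> carrier N\<rbrakk> \<Longrightarrow> bilinear k M' N' P (f x y)"
    and "\<And>u v. \<lbrakk>u \<in> carrier M'; v \<in> carrier N'\<rbrakk> \<Longrightarrow> bilinear k M N P (\<lambda>x y. f x y u v)"
  shows "tensor_lift k P (\<lambda>x y. tensor_lift k P (f x y) s) t =
    tensor_lift k P (\<lambda>u v. tensor_lift k P (\<lambda>x y. f x y u v) t) s"
proof (rule tensor_ext[OF M P _ _ _ assms(6)])
  have lin: "bilinear k M N P (\<lambda>x y. tensor_lift k P (f x y) s)"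
    by (rule bilinearI; rule linear_map_lift_fun[OF M' P _ assms(7)])
      (use M assms(8) bilinearD[OF assms(9)] in auto)
  show "linear_map k (tensor k M N) P (tensor_lift k P (\<lambda>x y. tensor_lift k P (f x y) s))"
    by (rule linear_map_lift[OF M P lin])
  have bil: "bilinear k M' N' P (\<lambda>u v. tensor_lift k P (\<lambda>x y. f x y u v) t)" if "t \<in> carrier (tensor
      k M N)" for t
    by (rule bilinearI; rule linear_map_lift_fun[OF M P _ that])
      (use M' assms(9) bilinearD[OF assms(8)] in auto)
  show "linear_map k (tensor k M N) P (\<lambda>t. tensor_lift k P (\<lambda>u v. tensor_lift k P (\<lambda>x y. f x y u v)
      t) s)"
    by (rule linear_map_lift_fun[OF M' P module_tensor[OF M] assms(7) bil linear_map_lift[OF M P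
        assms(9)]])
  fix x y assume xy: "x \<in> carrier M" "y \<in> carrier N"
  show "tensor_lift k P (\<lambda>x y. tensor_lift k P (f x y) s) (pure k M N x y) =
      tensor_lift k P (\<lambda>u v. tensor_lift k P (\<lambda>x y. f x y u v) (pure k M N x y)) s"
    unfolding lift_pure[OF M P lin xy]
    by (rule lift_cong[OF M' P assms(7) assms(8)[OF xy]]) (simp add: lift_pure[OF M P assms(9) xy])
qed

section \<open>Tensor products of linear maps\<close>

context
  fixes k :: "'k ring" and M :: "('k, 'a) module" and N :: "('k, 'b) module"
    and P :: "('k, 'c) module" and Q :: "('k, 'd) module" and f g
  assumes M: "module k M" and N: "module k N" and P: "module k P" and Q: "module k Q"
    and f: "linear_map k M P f" and g: "linear_map k N Q g"
begin

private lemma bilinear_pure_map: "bilinear k M N (tensor k P Q) (\<lambda>x y. pure k P Q (f x) (g y))"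
  by (rule bilinearI)
    (use linear_map_pure_left[OF P Q f] linear_map_pure_right[OF P Q g] linear_mapD(1)[OF f]
        linear_mapD(1)[OF g] in auto)

lemma tensor_map_pure:
  "x \<in> carrier M \<Longrightarrow> y \<in> carrier N \<Longrightarrow> tensor_map k P Q f g (pure k M N x y) = pure k P Q (f x) (g y)"
  unfolding tensor_map_def by (rule lift_pure[OF M N module_tensor[OF P Q] bilinear_pure_map])

lemma linear_map_tensor_map: "linear_map k (tensor k M N) (tensor k P Q) (tensor_map k P Q f g)"
  unfolding tensor_map_def by (rule linear_map_lift[OF M N module_tensor[OF P Q] bilinear_pure_map])

text \<open>The change of variables in a sum. It is the reason why relations between twisting maps
  and linear maps can be applied under further sums.\<close>

lemma lift_tensor_map:
  assumes "module k W" and "bilinear k P Q W h" and "t \<in> carrier (tensor k M N)"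
  shows "tensor_lift k W h (tensor_map k P Q f g t) = tensor_lift k W (\<lambda>x y. h (f x) (g y)) t"
proof -
  have *: "tensor_lift k W h (pure k P Q (f x) (g y)) = h (f x) (g y)" if "x \<in> carrier M" "y \<in>
      carrier N" for x y
    by (rule lift_pure[OF P Q assms(1,2)]) (use linear_mapD(1)[OF f] linear_mapD(1)[OF g]
        that in auto)
  have "tensor_lift k W h (tensor_map k P Q f g t) =
      tensor_lift k W (\<lambda>x y. tensor_lift k W h (pure k P Q (f x) (g y))) t"
    unfolding tensor_map_def by (rule lift_lift[OF M N P Q assms(1,2) bilinear_pure_map assms(3)])
  also have "\<dots> = tensor_lift k W (\<lambda>x y. h (f x) (g y)) t"
    by (rule lift_cong[OF M N assms(1,3) bilinear_comp[OF linear_map_lift[OF P Q assms(1,2)]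
        bilinear_pure_map]])
      (rule *)
  finally show ?thesis .
qed

end

context
  fixes k :: "'k ring" and M :: "('k, 'a) module" and N :: "('k, 'b) module" and P :: "('k, 'c)
      module"
  assumes M: "module k M" and N: "module k N" and P: "module k P"
begin

private abbreviation "TR \<equiv> tensor k M (tensor k N P)"
private abbreviation "TL \<equiv> tensor k (tensor k M N) P"

private lemmas mods = M N P module_tensor[OF M N] module_tensor[OF N P]
private lemma TR: "module k TR" by (rule module_tensor[OF M module_tensor[OF N P]])
private lemma TL: "module k TL" by (rule module_tensor[OF module_tensor[OF M N] P])

private lemma right1: "z \<in> carrier P \<Longrightarrow> bilinear k M N TR (\<lambda>x y. pure k M (tensor k N P) x (pure k N
    P y z))"
  by (rule bilinearI) (intro linear_map_pure_left linear_map_pure_right linear_map_id mods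
      pure_closed; assumption)+

private lemma right2: "bilinear k (tensor k M N) P TR
    (\<lambda>t z. tensor_lift k TR (\<lambda>x y. pure k M (tensor k N P) x (pure k N P y z)) t)"
proof (rule bilinearI)
  show "linear_map k P TR (\<lambda>z. tensor_lift k TR (\<lambda>x y. pure k M (tensor k N P) x (pure k N P y z))
      t)"
    if "t \<in> carrier (tensor k M N)" for t
    by (rule linear_map_lift_fun[OF M N TR P that right1])
      (assumption | intro linear_map_pure_right linear_map_id mods)+
qed (rule linear_map_lift[OF M N TR right1])

lemma linear_map_assoc_right: "linear_map k TL TR (assoc_right k M N P)"
  unfolding assoc_right_def Let_def by (rule linear_map_lift[OF module_tensor[OF M N] P TR right2])

text \<open>The tensor \<open>t\<close> stays general because the associators are met right after a
  twisting map, whose value is not pure. This is the place where a composite written with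
  associators turns into a sum.\<close>

lemma assoc_right_pure:
  "t \<in> carrier (tensor k M N) \<Longrightarrow> z \<in> carrier P \<Longrightarrow> assoc_right k M N P (pure k (tensor k M N) P t z) =
    tensor_lift k TR (\<lambda>x y. pure k M (tensor k N P) x (pure k N P y z)) t"
  unfolding assoc_right_def Let_def by (rule lift_pure[OF module_tensor[OF M N] P TR right2])

lemma assoc_right_pure_pure:
  "x \<in> carrier M \<Longrightarrow> y \<in> carrier N \<Longrightarrow> z \<in> carrier P \<Longrightarrow>
    assoc_right k M N P (pure k (tensor k M N) P (pure k M N x y) z) =
        pure k M (tensor k N P) x (pure k N P y z)"
  by (simp add: assoc_right_pure pure_closed M N lift_pure[OF M N TR right1])

private lemma left1: "x \<in> carrier M \<Longrightarrow> bilinear k N P TL (\<lambda>y z. pure k (tensor k M N) P (pure k M N x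
    y) z)"
  by (rule bilinearI) (intro linear_map_pure_left linear_map_pure_right linear_map_id mods
      pure_closed; assumption)+

private lemma left2: "bilinear k M (tensor k N P) TL
    (\<lambda>x t. tensor_lift k TL (\<lambda>y z. pure k (tensor k M N) P (pure k M N x y) z) t)"
proof (rule bilinearI)
  show "linear_map k M TL (\<lambda>x. tensor_lift k TL (\<lambda>y z. pure k (tensor k M N) P (pure k M N x y) z)
      t)"
    if "t \<in> carrier (tensor k N P)" for t
    by (rule linear_map_lift_fun[OF N P TL M that left1])
      (assumption | intro linear_map_pure_left linear_map_id mods)+
qed (rule linear_map_lift[OF N P TL left1])

lemma linear_map_assoc_left: "linear_map k TR TL (assoc_left k M N P)"
  unfolding assoc_left_def Let_def by (rule linear_map_lift[OF M module_tensor[OF N P] TL left2])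

lemma assoc_left_pure:
  "x \<in> carrier M \<Longrightarrow> t \<in> carrier (tensor k N P) \<Longrightarrow> assoc_left k M N P (pure k M (tensor k N P) x t) =
    tensor_lift k TL (\<lambda>y z. pure k (tensor k M N) P (pure k M N x y) z) t"
  unfolding assoc_left_def Let_def by (rule lift_pure[OF M module_tensor[OF N P] TL left2])

lemma assoc_left_pure_pure:
  "x \<in> carrier M \<Longrightarrow> y \<in> carrier N \<Longrightarrow> z \<in> carrier P \<Longrightarrow>
    assoc_left k M N P (pure k M (tensor k N P) x (pure k N P y z)) = pure k (tensor k M N) P (pure
        k M N x y) z"
  by (simp add: assoc_left_pure pure_closed N P lift_pure[OF N P TL left1])

end

lemma unital_algebra_module: "unital_algebra k A \<Longrightarrow> module k A"
  by (simp add: unital_algebra_def)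

lemma bilinear_mult:
  assumes "unital_algebra k A"
  shows "bilinear k A A A (\<lambda>x y. x \<otimes>\<^bsub>A\<^esub> y)"
proof -
  interpret A: unital_algebra k A by fact
  show ?thesis
    by (intro bilinearI linear_mapI) (auto simp: A.l_distr A.r_distr A.smult_mult_left
        A.smult_mult_right)
qed

lemma linear_map_mult_left:
  assumes "unital_algebra k A" and "linear_map k Q A e" and "y \<in> carrier A"
  shows "linear_map k Q A (\<lambda>x. e x \<otimes>\<^bsub>A\<^esub> y)"
  by (rule linear_map_comp[OF bilinearD(2)[OF bilinear_mult[OF assms(1)] assms(3)] assms(2)])

lemma linear_map_mult_right:
  assumes "unital_algebra k A" and "linear_map k Q A e" and "x \<in> carrier A"
  shows "linear_map k Q A (\<lambda>y. x \<otimes>\<^bsub>A\<^esub> e y)"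
  by (rule linear_map_comp[OF bilinearD(1)[OF bilinear_mult[OF assms(1)] assms(3)] assms(2)])

lemma linear_map_product_map:
  assumes "unital_algebra k A"
  shows "linear_map k (tensor k A A) A (product_map k A)"
  unfolding product_map_def
  using linear_map_lift[OF _ _ _ bilinear_mult[OF assms]] unital_algebra_module[OF assms] by auto

lemma product_map_pure:
  assumes "unital_algebra k A" and "x \<in> carrier A" and "y \<in> carrier A"
  shows "product_map k A (pure k A A x y) = x \<otimes>\<^bsub>A\<^esub> y"
  unfolding product_map_def
  using lift_pure[OF _ _ _ bilinear_mult[OF assms(1)] assms(2,3)] unital_algebra_module[OF assms(1)]
      by auto

lemma linear_map_id': "linear_map k M M id"
  by (rule linear_mapI) auto

lemma linear_map_bilinear:
  assumes "bilinear k M N P g" and "linear_map k Q M e"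
  shows "y \<in> carrier N \<Longrightarrow> linear_map k Q P (\<lambda>x. g (e x) y)"
  by (rule linear_map_comp[OF bilinearD(2)[OF assms(1)] assms(2)])

lemma linear_map_bilinear':
  assumes "bilinear k M N P g" and "linear_map k Q N e"
  shows "x \<in> carrier M \<Longrightarrow> linear_map k Q P (\<lambda>y. g x (e y))"
  by (rule linear_map_comp[OF bilinearD(1)[OF assms(1)] assms(2)])

text \<open>These rules prove that an expression is linear in a variable by following the unique
  occurrence of that variable.\<close>

named_theorems linear_intros

lemma mult_closed:
  fixes k :: "'k ring" and A :: "('k, 'a) module"
  assumes "unital_algebra k A" and "x \<in> carrier A" and "y \<in> carrier A"
  shows "x \<otimes>\<^bsub>A\<^esub> y \<in> carrier A"
  by (rule bilinearD(3)[OF bilinear_mult[OF assms(1)] assms(2,3)])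

lemma lift_closed':
  assumes "t \<in> carrier (tensor k M N)" and "bilinear k M N P f"
    and "module k M" and "module k N" and "module k P"
  shows "tensor_lift k P f t \<in> carrier P"
  by (rule lift_closed[OF assms(3-5,2,1)])

lemmas [linear_intros] =
  linear_map_id linear_map_id' linear_map_lift_arg[rotated 3] linear_map_lift_fun[rotated 4]
  linear_map_pure_left linear_map_pure_right linear_map_mult_left linear_map_mult_right
  pure_closed mult_closed lift_closed' module_tensor
  linear_map_tensor_map linear_map_assoc_right linear_map_assoc_left linear_map_product_map
  linear_map_lift bilinearI

section \<open>Twisting maps\<close>

text \<open>The pointwise form of \<open>twisting_map\<close>: at pure tensors the associators
  disappear, and each axiom becomes a rule for moving a twist past a product at the price of one
  more sum.\<close>

locale twist =
  fixes k :: "'k ring" and A :: "('k, 'a) module" and B :: "('k, 'b) module"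
    and S :: "('b \<times> 'a \<Rightarrow> 'k) set \<Rightarrow> ('a \<times> 'b \<Rightarrow> 'k) set"
  assumes A: "unital_algebra k A" and B: "unital_algebra k B"
    and S: "linear_map k (tensor k B A) (tensor k A B) S"
    and twist_mult_right: "\<lbrakk>b \<in> carrier B; a \<in> carrier A; a' \<in> carrier A\<rbrakk> \<Longrightarrow>
      S (pure k B A b (a \<otimes>\<^bsub>A\<^esub> a')) =
      tensor_lift k (tensor k A B) (\<lambda>x y. tensor_lift k (tensor k A B) (\<lambda>u v.
        pure k A B (x \<otimes>\<^bsub>A\<^esub> u) v) (S (pure k B A y a'))) (S (pure k B A b a))"
    and twist_mult_left: "\<lbrakk>b \<in> carrier B; b' \<in> carrier B; a \<in> carrier A\<rbrakk> \<Longrightarrow>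
      S (pure k B A (b \<otimes>\<^bsub>B\<^esub> b') a) =
      tensor_lift k (tensor k A B) (\<lambda>x y. tensor_lift k (tensor k A B) (\<lambda>u v.
        pure k A B u (v \<otimes>\<^bsub>B\<^esub> y)) (S (pure k B A b x))) (S (pure k B A b' a))"
begin

lemmas mod_A = unital_algebra_module[OF A] and mod_B = unital_algebra_module[OF B]

lemmas S_closed = linear_mapD(1)[OF S] and S_comp = linear_map_comp[OF S]

lemmas [linear_intros] = A B mod_A mod_B S S_closed S_comp

text \<open>Within a chain of nested sums, whatever follows a twist is a bilinear function of its
  two components. With \<open>g\<close> standing for that continuation, the axiom rewrites in the
  middle of a chain.\<close>

lemma lift_twist_mult_right:
  assumes "bilinear k A B P g" and P: "module k P"
    and "b \<in> carrier B" and "a \<in> carrier A" and "a' \<in> carrier A"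
  shows "tensor_lift k P g (S (pure k B A b (a \<otimes>\<^bsub>A\<^esub> a'))) =
      tensor_lift k P (\<lambda>x y. tensor_lift k P (\<lambda>u v. g (x \<otimes>\<^bsub>A\<^esub> u) v) (S (pure k B A y a')))
        (S (pure k B A b a))"
  unfolding twist_mult_right[OF assms(3-5)]
proof (rule lift_push[where h = "tensor_lift k P g"])
  note ints = assms linear_map_bilinear[OF assms(1)] linear_map_bilinear'[OF assms(1)] linear_intros
  show "tensor_lift k P g (tensor_lift k (tensor k A B) (\<lambda>u v. pure k A B (x \<otimes>\<^bsub>A\<^esub> u) v) (S (pure k B
      A y a'))) =
      tensor_lift k P (\<lambda>u v. g (x \<otimes>\<^bsub>A\<^esub> u) v) (S (pure k B A y a'))"
    if xy: "x \<in> carrier A" "y \<in> carrier B" for x y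
    by (rule lift_push[where h = "tensor_lift k P g"])
      ((rule ints xy | assumption)+, (rule lift_pure, (rule ints xy | assumption)+))
qed (rule assms linear_map_bilinear[OF assms(1)] linear_map_bilinear'[OF assms(1)] linear_intros |
    assumption)+

lemma lift_twist_mult_left:
  assumes "bilinear k A B P g" and P: "module k P"
    and "b \<in> carrier B" and "b' \<in> carrier B" and "a \<in> carrier A"
  shows "tensor_lift k P g (S (pure k B A (b \<otimes>\<^bsub>B\<^esub> b') a)) =
      tensor_lift k P (\<lambda>x y. tensor_lift k P (\<lambda>u v. g u (v \<otimes>\<^bsub>B\<^esub> y)) (S (pure k B A b x)))
        (S (pure k B A b' a))"
  unfolding twist_mult_left[OF assms(3-5)]
proof (rule lift_push[where h = "tensor_lift k P g"])
  note ints = assms linear_map_bilinear[OF assms(1)] linear_map_bilinear'[OF assms(1)] linear_intros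
  show "tensor_lift k P g (tensor_lift k (tensor k A B) (\<lambda>u v. pure k A B u (v \<otimes>\<^bsub>B\<^esub> y)) (S (pure k B
      A b x))) =
      tensor_lift k P (\<lambda>u v. g u (v \<otimes>\<^bsub>B\<^esub> y)) (S (pure k B A b x))"
    if xy: "x \<in> carrier A" "y \<in> carrier B" for x y
    by (rule lift_push[where h = "tensor_lift k P g"])
      ((rule ints xy | assumption)+, (rule lift_pure, (rule ints xy | assumption)+))
qed (rule assms linear_map_bilinear[OF assms(1)] linear_map_bilinear'[OF assms(1)] linear_intros |
    assumption)+

end

lemma twist_of_twisting_map:
  assumes A: "unital_algebra k A" and B: "unital_algebra k B" and R: "twisting_map k A B R"
  shows "twist k A B R"
proof (rule twist.intro[OF A B])
  note mods = unital_algebra_module[OF A] unital_algebra_module[OF B]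
  show S: "linear_map k (tensor k B A) (tensor k A B) R"
    using R by (simp add: twisting_map_def)
  note ints = A B mods linear_mapD(1)[OF S] linear_map_comp[OF S] S linear_intros
  show "R (pure k B A b (a \<otimes>\<^bsub>A\<^esub> a')) =
      tensor_lift k (tensor k A B) (\<lambda>x y. tensor_lift k (tensor k A B) (\<lambda>u v.
        pure k A B (x \<otimes>\<^bsub>A\<^esub> u) v) (R (pure k B A y a'))) (R (pure k B A b a))"
    if b: "b \<in> carrier B" and a: "a \<in> carrier A" and a': "a' \<in> carrier A" for a a' b
  proof -
    let ?t = "pure k B (tensor k A A) b (pure k A A a a')" and ?r = "R (pure k B A b a)"
    have t: "?t \<in> carrier (tensor k B (tensor k A A))" by (rule ints b a a')+
    have r: "?r \<in> carrier (tensor k A B)" by (rule ints b a a')+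
    \<comment> \<open>\<open>e0\<close> evaluates the left side of the axiom. The other four
      equations peel off the maps of the right side from the inside out; a sum opens whenever an
      associator meets a tensor that is not pure, in \<open>e2\<close> for the first twist and in
      \<open>e3\<close> for the second.\<close>
    have e0: "tensor_map k B A id (product_map k A) ?t = pure k B A b (a \<otimes>\<^bsub>A\<^esub> a')"
      by (subst tensor_map_pure, (rule ints b a a')+) (simp add: product_map_pure A a a')
    have e1: "tensor_map k (tensor k A B) A R id (assoc_left k B A A ?t) =
        pure k (tensor k A B) A ?r a'"
      by (subst assoc_left_pure_pure, (rule ints b a a')+, subst tensor_map_pure,
          (rule ints b a a')+) simp
    have e2: "tensor_map k A (tensor k A B) id R (assoc_right k A B A (pure k (tensor k A B) A ?r
        a')) =
        tensor_lift k (tensor k A (tensor k A B)) (\<lambda>x y. pure k A (tensor k A B) x (R (pure k B A y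
            a'))) ?r"
      by (subst assoc_right_pure, (rule ints r a')+, rule lift_push, (rule ints r a' | assumption)+,
          subst tensor_map_pure, (rule ints r a' | assumption)+, simp)
    have e3: "assoc_left k A A B (tensor_lift k (tensor k A (tensor k A B)) (\<lambda>x y. pure k A (tensor
        k A B) x (R (pure k B A y a'))) ?r) =
        tensor_lift k (tensor k (tensor k A A) B) (\<lambda>x y. tensor_lift k (tensor k (tensor k A A) B)
          (\<lambda>u v. pure k (tensor k A A) B (pure k A A x u) v) (R (pure k B A y a'))) ?r"
      by (rule lift_push, (rule ints r a' | assumption)+, subst assoc_left_pure,
          (rule ints r a' | assumption)+, simp)
    have e4: "tensor_map k A B (product_map k A) id (tensor_lift k (tensor k (tensor k A A) B) (\<lambda>x
        y. tensor_lift k (tensor k (tensor k A A) B)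
          (\<lambda>u v. pure k (tensor k A A) B (pure k A A x u) v) (R (pure k B A y a'))) ?r) =
        tensor_lift k (tensor k A B) (\<lambda>x y. tensor_lift k (tensor k A B)
          (\<lambda>u v. pure k A B (x \<otimes>\<^bsub>A\<^esub> u) v) (R (pure k B A y a'))) ?r"
      by (rule lift_push, (rule ints r a' | assumption)+, rule lift_push,
          (rule ints r a' | assumption)+,
          subst tensor_map_pure, (rule ints r a' | assumption)+, simp add: product_map_pure A)
    show ?thesis using R t by (simp add: twisting_map_def e0[symmetric] e1 e2 e3 e4)
  qed
  show "R (pure k B A (b \<otimes>\<^bsub>B\<^esub> b') a) =
      tensor_lift k (tensor k A B) (\<lambda>x y. tensor_lift k (tensor k A B) (\<lambda>u v.
        pure k A B u (v \<otimes>\<^bsub>B\<^esub> y)) (R (pure k B A b x))) (R (pure k B A b' a))"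
    if b: "b \<in> carrier B" and b': "b' \<in> carrier B" and a: "a \<in> carrier A" for a b b'
  proof -
    let ?t = "pure k (tensor k B B) A (pure k B B b b') a" and ?r = "R (pure k B A b' a)"
    have t: "?t \<in> carrier (tensor k (tensor k B B) A)" by (rule ints b a b')+
    have r: "?r \<in> carrier (tensor k A B)" by (rule ints b a b')+
    have e0: "tensor_map k B A (product_map k B) id ?t = pure k B A (b \<otimes>\<^bsub>B\<^esub> b') a"
      by (subst tensor_map_pure, (rule ints b a b')+) (simp add: product_map_pure B b b')
    have e1: "tensor_map k B (tensor k A B) id R (assoc_right k B B A ?t) =
        pure k B (tensor k A B) b ?r"
      by (subst assoc_right_pure_pure, (rule ints b a b')+, subst tensor_map_pure,
          (rule ints b a b')+) simp
    have e2: "tensor_map k (tensor k A B) B R id (assoc_left k B A B (pure k B (tensor k A B) b ?r))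
        =
        tensor_lift k (tensor k (tensor k A B) B) (\<lambda>x y. pure k (tensor k A B) B (R (pure k B A b
            x)) y) ?r"
      by (subst assoc_left_pure, (rule ints r b)+, rule lift_push, (rule ints r b | assumption)+,
          subst tensor_map_pure, (rule ints r b | assumption)+, simp)
    have e3: "assoc_right k A B B (tensor_lift k (tensor k (tensor k A B) B) (\<lambda>x y. pure k (tensor k
        A B) B (R (pure k B A b x)) y) ?r) =
        tensor_lift k (tensor k A (tensor k B B)) (\<lambda>x y. tensor_lift k (tensor k A (tensor k B B))
          (\<lambda>u v. pure k A (tensor k B B) u (pure k B B v y)) (R (pure k B A b x))) ?r"
      by (rule lift_push, (rule ints r b | assumption)+, subst assoc_right_pure,
          (rule ints r b | assumption)+, simp)
    have e4: "tensor_map k A B id (product_map k B) (tensor_lift k (tensor k A (tensor k B B)) (\<lambda>x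
        y. tensor_lift k (tensor k A (tensor k B B))
          (\<lambda>u v. pure k A (tensor k B B) u (pure k B B v y)) (R (pure k B A b x))) ?r) =
        tensor_lift k (tensor k A B) (\<lambda>x y. tensor_lift k (tensor k A B)
          (\<lambda>u v. pure k A B u (v \<otimes>\<^bsub>B\<^esub> y)) (R (pure k B A b x))) ?r"
      by (rule lift_push, (rule ints r b | assumption)+, rule lift_push,
          (rule ints r b | assumption)+,
          subst tensor_map_pure, (rule ints r b | assumption)+, simp add: product_map_pure B)
    show ?thesis using R t by (simp add: twisting_map_def e0[symmetric] e1 e2 e3 e4)
  qed
qed

section \<open>The twisted tensor product algebra\<close>

lemma twisted_tensor_simps [simp]:
  "carrier (twisted_tensor k A B S) = carrier (tensor k A B)"
  "add (twisted_tensor k A B S) = add (tensor k A B)"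
  "zero (twisted_tensor k A B S) = zero (tensor k A B)"
  "smult (twisted_tensor k A B S) = smult (tensor k A B)"
  "one (twisted_tensor k A B S) = pure k A B \<one>\<^bsub>A\<^esub> \<one>\<^bsub>B\<^esub>"
  by (simp_all add: twisted_tensor_def)

lemma linear_map_twisted_tensor [simp]:
  "linear_map k (twisted_tensor k A B S) N f \<longleftrightarrow> linear_map k (tensor k A B) N f"
  "linear_map k N (twisted_tensor k A B S) g \<longleftrightarrow> linear_map k N (tensor k A B) g"
  by (simp_all add: linear_map_def)

text \<open>A tensor product sees only the module structure of its factors, so a twisted product can
  be replaced by the plain one inside it. This keeps the iterated construction from producing two
  versions of the same module.\<close>

lemma tensor_twisted_tensor [simp]:
  "tensor k (twisted_tensor k A B S) C = tensor k (tensor k A B) C"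
  "tensor k C (twisted_tensor k A B S) = tensor k C (tensor k A B)"
  by (simp_all add: tensor_def tensor_kernel_def tensor_relations_def)

lemma pure_twisted_tensor [simp]:
  "pure k (twisted_tensor k A B S) C = pure k (tensor k A B) C"
  "pure k C (twisted_tensor k A B S) = pure k C (tensor k A B)"
  by (simp_all add: fun_eq_iff pure_def tensor_kernel_def tensor_relations_def)

lemma a_inv_cong:
  assumes "carrier M = carrier N" and "add M = add N" and "zero M = zero N"
  shows "a_inv M = a_inv N"
  using assms by (simp add: fun_eq_iff a_inv_def m_inv_def)

context twist
begin

abbreviation T where "T \<equiv> tensor k A B"
abbreviation AB where "AB \<equiv> twisted_tensor k A B S"

lemma mod_T: "module k T"
  by (rule linear_intros)+

lemma module_twisted_tensor: "module k AB"
proof -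
  interpret T: module k T by (rule mod_T)
  show ?thesis
  proof (rule moduleI)
    show "abelian_group AB"
      by (rule abelian_groupI) (auto simp: T.a_ac intro: T.l_neg)
  qed (use T.R.cring_axioms in \<open>auto simp: T.smult_l_distr T.smult_r_distr T.smult_assoc1\<close>)
qed

context
begin

private abbreviation "L1 \<equiv> assoc_left k T A B"
private abbreviation "L2 \<equiv> tensor_map k (tensor k A (tensor k B A)) B (assoc_right k A B A) id"
private abbreviation "L3 \<equiv> tensor_map k (tensor k A T) B (tensor_map k A T id S) id"
private abbreviation "L4 \<equiv> tensor_map k (tensor k (tensor k A A) B) B (assoc_left k A A B) id"
private abbreviation "L5 \<equiv> assoc_right k (tensor k A A) B B"
private abbreviation "L6 \<equiv> tensor_map k A B (product_map k A) (product_map k B)"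

private lemma mult_L: "s \<otimes>\<^bsub>AB\<^esub> t = L6 (L5 (L4 (L3 (L2 (L1 (pure k T T s t))))))"
  by (simp add: twisted_tensor_def)

private lemma linear_L: "linear_map k (tensor k T T) T (\<lambda>w. L6 (L5 (L4 (L3 (L2 (L1 w))))))"
  by (rule linear_map_comp[where g = L6], (rule linear_intros)+)
     (rule linear_map_comp[where g = L5], (rule linear_intros)+,
      rule linear_map_comp[where g = L4], (rule linear_intros)+,
      rule linear_map_comp[where g = L3], (rule linear_intros)+,
      rule linear_map_comp[where g = L2], (rule linear_intros)+)

lemma bilinear_twisted_mult: "bilinear k T T T (\<lambda>s t. s \<otimes>\<^bsub>AB\<^esub> t)"
  unfolding mult_L by (rule bilinear_comp[OF linear_L bilinear_pure[OF mod_T mod_T]])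

lemmas twisted_mult_intros =
  linear_map_bilinear[OF bilinear_twisted_mult] linear_map_bilinear'[OF bilinear_twisted_mult]
  bilinearD(3)[OF bilinear_twisted_mult]

text \<open>Among the six maps that define the product, only \<open>L3\<close> involves
  \<open>S\<close>. Up to that point all tensors are built from pure ones; afterwards a single sum
  over the components of \<open>?s\<close> is carried to the end.\<close>

lemma twisted_mult_pure:
  assumes "a \<in> carrier A" and "b \<in> carrier B" and "a' \<in> carrier A" and "b' \<in> carrier B"
  shows "pure k A B a b \<otimes>\<^bsub>AB\<^esub> pure k A B a' b' =
    tensor_lift k T (\<lambda>x y. pure k A B (a \<otimes>\<^bsub>A\<^esub> x) (y \<otimes>\<^bsub>B\<^esub> b')) (S (pure k B A b a'))"
proof -
  note ints = assms linear_intros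
  let ?s = "S (pure k B A b a')"
  have s: "?s \<in> carrier T" by (rule ints)+
  have "L1 (pure k T T (pure k A B a b) (pure k A B a' b')) = pure k (tensor k T A) B (pure k T A
      (pure k A B a b) a') b'"
    by (rule assoc_left_pure_pure, (rule ints)+)
  moreover have "L2 \<dots> = pure k (tensor k A (tensor k B A)) B (pure k A (tensor k B A) a (pure k B A
      b a')) b'"
    by (subst tensor_map_pure, (rule ints)+, subst assoc_right_pure_pure, (rule ints)+, simp)
  moreover have "L3 \<dots> = pure k (tensor k A T) B (pure k A T a ?s) b'"
    by (subst tensor_map_pure, (rule ints)+, subst tensor_map_pure, (rule ints)+, simp)
  moreover have "L4 \<dots> = tensor_lift k (tensor k (tensor k (tensor k A A) B) B)
      (\<lambda>x y. pure k (tensor k (tensor k A A) B) B (pure k (tensor k A A) B (pure k A A a x) y) b')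
          ?s"
    by (subst tensor_map_pure, (rule ints)+, subst assoc_left_pure, (rule ints)+,
        rule lift_push[where h = "\<lambda>t. pure k (tensor k (tensor k A A) B) B t (id b')"],
            (rule s ints | assumption)+, simp_all add: ints)
  moreover have "L5 \<dots> = tensor_lift k (tensor k (tensor k A A) (tensor k B B))
      (\<lambda>x y. pure k (tensor k A A) (tensor k B B) (pure k A A a x) (pure k B B y b')) ?s"
    by (rule lift_push[where h = L5], (rule s ints | assumption)+, rule assoc_right_pure_pure,
        (rule ints | assumption)+)
  moreover have "L6 \<dots> = tensor_lift k T (\<lambda>x y. pure k A B (a \<otimes>\<^bsub>A\<^esub> x) (y \<otimes>\<^bsub>B\<^esub> b')) ?s"
    by (rule lift_push[where h = L6], (rule s ints | assumption)+, subst tensor_map_pure,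
        (rule ints | assumption)+,
        simp add: product_map_pure A B assms)
  ultimately show ?thesis unfolding mult_L by simp
qed

end

text \<open>Both bracketings lead to the same triple sum: over \<open>?s\<close>, over
  \<open>?t\<close>, and over the twist of the inner components \<open>y\<close> and
  \<open>p\<close>. The left one arrives there by splitting the product
  \<open>y \<otimes> b'\<close> before \<open>a''\<close>, the right one by splitting
  \<open>a' \<otimes> p\<close> behind \<open>b\<close>; the sums over \<open>?s\<close> and
  \<open>?t\<close> are independent and can be exchanged.\<close>

lemma twisted_assoc_pure:
  assumes "a \<in> carrier A" and "b \<in> carrier B" and "a' \<in> carrier A" and "b' \<in> carrier B"
    and "a'' \<in> carrier A" and "b'' \<in> carrier B"
  shows "(pure k A B a b \<otimes>\<^bsub>AB\<^esub> pure k A B a' b') \<otimes>\<^bsub>AB\<^esub> pure k A B a'' b'' =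
    pure k A B a b \<otimes>\<^bsub>AB\<^esub> (pure k A B a' b' \<otimes>\<^bsub>AB\<^esub> pure k A B a'' b'')"
proof -
  interpret A: unital_algebra k A by (rule A)
  interpret B: unital_algebra k B by (rule B)
  note ints = assms twisted_mult_intros linear_intros
  let ?s = "S (pure k B A b a')" and ?t = "S (pure k B A b' a'')"
  have s: "?s \<in> carrier T" and t: "?t \<in> carrier T" by (rule ints)+
  have "(pure k A B a b \<otimes>\<^bsub>AB\<^esub> pure k A B a' b') \<otimes>\<^bsub>AB\<^esub> pure k A B a'' b'' =
      tensor_lift k T (\<lambda>x y. tensor_lift k T (\<lambda>u v. pure k A B (a \<otimes>\<^bsub>A\<^esub> x \<otimes>\<^bsub>A\<^esub> u) (v \<otimes>\<^bsub>B\<^esub> b''))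
        (S (pure k B A (y \<otimes>\<^bsub>B\<^esub> b') a''))) ?s"
    by (subst twisted_mult_pure, (rule ints)+,
        rule lift_push[where h = "\<lambda>s. s \<otimes>\<^bsub>AB\<^esub> pure k A B a'' b''"], (rule s ints | assumption)+,
        rule twisted_mult_pure, (rule ints | assumption)+)
  also have "\<dots> = tensor_lift k T (\<lambda>x y. tensor_lift k T (\<lambda>p q. tensor_lift k T (\<lambda>u v.
        pure k A B (a \<otimes>\<^bsub>A\<^esub> x \<otimes>\<^bsub>A\<^esub> u) (v \<otimes>\<^bsub>B\<^esub> q \<otimes>\<^bsub>B\<^esub> b''))
        (S (pure k B A y p))) ?t) ?s"
    by (rule lift_cong[OF mod_A mod_B mod_T s], (rule ints | assumption)+,
        rule lift_twist_mult_left, (rule ints | assumption)+)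
  also have "\<dots> = tensor_lift k T (\<lambda>p q. tensor_lift k T (\<lambda>x y. tensor_lift k T (\<lambda>u v.
        pure k A B (a \<otimes>\<^bsub>A\<^esub> x \<otimes>\<^bsub>A\<^esub> u) (v \<otimes>\<^bsub>B\<^esub> q \<otimes>\<^bsub>B\<^esub> b''))
        (S (pure k B A y p))) ?s) ?t"
    by (rule lift_swap[OF mod_A mod_B mod_A mod_B mod_T s t]; (rule ints | assumption)+)
  also have "\<dots> = tensor_lift k T (\<lambda>p q. tensor_lift k T (\<lambda>x y. tensor_lift k T (\<lambda>u v.
        pure k A B (a \<otimes>\<^bsub>A\<^esub> (x \<otimes>\<^bsub>A\<^esub> u)) (v \<otimes>\<^bsub>B\<^esub> (q \<otimes>\<^bsub>B\<^esub> b'')))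
        (S (pure k B A y p))) ?s) ?t"
    by (rule lift_cong[OF mod_A mod_B mod_T t], (rule ints | assumption)+,
        rule lift_cong[OF mod_A mod_B mod_T s], (rule ints | assumption)+,
        rule lift_cong[OF mod_A mod_B mod_T], (rule ints | assumption)+,
        simp add: A.m_assoc B.m_assoc assms)
  also have "\<dots> = tensor_lift k T (\<lambda>p q. tensor_lift k T (\<lambda>u v.
        pure k A B (a \<otimes>\<^bsub>A\<^esub> u) (v \<otimes>\<^bsub>B\<^esub> (q \<otimes>\<^bsub>B\<^esub> b''))) (S (pure k B A b (a' \<otimes>\<^bsub>A\<^esub> p)))) ?t"
    by (rule sym, rule lift_cong[OF mod_A mod_B mod_T t], (rule ints | assumption)+,
        rule lift_twist_mult_right, (rule ints | assumption)+)
  also have "\<dots> = pure k A B a b \<otimes>\<^bsub>AB\<^esub> (pure k A B a' b' \<otimes>\<^bsub>AB\<^esub> pure k A B a'' b'')"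
    by (rule sym, subst twisted_mult_pure[of a' b' a'' b''], (rule ints)+,
        rule lift_push[where h = "\<lambda>s. pure k A B a b \<otimes>\<^bsub>AB\<^esub> s"], (rule t ints | assumption)+,
        rule twisted_mult_pure, (rule ints | assumption)+)
  finally show ?thesis .
qed

lemma twisted_assoc:
  assumes "r \<in> carrier T" and "s \<in> carrier T" and "t \<in> carrier T"
  shows "(r \<otimes>\<^bsub>AB\<^esub> s) \<otimes>\<^bsub>AB\<^esub> t = r \<otimes>\<^bsub>AB\<^esub> (s \<otimes>\<^bsub>AB\<^esub> t)"
proof (rule tensor_ext[OF mod_A mod_B mod_T _ _ _ assms(1)])
  note ints = twisted_mult_intros linear_intros
  fix a b assume 1: "a \<in> carrier A" "b \<in> carrier B"
  show "(pure k A B a b \<otimes>\<^bsub>AB\<^esub> s) \<otimes>\<^bsub>AB\<^esub> t = pure k A B a b \<otimes>\<^bsub>AB\<^esub> (s \<otimes>\<^bsub>AB\<^esub> t)"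
  proof (rule tensor_ext[OF mod_A mod_B mod_T _ _ _ assms(2)])
    fix a' b' assume 2: "a' \<in> carrier A" "b' \<in> carrier B"
    show "(pure k A B a b \<otimes>\<^bsub>AB\<^esub> pure k A B a' b') \<otimes>\<^bsub>AB\<^esub> t = pure k A B a b \<otimes>\<^bsub>AB\<^esub> (pure k A B a' b'
        \<otimes>\<^bsub>AB\<^esub> t)"
      by (rule tensor_ext[OF mod_A mod_B mod_T _ _ _ assms(3)])
        ((rule ints 1 2)+, rule twisted_assoc_pure[OF 1 2])
  qed (rule ints 1 assms(3))+
qed (rule twisted_mult_intros linear_intros assms(2,3))+

end

locale unital_twist = twist +
  assumes S_one_left: "a \<in> carrier A \<Longrightarrow> S (pure k B A \<one>\<^bsub>B\<^esub> a) = pure k A B a \<one>\<^bsub>B\<^esub>"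
    and S_one_right: "b \<in> carrier B \<Longrightarrow> S (pure k B A b \<one>\<^bsub>A\<^esub>) = pure k A B \<one>\<^bsub>A\<^esub> b"
begin

lemma unital_algebra_twisted_tensor: "unital_algebra k AB"
proof -
  interpret A: unital_algebra k A by (rule A)
  interpret B: unital_algebra k B by (rule B)
  interpret AB: module k AB by (rule module_twisted_tensor)
  note ints = twisted_mult_intros linear_intros
  have ones: "\<one>\<^bsub>A\<^esub> \<in> carrier A" "\<one>\<^bsub>B\<^esub> \<in> carrier B" by auto
  have l_one: "pure k A B \<one>\<^bsub>A\<^esub> \<one>\<^bsub>B\<^esub> \<otimes>\<^bsub>AB\<^esub> t = t" if "t \<in> carrier T" for t
  proof (rule tensor_ext[OF mod_A mod_B mod_T _ _ _ that])
    fix a b assume ab: "a \<in> carrier A" "b \<in> carrier B"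
    show "pure k A B \<one>\<^bsub>A\<^esub> \<one>\<^bsub>B\<^esub> \<otimes>\<^bsub>AB\<^esub> pure k A B a b = pure k A B a b"
      by (subst twisted_mult_pure, (rule ones ab)+, subst S_one_left[OF ab(1)], subst lift_pure,
          (rule ints ab ones | assumption)+, use ab in simp)
  qed (rule ints ones)+
  have r_one: "t \<otimes>\<^bsub>AB\<^esub> pure k A B \<one>\<^bsub>A\<^esub> \<one>\<^bsub>B\<^esub> = t" if "t \<in> carrier T" for t
  proof (rule tensor_ext[OF mod_A mod_B mod_T _ _ _ that])
    fix a b assume ab: "a \<in> carrier A" "b \<in> carrier B"
    show "pure k A B a b \<otimes>\<^bsub>AB\<^esub> pure k A B \<one>\<^bsub>A\<^esub> \<one>\<^bsub>B\<^esub> = pure k A B a b"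
      by (subst twisted_mult_pure, (rule ones ab)+, subst S_one_right[OF ab(2)], subst lift_pure,
          (rule ints ab ones | assumption)+, use ab in simp)
  qed (rule ints ones)+
  note D = bilinearD(1,2)[OF bilinear_twisted_mult, THEN linear_mapD(2)]
    bilinearD(1,2)[OF bilinear_twisted_mult, THEN linear_mapD(3)]
  have "ring AB"
  proof (rule ringI)
    show "Group.monoid AB"
      by (rule monoidI)
        (use l_one r_one twisted_assoc bilinearD(3)[OF bilinear_twisted_mult] pure_closed[OF mod_A
            mod_B ones] in auto)
  qed (use D AB.abelian_group_axioms in auto)
  then show ?thesis
    by (intro unital_algebra.intro unital_algebra_axioms.intro module_twisted_tensor)
      (use D in auto)
qed

end

section \<open>The hexagon equation\<close>

definition trilinear :: "'k ring \<Rightarrow> ('k, 'a) module \<Rightarrow> ('k, 'b) module \<Rightarrow> ('k, 'c) module \<Rightarrow>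
    ('k, 'd) module \<Rightarrow> ('a \<Rightarrow> 'b \<Rightarrow> 'c \<Rightarrow> 'd) \<Rightarrow> bool" where
  "trilinear k A B C P g \<longleftrightarrow> (\<forall>a\<in>carrier A. bilinear k B C P (g a)) \<and>
     (\<forall>b\<in>carrier B. \<forall>c\<in>carrier C. linear_map k A P (\<lambda>a. g a b c))"

lemma trilinearI:
  assumes "\<And>a. a \<in> carrier A \<Longrightarrow> bilinear k B C P (\<lambda>b c. g a b c)"
    and "\<And>b c. \<lbrakk>b \<in> carrier B; c \<in> carrier C\<rbrakk> \<Longrightarrow> linear_map k A P (\<lambda>a. g a b c)"
  shows "trilinear k A B C P g"
  using assms by (simp add: trilinear_def)

lemma trilinear_linear:
  assumes "trilinear k A B C P g"
  shows "\<lbrakk>linear_map k Q A e; b \<in> carrier B; c \<in> carrier C\<rbrakk> \<Longrightarrow> linear_map k Q P (\<lambda>x. g (e x) b c)"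
    and "\<lbrakk>linear_map k Q B f; a \<in> carrier A; c \<in> carrier C\<rbrakk> \<Longrightarrow> linear_map k Q P (\<lambda>x. g a (f x) c)"
    and "\<lbrakk>linear_map k Q C h; a \<in> carrier A; b \<in> carrier B\<rbrakk> \<Longrightarrow> linear_map k Q P (\<lambda>x. g a b (h x))"
proof -
  have g: "bilinear k B C P (g a)" if "a \<in> carrier A" for a using assms that by (simp add:
      trilinear_def)
  show "linear_map k Q P (\<lambda>x. g (e x) b c)" if "linear_map k Q A e" "b \<in> carrier B" "c \<in> carrier C"
    by (rule linear_map_comp[OF _ that(1)]) (use assms that in \<open>simp add: trilinear_def\<close>)
  show "linear_map k Q P (\<lambda>x. g a (f x) c)" if "linear_map k Q B f" "a \<in> carrier A" "c \<in> carrier C"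
    by (rule linear_map_bilinear[OF g[OF that(2)] that(1,3)])
  show "linear_map k Q P (\<lambda>x. g a b (h x))" if "linear_map k Q C h" "a \<in> carrier A" "b \<in> carrier B"
    by (rule linear_map_bilinear'[OF g[OF that(2)] that(1,3)])
qed

locale triple_twist = ab: twist k A B S1 + bc: twist k B C S2 + ac: twist k A C S3
  for k :: "'k ring" and A :: "('k, 'a) module" and B :: "('k, 'b) module" and C :: "('k, 'c)
      module"
    and S1 S2 S3
begin

abbreviation "l1 P b a f \<equiv> tensor_lift k P f (S1 (pure k B A b a))"
abbreviation "l2 P c b f \<equiv> tensor_lift k P f (S2 (pure k C B c b))"
abbreviation "l3 P c a f \<equiv> tensor_lift k P f (S3 (pure k C A c a))"

text \<open>The two sides of the hexagon equation at \<open>c \<otimes> b \<otimes> a\<close>, followed by the map on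
  \<open>A \<otimes> B \<otimes> C\<close> given by a trilinear \<open>g\<close>.\<close>

definition "hexL P g c b a = l1 P b a (\<lambda>x b1. l3 P c x (\<lambda>x1 c1. l2 P c1 b1 (\<lambda>b2 c2. g x1 b2 c2)))"
definition "hexR P g c b a = l2 P c b (\<lambda>b1 c1. l3 P c1 a (\<lambda>x c2. l1 P b1 x (\<lambda>x1 b2. g x1 b2 c2)))"

abbreviation "U \<equiv> tensor k A (tensor k B C)"
abbreviation "pureU x y z \<equiv> pure k A (tensor k B C) x (pure k B C y z)"

definition "hex c b a \<longleftrightarrow> hexL U pureU c b a = hexR U pureU c b a"

lemma mod_U: "module k U"
  by (rule linear_intros)+

text \<open>\<open>pureU\<close> is the universal trilinear map: every trilinear \<open>g\<close>
  factors through it by the linear map \<open>h\<close>, and \<open>h\<close> can be pushed through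
  the three sums. The freedom in \<open>g\<close> is what makes the equation applicable inside a
  longer computation.\<close>

lemma hex_lift:
  assumes "hex c b a" and g: "trilinear k A B C P g" and P: "module k P"
    and "c \<in> carrier C" "b \<in> carrier B" "a \<in> carrier A"
  shows "hexL P g c b a = hexR P g c b a"
proof -
  note ints = assms(3-) trilinear_linear[OF g] linear_intros
  define h where "h = tensor_lift k P (\<lambda>x. tensor_lift k P (g x))"
  have bil: "bilinear k A (tensor k B C) P (\<lambda>x. tensor_lift k P (g x))"
    by (rule ints | assumption)+
  have h: "linear_map k U P h" unfolding h_def by (rule linear_map_lift[OF _ _ _ bil]; (rule ints)+)
  have h_pure: "h (pureU x y z) = g x y z" if "x \<in> carrier A" "y \<in> carrier B" "z \<in> carrier C" for x
      y z
    unfolding h_def by (subst lift_pure[OF _ _ _ bil], (rule ints that)+, subst lift_pure,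
        (rule ints that | assumption)+, rule refl)
  have "h (hexL U pureU c b a) = hexL P g c b a" unfolding hexL_def
    by (rule lift_push[where h = h], (rule h ints | assumption)+, rule lift_push[where h = h],
        (rule h ints | assumption)+,
        rule lift_push[where h = h], (rule h ints | assumption)+, rule h_pure)
  moreover have "h (hexR U pureU c b a) = hexR P g c b a" unfolding hexR_def
    by (rule lift_push[where h = h], (rule h ints | assumption)+, rule lift_push[where h = h],
        (rule h ints | assumption)+,
        rule lift_push[where h = h], (rule h ints | assumption)+, rule h_pure)
  ultimately show ?thesis using assms(1) by (simp add: hex_def)
qed

lemma hexagon_iff:
  "hexagon k A B C S1 S2 S3 \<longleftrightarrow> (\<forall>c\<in>carrier C. \<forall>b\<in>carrier B. \<forall>a\<in>carrier A. hex c b a)"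
proof -
  note ints = linear_intros
  define L where "L t = tensor_map k A (tensor k B C) id S2 (assoc_right k A C B
      (tensor_map k (tensor k A C) B S3 id (assoc_left k C A B (tensor_map k C (tensor k A B) id S1
          t))))" for t
  define R where "R t = assoc_right k A B C (tensor_map k (tensor k A B) C S1 id
      (assoc_left k B A C (tensor_map k B (tensor k A C) id S3
        (assoc_right k B C A (tensor_map k (tensor k B C) A S2 id (assoc_left k C B A t))))))" for t
  have hexagon: "hexagon k A B C S1 S2 S3 \<longleftrightarrow> (\<forall>t\<in>carrier (tensor k C (tensor k B A)). L t = R t)"
    by (simp add: hexagon_def L_def R_def)
  have linL: "linear_map k (tensor k C (tensor k B A)) U L" unfolding L_def
    by (rule linear_map_comp[where g = "tensor_map k A (tensor k B C) id S2"], (rule ints)+,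
        rule linear_map_comp[where g = "assoc_right k A C B"], (rule ints)+,
        rule linear_map_comp[where g = "tensor_map k (tensor k A C) B S3 id"], (rule ints)+,
        rule linear_map_comp[where g = "assoc_left k C A B"], (rule ints)+)
  have linR: "linear_map k (tensor k C (tensor k B A)) U R" unfolding R_def
    by (rule linear_map_comp[where g = "assoc_right k A B C"], (rule ints)+,
        rule linear_map_comp[where g = "tensor_map k (tensor k A B) C S1 id"], (rule ints)+,
        rule linear_map_comp[where g = "assoc_left k B A C"], (rule ints)+,
        rule linear_map_comp[where g = "tensor_map k B (tensor k A C) id S3"], (rule ints)+,
        rule linear_map_comp[where g = "assoc_right k B C A"], (rule ints)+,
        rule linear_map_comp[where g = "tensor_map k (tensor k B C) A S2 id"], (rule ints)+)
  \<comment> \<open>Each twisting map contributes one sum and the associators only rebracket, so the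
    two composites become the two threefold sums.\<close>
  have L: "L (pure k C (tensor k B A) c (pure k B A b a)) = hexL U pureU c b a"
    and R: "R (pure k C (tensor k B A) c (pure k B A b a)) = hexR U pureU c b a"
    if abc: "c \<in> carrier C" "b \<in> carrier B" "a \<in> carrier A" for a b c
  proof -
    note ints = abc linear_intros
    let ?s = "S1 (pure k B A b a)" and ?r = "S2 (pure k C B c b)"
    have s: "?s \<in> carrier (tensor k A B)" and r: "?r \<in> carrier (tensor k B C)" by (rule ints)+
    have "assoc_left k C A B (tensor_map k C (tensor k A B) id S1 (pure k C (tensor k B A) c (pure k
        B A b a))) =
        tensor_lift k (tensor k (tensor k C A) B) (\<lambda>x y. pure k (tensor k C A) B (pure k C A c x) y)
            ?s"
      by (subst tensor_map_pure, (rule ints)+, unfold id_apply, rule assoc_left_pure, (rule ints)+)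
    moreover have "tensor_map k (tensor k A C) B S3 id \<dots> =
        tensor_lift k (tensor k (tensor k A C) B) (\<lambda>x y. pure k (tensor k A C) B (S3 (pure k C A c
            x)) y) ?s"
      by (rule lift_push, (rule s ints | assumption)+, subst tensor_map_pure,
          (rule ints | assumption)+, simp)
    moreover have "assoc_right k A C B \<dots> = tensor_lift k (tensor k A (tensor k C B)) (\<lambda>x y. l3
        (tensor k A (tensor k C B)) c x
        (\<lambda>u v. pure k A (tensor k C B) u (pure k C B v y))) ?s"
      by (rule lift_push, (rule s ints | assumption)+, subst assoc_right_pure,
          (rule ints | assumption)+, simp)
    \<comment> \<open>Here the value of \<open>S2\<close> sits as an unopened tensor in the second
      slot; opening it yields the innermost sum of \<open>hexL\<close>.\<close>
    moreover have "tensor_map k A (tensor k B C) id S2 \<dots> = hexL U pureU c b a" unfolding hexL_def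
      by (rule lift_push[where h = "tensor_map k A (tensor k B C) id S2"],
          (rule s ints | assumption)+,
          rule lift_push[where h = "tensor_map k A (tensor k B C) id S2"],
              (rule s ints | assumption)+,
          subst tensor_map_pure, (rule ints | assumption)+, unfold id_apply,
          rule linear_map_eq_lift[where h = "pure k A (tensor k B C) _"], (rule ints | assumption)+)
    ultimately show "L (pure k C (tensor k B A) c (pure k B A b a)) = hexL U pureU c b a"
      unfolding L_def by metis
    have "tensor_map k (tensor k B C) A S2 id (assoc_left k C B A (pure k C (tensor k B A) c (pure k
        B A b a))) =
        pure k (tensor k B C) A ?r a"
      by (subst assoc_left_pure_pure, (rule ints)+, subst tensor_map_pure, (rule ints)+, simp)
    moreover have "assoc_right k B C A \<dots> = tensor_lift k (tensor k B (tensor k C A))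
        (\<lambda>x y. pure k B (tensor k C A) x (pure k C A y a)) ?r"
      by (rule assoc_right_pure, (rule r ints)+)
    moreover have "tensor_map k B (tensor k A C) id S3 \<dots> = tensor_lift k (tensor k B (tensor k A C))
        (\<lambda>x y. pure k B (tensor k A C) x (S3 (pure k C A y a))) ?r"
      by (rule lift_push, (rule r ints | assumption)+, subst tensor_map_pure,
          (rule ints | assumption)+, simp)
    moreover have "assoc_left k B A C \<dots> = tensor_lift k (tensor k (tensor k B A) C)
        (\<lambda>x y. l3 (tensor k (tensor k B A) C) y a (\<lambda>u v. pure k (tensor k B A) C (pure k B A x u)
            v)) ?r"
      by (rule lift_push, (rule r ints | assumption)+, rule assoc_left_pure,
          (rule ints | assumption)+)
    moreover have "tensor_map k (tensor k A B) C S1 id \<dots> = tensor_lift k (tensor k (tensor k A B) C)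
        (\<lambda>x y. l3 (tensor k (tensor k A B) C) y a (\<lambda>u v. pure k (tensor k A B) C (S1 (pure k B A x
            u)) v)) ?r"
      by (rule lift_push[where h = "tensor_map k (tensor k A B) C S1 id"],
          (rule r ints | assumption)+,
          rule lift_push[where h = "tensor_map k (tensor k A B) C S1 id"],
              (rule r ints | assumption)+,
          subst tensor_map_pure, (rule ints | assumption)+, simp)
    moreover have "assoc_right k A B C \<dots> = hexR U pureU c b a" unfolding hexR_def
      by (rule lift_push[where h = "assoc_right k A B C"], (rule r ints | assumption)+,
          rule lift_push[where h = "assoc_right k A B C"], (rule r ints | assumption)+,
          rule assoc_right_pure, (rule ints | assumption)+)
    ultimately show "R (pure k C (tensor k B A) c (pure k B A b a)) = hexR U pureU c b a"
      unfolding R_def by metis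
  qed
  have "L t = R t" if hex: "\<forall>c\<in>carrier C. \<forall>b\<in>carrier B. \<forall>a\<in>carrier A. hex c b a"
    and t: "t \<in> carrier (tensor k C (tensor k B A))" for t
  proof (rule tensor_ext[OF _ _ _ linL linR _ t])
    fix c w assume c: "c \<in> carrier C" and w: "w \<in> carrier (tensor k B A)"
    show "L (pure k C (tensor k B A) c w) = R (pure k C (tensor k B A) c w)"
      by (rule tensor_ext[OF _ _ _ linear_map_comp[OF linL] linear_map_comp[OF linR] _ w])
        ((rule ints c)+, use hex c in \<open>simp add: L R hex_def\<close>)
  qed (rule ints)+
  moreover have "hex c b a" if eq: "\<forall>t\<in>carrier (tensor k C (tensor k B A)). L t = R t"
    and abc: "c \<in> carrier C" "b \<in> carrier B" "a \<in> carrier A" for a b c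
  proof -
    have "pure k C (tensor k B A) c (pure k B A b a) \<in> carrier (tensor k C (tensor k B A))"
        by (rule ints abc)+
    then show ?thesis using eq L[OF abc] R[OF abc] by (metis hex_def)
  qed
  ultimately show ?thesis unfolding hexagon by blast
qed

text \<open>On the left side \<open>b\<close> and \<open>c\<close> pass the first factor
  \<open>a\<close>, and the components that come out of this then meet \<open>a'\<close>. So the
  equation for \<open>a'\<close> is needed at these components, which the two span conditions place
  in \<open>Y\<close> and \<open>X\<close>, while the equation for \<open>a\<close> is needed at
  \<open>c\<close> and \<open>b\<close> themselves.\<close>

lemma hex_mult_A:
  assumes c: "c \<in> carrier C" and b: "b \<in> carrier B" and a: "a \<in> carrier A" and a': "a' \<in> carrier A"
    and X: "X \<subseteq> carrier C" and Y: "Y \<subseteq> carrier B"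
    and Sb: "S1 (pure k B A b a) \<in> tensor_span k A B (carrier A) Y"
    and Sc: "\<And>x. x \<in> carrier A \<Longrightarrow> S3 (pure k C A c x) \<in> tensor_span k A C (carrier A) X"
    and hex: "hex c b a" and hex': "\<And>c b. c \<in> X \<Longrightarrow> b \<in> Y \<Longrightarrow> hex c b a'"
  shows "hex c b (a \<otimes>\<^bsub>A\<^esub> a')"
proof -
  note ints = c b a a' linear_intros
  \<comment> \<open>The tail of the right side for \<open>a'\<close>, once \<open>S2\<close> has
    acted, with the component \<open>x\<close> of the first factor multiplied in. It is trilinear
    and serves as the continuation for the equation at \<open>a\<close>.\<close>
  let ?h = "\<lambda>x b c. l3 U c a' (\<lambda>y c. l1 U b y (\<lambda>u b. pureU (x \<otimes>\<^bsub>A\<^esub> u) b c))"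
  have "hexL U pureU c b (a \<otimes>\<^bsub>A\<^esub> a') =
      l1 U b a (\<lambda>x b1. l1 U b1 a' (\<lambda>y b2. l3 U c (x \<otimes>\<^bsub>A\<^esub> y) (\<lambda>x1 c1. l2 U c1 b2 (\<lambda>b3 c2. pureU x1 b3
          c2))))"
    unfolding hexL_def by (rule ab.lift_twist_mult_right, (rule ints | assumption)+)
  also have "\<dots> = l1 U b a (\<lambda>x b1. l1 U b1 a' (\<lambda>y b2. l3 U c x (\<lambda>x1 c1. l3 U c1 y (\<lambda>y1 c2.
      l2 U c2 b2 (\<lambda>b3 c3. pureU (x1 \<otimes>\<^bsub>A\<^esub> y1) b3 c3)))))"
    by (rule lift_cong, (rule ints | assumption)+, rule lift_cong, (rule ints | assumption)+,
        rule ac.lift_twist_mult_right, (rule ints | assumption)+)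
  also have "\<dots> = l1 U b a (\<lambda>x b1. l3 U c x (\<lambda>x1 c1. l1 U b1 a' (\<lambda>y b2. l3 U c1 y (\<lambda>y1 c2.
      l2 U c2 b2 (\<lambda>b3 c3. pureU (x1 \<otimes>\<^bsub>A\<^esub> y1) b3 c3)))))"
    by (rule lift_cong, (rule ints | assumption)+, rule lift_swap[of k A B A C],
        (rule ints | assumption)+)
  also have "\<dots> = l1 U b a (\<lambda>x b1. l3 U c x (\<lambda>x1 c1. l2 U c1 b1 (\<lambda>b2 c2. ?h x1 b2 c2)))"
  \<comment> \<open>After the exchange, the sums over \<open>a'\<close> form the left side of its
    equation at \<open>c1\<close> and \<open>b1\<close>. The two span conditions allow
    \<open>b1\<close> in \<open>Y\<close> and \<open>c1\<close> in \<open>X\<close> to be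
    assumed.\<close>
  proof (rule lift_cong_span[OF ab.mod_A ab.mod_B mod_U _ _ _ subset_refl Y Sb])
    fix x b1 assume x: "x \<in> carrier A" and b1: "b1 \<in> Y"
    then have b1': "b1 \<in> carrier B" using Y by blast
    show "l3 U c x (\<lambda>x1 c1. l1 U b1 a' (\<lambda>y b2. l3 U c1 y (\<lambda>y1 c2.
          l2 U c2 b2 (\<lambda>b3 c3. pureU (x1 \<otimes>\<^bsub>A\<^esub> y1) b3 c3)))) =
        l3 U c x (\<lambda>x1 c1. l2 U c1 b1 (\<lambda>b2 c2. ?h x1 b2 c2))"
    proof (rule lift_cong_span[OF ac.mod_A ac.mod_B mod_U _ _ _ subset_refl X Sc[OF x]])
      fix x1 c1 assume x1: "x1 \<in> carrier A" and c1: "c1 \<in> X"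
      then have c1': "c1 \<in> carrier C" using X by blast
      show "l1 U b1 a' (\<lambda>y b2. l3 U c1 y (\<lambda>y1 c2. l2 U c2 b2 (\<lambda>b3 c3. pureU (x1 \<otimes>\<^bsub>A\<^esub> y1) b3 c3))) =
          l2 U c1 b1 (\<lambda>b2 c2. ?h x1 b2 c2)"
        by (rule hex_lift[OF hex'[OF c1 b1], unfolded hexL_def hexR_def, of U "\<lambda>a b c. pureU (x1
            \<otimes>\<^bsub>A\<^esub> a) b c"])
          (rule trilinearI ints x1 c1' b1' | assumption)+
    qed (rule ints b1' | assumption)+
  qed (rule ints | assumption)+
  also have "\<dots> = l2 U c b (\<lambda>b1 c1. l3 U c1 a (\<lambda>x c2. l1 U b1 x (\<lambda>x1 b2. ?h x1 b2 c2)))"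
    by (rule hex_lift[OF hex, unfolded hexL_def hexR_def, of U ?h]) (rule trilinearI ints |
        assumption)+
  also have "\<dots> = l2 U c b (\<lambda>b1 c1. l3 U c1 a (\<lambda>x c2. l3 U c2 a' (\<lambda>y c3. l1 U b1 x (\<lambda>x1 b2.
      l1 U b2 y (\<lambda>u b3. pureU (x1 \<otimes>\<^bsub>A\<^esub> u) b3 c3)))))"
    by (rule lift_cong, (rule ints | assumption)+, rule lift_cong, (rule ints | assumption)+,
        rule lift_swap[of k A B A C], (rule ints | assumption)+)
  also have "\<dots> = l2 U c b (\<lambda>b1 c1. l3 U c1 a (\<lambda>x c2. l3 U c2 a' (\<lambda>y c3. l1 U b1 (x \<otimes>\<^bsub>A\<^esub> y) (\<lambda>u b3.
      pureU u b3 c3))))"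
    by (rule sym, rule lift_cong, (rule ints | assumption)+, rule lift_cong,
        (rule ints | assumption)+,
        rule lift_cong, (rule ints | assumption)+, rule ab.lift_twist_mult_right,
            (rule ints | assumption)+)
  also have "\<dots> = hexR U pureU c b (a \<otimes>\<^bsub>A\<^esub> a')" unfolding hexR_def
    by (rule sym, rule lift_cong, (rule ints | assumption)+, rule ac.lift_twist_mult_right,
        (rule ints | assumption)+)
  finally show ?thesis unfolding hex_def .
qed

text \<open>Twisting \<open>b'\<close> past \<open>a\<close> yields arbitrary elements of
  \<open>A\<close>, which then meet \<open>b\<close>; hence the equation for \<open>b\<close> is
  required at every \<open>a\<close>. Twisting \<open>c\<close> past \<open>b\<close> yields the
  elements of \<open>C\<close> that meet \<open>b'\<close>, and these lie in
  \<open>X\<close>.\<close>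

lemma hex_mult_B:
  assumes c: "c \<in> carrier C" and b: "b \<in> carrier B" and b': "b' \<in> carrier B" and a: "a \<in> carrier A"
    and X: "X \<subseteq> carrier C" and Sc: "S2 (pure k C B c b) \<in> tensor_span k B C (carrier B) X"
    and hex: "\<And>a. a \<in> carrier A \<Longrightarrow> hex c b a" and hex': "\<And>c. c \<in> X \<Longrightarrow> hex c b' a"
  shows "hex c (b \<otimes>\<^bsub>B\<^esub> b') a"
proof -
  note ints = c b b' a linear_intros
  \<comment> \<open>Two continuations. Under \<open>?h\<close> the element of \<open>C\<close> still
    has to pass the component \<open>y\<close> of the second factor; under \<open>?h'\<close> the
    component \<open>b1\<close> of the first factor still has to pass the element of
    \<open>A\<close>.\<close>
  let ?h = "\<lambda>y x b c. l2 U c y (\<lambda>b3 c3. pureU x (b \<otimes>\<^bsub>B\<^esub> b3) c3)"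
  let ?h' = "\<lambda>b1 x b c. l1 U b1 x (\<lambda>x b2. pureU x (b2 \<otimes>\<^bsub>B\<^esub> b) c)"
  have "hexL U pureU c (b \<otimes>\<^bsub>B\<^esub> b') a =
      l1 U b' a (\<lambda>x y. l1 U b x (\<lambda>u v. l3 U c u (\<lambda>x1 c1. l2 U c1 (v \<otimes>\<^bsub>B\<^esub> y) (\<lambda>b2 c2. pureU x1 b2
          c2))))"
    unfolding hexL_def by (rule ab.lift_twist_mult_left, (rule ints | assumption)+)
  also have "\<dots> = l1 U b' a (\<lambda>x y. l1 U b x (\<lambda>u v. l3 U c u (\<lambda>x1 c1. l2 U c1 v (\<lambda>b2 c2. ?h y x1 b2
      c2))))"
    by (rule lift_cong, (rule ints | assumption)+, rule lift_cong, (rule ints | assumption)+,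
        rule lift_cong, (rule ints | assumption)+, rule bc.lift_twist_mult_right,
            (rule ints | assumption)+)
  also have "\<dots> = l1 U b' a (\<lambda>x y. l2 U c b (\<lambda>b1 c1. l3 U c1 x (\<lambda>x1 c2. l1 U b1 x1 (\<lambda>x2 b2. ?h y x2
      b2 c2))))"
  proof (rule lift_cong, (rule ints | assumption)+)
    fix x y assume xy: "x \<in> carrier A" "y \<in> carrier B"
    show "l1 U b x (\<lambda>u v. l3 U c u (\<lambda>x1 c1. l2 U c1 v (\<lambda>b2 c2. ?h y x1 b2 c2))) =
        l2 U c b (\<lambda>b1 c1. l3 U c1 x (\<lambda>x1 c2. l1 U b1 x1 (\<lambda>x2 b2. ?h y x2 b2 c2)))"
      by (rule hex_lift[OF hex[OF xy(1)], unfolded hexL_def hexR_def, of U "?h y"])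
        (rule trilinearI ints xy | assumption)+
  qed
  \<comment> \<open>The twist of \<open>b'\<close> past \<open>a\<close> and the twist of
    \<open>c\<close> past \<open>b\<close> are independent, so their sums may be exchanged. This
    brings the equation for \<open>b'\<close> into position.\<close>
  also have "\<dots> = l2 U c b (\<lambda>b1 c1. l1 U b' a (\<lambda>x y. l3 U c1 x (\<lambda>x1 c2. l1 U b1 x1 (\<lambda>x2 b2. ?h y x2
      b2 c2))))"
    by (rule lift_swap[of k A B B C], (rule ints | assumption)+)
  also have "\<dots> = l2 U c b (\<lambda>b1 c1. l1 U b' a (\<lambda>x y. l3 U c1 x (\<lambda>x1 c2. l2 U c2 y (\<lambda>b3 c3. ?h' b1 x1
      b3 c3))))"
    by (rule lift_cong, (rule ints | assumption)+, rule lift_cong, (rule ints | assumption)+,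
        rule lift_cong, (rule ints | assumption)+, rule lift_swap[of k A B B C],
            (rule ints | assumption)+)
  also have "\<dots> = l2 U c b (\<lambda>b1 c1. l2 U c1 b' (\<lambda>p q. l3 U q a (\<lambda>x c3. l1 U p x (\<lambda>x1 b3. ?h' b1 x1 b3
      c3))))"
  proof (rule lift_cong_span[OF bc.mod_A bc.mod_B mod_U _ _ _ subset_refl X Sc])
    fix b1 c1 assume b1: "b1 \<in> carrier B" and c1: "c1 \<in> X"
    then have c1': "c1 \<in> carrier C" using X by blast
    show "l1 U b' a (\<lambda>x y. l3 U c1 x (\<lambda>x1 c2. l2 U c2 y (\<lambda>b3 c3. ?h' b1 x1 b3 c3))) =
        l2 U c1 b' (\<lambda>p q. l3 U q a (\<lambda>x c3. l1 U p x (\<lambda>x1 b3. ?h' b1 x1 b3 c3)))"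
      by (rule hex_lift[OF hex'[OF c1], unfolded hexL_def hexR_def, of U "?h' b1"])
        (rule trilinearI ints b1 c1' | assumption)+
  qed (rule ints | assumption)+
  also have "\<dots> = l2 U c b (\<lambda>b1 c1. l2 U c1 b' (\<lambda>p q. l3 U q a (\<lambda>x c3. l1 U (b1 \<otimes>\<^bsub>B\<^esub> p) x (\<lambda>x2 b2.
      pureU x2 b2 c3))))"
    by (rule sym, rule lift_cong, (rule ints | assumption)+, rule lift_cong,
        (rule ints | assumption)+,
        rule lift_cong, (rule ints | assumption)+, rule ab.lift_twist_mult_left,
            (rule ints | assumption)+)
  also have "\<dots> = hexR U pureU c (b \<otimes>\<^bsub>B\<^esub> b') a" unfolding hexR_def
    by (rule sym, rule bc.lift_twist_mult_right, (rule ints | assumption)+)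
  finally show ?thesis unfolding hex_def .
qed

text \<open>The factor \<open>c'\<close> passes \<open>b\<close> and \<open>a\<close> before
  \<open>c\<close> does, and \<open>c\<close> meets the components that result. The equation for
  \<open>c'\<close> is used at \<open>b\<close> and \<open>a\<close>, the one for \<open>c\<close>
  at these arbitrary components.\<close>

lemma hex_mult_C:
  assumes c: "c \<in> carrier C" and c': "c' \<in> carrier C" and b: "b \<in> carrier B" and a: "a \<in> carrier A"
    and hex: "\<And>b a. \<lbrakk>b \<in> carrier B; a \<in> carrier A\<rbrakk> \<Longrightarrow> hex c b a" and hex': "hex c' b a"
  shows "hex (c \<otimes>\<^bsub>C\<^esub> c') b a"
proof -
  note ints = c c' b a linear_intros
  \<comment> \<open>What remains once \<open>c'\<close> has passed: \<open>c\<close> has to be moved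
    past the resulting components of \<open>A\<close> and \<open>B\<close>.\<close>
  let ?h = "\<lambda>x b c'. l3 U c x (\<lambda>x c. l2 U c b (\<lambda>b c. pureU x b (c \<otimes>\<^bsub>C\<^esub> c')))"
  have "hexL U pureU (c \<otimes>\<^bsub>C\<^esub> c') b a =
      l1 U b a (\<lambda>x b1. l3 U c' x (\<lambda>x1 c1. l3 U c x1 (\<lambda>x2 c2. l2 U (c2 \<otimes>\<^bsub>C\<^esub> c1) b1 (\<lambda>b2 c3. pureU x2
          b2 c3))))"
    unfolding hexL_def by (rule lift_cong, (rule ints | assumption)+, rule ac.lift_twist_mult_left,
        (rule ints | assumption)+)
  also have "\<dots> = l1 U b a (\<lambda>x b1. l3 U c' x (\<lambda>x1 c1. l3 U c x1 (\<lambda>x2 c2. l2 U c1 b1 (\<lambda>b2 c3. l2 U c2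
      b2 (\<lambda>b3 c4.
      pureU x2 b3 (c4 \<otimes>\<^bsub>C\<^esub> c3))))))"
    by (rule lift_cong, (rule ints | assumption)+, rule lift_cong, (rule ints | assumption)+,
        rule lift_cong, (rule ints | assumption)+, rule bc.lift_twist_mult_left,
            (rule ints | assumption)+)
  also have "\<dots> = l1 U b a (\<lambda>x b1. l3 U c' x (\<lambda>x1 c1. l2 U c1 b1 (\<lambda>b2 c3. ?h x1 b2 c3)))"
    by (rule lift_cong, (rule ints | assumption)+, rule lift_cong, (rule ints | assumption)+,
        rule lift_swap[of k A C B C], (rule ints | assumption)+)
  also have "\<dots> = l2 U c' b (\<lambda>b1 c1. l3 U c1 a (\<lambda>x c2. l1 U b1 x (\<lambda>x1 b2. ?h x1 b2 c2)))"
    by (rule hex_lift[OF hex', unfolded hexL_def hexR_def, of U ?h]) (rule trilinearI ints |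
        assumption)+
  also have "\<dots> = l2 U c' b (\<lambda>b1 c1. l3 U c1 a (\<lambda>x c2. l2 U c b1 (\<lambda>b2 c3. l3 U c3 x (\<lambda>x1 c4. l1 U b2
      x1 (\<lambda>x2 b3.
      pureU x2 b3 (c4 \<otimes>\<^bsub>C\<^esub> c2))))))"
  proof (rule lift_cong, (rule ints | assumption)+, rule lift_cong, (rule ints | assumption)+)
    fix b1 c1 x c2
    assume 1: "b1 \<in> carrier B" "c1 \<in> carrier C" "x \<in> carrier A" "c2 \<in> carrier C"
    show "l1 U b1 x (\<lambda>x1 b2. ?h x1 b2 c2) =
        l2 U c b1 (\<lambda>b2 c3. l3 U c3 x (\<lambda>x1 c4. l1 U b2 x1 (\<lambda>x2 b3. pureU x2 b3 (c4 \<otimes>\<^bsub>C\<^esub> c2))))"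
      by (rule hex_lift[OF hex[OF 1(1,3)], unfolded hexL_def hexR_def, of U "\<lambda>a b c. pureU a b (c
          \<otimes>\<^bsub>C\<^esub> c2)"])
        (rule trilinearI ints 1 | assumption)+
  qed
  also have "\<dots> = l2 U c' b (\<lambda>b1 c1. l2 U c b1 (\<lambda>b2 c3. l3 U c1 a (\<lambda>x c2. l3 U c3 x (\<lambda>x1 c4. l1 U b2
      x1 (\<lambda>x2 b3.
      pureU x2 b3 (c4 \<otimes>\<^bsub>C\<^esub> c2))))))"
    by (rule lift_cong, (rule ints | assumption)+, rule lift_swap[of k A C B C],
        (rule ints | assumption)+)
  also have "\<dots> = l2 U c' b (\<lambda>b1 c1. l2 U c b1 (\<lambda>b2 c3. l3 U (c3 \<otimes>\<^bsub>C\<^esub> c1) a (\<lambda>x c4. l1 U b2 x (\<lambda>x2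
      b3. pureU x2 b3 c4))))"
    by (rule sym, rule lift_cong, (rule ints | assumption)+, rule lift_cong,
        (rule ints | assumption)+,
        rule ac.lift_twist_mult_left, (rule ints | assumption)+)
  also have "\<dots> = hexR U pureU (c \<otimes>\<^bsub>C\<^esub> c') b a" unfolding hexR_def
    by (rule sym, rule bc.lift_twist_mult_left, (rule ints | assumption)+)
  finally show ?thesis unfolding hex_def .
qed

end

section \<open>The iterated twisting map on C \<otimes> (A \<otimes> B)\<close>

context triple_twist
begin

abbreviation "AB \<equiv> twisted_tensor k A B S1"
abbreviation "V \<equiv> tensor k (tensor k A B) C"
abbreviation "pureV x y z \<equiv> pure k (tensor k A B) C (pure k A B x y) z"
abbreviation "T1 \<equiv> iterated_twist k A B C S2 S3"

lemma mod_V: "module k V"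
  by (rule linear_intros)+

lemma linear_T1: "linear_map k (tensor k C (tensor k A B)) V T1"
  unfolding iterated_twist_def comp_def
  by (rule linear_map_comp[where g = "assoc_left k A B C"], (rule linear_intros)+,
      rule linear_map_comp[where g = "tensor_map k A (tensor k B C) id S2"], (rule linear_intros)+,
      rule linear_map_comp[where g = "assoc_right k A C B"], (rule linear_intros)+,
      rule linear_map_comp[where g = "tensor_map k (tensor k A C) B S3 id"], (rule linear_intros)+)

lemma T1_pure:
  assumes c: "c \<in> carrier C" and a: "a \<in> carrier A" and b: "b \<in> carrier B"
  shows "T1 (pure k C (tensor k A B) c (pure k A B a b)) =
    l3 V c a (\<lambda>a1 c1. l2 V c1 b (\<lambda>b1 c2. pureV a1 b1 c2))"
proof -
  note ints = c a b linear_intros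
  let ?s = "S3 (pure k C A c a)"
  have s: "?s \<in> carrier (tensor k A C)" by (rule ints)+
  have "tensor_map k (tensor k A C) B S3 id (assoc_left k C A B (pure k C (tensor k A B) c (pure k A
      B a b))) =
      pure k (tensor k A C) B ?s b"
    by (subst assoc_left_pure_pure, (rule ints)+, subst tensor_map_pure, (rule ints)+, simp)
  moreover have "assoc_right k A C B \<dots> = tensor_lift k (tensor k A (tensor k C B))
      (\<lambda>x y. pure k A (tensor k C B) x (pure k C B y b)) ?s"
    by (rule assoc_right_pure, (rule ints)+)
  moreover have "tensor_map k A (tensor k B C) id S2 \<dots> = tensor_lift k (tensor k A (tensor k B C))
      (\<lambda>x y. pure k A (tensor k B C) x (S2 (pure k C B y b))) ?s"
    by (rule lift_push, (rule s ints | assumption)+, subst tensor_map_pure,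
        (rule ints | assumption)+, simp)
  moreover have "assoc_left k A B C \<dots> = l3 V c a (\<lambda>a1 c1. l2 V c1 b (\<lambda>b1 c2. pureV a1 b1 c2))"
    by (rule lift_push[where h = "assoc_left k A B C"], (rule s ints | assumption)+,
        rule assoc_left_pure, (rule ints | assumption)+)
  ultimately show ?thesis unfolding iterated_twist_def comp_def by metis
qed

lemma lift_T1:
  assumes g: "bilinear k (tensor k A B) C P g" and P: "module k P"
    and c: "c \<in> carrier C" and a: "a \<in> carrier A" and b: "b \<in> carrier B"
  shows "tensor_lift k P g (T1 (pure k C (tensor k A B) c (pure k A B a b))) =
    l3 P c a (\<lambda>a1 c1. l2 P c1 b (\<lambda>b1 c2. g (pure k A B a1 b1) c2))"
proof -
  note ints = c a b P g linear_map_bilinear[OF g] linear_map_bilinear'[OF g] linear_intros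
  show ?thesis unfolding T1_pure[OF c a b]
    by (rule lift_push[where h = "tensor_lift k P g"], (rule ints | assumption)+,
        rule lift_push[where h = "tensor_lift k P g"], (rule ints | assumption)+,
        rule lift_pure, (rule ints | assumption)+)
qed

text \<open>In the product of A \<otimes> B the element \<open>b\<close> is twisted past
  \<open>a'\<close>. The axiom for that product compares passing \<open>c\<close> after this twist
  with passing it before, which is where the hexagon equation enters. The axiom for the product of
  \<open>C\<close> combines the corresponding axioms of \<open>S3\<close> and \<open>S2\<close> with
  an exchange of independent sums.\<close>

lemma twist_iterated:
  assumes AB: "unital_algebra k AB"
    and hex: "\<And>c b a. \<lbrakk>c \<in> carrier C; b \<in> carrier B; a \<in> carrier A\<rbrakk> \<Longrightarrow> hex c b a"
  shows "twist k AB C T1"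
proof (rule twist.intro[OF AB bc.B], unfold tensor_twisted_tensor pure_twisted_tensor
    twisted_tensor_simps)
  note T1_closed = linear_mapD(1)[OF linear_T1] and T1_comp = linear_map_comp[OF linear_T1]
  note ints = T1_closed T1_comp ab.twisted_mult_intros linear_intros
  note modAB = ab.mod_A ab.mod_B
  show "linear_map k (tensor k C (tensor k A B)) V T1" by (rule linear_T1)
  show "T1 (pure k C (tensor k A B) c (w \<otimes>\<^bsub>AB\<^esub> w')) =
      tensor_lift k V (\<lambda>x y. tensor_lift k V (\<lambda>u v. pure k (tensor k A B) C (x \<otimes>\<^bsub>AB\<^esub> u) v)
        (T1 (pure k C (tensor k A B) y w'))) (T1 (pure k C (tensor k A B) c w))"
    if c: "c \<in> carrier C" and w: "w \<in> carrier (tensor k A B)" and w': "w' \<in> carrier (tensor k A B)"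
        for c w w'
  proof (rule tensor_ext[OF modAB mod_V _ _ _ w])
    fix a b assume a: "a \<in> carrier A" and b: "b \<in> carrier B"
    show "T1 (pure k C (tensor k A B) c (pure k A B a b \<otimes>\<^bsub>AB\<^esub> w')) =
      tensor_lift k V (\<lambda>x y. tensor_lift k V (\<lambda>u v. pure k (tensor k A B) C (x \<otimes>\<^bsub>AB\<^esub> u) v)
        (T1 (pure k C (tensor k A B) y w'))) (T1 (pure k C (tensor k A B) c (pure k A B a b)))"
    proof (rule tensor_ext[OF modAB mod_V _ _ _ w'])
      fix a' b' assume a': "a' \<in> carrier A" and b': "b' \<in> carrier B"
      note ints = c a b a' b' ints
      \<comment> \<open>The continuation after the three-way exchange: the element of
        \<open>C\<close> still has to pass \<open>b'\<close>.\<close>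
      let ?h = "\<lambda>a1 x y c. l2 V c b' (\<lambda>b1 c1. pureV (a1 \<otimes>\<^bsub>A\<^esub> x) (y \<otimes>\<^bsub>B\<^esub> b1) c1)"
      have "T1 (pure k C (tensor k A B) c (pure k A B a b \<otimes>\<^bsub>AB\<^esub> pure k A B a' b')) =
          l1 V b a' (\<lambda>x y. l3 V c (a \<otimes>\<^bsub>A\<^esub> x) (\<lambda>u c1. l2 V c1 (y \<otimes>\<^bsub>B\<^esub> b') (\<lambda>v c2. pureV u v c2)))"
        by (subst ab.twisted_mult_pure, (rule ints)+,
            rule lift_push[where h = "\<lambda>t. T1 (pure k C (tensor k A B) c t)"],
                (rule ints | assumption)+,
            rule T1_pure, (rule ints | assumption)+)
      also have "\<dots> = l1 V b a' (\<lambda>x y. l3 V c a (\<lambda>a1 c1. l3 V c1 x (\<lambda>x1 c2.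
          l2 V c2 (y \<otimes>\<^bsub>B\<^esub> b') (\<lambda>v c3. pureV (a1 \<otimes>\<^bsub>A\<^esub> x1) v c3))))"
        by (rule lift_cong, (rule ints | assumption)+, rule ac.lift_twist_mult_right,
            (rule ints | assumption)+)
      also have "\<dots> = l1 V b a' (\<lambda>x y. l3 V c a (\<lambda>a1 c1. l3 V c1 x (\<lambda>x1 c2. l2 V c2 y (\<lambda>y1 c3. ?h a1
          x1 y1 c3))))"
        by (rule lift_cong, (rule ints | assumption)+, rule lift_cong, (rule ints | assumption)+,
            rule lift_cong, (rule ints | assumption)+, rule bc.lift_twist_mult_right,
                (rule ints | assumption)+)
      also have "\<dots> = l3 V c a (\<lambda>a1 c1. l1 V b a' (\<lambda>x y. l3 V c1 x (\<lambda>x1 c2. l2 V c2 y (\<lambda>y1 c3. ?h a1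
          x1 y1 c3))))"
        by (rule lift_swap[of k A B A C], (rule ints | assumption)+)
      also have "\<dots> = l3 V c a (\<lambda>a1 c1. l2 V c1 b (\<lambda>b1 c2. l3 V c2 a' (\<lambda>a2 c3. l1 V b1 a2 (\<lambda>x y. ?h
          a1 x y c3))))"
      \<comment> \<open>At this point \<open>c1\<close>, \<open>b\<close> and \<open>a'\<close>
        stand in the order of the left side of the hexagon equation.\<close>
      proof (rule lift_cong, (rule ints | assumption)+)
        fix a1 c1 assume 1: "a1 \<in> carrier A" "c1 \<in> carrier C"
        show "l1 V b a' (\<lambda>x y. l3 V c1 x (\<lambda>x1 c2. l2 V c2 y (\<lambda>y1 c3. ?h a1 x1 y1 c3))) =
            l2 V c1 b (\<lambda>b1 c2. l3 V c2 a' (\<lambda>a2 c3. l1 V b1 a2 (\<lambda>x y. ?h a1 x y c3)))"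
          by (rule hex_lift[OF hex[OF 1(2) b a'], unfolded hexL_def hexR_def, of V "?h a1"])
            (rule trilinearI ints 1 | assumption)+
      qed
      also have "\<dots> = l3 V c a (\<lambda>a1 c1. l2 V c1 b (\<lambda>b1 c2. l3 V c2 a' (\<lambda>a2 c3. l2 V c3 b' (\<lambda>b2 c4.
          l1 V b1 a2 (\<lambda>x y. pureV (a1 \<otimes>\<^bsub>A\<^esub> x) (y \<otimes>\<^bsub>B\<^esub> b2) c4)))))"
        by (rule lift_cong, (rule ints | assumption)+, rule lift_cong, (rule ints | assumption)+,
            rule lift_cong, (rule ints | assumption)+, rule lift_swap[of k A B B C],
                (rule ints | assumption)+)
      also have "\<dots> = l3 V c a (\<lambda>a1 c1. l2 V c1 b (\<lambda>b1 c2. l3 V c2 a' (\<lambda>a2 c3. l2 V c3 b' (\<lambda>b2 c4.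
          pure k (tensor k A B) C (pure k A B a1 b1 \<otimes>\<^bsub>AB\<^esub> pure k A B a2 b2) c4))))"
      proof (rule lift_cong, (rule ints | assumption)+, rule lift_cong, (rule ints | assumption)+,
            rule lift_cong, (rule ints | assumption)+, rule lift_cong, (rule ints | assumption)+)
        fix a1 c1 b1 c2 a2 c3 b2 c4
        assume 1: "a1 \<in> carrier A" "b1 \<in> carrier B" "a2 \<in> carrier A" "b2 \<in> carrier B" "c4 \<in> carrier
            C"
        show "l1 V b1 a2 (\<lambda>x y. pureV (a1 \<otimes>\<^bsub>A\<^esub> x) (y \<otimes>\<^bsub>B\<^esub> b2) c4) =
            pure k (tensor k A B) C (pure k A B a1 b1 \<otimes>\<^bsub>AB\<^esub> pure k A B a2 b2) c4"
          by (subst ab.twisted_mult_pure, (rule 1)+, rule sym,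
              rule lift_push[where h = "\<lambda>t. pure k (tensor k A B) C t c4"],
                  (rule ints 1 | assumption)+, rule refl)
      qed
      also have "\<dots> = l3 V c a (\<lambda>a1 c1. l2 V c1 b (\<lambda>b1 c2. tensor_lift k V
          (\<lambda>u v. pure k (tensor k A B) C (pure k A B a1 b1 \<otimes>\<^bsub>AB\<^esub> u) v) (T1 (pure k C (tensor k A B)
              c2 (pure k A B a' b')))))"
        by (rule sym, rule lift_cong, (rule ints | assumption)+, rule lift_cong,
            (rule ints | assumption)+,
            rule lift_T1, (rule ints | assumption)+)
      also have "\<dots> = tensor_lift k V (\<lambda>x y. tensor_lift k V (\<lambda>u v. pure k (tensor k A B) C (x \<otimes>\<^bsub>AB\<^esub>
          u) v)
          (T1 (pure k C (tensor k A B) y (pure k A B a' b')))) (T1 (pure k C (tensor k A B) c (pure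
              k A B a b)))"
        by (rule sym, rule lift_T1, (rule ints | assumption)+)
      finally show "T1 (pure k C (tensor k A B) c (pure k A B a b \<otimes>\<^bsub>AB\<^esub> pure k A B a' b')) = \<dots>" .
    qed (rule ints c a b | assumption)+
  qed (rule ints c w' | assumption)+
  show "T1 (pure k C (tensor k A B) (c \<otimes>\<^bsub>C\<^esub> c') w) =
      tensor_lift k V (\<lambda>x y. tensor_lift k V (\<lambda>u v. pure k (tensor k A B) C u (v \<otimes>\<^bsub>C\<^esub> y))
        (T1 (pure k C (tensor k A B) c x))) (T1 (pure k C (tensor k A B) c' w))"
    if c: "c \<in> carrier C" and c': "c' \<in> carrier C" and w: "w \<in> carrier (tensor k A B)" for c c' w
  proof (rule tensor_ext[OF modAB mod_V _ _ _ w])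
    fix a b assume a: "a \<in> carrier A" and b: "b \<in> carrier B"
    note ints = c c' a b ints
    have "T1 (pure k C (tensor k A B) (c \<otimes>\<^bsub>C\<^esub> c') (pure k A B a b)) =
        l3 V (c \<otimes>\<^bsub>C\<^esub> c') a (\<lambda>a1 c1. l2 V c1 b (\<lambda>b1 c2. pureV a1 b1 c2))"
      by (rule T1_pure, (rule ints)+)
    also have "\<dots> = l3 V c' a (\<lambda>x y. l3 V c x (\<lambda>u v. l2 V (v \<otimes>\<^bsub>C\<^esub> y) b (\<lambda>b1 c2. pureV u b1 c2)))"
      by (rule ac.lift_twist_mult_left, (rule ints | assumption)+)
    also have "\<dots> = l3 V c' a (\<lambda>x y. l3 V c x (\<lambda>u v. l2 V y b (\<lambda>p q. l2 V v p (\<lambda>b1 c2. pureV u b1 (c2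
        \<otimes>\<^bsub>C\<^esub> q)))))"
      by (rule lift_cong, (rule ints | assumption)+, rule lift_cong, (rule ints | assumption)+,
          rule bc.lift_twist_mult_left, (rule ints | assumption)+)
    also have "\<dots> = l3 V c' a (\<lambda>x y. l2 V y b (\<lambda>p q. l3 V c x (\<lambda>u v. l2 V v p (\<lambda>b1 c2. pureV u b1 (c2
        \<otimes>\<^bsub>C\<^esub> q)))))"
      by (rule lift_cong, (rule ints | assumption)+, rule lift_swap[of k A C B C],
          (rule ints | assumption)+)
    also have "\<dots> = l3 V c' a (\<lambda>x y. l2 V y b (\<lambda>p q. tensor_lift k V (\<lambda>u v. pure k (tensor k A B) C u
        (v \<otimes>\<^bsub>C\<^esub> q))
        (T1 (pure k C (tensor k A B) c (pure k A B x p)))))"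
      by (rule sym, rule lift_cong, (rule ints | assumption)+, rule lift_cong,
          (rule ints | assumption)+,
          rule lift_T1, (rule ints | assumption)+)
    also have "\<dots> = tensor_lift k V (\<lambda>x y. tensor_lift k V (\<lambda>u v. pure k (tensor k A B) C u (v \<otimes>\<^bsub>C\<^esub>
        y))
        (T1 (pure k C (tensor k A B) c x))) (T1 (pure k C (tensor k A B) c' (pure k A B a b)))"
      by (rule sym, rule lift_T1, (rule ints | assumption)+)
    finally show "T1 (pure k C (tensor k A B) (c \<otimes>\<^bsub>C\<^esub> c') (pure k A B a b)) = \<dots>" .
  qed (rule ints c c' | assumption)+
qed

text \<open>A unit crosses \<open>S3\<close> and then \<open>S2\<close> unchanged, so both sums in
  \<open>T1_pure\<close> reduce to a single term.\<close>

lemma unital_twist_iterated: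
  assumes "unital_twist k A B S1" and "unital_twist k B C S2" and "unital_twist k A C S3"
    and hex: "\<And>c b a. \<lbrakk>c \<in> carrier C; b \<in> carrier B; a \<in> carrier A\<rbrakk> \<Longrightarrow> hex c b a"
  shows "unital_twist k AB C T1"
proof -
  interpret uab: unital_twist k A B S1 by fact
  interpret ubc: unital_twist k B C S2 by fact
  interpret uac: unital_twist k A C S3 by fact
  interpret A: unital_algebra k A by (rule ab.A)
  interpret B: unital_algebra k B by (rule ab.B)
  interpret C: unital_algebra k C by (rule bc.B)
  note T1_closed = linear_mapD(1)[OF linear_T1] and T1_comp = linear_map_comp[OF linear_T1]
  have one: "\<one>\<^bsub>A\<^esub> \<in> carrier A" "\<one>\<^bsub>B\<^esub> \<in> carrier B" "\<one>\<^bsub>C\<^esub> \<in> carrier C" by auto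
  note ints = one T1_closed T1_comp linear_intros
  note AB = uab.unital_algebra_twisted_tensor
  show ?thesis
  proof (intro unital_twist.intro unital_twist_axioms.intro twist_iterated[OF AB hex],
      unfold tensor_twisted_tensor pure_twisted_tensor twisted_tensor_simps)
    show "T1 (pure k C (tensor k A B) \<one>\<^bsub>C\<^esub> w) = pure k (tensor k A B) C w \<one>\<^bsub>C\<^esub>" if "w \<in> carrier
        (tensor k A B)" for w
    proof (rule tensor_ext[OF ab.mod_A ab.mod_B mod_V _ _ _ that])
      fix a b assume ab: "a \<in> carrier A" "b \<in> carrier B"
      show "T1 (pure k C (tensor k A B) \<one>\<^bsub>C\<^esub> (pure k A B a b)) = pure k (tensor k A B) C (pure k A B
          a b) \<one>\<^bsub>C\<^esub>"
        by (subst T1_pure, (rule ints ab)+, subst uac.S_one_left[OF ab(1)], subst lift_pure,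
            (rule ints ab | assumption)+,
          subst ubc.S_one_left[OF ab(2)], subst lift_pure, (rule ints ab | assumption)+, rule refl)
    qed (rule ints)+
    show "T1 (pure k C (tensor k A B) c (pure k A B \<one>\<^bsub>A\<^esub> \<one>\<^bsub>B\<^esub>)) = pureV \<one>\<^bsub>A\<^esub> \<one>\<^bsub>B\<^esub> c" if "c \<in> carrier
        C" for c
      by (subst T1_pure, (rule ints that)+, subst uac.S_one_right[OF that], subst lift_pure,
          (rule ints that | assumption)+,
        subst ubc.S_one_right[OF that], subst lift_pure, (rule ints that | assumption)+, rule refl)
  qed
qed

end

section \<open>Graded modules and differential graded algebras\<close>

lemma signed_linear_map:
  assumes "module k M" and "module k N" and "linear_map k M N f" and "x \<in> carrier M"
  shows "f (signed M p x) = signed N p (f x)"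
  using linear_map_uminus[OF assms] by (simp add: signed_def)

lemma bilinear_span:
  assumes M: "module k M" and N: "module k N" and P: "module k P" and f: "bilinear k M N P f"
    and X: "X \<subseteq> carrier M" and Y: "Y \<subseteq> carrier N" and H: "submodule H k P"
    and XY: "\<And>x y. \<lbrakk>x \<in> X; y \<in> Y\<rbrakk> \<Longrightarrow> f x y \<in> H"
    and s: "s \<in> submodule_span k M X" and t: "t \<in> submodule_span k N Y"
  shows "f s t \<in> H"
proof -
  have *: "f x t \<in> H" if "x \<in> X" for x
  proof -
    have "x \<in> carrier M" using that X by blast
    then have "submodule_span k N Y \<subseteq> {y \<in> carrier N. f x y \<in> H}"
      using XY[OF that] Y by (intro submodule_span_minimal submodule_vimage[OF N P _ H]
          bilinearD(1)[OF f]) auto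
    with t show ?thesis by blast
  qed
  have "t \<in> carrier N" using submoduleD(1)[OF submodule_span[OF N Y] t] .
  then have "submodule_span k M X \<subseteq> {x \<in> carrier M. f x t \<in> H}"
    using * X by (intro submodule_span_minimal submodule_vimage[OF M P _ H] bilinearD(2)[OF f]) auto
  with s show ?thesis by blast
qed

text \<open>A grading is witnessed by the projections \<open>\<pi> p\<close> onto the homogeneous components, which makes
  it easy to pass to quotients and tensor products.\<close>

locale graded_module =
  fixes k :: "'k ring" and M :: "('k, 'a) module" and G :: "nat \<Rightarrow> 'a set" and \<pi> :: "nat \<Rightarrow> 'a \<Rightarrow> 'a"
  assumes mod: "module k M"
    and sub: "submodule (G p) k M"
    and proj_linear: "linear_map k M M (\<pi> p)"
    and proj_id: "x \<in> G p \<Longrightarrow> \<pi> p x = x"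
    and proj_0: "\<lbrakk>x \<in> G q; q \<noteq> p\<rbrakk> \<Longrightarrow> \<pi> p x = \<zero>\<^bsub>M\<^esub>"
    and homogeneous_span: "\<lbrakk>submodule H k M; \<And>p. G p \<subseteq> H\<rbrakk> \<Longrightarrow> carrier M \<subseteq> H"
begin

lemma G_closed: "x \<in> G p \<Longrightarrow> x \<in> carrier M"
  by (rule submoduleD(1)[OF sub])

lemma proj_in: "x \<in> carrier M \<Longrightarrow> \<pi> p x \<in> G p"
proof -
  have "carrier M \<subseteq> {x \<in> carrier M. \<pi> p x \<in> G p}"
  proof (rule homogeneous_span[OF submodule_vimage[OF mod mod proj_linear sub]], rule subsetI)
    fix q x assume x: "x \<in> G q"
    then show "x \<in> {x \<in> carrier M. \<pi> p x \<in> G p}"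
      using submoduleD(2)[OF sub] by (cases "q = p") (simp_all add: G_closed proj_id proj_0)
  qed
  then show "x \<in> carrier M \<Longrightarrow> \<pi> p x \<in> G p" by blast
qed

lemma homogeneous_ext:
  assumes "module k P" and "linear_map k M P f" and "linear_map k M P g"
    and "\<And>p x. x \<in> G p \<Longrightarrow> f x = g x" and "x \<in> carrier M"
  shows "f x = g x"
  using homogeneous_span[OF submodule_equalizer[OF mod assms(1-3)]] assms(4,5) G_closed by blast

lemma decomposition_unique:
  assumes "\<And>p. c p \<in> G p" and "finite {p. c p \<noteq> \<zero>\<^bsub>M\<^esub>}"
    and "x = (\<Oplus>\<^bsub>M\<^esub>p\<in>{p. c p \<noteq> \<zero>\<^bsub>M\<^esub>}. c p)"
  shows "c q = \<pi> q x"
proof -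
  interpret M: module k M by (rule mod)
  let ?I = "{p. c p \<noteq> \<zero>\<^bsub>M\<^esub>}"
  have c: "c p \<in> carrier M" for p using assms(1) G_closed by blast
  have "\<pi> q x = (\<Oplus>\<^bsub>M\<^esub>p\<in>?I. \<pi> q (c p))"
    unfolding assms(3) by (rule linear_map_finsum[OF mod mod proj_linear assms(2) c])
  \<comment> \<open>Adjoining \<open>q\<close> to the support lets the projection pick out
    \<open>c q\<close> also when that component is zero.\<close>
  also have "\<dots> = (\<Oplus>\<^bsub>M\<^esub>p\<in>insert q ?I. \<pi> q (c p))"
    by (rule M.add.finprod_mono_neutral_cong_left)
      (use assms(2) linear_map_0[OF mod mod proj_linear] linear_mapD(1)[OF proj_linear c] in auto)
  also have "\<dots> = (\<Oplus>\<^bsub>M\<^esub>p\<in>insert q ?I. if q = p then c p else \<zero>\<^bsub>M\<^esub>)"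
    by (rule M.finsum_cong') (use c proj_id[OF assms(1)] proj_0[OF assms(1)] in auto)
  also have "\<dots> = c q"
    by (rule M.add.finprod_singleton) (use assms(2) c in auto)
  finally show ?thesis by simp
qed

text \<open>The elements that eventually agree with their partial sums of projections form a
  submodule containing every homogeneous element. Working with a bound on the degrees makes closure
  under addition a matter of taking a maximum; the finite support is extracted at the end.\<close>

lemma decomposition_exists:
  assumes "x \<in> carrier M"
  shows "finite {p. \<pi> p x \<noteq> \<zero>\<^bsub>M\<^esub>}" and "x = (\<Oplus>\<^bsub>M\<^esub>p\<in>{p. \<pi> p x \<noteq> \<zero>\<^bsub>M\<^esub>}. \<pi> p x)"
proof -
  interpret M: module k M by (rule mod)
  note D = linear_mapD[OF proj_linear] and Z = linear_map_0[OF mod mod proj_linear]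
  let ?H = "{x \<in> carrier M. \<exists>N. \<forall>n\<ge>N. x = (\<Oplus>\<^bsub>M\<^esub>p\<in>{..n}. \<pi> p x)}"
  have "submodule ?H k M"
  proof (rule submoduleI'[OF mod])
    show "\<zero>\<^bsub>M\<^esub> \<in> ?H" by (simp add: Z)
    fix x assume "x \<in> ?H"
    then obtain N where x: "x \<in> carrier M" and N: "\<And>n. n \<ge> N \<Longrightarrow> x = (\<Oplus>\<^bsub>M\<^esub>p\<in>{..n}. \<pi> p x)" by blast
    show "r \<odot>\<^bsub>M\<^esub> x \<in> ?H" if r: "r \<in> carrier k" for r
    proof -
      have "r \<odot>\<^bsub>M\<^esub> x = (\<Oplus>\<^bsub>M\<^esub>p\<in>{..n}. \<pi> p (r \<odot>\<^bsub>M\<^esub> x))" if "n \<ge> N" for n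
      proof -
        have "r \<odot>\<^bsub>M\<^esub> x = r \<odot>\<^bsub>M\<^esub> (\<Oplus>\<^bsub>M\<^esub>p\<in>{..n}. \<pi> p x)" using N[OF that] by simp
        also have "\<dots> = (\<Oplus>\<^bsub>M\<^esub>p\<in>{..n}. r \<odot>\<^bsub>M\<^esub> \<pi> p x)"
          by (rule M.finsum_smult_ldistr) (use r x D(1) in auto)
        also have "\<dots> = (\<Oplus>\<^bsub>M\<^esub>p\<in>{..n}. \<pi> p (r \<odot>\<^bsub>M\<^esub> x))" by (simp only: D(3)[OF r x])
        finally show ?thesis .
      qed
      then show ?thesis using r x by auto
    qed
    fix y assume "y \<in> ?H"
    then obtain N' where y: "y \<in> carrier M" and N': "\<And>n. n \<ge> N' \<Longrightarrow> y = (\<Oplus>\<^bsub>M\<^esub>p\<in>{..n}. \<pi> p y)" by blast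
    have "x \<oplus>\<^bsub>M\<^esub> y = (\<Oplus>\<^bsub>M\<^esub>p\<in>{..n}. \<pi> p (x \<oplus>\<^bsub>M\<^esub> y))" if "n \<ge> max N N'" for n
    proof -
      have "x \<oplus>\<^bsub>M\<^esub> y = (\<Oplus>\<^bsub>M\<^esub>p\<in>{..n}. \<pi> p x) \<oplus>\<^bsub>M\<^esub> (\<Oplus>\<^bsub>M\<^esub>p\<in>{..n}. \<pi> p y)"
        using N[of n] N'[of n] that by simp
      also have "\<dots> = (\<Oplus>\<^bsub>M\<^esub>p\<in>{..n}. \<pi> p x \<oplus>\<^bsub>M\<^esub> \<pi> p y)"
        by (rule M.finsum_addf[symmetric]) (use x y D(1) in auto)
      also have "\<dots> = (\<Oplus>\<^bsub>M\<^esub>p\<in>{..n}. \<pi> p (x \<oplus>\<^bsub>M\<^esub> y))" by (simp only: D(2)[OF x y])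
      finally show ?thesis .
    qed
    then show "x \<oplus>\<^bsub>M\<^esub> y \<in> ?H" using x y by blast
  qed auto
  moreover have "G q \<subseteq> ?H" for q
  proof
    fix x assume x: "x \<in> G q"
    have "x = (\<Oplus>\<^bsub>M\<^esub>p\<in>{..n}. \<pi> p x)" if "n \<ge> q" for n
    proof -
      have "(\<Oplus>\<^bsub>M\<^esub>p\<in>{..n}. \<pi> p x) = (\<Oplus>\<^bsub>M\<^esub>p\<in>{..n}. if q = p then x else \<zero>\<^bsub>M\<^esub>)"
        by (rule M.finsum_cong') (use x G_closed proj_id proj_0 in auto)
      also have "\<dots> = x"
        by (rule M.add.finprod_singleton) (use x G_closed that in auto)
      finally show ?thesis by simp
    qed
    then show "x \<in> ?H" using x G_closed by blast
  qed
  ultimately have "carrier M \<subseteq> ?H" by (rule homogeneous_span)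
  then obtain N where N: "x = (\<Oplus>\<^bsub>M\<^esub>p\<in>{..N}. \<pi> p x)" using assms by blast
  \<comment> \<open>Above the bound, projecting the partial sum gives zero because each of its terms
    is homogeneous of another degree.\<close>
  have 0: "\<pi> q x = \<zero>\<^bsub>M\<^esub>" if "q > N" for q
  proof -
    have "\<pi> q x = (\<Oplus>\<^bsub>M\<^esub>p\<in>{..N}. \<pi> q (\<pi> p x))"
      by (subst N, rule linear_map_finsum[OF mod mod proj_linear]) (use assms D(1) in auto)
    also have "\<dots> = \<zero>\<^bsub>M\<^esub>"
      by (rule M.add.finprod_one_eqI, rule proj_0[OF proj_in[OF assms]]) (use that in auto)
    finally show ?thesis .
  qed
  then have sub: "{p. \<pi> p x \<noteq> \<zero>\<^bsub>M\<^esub>} \<subseteq> {..N}" by (metis (mono_tags) atMost_iff mem_Collect_eq not_le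
      subsetI)
  then show "finite {p. \<pi> p x \<noteq> \<zero>\<^bsub>M\<^esub>}" by (rule finite_subset) simp
  have "(\<Oplus>\<^bsub>M\<^esub>p\<in>{p. \<pi> p x \<noteq> \<zero>\<^bsub>M\<^esub>}. \<pi> p x) = (\<Oplus>\<^bsub>M\<^esub>p\<in>{..N}. \<pi> p x)"
    by (rule M.add.finprod_mono_neutral_cong_left) (use sub assms D(1) in auto)
  with N show "x = (\<Oplus>\<^bsub>M\<^esub>p\<in>{p. \<pi> p x \<noteq> \<zero>\<^bsub>M\<^esub>}. \<pi> p x)" by simp
qed

end

text \<open>The sign is carried as an explicit linear map \<open>e\<close>. The Leibniz rule is then
  an identity between bilinear maps, valid for all arguments, and can be checked on any generating
  set.\<close>

locale dga = graded_module +
  fixes d :: "'b \<Rightarrow> 'b" and e :: "'b \<Rightarrow> 'b"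
  assumes alg: "unital_algebra k M"
    and one_G: "\<one>\<^bsub>M\<^esub> \<in> G 0"
    and mult_G: "\<lbrakk>x \<in> G p; y \<in> G q\<rbrakk> \<Longrightarrow> x \<otimes>\<^bsub>M\<^esub> y \<in> G (p + q)"
    and d_linear: "linear_map k M M d"
    and d_G: "x \<in> G p \<Longrightarrow> d x \<in> G (Suc p)"
    and d_d: "x \<in> carrier M \<Longrightarrow> d (d x) = \<zero>\<^bsub>M\<^esub>"
    and e_linear: "linear_map k M M e"
    and e_signed: "x \<in> G p \<Longrightarrow> e x = signed M p x"
    and d_mult: "\<lbrakk>x \<in> carrier M; y \<in> carrier M\<rbrakk> \<Longrightarrow> d (x \<otimes>\<^bsub>M\<^esub> y) = d x \<otimes>\<^bsub>M\<^esub> y \<oplus>\<^bsub>M\<^esub> e x \<otimes>\<^bsub>M\<^esub> d y"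
begin

lemmas d_closed = linear_mapD(1)[OF d_linear] and e_closed = linear_mapD(1)[OF e_linear]

lemma e_G: "x \<in> G p \<Longrightarrow> e x \<in> G p"
  by (simp add: e_signed submodule_signed[OF mod sub])

lemma e_G0: "x \<in> G 0 \<Longrightarrow> e x = x"
  by (simp add: e_signed signed_def)

text \<open>The differential raises the degree by one and so reverses the sign.\<close>

lemma e_d: "x \<in> carrier M \<Longrightarrow> e (d x) = \<ominus>\<^bsub>M\<^esub> d (e x)"
proof (rule homogeneous_ext[OF mod linear_map_comp[OF e_linear d_linear]
      linear_map_neg[OF mod mod linear_map_comp[OF d_linear e_linear]]])
  interpret M: module k M by (rule mod)
  fix p x assume x: "x \<in> G p"
  then have "x \<in> carrier M" by (rule G_closed)
  then show "e (d x) = \<ominus>\<^bsub>M\<^esub> d (e x)"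
    using linear_map_uminus[OF mod mod d_linear] d_closed
    by (auto simp: e_signed[OF d_G[OF x]] e_signed[OF x] signed_def)
qed

lemma e_e: "x \<in> carrier M \<Longrightarrow> e (e x) = x"
proof (rule homogeneous_ext[OF mod linear_map_comp[OF e_linear e_linear] linear_map_id])
  interpret M: module k M by (rule mod)
  fix p x assume x: "x \<in> G p"
  then have "x \<in> carrier M" by (rule G_closed)
  then show "e (e x) = x"
    by (simp add: e_signed[OF x] signed_linear_map[OF mod mod e_linear], simp add: signed_def)
qed

text \<open>Degrees add under the product, hence signs multiply; bilinearity reduces the general
  case to homogeneous factors.\<close>

lemma e_mult:
  assumes x: "x \<in> carrier M" and y: "y \<in> carrier M"
  shows "e (x \<otimes>\<^bsub>M\<^esub> y) = e x \<otimes>\<^bsub>M\<^esub> e y"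
proof -
  interpret M: unital_algebra k M by (rule alg)
  note ints = alg linear_map_comp[OF e_linear] e_linear e_closed linear_intros
  show ?thesis
  proof (rule homogeneous_ext[OF mod _ _ _ x])
    fix p x assume x: "x \<in> G p"
    note x' = G_closed[OF x]
    show "e (x \<otimes>\<^bsub>M\<^esub> y) = e x \<otimes>\<^bsub>M\<^esub> e y"
    proof (rule homogeneous_ext[OF mod _ _ _ y])
      fix q y assume y: "y \<in> G q"
      note y' = G_closed[OF y]
      show "e (x \<otimes>\<^bsub>M\<^esub> y) = e x \<otimes>\<^bsub>M\<^esub> e y"
        using x' y' by (simp add: e_signed[OF mult_G[OF x y]] e_signed[OF x] e_signed[OF y]
            signed_def M.l_minus M.r_minus)
    qed (rule ints x')+
  qed (rule ints y)+
qed

text \<open>The differential may be replaced by any function that agrees with it on the carrier. The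
  formula for three factors and the differential obtained by iteration are linked in exactly this
  way.\<close>

lemma dg_algebra_dga:
  assumes "\<And>x. x \<in> carrier M \<Longrightarrow> d' x = d x"
  shows "dg_algebra k M G d'"
proof (intro dg_algebra.intro dg_algebra_axioms.intro)
  interpret M: unital_algebra k M by (rule alg)
  show "unital_algebra k M" by (rule alg)
  show "\<exists>!c. (\<forall>p. c p \<in> G p) \<and> finite {p. c p \<noteq> \<zero>\<^bsub>M\<^esub>} \<and> x = (\<Oplus>\<^bsub>M\<^esub>p\<in>{p. c p \<noteq> \<zero>\<^bsub>M\<^esub>}. c p)"
    if x: "x \<in> carrier M" for x
  proof (rule ex1I)
    show "(\<forall>p. \<pi> p x \<in> G p) \<and> finite {p. \<pi> p x \<noteq> \<zero>\<^bsub>M\<^esub>} \<and> x = (\<Oplus>\<^bsub>M\<^esub>p\<in>{p. \<pi> p x \<noteq> \<zero>\<^bsub>M\<^esub>}. \<pi> p x)"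
      using decomposition_exists[OF x] proj_in[OF x] by blast
    show "c = (\<lambda>p. \<pi> p x)"
      if "(\<forall>p. c p \<in> G p) \<and> finite {p. c p \<noteq> \<zero>\<^bsub>M\<^esub>} \<and> x = (\<Oplus>\<^bsub>M\<^esub>p\<in>{p. c p \<noteq> \<zero>\<^bsub>M\<^esub>}. c p)" for c
      using decomposition_unique[of c x] that by (intro ext) blast
  qed
  show "linear_map k M M d'" by (rule linear_map_cong[OF assms[symmetric] d_linear mod])
  show "d' x \<in> G (Suc p)" if "x \<in> G p" for x p
    using assms[OF G_closed[OF that]] d_G[OF that] by simp
  show "d' (d' x) = \<zero>\<^bsub>M\<^esub>" if "x \<in> carrier M" for x
    using assms[OF that] assms[OF d_closed[OF that]] d_d[OF that] by simp
  show "d' (x \<otimes>\<^bsub>M\<^esub> y) = d' x \<otimes>\<^bsub>M\<^esub> y \<oplus>\<^bsub>M\<^esub> signed M p (x \<otimes>\<^bsub>M\<^esub> d' y)"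
    if x: "x \<in> G p" and y: "y \<in> carrier M" for x y p
    using G_closed[OF x] y d_closed[OF y]
    by (simp add: assms d_mult e_signed[OF x] signed_def M.l_minus)
qed (rule sub one_G mult_G, assumption?)+

end

text \<open>Being generated by degree zero and its differentials is stated as an induction principle
  for a family \<open>Q\<close>, one predicate per degree. A constant family proves ungraded claims;
  a varying one proves that degrees are preserved.\<close>

locale generated_dga = dga +
  assumes generated: "\<lbrakk>\<And>p. submodule (Q p) k M; \<And>x. x \<in> G 0 \<Longrightarrow> x \<in> Q 0; \<And>x. x \<in> G 0 \<Longrightarrow>
      d x \<in> Q (Suc 0);
      \<And>p q x y. \<lbrakk>x \<in> Q p; y \<in> Q q\<rbrakk> \<Longrightarrow> x \<otimes>\<^bsub>M\<^esub> y \<in> Q (p + q); x \<in> G p\<rbrakk> \<Longrightarrow> x \<in> Q p"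
begin

lemma generated_carrier:
  assumes "submodule Q k M" and "\<And>x. x \<in> G 0 \<Longrightarrow> x \<in> Q" and "\<And>x. x \<in> G 0 \<Longrightarrow> d x \<in> Q"
    and "\<And>x y. \<lbrakk>x \<in> Q; y \<in> Q\<rbrakk> \<Longrightarrow> x \<otimes>\<^bsub>M\<^esub> y \<in> Q" and "x \<in> carrier M"
  shows "x \<in> Q"
  using homogeneous_span[OF assms(1)] generated[of "\<lambda>_. Q", OF assms(1-4)] assms(5) by blast

end

section \<open>Intertwining relations\<close>

text \<open>The relation \<open>S \<circ> (\<beta> \<otimes> \<alpha>) = (\<alpha>' \<otimes> \<beta>') \<circ> R\<close>, on pure tensors.  It covers the compatibility of
  a twisting map with differentials and signs as well as the extension property of \<open>S\<close>.\<close>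

definition intertwines where
  "intertwines k A B A' B' R S \<beta> \<alpha> \<alpha>' \<beta>' \<longleftrightarrow> (\<forall>b\<in>carrier B. \<forall>a\<in>carrier A.
     S (pure k B' A' (\<beta> b) (\<alpha> a)) = tensor_map k A' B' \<alpha>' \<beta>' (R (pure k B A b a)))"

lemma lift_intertwines:
  assumes "intertwines k A B A' B' R S \<beta> \<alpha> \<alpha>' \<beta>'"
    and "twist k A B R" and "twist k A' B' S"
    and "linear_map k A A' \<alpha>'" and "linear_map k B B' \<beta>'"
    and "bilinear k A' B' P g" and "module k P" and "b \<in> carrier B" and "a \<in> carrier A"
  shows "tensor_lift k P g (S (pure k B' A' (\<beta> b) (\<alpha> a))) =
    tensor_lift k P (\<lambda>x y. g (\<alpha>' x) (\<beta>' y)) (R (pure k B A b a))"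
proof -
  interpret R: twist k A B R by fact
  interpret S: twist k A' B' S by fact
  have "S (pure k B' A' (\<beta> b) (\<alpha> a)) = tensor_map k A' B' \<alpha>' \<beta>' (R (pure k B A b a))"
    using assms(1,8,9) by (simp add: intertwines_def)
  then show ?thesis
    using lift_tensor_map[OF R.mod_A R.mod_B S.mod_A S.mod_B assms(4,5,7,6)]
      R.S_closed pure_closed[OF R.mod_B R.mod_A assms(8,9)] by simp
qed

section \<open>Twisted tensor products of differential graded algebras\<close>

lemma submodule_cong:
  assumes "carrier M = carrier N" and "add M = add N" and "zero M = zero N" and "smult M = smult N"
    and "module k N" and "submodule H k M"
  shows "submodule H k N"
proof -
  note D = submoduleD[OF assms(6), unfolded assms(1-4)]
  have "H \<subseteq> carrier N" using D(1) by blast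
  then show ?thesis by (rule submoduleI'[OF assms(5)]) (rule D; assumption)+
qed

lemma submodule_twisted_tensor:
  assumes "twist k A B S"
  shows "submodule H k (twisted_tensor k A B S) \<longleftrightarrow> submodule H k (tensor k A B)"
proof -
  interpret twist k A B S by fact
  show ?thesis
    using submodule_cong[of AB T, OF _ _ _ _ mod_T] submodule_cong[of T AB, OF _ _ _ _
        module_twisted_tensor]
    by auto
qed

lemma tensor_span_twisted_tensor [simp]:
  "tensor_span k (twisted_tensor k A B S) C = tensor_span k (tensor k A B) C"
  "tensor_span k C (twisted_tensor k A B S) = tensor_span k C (tensor k A B)"
  by (simp_all add: fun_eq_iff tensor_span_def)

lemma signed_twisted_tensor [simp]: "signed (twisted_tensor k A B S) = signed (tensor k A B)"
  by (simp add: fun_eq_iff signed_def a_inv_cong[of "twisted_tensor k A B S" "tensor k A B"])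

lemma lift_add:
  assumes M: "module k M" and N: "module k N" and P: "module k P"
    and "bilinear k M N P f" and "bilinear k M N P g" and "t \<in> carrier (tensor k M N)"
  shows "tensor_lift k P (\<lambda>x y. f x y \<oplus>\<^bsub>P\<^esub> g x y) t = tensor_lift k P f t \<oplus>\<^bsub>P\<^esub> tensor_lift k P g t"
proof (rule tensor_ext[OF M N P _ _ _ assms(6)])
  note bil = bilinearI[OF linear_map_add[OF N P bilinearD(1)[OF assms(4)] bilinearD(1)[OF assms(5)]]
      linear_map_add[OF M P bilinearD(2)[OF assms(4)] bilinearD(2)[OF assms(5)]]]
  show "linear_map k (tensor k M N) P (tensor_lift k P (\<lambda>x y. f x y \<oplus>\<^bsub>P\<^esub> g x y))"
    by (rule linear_map_lift[OF M N P bil])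
  show "linear_map k (tensor k M N) P (\<lambda>t. tensor_lift k P f t \<oplus>\<^bsub>P\<^esub> tensor_lift k P g t)"
    by (rule linear_map_add[OF module_tensor[OF M N] P linear_map_lift[OF M N P assms(4)]
        linear_map_lift[OF M N P assms(5)]])
qed (simp add: lift_pure[OF M N P bilinearI[OF linear_map_add[OF N P bilinearD(1)[OF assms(4)]
    bilinearD(1)[OF assms(5)]]
      linear_map_add[OF M P bilinearD(2)[OF assms(4)] bilinearD(2)[OF assms(5)]]]] lift_pure[OF M N
          P assms(4)] lift_pure[OF M N P assms(5)])

text \<open>The bidegree condition \<open>S_G\<close> places the twisted product in the total
  grading. It also makes \<open>S\<close> commute with the sign of each factor separately, so signs
  produced by the differentials can be moved through later twists.\<close>

locale dga_twist = A: dga k A GA \<pi>A dA eA + B: dga k B GB \<pi>B dB eB + unital_twist k A B S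
  for k :: "'k ring" and A :: "('k, 'a) module" and GA \<pi>A dA eA
    and B :: "('k, 'b) module" and GB \<pi>B dB eB and S +
  assumes S_G: "\<lbrakk>b \<in> GB p; a \<in> GA q\<rbrakk> \<Longrightarrow> S (pure k B A b a) \<in> tensor_span k A B (GA q) (GB p)"
    and S_d_left: "intertwines k A B A B S S dB id eA dB"
    and S_d_right: "intertwines k A B A B S S id dA dA eB"
begin

lemmas dga_intros = A.d_linear A.e_linear A.d_closed A.e_closed
  B.d_linear B.e_linear B.d_closed B.e_closed
  linear_map_comp[OF A.d_linear] linear_map_comp[OF A.e_linear]
  linear_map_comp[OF B.d_linear] linear_map_comp[OF B.e_linear]

lemmas [linear_intros] = dga_intros

text \<open>The exponents 0 and 1 switch the two signs off and on, so one proof serves the three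
  variants below. For \<open>b\<close> of degree \<open>p\<close> and \<open>a\<close> of degree
  \<open>q\<close>, both sides multiply by the sign with exponent \<open>j * q + i * p\<close>,
  since the twisted tensor has the same bidegree.\<close>

lemma S_e:
  assumes "i \<in> {0, Suc 0}" and "j \<in> {0, Suc 0}"
  shows "intertwines k A B A B S S (eB ^^ i) (eA ^^ j) (eA ^^ j) (eB ^^ i)"
  unfolding intertwines_def
proof (intro ballI)
  fix b a assume b: "b \<in> carrier B" and a: "a \<in> carrier A"
  interpret T: module k T by (rule mod_T)
  note ints = a b linear_intros
  have ei: "linear_map k B B (eB ^^ i)" using assms(1) linear_map_id'[of k B] B.e_linear by auto
  have ej: "linear_map k A A (eA ^^ j)" using assms(2) linear_map_id'[of k A] A.e_linear by auto
  have si: "(eB ^^ i) y = signed B (i * p) y" if "y \<in> GB p" for y p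
    using assms(1) that B.e_signed by (auto simp: signed_def)
  have sj: "(eA ^^ j) x = signed A (j * q) x" if "x \<in> GA q" for x q
    using assms(2) that A.e_signed by (auto simp: signed_def)
  have pure_signed: "pure k A B (signed A m x) (signed B n y) = signed T (m + n) (pure k A B x y)"
    if "x \<in> carrier A" "y \<in> carrier B" for x y m n
  proof -
    have "pure k A B (signed A m x) (signed B n y) = signed T m (pure k A B x (signed B n y))"
      by (rule signed_linear_map[OF mod_A mod_T, where f = "\<lambda>x. pure k A B x _"])
        (rule linear_intros that linear_mapD(1)[OF linear_map_signed[OF mod_B mod_B
            linear_map_id]])+
    also have "pure k A B x (signed B n y) = signed T n (pure k A B x y)"
      by (rule signed_linear_map[OF mod_B mod_T, where f = "pure k A B x"])
        (rule linear_intros that)+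
    finally show ?thesis
      using pure_closed[OF mod_A mod_B that] by (auto simp: signed_def)
  qed
  note ints = ei ej linear_mapD(1)[OF ei] linear_mapD(1)[OF ej] linear_map_comp[OF ei]
      linear_map_comp[OF ej] linear_intros
  let ?E = "tensor_map k A B (eA ^^ j) (eB ^^ i)"
  have E: "linear_map k T T ?E" by (rule ints)+
  note ints = linear_map_comp[OF E] ints
  show "S (pure k B A ((eB ^^ i) b) ((eA ^^ j) a)) = ?E (S (pure k B A b a))"
  proof (rule B.homogeneous_ext[OF mod_T _ _ _ b])
    fix p b assume b: "b \<in> GB p"
    note b' = B.G_closed[OF b]
    show "S (pure k B A ((eB ^^ i) b) ((eA ^^ j) a)) = ?E (S (pure k B A b a))"
    proof (rule A.homogeneous_ext[OF mod_T _ _ _ a])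
      fix q a assume a: "a \<in> GA q"
      note a' = A.G_closed[OF a]
      have cl: "signed A m a \<in> carrier A" for m
        by (rule linear_mapD(1)[OF linear_map_signed[OF mod_A mod_A linear_map_id] a'])
      have s: "S (pure k B A b a) \<in> carrier T" by (rule ints a' b')+
      have "S (pure k B A ((eB ^^ i) b) ((eA ^^ j) a)) = signed T (i * p) (S (pure k B A b (signed A
          (j * q) a)))"
        unfolding si[OF b] sj[OF a]
        by (rule signed_linear_map[OF mod_B mod_T, where f = "\<lambda>x. S (pure k B A x _)"]) (rule
            linear_intros cl b')+
      also have "S (pure k B A b (signed A (j * q) a)) = signed T (j * q) (S (pure k B A b a))"
        by (rule signed_linear_map[OF mod_A mod_T, where f = "\<lambda>x. S (pure k B A b x)"]) (rule
            linear_intros a' b')+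
      also have "signed T (i * p) (signed T (j * q) (S (pure k B A b a))) =
          signed T (j * q + i * p) (S (pure k B A b a))"
        using s by (auto simp: signed_def)
      also have "\<dots> = ?E (S (pure k B A b a))"
      proof -
        have "S (pure k B A b a) \<in> {t \<in> carrier T. signed T (j * q + i * p) t = ?E t}"
        proof (rule tensor_span_minimal[OF mod_A mod_B _ _ S_G[OF b a]])
          show "submodule {t \<in> carrier T. signed T (j * q + i * p) t = ?E t} k T"
            by (rule submodule_equalizer[OF mod_T mod_T linear_map_signed[OF mod_T mod_T
                linear_map_id] E])
          fix x y assume x: "x \<in> GA q" and y: "y \<in> GB p"
          note xy = A.G_closed[OF x] B.G_closed[OF y]
          have "?E (pure k A B x y) = pure k A B ((eA ^^ j) x) ((eB ^^ i) y)"
            by (rule tensor_map_pure) (rule ints xy)+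
          also have "\<dots> = signed T (j * q + i * p) (pure k A B x y)"
            unfolding si[OF y] sj[OF x] by (rule pure_signed[OF xy])
          finally show "pure k A B x y \<in> {t \<in> carrier T. signed T (j * q + i * p) t = ?E t}"
            using pure_closed[OF mod_A mod_B xy] by simp
        qed
        then show ?thesis by simp
      qed
      finally show "S (pure k B A ((eB ^^ i) b) ((eA ^^ j) a)) = ?E (S (pure k B A b a))" .
    qed (rule ints b' | assumption)+
  qed (rule ints a)+
qed

lemma S_e_left: "intertwines k A B A B S S eB id id eB"
  using S_e[of "Suc 0" 0] by simp

lemma S_e_right: "intertwines k A B A B S S id eA eA id"
  using S_e[of 0 "Suc 0"] by simp

lemma S_e_both: "intertwines k A B A B S S eB eA eA eB"
  using S_e[of "Suc 0" "Suc 0"] by simp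

definition "dT t = tensor_map k A B dA id t \<oplus>\<^bsub>tensor k A B\<^esub> tensor_map k A B eA dB t"
abbreviation "eT \<equiv> tensor_map k A B eA eB"
abbreviation "GT \<equiv> tensor_grading k A B GA GB"
text \<open>Degrees are natural numbers, so a total degree splits in finitely many ways; the
  truncated subtraction is exact on this range of \<open>i\<close>.\<close>

definition "\<pi>T n = tensor_lift k (tensor k A B)
  (\<lambda>x y. finsum (tensor k A B) (\<lambda>i. pure k A B (\<pi>A i x) (\<pi>B (n - i) y)) {..n})"

lemma dT_linear: "linear_map k T T dT"
  unfolding dT_def by (rule linear_map_add[OF mod_T mod_T]) (rule linear_intros)+

lemma dT_pure:
  assumes "a \<in> carrier A" and "b \<in> carrier B"
  shows "dT (pure k A B a b) = pure k A B (dA a) b \<oplus>\<^bsub>T\<^esub> pure k A B (eA a) (dB b)"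
  unfolding dT_def by (subst (1 2) tensor_map_pure) (rule linear_intros assms | simp)+

lemma eT_linear: "linear_map k T T eT"
  by (rule linear_intros)+

lemma eT_pure: "a \<in> carrier A \<Longrightarrow> b \<in> carrier B \<Longrightarrow> eT (pure k A B a b) = pure k A B (eA a) (eB b)"
  by (rule tensor_map_pure) (rule linear_intros | assumption)+

lemma GT_generators: "{pure k A B x y | x y p q. x \<in> GA p \<and> y \<in> GB q \<and> p + q = n} \<subseteq> carrier T"
  using pure_closed[OF mod_A mod_B A.G_closed B.G_closed] by blast

lemma GT_sub: "submodule (GT n) k T"
  unfolding tensor_grading_def by (rule submodule_span[OF mod_T GT_generators])

lemma GT_pure: "x \<in> GA p \<Longrightarrow> y \<in> GB q \<Longrightarrow> p + q = n \<Longrightarrow> pure k A B x y \<in> GT n"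
  unfolding tensor_grading_def by (rule submodule_span_inc) blast

lemma GT_minimal:
  assumes "submodule H k T" and "\<And>x y p q. \<lbrakk>x \<in> GA p; y \<in> GB q; p + q = n\<rbrakk> \<Longrightarrow> pure k A B x y \<in> H"
    and "t \<in> GT n"
  shows "t \<in> H"
proof -
  have "{pure k A B x y | x y p q. x \<in> GA p \<and> y \<in> GB q \<and> p + q = n} \<subseteq> H" using assms(2) by auto
  then show ?thesis using submodule_span_minimal[OF _ assms(1)] assms(3) unfolding
      tensor_grading_def by blast
qed


lemma \<pi>T_bilinear: "bilinear k A B T (\<lambda>x y. finsum T (\<lambda>i. pure k A B (\<pi>A i x) (\<pi>B (n - i) y))
    {..n})"
  by (rule bilinearI; rule linear_map_finsum_maps)
    (rule linear_intros A.proj_linear B.proj_linear linear_mapD(1)[OF A.proj_linear]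
        linear_mapD(1)[OF B.proj_linear] finite_atMost | assumption)+

lemma \<pi>T_linear: "linear_map k T T (\<pi>T n)"
  unfolding \<pi>T_def by (rule linear_map_lift[OF mod_A mod_B mod_T \<pi>T_bilinear])

lemma \<pi>T_pure:
  assumes x: "x \<in> GA p" and y: "y \<in> GB q"
  shows "\<pi>T n (pure k A B x y) = (if p + q = n then pure k A B x y else \<zero>\<^bsub>T\<^esub>)"
proof -
  interpret T: module k T by (rule mod_T)
  note xy = A.G_closed[OF x] B.G_closed[OF y]
  have l0: "pure k A B \<zero>\<^bsub>A\<^esub> v = \<zero>\<^bsub>T\<^esub>" if "v \<in> carrier B" for v
    by (rule linear_map_0[OF mod_A mod_T, where f = "\<lambda>x. pure k A B x v"]) (rule linear_intros
        that)+
  have r0: "pure k A B u \<zero>\<^bsub>B\<^esub> = \<zero>\<^bsub>T\<^esub>" if "u \<in> carrier A" for u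
    by (rule linear_map_0[OF mod_B mod_T, where f = "pure k A B u"]) (rule linear_intros that)+
  have cl: "pure k A B (\<pi>A i x) (\<pi>B j y) \<in> carrier T" for i j
    by (rule linear_intros xy linear_mapD(1)[OF A.proj_linear] linear_mapD(1)[OF B.proj_linear])+
  have "\<pi>T n (pure k A B x y) = (\<Oplus>\<^bsub>T\<^esub>i\<in>{..n}. pure k A B (\<pi>A i x) (\<pi>B (n - i) y))"
    unfolding \<pi>T_def by (rule lift_pure[OF mod_A mod_B mod_T \<pi>T_bilinear xy])
  also have "\<dots> = (\<Oplus>\<^bsub>T\<^esub>i\<in>{..n}. if p = i then (if p + q = n then pure k A B x y else \<zero>\<^bsub>T\<^esub>) else
      \<zero>\<^bsub>T\<^esub>)"
  proof (rule T.finsum_cong')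
    fix i assume i: "i \<in> {..n}"
    show "pure k A B (\<pi>A i x) (\<pi>B (n - i) y) = (if p = i then (if p + q =
        n then pure k A B x y else \<zero>\<^bsub>T\<^esub>) else \<zero>\<^bsub>T\<^esub>)"
    proof (cases "p = i")
      case True
      have "n - i = q \<longleftrightarrow> p + q = n" using i True by auto
      then show ?thesis using True A.proj_id[OF x] B.proj_id[OF y] B.proj_0[OF y, of "n - i"]
          r0[OF xy(1)]
        by (cases "p + q = n") auto
    next
      case False
      then show ?thesis using A.proj_0[OF x] l0 linear_mapD(1)[OF B.proj_linear xy(2)] by auto
    qed
  qed (use pure_closed[OF mod_A mod_B xy] in auto)
  also have "\<dots> = (if p + q = n then pure k A B x y else \<zero>\<^bsub>T\<^esub>)"
  proof (cases "p \<le> n")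
    case True
    then show ?thesis by (intro T.add.finprod_singleton) (use pure_closed[OF mod_A mod_B xy]
        in auto)
  next
    \<comment> \<open>For \<open>p\<close> above \<open>n\<close> the index \<open>p\<close> is
      missing from the range, and \<open>p + q = n\<close> fails as well, so both sides are
      zero.\<close>
    case False
    then show ?thesis by (auto intro!: T.add.finprod_one_eqI)
  qed
  finally show ?thesis .
qed

lemma bihomogeneous_span:
  assumes H: "submodule H k T" and pure: "\<And>p q x y. \<lbrakk>x \<in> GA p; y \<in> GB q\<rbrakk> \<Longrightarrow> pure k A B x y \<in> H"
    and "t \<in> carrier T"
  shows "t \<in> H"
proof (rule tensor_subset_submodule[OF mod_A mod_B H _ assms(3)])
  fix x y assume x: "x \<in> carrier A" and y: "y \<in> carrier B"
  have *: "pure k A B x y \<in> H" if x: "x \<in> GA p" for x p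
  proof -
    note x' = A.G_closed[OF x]
    have lin: "linear_map k B T (pure k A B x)" by (rule linear_intros x')+
    have "carrier B \<subseteq> {y \<in> carrier B. pure k A B x y \<in> H}"
      by (rule B.homogeneous_span[OF submodule_vimage[OF mod_B mod_T lin H]]) (use pure[OF x]
          B.G_closed in blast)
    with y show ?thesis by blast
  qed
  have lin: "linear_map k A T (\<lambda>x. pure k A B x y)" by (rule linear_intros y)+
  have "carrier A \<subseteq> {x \<in> carrier A. pure k A B x y \<in> H}"
    by (rule A.homogeneous_span[OF submodule_vimage[OF mod_A mod_T lin H]]) (use * A.G_closed in
        blast)
  with x show "pure k A B x y \<in> H" by blast
qed

lemma graded_module_T: "graded_module k AB GT \<pi>T"
proof (rule graded_module.intro)
  show "module k AB" by (rule module_twisted_tensor)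
  show "submodule (GT p) k AB" for p
    using GT_sub submodule_twisted_tensor[OF twist_axioms] by simp
  show "linear_map k AB AB (\<pi>T p)" for p using \<pi>T_linear by simp
  show "\<pi>T p t = t" if "t \<in> GT p" for t p
  proof -
    have "t \<in> {t \<in> carrier T. \<pi>T p t = t}"
      by (rule GT_minimal[OF submodule_equalizer[OF mod_T mod_T \<pi>T_linear linear_map_id] _ that])
        (use \<pi>T_pure pure_closed[OF mod_A mod_B A.G_closed B.G_closed] in auto)
    then show ?thesis by simp
  qed
  show "\<pi>T p t = \<zero>\<^bsub>AB\<^esub>" if "t \<in> GT q" "q \<noteq> p" for t p q
  proof -
    have "t \<in> {t \<in> carrier T. \<pi>T p t \<in> {\<zero>\<^bsub>T\<^esub>}}"
      by (rule GT_minimal[OF submodule_vimage[OF mod_T mod_T \<pi>T_linear submodule_zero[OF mod_T]]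
          _ that(1)])
        (use that(2) \<pi>T_pure pure_closed[OF mod_A mod_B A.G_closed B.G_closed] in auto)
    then show ?thesis by simp
  qed
  show "carrier AB \<subseteq> H" if "submodule H k AB" "\<And>p. GT p \<subseteq> H" for H
    using bihomogeneous_span[of H] that GT_pure submodule_twisted_tensor[OF twist_axioms]
        by (simp add: subset_iff) blast
qed

lemma GT_closed: "t \<in> GT n \<Longrightarrow> t \<in> carrier T"
  by (rule submoduleD(1)[OF GT_sub])

text \<open>Bilinearity reduces this to pure tensors with homogeneous components. By
  \<open>S_G\<close> the twist of \<open>b\<close> past \<open>a'\<close> keeps the degrees
  \<open>p'\<close> and \<open>q\<close>, so the degrees of the four factors add up.\<close>

lemma GT_mult:
  assumes "s \<in> GT m" and "t \<in> GT n"
  shows "s \<otimes>\<^bsub>AB\<^esub> t \<in> GT (m + n)"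
proof (rule bilinear_span[OF mod_T mod_T mod_T bilinear_twisted_mult GT_generators GT_generators
    GT_sub _
      assms[unfolded tensor_grading_def]])
  fix s t
  assume "s \<in> {pure k A B x y | x y p q. x \<in> GA p \<and> y \<in> GB q \<and> p + q = m}"
    and "t \<in> {pure k A B x y | x y p q. x \<in> GA p \<and> y \<in> GB q \<and> p + q = n}"
  then obtain a b p q a' b' p' q' where s: "s = pure k A B a b" "a \<in> GA p" "b \<in> GB q" "p + q = m"
    and t: "t = pure k A B a' b'" "a' \<in> GA p'" "b' \<in> GB q'" "p' + q' = n" by auto
  note cl = A.G_closed[OF s(2)] B.G_closed[OF s(3)] A.G_closed[OF t(2)] B.G_closed[OF t(3)]
  have "tensor_lift k T (\<lambda>x y. pure k A B (a \<otimes>\<^bsub>A\<^esub> x) (y \<otimes>\<^bsub>B\<^esub> b')) (S (pure k B A b a')) \<in> GT (m +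
      n)"
  proof (rule lift_tensor_span[OF mod_A mod_B mod_T _ GT_sub _ _ _ S_G[OF s(3) t(2)]])
    show "pure k A B (a \<otimes>\<^bsub>A\<^esub> x) (y \<otimes>\<^bsub>B\<^esub> b') \<in> GT (m + n)" if "x \<in> GA p'" "y \<in> GB q" for x y
      by (rule GT_pure[OF A.mult_G[OF s(2) that(1)] B.mult_G[OF that(2) t(3)]]) (use s t in simp)
    show "GA p' \<subseteq> carrier A" "GB q \<subseteq> carrier B" using A.G_closed B.G_closed by blast+
  qed (rule cl linear_intros | assumption)+
  then show "s \<otimes>\<^bsub>AB\<^esub> t \<in> GT (m + n)" using twisted_mult_pure[OF cl] s(1) t(1) by simp
qed

text \<open>Expanding gives four sums, in which the differential falls on \<open>a\<close>, on the
  twisted \<open>a'\<close>, on the twisted \<open>b\<close>, and on \<open>b'\<close>. The sums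
  \<open>?f1\<close> and \<open>?f3\<close> make up the term with \<open>dT\<close> on the first
  factor, \<open>?f2\<close> and \<open>?f4\<close> the term with \<open>dT\<close> on the second.
  What remains is to move the differentials and signs back through \<open>S\<close>.\<close>

lemma dT_mult_pure:
  assumes a: "a \<in> carrier A" and b: "b \<in> carrier B" and a': "a' \<in> carrier A" and b': "b' \<in> carrier
      B"
  shows "dT (pure k A B a b \<otimes>\<^bsub>AB\<^esub> pure k A B a' b') =
    dT (pure k A B a b) \<otimes>\<^bsub>AB\<^esub> pure k A B a' b' \<oplus>\<^bsub>T\<^esub> eT (pure k A B a b) \<otimes>\<^bsub>AB\<^esub> dT (pure k A B a' b')"
proof -
  interpret T: module k T by (rule mod_T)
  note ints = a b a' b' linear_map_comp[OF dT_linear] twisted_mult_intros linear_intros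
  let ?s = "S (pure k B A b a')"
  let ?m = "\<lambda>a b'. \<lambda>x y. pure k A B (a \<otimes>\<^bsub>A\<^esub> x) (y \<otimes>\<^bsub>B\<^esub> b')"
  let ?f1 = "\<lambda>x y. ?m (dA a) b' x y"
  let ?f2 = "\<lambda>x y. ?m (eA a) b' (dA x) y"
  let ?f3 = "\<lambda>x y. ?m (eA a) b' (eA x) (dB y)"
  let ?f4 = "\<lambda>x y. ?m (eA a) (dB b') (eA x) (eB y)"
  have s: "?s \<in> carrier T" by (rule ints)+
  have bil: "bilinear k A B T (?m u v)" if "u \<in> carrier A" "v \<in> carrier B" for u v
    by (rule ints that | assumption)+
  have f: "bilinear k A B T ?f1" "bilinear k A B T ?f2" "bilinear k A B T ?f3" "bilinear k A B T
      ?f4"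
    by (rule ints | assumption)+
  have add: "bilinear k A B T (\<lambda>x y. f x y \<oplus>\<^bsub>T\<^esub> g x y)" if "bilinear k A B T f" "bilinear k A B T g"
      for f g
    by (rule bilinearI[OF linear_map_add[OF mod_B mod_T bilinearD(1)[OF that(1)] bilinearD(1)[OF
        that(2)]]
      linear_map_add[OF mod_A mod_T bilinearD(2)[OF that(1)] bilinearD(2)[OF that(2)]]])
  have m: "pure k A B u v \<otimes>\<^bsub>AB\<^esub> pure k A B u' v' = tensor_lift k T (?m u v') (S (pure k B A v u'))"
    if "u \<in> carrier A" "v \<in> carrier B" "u' \<in> carrier A" "v' \<in> carrier B" for u v u' v'
    by (rule twisted_mult_pure[OF that])
  let ?L = "\<lambda>f. tensor_lift k T f ?s"
  have L: "?L ?f1 \<in> carrier T" "?L ?f2 \<in> carrier T" "?L ?f3 \<in> carrier T" "?L ?f4 \<in> carrier T"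
    using f by (auto intro!: lift_closed[OF mod_A mod_B mod_T] s)
  have "dT (pure k A B a b \<otimes>\<^bsub>AB\<^esub> pure k A B a' b') =
      ?L (\<lambda>x y. (?f1 x y \<oplus>\<^bsub>T\<^esub> ?f2 x y) \<oplus>\<^bsub>T\<^esub> (?f3 x y \<oplus>\<^bsub>T\<^esub> ?f4 x y))"
    unfolding m[OF a b a' b']
  proof (rule lift_push[where h = dT])
    fix x y assume x: "x \<in> carrier A" and y: "y \<in> carrier B"
    have "pure k A B (dA (a \<otimes>\<^bsub>A\<^esub> x)) (y \<otimes>\<^bsub>B\<^esub> b') = ?f1 x y \<oplus>\<^bsub>T\<^esub> ?f2 x y"
      unfolding A.d_mult[OF a x]
      by (rule linear_mapD(2)[where f = "\<lambda>u. pure k A B u (y \<otimes>\<^bsub>B\<^esub> b')"], (rule ints x y)+)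
    moreover have "pure k A B (eA (a \<otimes>\<^bsub>A\<^esub> x)) (dB (y \<otimes>\<^bsub>B\<^esub> b')) = ?f3 x y \<oplus>\<^bsub>T\<^esub> ?f4 x y"
      unfolding A.e_mult[OF a x] B.d_mult[OF y b']
      by (rule linear_mapD(2)[where f = "\<lambda>v. pure k A B (eA a \<otimes>\<^bsub>A\<^esub> eA x) v"], (rule ints x y)+)
    moreover have "dT (?m a b' x y) = pure k A B (dA (a \<otimes>\<^bsub>A\<^esub> x)) (y \<otimes>\<^bsub>B\<^esub> b') \<oplus>\<^bsub>T\<^esub>
        pure k A B (eA (a \<otimes>\<^bsub>A\<^esub> x)) (dB (y \<otimes>\<^bsub>B\<^esub> b'))"
      by (rule dT_pure) (rule ints x y)+
    ultimately show "dT (?m a b' x y) = (?f1 x y \<oplus>\<^bsub>T\<^esub> ?f2 x y) \<oplus>\<^bsub>T\<^esub> (?f3 x y \<oplus>\<^bsub>T\<^esub> ?f4 x y)" by simp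
  qed (rule s bil[OF a b'] dT_linear mod_A mod_B mod_T)+
  also have "\<dots> = (?L ?f1 \<oplus>\<^bsub>T\<^esub> ?L ?f2) \<oplus>\<^bsub>T\<^esub> (?L ?f3 \<oplus>\<^bsub>T\<^esub> ?L ?f4)"
    by (subst lift_add[OF mod_A mod_B mod_T add[OF f(1,2)] add[OF f(3,4)] s],
        subst lift_add[OF mod_A mod_B mod_T f(1,2) s], subst lift_add[OF mod_A mod_B mod_T f(3,4)
            s], rule refl)
  also have "\<dots> = (?L ?f1 \<oplus>\<^bsub>T\<^esub> ?L ?f3) \<oplus>\<^bsub>T\<^esub> (?L ?f2 \<oplus>\<^bsub>T\<^esub> ?L ?f4)"
    using L by (simp add: T.a_ac)
  also have "?L ?f1 = pure k A B (dA a) b \<otimes>\<^bsub>AB\<^esub> pure k A B a' b'"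
    by (rule m[symmetric]) (rule ints)+
  also have "?L ?f3 = pure k A B (eA a) (dB b) \<otimes>\<^bsub>AB\<^esub> pure k A B a' b'"
    using lift_intertwines[OF S_d_left twist_axioms twist_axioms A.e_linear B.d_linear bil[OF
        A.e_closed[OF a] b'] mod_T b a']
      m[OF A.e_closed[OF a] B.d_closed[OF b] a' b'] by simp
  also have "?L ?f4 = pure k A B (eA a) (eB b) \<otimes>\<^bsub>AB\<^esub> pure k A B (eA a') (dB b')"
    using lift_intertwines[OF S_e_both twist_axioms twist_axioms A.e_linear B.e_linear
        bil[OF A.e_closed[OF a] B.d_closed[OF b']] mod_T b a']
      m[OF A.e_closed[OF a] B.e_closed[OF b] A.e_closed[OF a'] B.d_closed[OF b']] by simp
  \<comment> \<open>Moving \<open>dA\<close> through \<open>S\<close> leaves a sign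
    \<open>eB\<close> on the component of \<open>B\<close>. It cancels against the sign that
    \<open>eT\<close> puts on \<open>b\<close>, because \<open>eB\<close> is an involution commuting
    with \<open>S\<close>.\<close>
  also have "?L ?f2 = pure k A B (eA a) (eB b) \<otimes>\<^bsub>AB\<^esub> pure k A B (dA a') b'"
  proof -
    have "pure k A B (eA a) (eB b) \<otimes>\<^bsub>AB\<^esub> pure k A B (dA a') b' =
        tensor_lift k T (?m (eA a) b') (S (pure k B A (id (eB b)) (dA a')))"
      by (subst m, (rule ints)+, simp)
    also have "\<dots> = tensor_lift k T (\<lambda>x y. ?m (eA a) b' (dA x) (eB y)) (S (pure k B A (eB b) (id
        a')))"
      using lift_intertwines[OF S_d_right twist_axioms twist_axioms A.d_linear B.e_linear
          bil[OF A.e_closed[OF a] b'] mod_T B.e_closed[OF b] a'] by simp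
    also have "\<dots> = tensor_lift k T (\<lambda>x y. ?m (eA a) b' (dA (id x)) (eB (eB y))) ?s"
      by (rule lift_intertwines[OF S_e_left twist_axioms twist_axioms linear_map_id' B.e_linear _
          mod_T b a', where
          g = "\<lambda>x y. ?m (eA a) b' (dA x) (eB y)"]) (rule ints | assumption)+
    also have "\<dots> = ?L ?f2"
      by (rule sym, rule lift_cong[OF mod_A mod_B mod_T s f(2)]) (simp add: B.e_e)
    finally show ?thesis by simp
  qed
  also have "pure k A B (dA a) b \<otimes>\<^bsub>AB\<^esub> pure k A B a' b' \<oplus>\<^bsub>T\<^esub> pure k A B (eA a) (dB b) \<otimes>\<^bsub>AB\<^esub> pure k A
      B a' b' =
      dT (pure k A B a b) \<otimes>\<^bsub>AB\<^esub> pure k A B a' b'"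
    unfolding dT_pure[OF a b]
    by (rule linear_mapD(2)[where f = "\<lambda>u. u \<otimes>\<^bsub>AB\<^esub> pure k A B a' b'", symmetric], (rule ints)+)
  also have "pure k A B (eA a) (eB b) \<otimes>\<^bsub>AB\<^esub> pure k A B (dA a') b' \<oplus>\<^bsub>T\<^esub>
      pure k A B (eA a) (eB b) \<otimes>\<^bsub>AB\<^esub> pure k A B (eA a') (dB b') =
      eT (pure k A B a b) \<otimes>\<^bsub>AB\<^esub> dT (pure k A B a' b')"
    unfolding dT_pure[OF a' b'] eT_pure[OF a b]
    by (rule linear_mapD(2)[where f = "\<lambda>u. pure k A B (eA a) (eB b) \<otimes>\<^bsub>AB\<^esub> u", symmetric],
        (rule ints)+)
  finally show ?thesis .
qed

lemma dga_T: "dga k AB GT \<pi>T dT eT"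
proof (intro dga.intro dga_axioms.intro graded_module_T unital_algebra_twisted_tensor,
    unfold linear_map_twisted_tensor twisted_tensor_simps signed_twisted_tensor)
  interpret T: module k T by (rule mod_T)
  show "pure k A B \<one>\<^bsub>A\<^esub> \<one>\<^bsub>B\<^esub> \<in> GT 0" by (rule GT_pure[OF A.one_G B.one_G]) simp
  show "s \<otimes>\<^bsub>AB\<^esub> t \<in> GT (p + q)" if "s \<in> GT p" "t \<in> GT q" for s t p q by (rule GT_mult[OF that])
  show "linear_map k T T dT" by (rule dT_linear)
  show "linear_map k T T eT" by (rule eT_linear)
  show "dT t \<in> GT (Suc p)" if "t \<in> GT p" for t p
  proof -
    have "t \<in> {t \<in> carrier T. dT t \<in> GT (Suc p)}"
    proof (rule GT_minimal[OF submodule_vimage[OF mod_T mod_T dT_linear GT_sub] _ that])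
      fix x y i j assume *: "x \<in> GA i" "y \<in> GB j" "i + j = p"
      have "pure k A B (dA x) y \<in> GT (Suc p)" "pure k A B (eA x) (dB y) \<in> GT (Suc p)"
        by (rule GT_pure[OF A.d_G[OF *(1)] *(2)], use * in simp,
            rule GT_pure[OF A.e_G[OF *(1)] B.d_G[OF *(2)]], use * in simp)
      then show "pure k A B x y \<in> {t \<in> carrier T. dT t \<in> GT (Suc p)}"
        using dT_pure pure_closed[OF mod_A mod_B] A.G_closed[OF *(1)] B.G_closed[OF *(2)]
            submoduleD(3)[OF GT_sub] by simp
    qed
    then show ?thesis by simp
  qed
  \<comment> \<open>The two pure second derivatives vanish, and the mixed terms cancel because
    \<open>eA\<close> and \<open>dA\<close> anticommute.\<close>
  show "dT (dT t) = \<zero>\<^bsub>T\<^esub>" if "t \<in> carrier T" for t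
  proof (rule tensor_ext[OF mod_A mod_B mod_T linear_map_comp[OF dT_linear dT_linear]
      linear_map_zero[OF mod_T] _ that])
    fix x y assume x: "x \<in> carrier A" and y: "y \<in> carrier B"
    note ints = x y linear_intros
    have cl: "pure k A B (eA (dA x)) (dB y) \<in> carrier T" "pure k A B (dA x) y \<in> carrier T" "pure k A
        B (eA x) (dB y) \<in> carrier T"
      by (rule ints)+
    have l0: "pure k A B \<zero>\<^bsub>A\<^esub> v = \<zero>\<^bsub>T\<^esub>" if "v \<in> carrier B" for v
      by (rule linear_map_0[OF mod_A mod_T, where f = "\<lambda>x. pure k A B x v"]) (rule linear_intros
          that)+
    have r0: "pure k A B u \<zero>\<^bsub>B\<^esub> = \<zero>\<^bsub>T\<^esub>" if "u \<in> carrier A" for u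
      by (rule linear_map_0[OF mod_B mod_T, where f = "pure k A B u"]) (rule linear_intros that)+
    have "dT (pure k A B (dA x) y) = pure k A B (eA (dA x)) (dB y)"
      using cl x y by (simp add: dT_pure A.d_d l0 A.d_closed)
    moreover have "dT (pure k A B (eA x) (dB y)) = pure k A B (dA (eA x)) (dB y)"
      using x y pure_closed[OF mod_A mod_B] by (simp add: dT_pure B.d_d r0 A.d_closed A.e_closed
          B.d_closed)
    moreover have "pure k A B (eA (dA x)) (dB y) = \<ominus>\<^bsub>T\<^esub> pure k A B (dA (eA x)) (dB y)"
      unfolding A.e_d[OF x]
      by (rule linear_map_uminus[OF mod_A mod_T, where f = "\<lambda>x. pure k A B x (dB y)"]) (rule ints)+
    moreover have "pure k A B (dA (eA x)) (dB y) \<in> carrier T" by (rule ints)+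
    ultimately show "dT (dT (pure k A B x y)) = \<zero>\<^bsub>T\<^esub>"
      using cl x y by (simp add: dT_pure linear_mapD(2)[OF dT_linear] T.l_neg)
  qed
  show "eT t = signed T p t" if "t \<in> GT p" for t p
  proof -
    have "t \<in> {t \<in> carrier T. eT t = signed T p t}"
    proof (rule GT_minimal[OF submodule_equalizer[OF mod_T mod_T eT_linear linear_map_signed[OF
        mod_T mod_T linear_map_id]] _ that])
      fix x y i j assume *: "x \<in> GA i" "y \<in> GB j" "i + j = p"
      note cl = A.G_closed[OF *(1)] B.G_closed[OF *(2)]
      have sy: "eB y \<in> carrier B" by (rule B.e_closed[OF cl(2)])
      have "pure k A B (eA x) (eB y) = signed T i (pure k A B x (eB y))"
        unfolding A.e_signed[OF *(1)]
        by (rule signed_linear_map[OF mod_A mod_T, where f = "\<lambda>x. pure k A B x (eB y)"]) (rule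
            linear_intros cl)+
      also have "pure k A B x (eB y) = signed T j (pure k A B x y)"
        unfolding B.e_signed[OF *(2)]
        by (rule signed_linear_map[OF mod_B mod_T, where f = "pure k A B x"]) (rule linear_intros
            cl)+
      finally show "pure k A B x y \<in> {t \<in> carrier T. eT t = signed T p t}"
        using *(3) pure_closed[OF mod_A mod_B cl] cl by (auto simp: eT_pure signed_def)
    qed
    then show ?thesis by simp
  qed
  show "dT (s \<otimes>\<^bsub>AB\<^esub> t) = dT s \<otimes>\<^bsub>AB\<^esub> t \<oplus>\<^bsub>T\<^esub> eT s \<otimes>\<^bsub>AB\<^esub> dT t"
    if s: "s \<in> carrier T" and t: "t \<in> carrier T" for s t
  proof (rule tensor_ext[OF mod_A mod_B mod_T _ _ _ s])
    note ints = linear_map_add[OF mod_T mod_T] dT_linear eT_linear linear_map_comp[OF dT_linear]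
        linear_map_comp[OF eT_linear]
      linear_mapD(1)[OF dT_linear] linear_mapD(1)[OF eT_linear] twisted_mult_intros linear_intros
    show "linear_map k T T (\<lambda>s. dT (s \<otimes>\<^bsub>AB\<^esub> t))" "linear_map k T T (\<lambda>s. dT s \<otimes>\<^bsub>AB\<^esub> t \<oplus>\<^bsub>T\<^esub> eT s \<otimes>\<^bsub>AB\<^esub>
        dT t)"
      by (rule ints t)+
    fix a b assume a: "a \<in> carrier A" and b: "b \<in> carrier B"
    show "dT (pure k A B a b \<otimes>\<^bsub>AB\<^esub> t) = dT (pure k A B a b) \<otimes>\<^bsub>AB\<^esub> t \<oplus>\<^bsub>T\<^esub> eT (pure k A B a b) \<otimes>\<^bsub>AB\<^esub>
        dT t"
      by (rule tensor_ext[OF mod_A mod_B mod_T _ _ _ t]) (rule dT_mult_pure[OF a b] ints a b |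
          assumption)+
  qed
qed

end

lemma tensor_map_twisted_tensor [simp]:
  "tensor_map k (twisted_tensor k A B S) C = tensor_map k (tensor k A B) C"
  by (simp add: fun_eq_iff tensor_map_def)

lemma tensor_map_id_id:
  assumes "module k M" and "module k N" and "t \<in> carrier (tensor k M N)"
  shows "tensor_map k M N id id t = t"
  using lift_pure_id[OF assms] by (simp add: tensor_map_def)

lemma tensor_map_span:
  assumes M: "module k M" and N: "module k N" and P: "module k P" and Q: "module k Q"
    and f: "linear_map k M P f" and g: "linear_map k N Q g"
    and "\<And>x. x \<in> X \<Longrightarrow> f x \<in> X'" and "\<And>y. y \<in> Y \<Longrightarrow> g y \<in> Y'"
    and X: "X \<subseteq> carrier M" "Y \<subseteq> carrier N" and X': "X' \<subseteq> carrier P" "Y' \<subseteq> carrier Q"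
    and t: "t \<in> tensor_span k M N X Y"
  shows "tensor_map k P Q f g t \<in> tensor_span k P Q X' Y'"
proof -
  have "t \<in> {t \<in> carrier (tensor k M N). tensor_map k P Q f g t \<in> tensor_span k P Q X' Y'}"
  proof (rule tensor_span_minimal[OF M N _ _ t])
    show "submodule {t \<in> carrier (tensor k M N). tensor_map k P Q f g t \<in> tensor_span k P Q X' Y'} k
        (tensor k M N)"
      by (rule submodule_vimage[OF module_tensor[OF M N] module_tensor[OF P Q]
            linear_map_tensor_map[OF M N P Q f g] tensor_span_submodule[OF P Q X']])
    fix x y assume xy: "x \<in> X" "y \<in> Y"
    then have "x \<in> carrier M" "y \<in> carrier N" using X by blast+
    with xy show "pure k M N x y \<in> {t \<in> carrier (tensor k M N). tensor_map k P Q f g t \<in> tensor_span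
        k P Q X' Y'}"
      using pure_closed[OF M N] tensor_map_pure[OF M N P Q f g] tensor_span_pure[OF P Q] assms(7,8)
          by simp
  qed
  then show ?thesis by simp
qed

context dga_twist
begin

lemmas lift_d_left = lift_intertwines[OF S_d_left twist_axioms twist_axioms A.e_linear B.d_linear,
    unfolded id_apply]
lemmas lift_d_right = lift_intertwines[OF S_d_right twist_axioms twist_axioms A.d_linear B.e_linear,
    unfolded id_apply]
lemmas lift_e_left = lift_intertwines[OF S_e_left twist_axioms twist_axioms linear_map_id'
    B.e_linear, unfolded id_apply]
lemmas lift_e_right = lift_intertwines[OF S_e_right twist_axioms twist_axioms A.e_linear
    linear_map_id', unfolded id_apply]

lemma S_id: "intertwines k A B A B S S id id id id"
  using S_closed pure_closed[OF mod_B mod_A] by (simp add: intertwines_def tensor_map_id_id[OF mod_A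
      mod_B])

lemma GA_sub: "GA p \<subseteq> carrier A" and GB_sub: "GB p \<subseteq> carrier B"
  using A.G_closed B.G_closed by blast+

text \<open>Decomposing \<open>a\<close> into homogeneous parts leaves the degree of the component
  in \<open>B\<close> unaffected. This weaker form of the bidegree condition, with \<open>a\<close>
  arbitrary, is what confines components in the proof of the hexagon equation.\<close>

lemma S_span:
  assumes "b \<in> GB p" and "a \<in> carrier A"
  shows "S (pure k B A b a) \<in> tensor_span k A B (carrier A) (GB p)"
proof -
  note b = B.G_closed[OF assms(1)]
  have lin: "linear_map k A T (\<lambda>a. S (pure k B A b a))" by (rule linear_intros b)+
  note H = tensor_span_submodule[OF mod_A mod_B subset_refl GB_sub]
  have "GA q \<subseteq> {a \<in> carrier A. S (pure k B A b a) \<in> tensor_span k A B (carrier A) (GB p)}" for q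
  proof
    fix a assume a: "a \<in> GA q"
    have "S (pure k B A b a) \<in> tensor_span k A B (carrier A) (GB p)"
      by (rule tensor_span_minimal[OF mod_A mod_B H tensor_span_pure[OF mod_A mod_B A.G_closed]
          S_G[OF assms(1) a]])
    with A.G_closed[OF a] show "a \<in> {a \<in> carrier A. S (pure k B A b a) \<in> tensor_span k A B (carrier
        A) (GB p)}" by simp
  qed
  then show ?thesis using A.homogeneous_span[OF submodule_vimage[OF mod_A mod_T lin H]] assms(2)
      by blast
qed

end

text \<open>Bidegree and units are required in degree zero only, which is all that can be read off
  from the original twisting map. Generation extends both to all forms.\<close>

locale generated_twist = A: generated_dga k A GA \<pi>A dA eA + B: generated_dga k B GB \<pi>B dB eB + twist
    k A B S
  for k :: "'k ring" and A :: "('k, 'a) module" and GA \<pi>A dA eA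
    and B :: "('k, 'b) module" and GB \<pi>B dB eB and S +
  assumes S_G0: "\<lbrakk>b \<in> GB 0; a \<in> GA 0\<rbrakk> \<Longrightarrow> S (pure k B A b a) \<in> tensor_span k A B (GA 0) (GB 0)"
    and S_one_left_G0: "a \<in> GA 0 \<Longrightarrow> S (pure k B A \<one>\<^bsub>B\<^esub> a) = pure k A B a \<one>\<^bsub>B\<^esub>"
    and S_one_right_G0: "b \<in> GB 0 \<Longrightarrow> S (pure k B A b \<one>\<^bsub>A\<^esub>) = pure k A B \<one>\<^bsub>A\<^esub> b"
    and S_d_left: "intertwines k A B A B S S dB id eA dB"
    and S_d_right: "intertwines k A B A B S S id dA dA eB"
begin

lemmas [linear_intros] = A.d_linear A.e_linear A.d_closed A.e_closed
  B.d_linear B.e_linear B.d_closed B.e_closed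

lemma S_d_left': "b \<in> carrier B \<Longrightarrow> a \<in> carrier A \<Longrightarrow>
    S (pure k B A (dB b) a) = tensor_map k A B eA dB (S (pure k B A b a))"
  and S_d_right': "b \<in> carrier B \<Longrightarrow> a \<in> carrier A \<Longrightarrow>
    S (pure k B A b (dA a)) = tensor_map k A B dA eB (S (pure k B A b a))"
  using S_d_left S_d_right by (simp_all add: intertwines_def)

lemma GA_sub: "GA p \<subseteq> carrier A" and GB_sub: "GB p \<subseteq> carrier B"
  using A.G_closed B.G_closed by blast+

lemma one_A: "\<one>\<^bsub>A\<^esub> \<in> carrier A" and one_B: "\<one>\<^bsub>B\<^esub> \<in> carrier B"
  using A.G_closed[OF A.one_G] B.G_closed[OF B.one_G] by auto

lemma mod_T: "module k (tensor k A B)"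
  by (rule linear_intros)+

text \<open>The unit of \<open>B\<close> has degree zero, so \<open>eB\<close> fixes it and the
  claim passes from \<open>a\<close> to \<open>dA a\<close>. For a product,
  \<open>twist_mult_right\<close> lets the unit cross one factor after the other.\<close>

lemma S_one_left:
  assumes "a \<in> carrier A"
  shows "S (pure k B A \<one>\<^bsub>B\<^esub> a) = pure k A B a \<one>\<^bsub>B\<^esub>"
proof -
  interpret A': unital_algebra k A by (rule A)
  note ints = one_A one_B linear_intros
  have "a \<in> {a \<in> carrier A. S (pure k B A \<one>\<^bsub>B\<^esub> a) = pure k A B a \<one>\<^bsub>B\<^esub>}"
  proof (rule A.generated_carrier[OF submodule_equalizer[OF mod_A mod_T] _ _ _ assms])
    show "linear_map k A (tensor k A B) (\<lambda>a. S (pure k B A \<one>\<^bsub>B\<^esub> a))" by (rule ints)+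
    show "linear_map k A (tensor k A B) (\<lambda>a. pure k A B a \<one>\<^bsub>B\<^esub>)" by (rule ints)+
    show "a \<in> {a \<in> carrier A. S (pure k B A \<one>\<^bsub>B\<^esub> a) = pure k A B a \<one>\<^bsub>B\<^esub>}" if "a \<in> GA 0" for a
      using S_one_left_G0[OF that] A.G_closed[OF that] by simp
    show "dA a \<in> {a \<in> carrier A. S (pure k B A \<one>\<^bsub>B\<^esub> a) = pure k A B a \<one>\<^bsub>B\<^esub>}" if a: "a \<in> GA 0" for a
    proof -
      have "tensor_map k A B dA eB (pure k A B a \<one>\<^bsub>B\<^esub>) = pure k A B (dA a) (eB \<one>\<^bsub>B\<^esub>)"
        by (rule tensor_map_pure) (rule ints A.G_closed[OF a])+
      then show ?thesis using A.G_closed[OF a] A.d_closed one_B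
        by (simp add: S_d_right' S_one_left_G0[OF a] B.e_G0[OF B.one_G])
    qed
    fix a a'
    assume a: "a \<in> {a \<in> carrier A. S (pure k B A \<one>\<^bsub>B\<^esub> a) = pure k A B a \<one>\<^bsub>B\<^esub>}"
      and a': "a' \<in> {a \<in> carrier A. S (pure k B A \<one>\<^bsub>B\<^esub> a) = pure k A B a \<one>\<^bsub>B\<^esub>}"
    then have cl: "a \<in> carrier A" "a' \<in> carrier A" by auto
    have "S (pure k B A \<one>\<^bsub>B\<^esub> (a \<otimes>\<^bsub>A\<^esub> a')) = tensor_lift k (tensor k A B) (\<lambda>x y. tensor_lift k
        (tensor k A B) (\<lambda>u v.
        pure k A B (x \<otimes>\<^bsub>A\<^esub> u) v) (S (pure k B A y a'))) (pure k A B a \<one>\<^bsub>B\<^esub>)"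
      using twist_mult_right[OF one_B cl] a by simp
    also have "\<dots> = tensor_lift k (tensor k A B) (\<lambda>u v. pure k A B (a \<otimes>\<^bsub>A\<^esub> u) v) (S (pure k B A \<one>\<^bsub>B\<^esub>
        a'))"
      by (rule lift_pure) (rule ints cl | assumption)+
    also have "S (pure k B A \<one>\<^bsub>B\<^esub> a') = pure k A B a' \<one>\<^bsub>B\<^esub>" using a' by simp
    also have "tensor_lift k (tensor k A B) (\<lambda>u v. pure k A B (a \<otimes>\<^bsub>A\<^esub> u) v) (pure k A B a' \<one>\<^bsub>B\<^esub>) =
        pure k A B (a \<otimes>\<^bsub>A\<^esub> a') \<one>\<^bsub>B\<^esub>"
      by (rule lift_pure) (rule ints cl | assumption)+
    finally show "a \<otimes>\<^bsub>A\<^esub> a' \<in> {a \<in> carrier A. S (pure k B A \<one>\<^bsub>B\<^esub> a) = pure k A B a \<one>\<^bsub>B\<^esub>}" using cl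
        by simp
  qed
  then show ?thesis by simp
qed

lemma S_one_right:
  assumes "b \<in> carrier B"
  shows "S (pure k B A b \<one>\<^bsub>A\<^esub>) = pure k A B \<one>\<^bsub>A\<^esub> b"
proof -
  interpret B': unital_algebra k B by (rule B)
  note ints = one_A one_B linear_intros
  have "b \<in> {b \<in> carrier B. S (pure k B A b \<one>\<^bsub>A\<^esub>) = pure k A B \<one>\<^bsub>A\<^esub> b}"
  proof (rule B.generated_carrier[OF submodule_equalizer[OF mod_B mod_T] _ _ _ assms])
    show "linear_map k B (tensor k A B) (\<lambda>b. S (pure k B A b \<one>\<^bsub>A\<^esub>))" by (rule ints)+
    show "linear_map k B (tensor k A B) (\<lambda>b. pure k A B \<one>\<^bsub>A\<^esub> b)" by (rule ints)+
    show "b \<in> {b \<in> carrier B. S (pure k B A b \<one>\<^bsub>A\<^esub>) = pure k A B \<one>\<^bsub>A\<^esub> b}" if "b \<in> GB 0" for b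
      using S_one_right_G0[OF that] B.G_closed[OF that] by simp
    show "dB b \<in> {b \<in> carrier B. S (pure k B A b \<one>\<^bsub>A\<^esub>) = pure k A B \<one>\<^bsub>A\<^esub> b}" if b: "b \<in> GB 0" for b
    proof -
      have "tensor_map k A B eA dB (pure k A B \<one>\<^bsub>A\<^esub> b) = pure k A B (eA \<one>\<^bsub>A\<^esub>) (dB b)"
        by (rule tensor_map_pure) (rule ints B.G_closed[OF b])+
      then show ?thesis using B.G_closed[OF b] B.d_closed one_A
        by (simp add: S_d_left' S_one_right_G0[OF b] A.e_G0[OF A.one_G])
    qed
    fix b b'
    assume b: "b \<in> {b \<in> carrier B. S (pure k B A b \<one>\<^bsub>A\<^esub>) = pure k A B \<one>\<^bsub>A\<^esub> b}"
      and b': "b' \<in> {b \<in> carrier B. S (pure k B A b \<one>\<^bsub>A\<^esub>) = pure k A B \<one>\<^bsub>A\<^esub> b}"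
    then have cl: "b \<in> carrier B" "b' \<in> carrier B" by auto
    have "S (pure k B A (b \<otimes>\<^bsub>B\<^esub> b') \<one>\<^bsub>A\<^esub>) = tensor_lift k (tensor k A B) (\<lambda>x y. tensor_lift k
        (tensor k A B) (\<lambda>u v.
        pure k A B u (v \<otimes>\<^bsub>B\<^esub> y)) (S (pure k B A b x))) (pure k A B \<one>\<^bsub>A\<^esub> b')"
      using twist_mult_left[OF cl one_A] b' by simp
    also have "\<dots> = tensor_lift k (tensor k A B) (\<lambda>u v. pure k A B u (v \<otimes>\<^bsub>B\<^esub> b')) (S (pure k B A b
        \<one>\<^bsub>A\<^esub>))"
      by (rule lift_pure) (rule ints cl | assumption)+
    also have "S (pure k B A b \<one>\<^bsub>A\<^esub>) = pure k A B \<one>\<^bsub>A\<^esub> b" using b by simp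
    also have "tensor_lift k (tensor k A B) (\<lambda>u v. pure k A B u (v \<otimes>\<^bsub>B\<^esub> b')) (pure k A B \<one>\<^bsub>A\<^esub> b) =
        pure k A B \<one>\<^bsub>A\<^esub> (b \<otimes>\<^bsub>B\<^esub> b')"
      by (rule lift_pure) (rule ints cl | assumption)+
    finally show "b \<otimes>\<^bsub>B\<^esub> b' \<in> {b \<in> carrier B. S (pure k B A b \<one>\<^bsub>A\<^esub>) = pure k A B \<one>\<^bsub>A\<^esub> b}" using cl
        by simp
  qed
  then show ?thesis by simp
qed

text \<open>Generation frees one argument at a time, so the bidegree is obtained in two rounds,
  beginning with \<open>b\<close>. The quantifier over \<open>a\<close> is part of
  \<open>?Q\<close>: in a product the first factor meets the component coming from the twist of the
  second past \<open>a\<close>, which is another element of degree zero.\<close>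

lemma S_bidegree_0:
  assumes "b \<in> GB p" and "a \<in> GA 0"
  shows "S (pure k B A b a) \<in> tensor_span k A B (GA 0) (GB p)"
proof -
  let ?H = "\<lambda>p. tensor_span k A B (GA 0) (GB p)"
  let ?Q = "\<lambda>p. {b \<in> GB p. \<forall>a\<in>GA 0. S (pure k B A b a) \<in> ?H p}"
  note H = tensor_span_submodule[OF mod_A mod_B GA_sub GB_sub]
  have "b \<in> ?Q p"
  proof (rule B.generated[OF _ _ _ _ assms(1)])
    show "submodule (?Q p) k B" for p
    proof (rule submodule_Collect_conj[OF mod_B B.sub submodule_Collect_ball[OF mod_B
        submodule_vimage[OF mod_B mod_T _ H]]])
      fix a assume "a \<in> GA 0"
      then have "a \<in> carrier A" by (rule A.G_closed)
      then show "linear_map k B (tensor k A B) (\<lambda>b. S (pure k B A b a))" by (intro linear_intros)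
    qed
    show "b \<in> ?Q 0" if "b \<in> GB 0" for b using S_G0[OF that] that by blast
    show "dB b \<in> ?Q (Suc 0)" if b: "b \<in> GB 0" for b
    proof -
      have "S (pure k B A (dB b) a) \<in> ?H (Suc 0)" if a: "a \<in> GA 0" for a
        unfolding S_d_left'[OF B.G_closed[OF b] A.G_closed[OF a]]
        by (rule tensor_map_span[OF mod_A mod_B mod_A mod_B A.e_linear B.d_linear A.e_G B.d_G GA_sub
            GB_sub GA_sub GB_sub S_G0[OF b a]])
      then show ?thesis using B.d_G[OF b] by simp
    qed
    fix p q b b' assume b: "b \<in> ?Q p" and b': "b' \<in> ?Q q"
    then have cl: "b \<in> carrier B" "b' \<in> carrier B" using B.G_closed by blast+
    have "S (pure k B A (b \<otimes>\<^bsub>B\<^esub> b') a) \<in> ?H (p + q)" if a: "a \<in> GA 0" for a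
      unfolding twist_mult_left[OF cl A.G_closed[OF a]]
    proof (rule lift_tensor_span[OF mod_A mod_B mod_T _ H _ GA_sub GB_sub])
      note ints = cl A.G_closed[OF a] linear_intros
      show "S (pure k B A b' a) \<in> ?H q" using b' a by blast
      show "bilinear k A B (tensor k A B) (\<lambda>x y. tensor_lift k (tensor k A B) (\<lambda>u v.
        pure k A B u (v \<otimes>\<^bsub>B\<^esub> y)) (S (pure k B A b x)))" by (rule ints | assumption)+
      fix x y assume x: "x \<in> GA 0" and y: "y \<in> GB q"
      show "tensor_lift k (tensor k A B) (\<lambda>u v. pure k A B u (v \<otimes>\<^bsub>B\<^esub> y)) (S (pure k B A b x)) \<in> ?H
          (p + q)"
      proof (rule lift_tensor_span[OF mod_A mod_B mod_T _ H _ GA_sub GB_sub])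
        show "S (pure k B A b x) \<in> ?H p" using b x by blast
        show "bilinear k A B (tensor k A B) (\<lambda>u v. pure k A B u (v \<otimes>\<^bsub>B\<^esub> y))"
          by (rule linear_intros B.G_closed[OF y] | assumption)+
        show "pure k A B u (v \<otimes>\<^bsub>B\<^esub> y) \<in> ?H (p + q)" if "u \<in> GA 0" "v \<in> GB p" for u v
          by (rule tensor_span_pure[OF mod_A mod_B that(1) B.mult_G[OF that(2) y]])
      qed
    qed
    then show "b \<otimes>\<^bsub>B\<^esub> b' \<in> ?Q (p + q)" using b b' B.mult_G by blast
  qed
  with assms(2) show ?thesis by blast
qed

lemma S_bidegree:
  assumes "b \<in> GB p" and "a \<in> GA q"
  shows "S (pure k B A b a) \<in> tensor_span k A B (GA q) (GB p)"
proof -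
  let ?H = "\<lambda>q p. tensor_span k A B (GA q) (GB p)"
  \<comment> \<open>The degree and the element are bundled into one index, so that the universal
    condition in \<open>?Q\<close> fits \<open>submodule_Collect_ball\<close>. The condition ranges
    over all \<open>b\<close> since the twist past the first factor replaces \<open>b\<close> by
    other elements of its degree.\<close>
  let ?I = "{(p, b). b \<in> GB p}"
  let ?Q = "\<lambda>q. {a \<in> GA q. \<forall>i\<in>?I. S (pure k B A (snd i) a) \<in> ?H q (fst i)}"
  note H = tensor_span_submodule[OF mod_A mod_B GA_sub GB_sub]
  have Q: "a \<in> ?Q q \<longleftrightarrow> a \<in> GA q \<and> (\<forall>p. \<forall>b\<in>GB p. S (pure k B A b a) \<in> ?H q p)" for a q by auto
  have "a \<in> ?Q q"
  proof (rule A.generated[OF _ _ _ _ assms(2)])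
    show "submodule (?Q q) k A" for q
    proof (rule submodule_Collect_conj[OF mod_A A.sub submodule_Collect_ball[OF mod_A
        submodule_vimage[OF mod_A mod_T _ H]]])
      fix i assume "i \<in> ?I"
      then have "snd i \<in> carrier B" using B.G_closed by auto
      then show "linear_map k A (tensor k A B) (\<lambda>a. S (pure k B A (snd i) a))" by (intro
          linear_intros)
    qed
    show "a \<in> ?Q 0" if "a \<in> GA 0" for a using S_bidegree_0[OF _ that] that unfolding Q by blast
    show "dA a \<in> ?Q (Suc 0)" if a: "a \<in> GA 0" for a
    proof -
      have "S (pure k B A b (dA a)) \<in> ?H (Suc 0) p" if b: "b \<in> GB p" for b p
        unfolding S_d_right'[OF B.G_closed[OF b] A.G_closed[OF a]]
        by (rule tensor_map_span[OF mod_A mod_B mod_A mod_B A.d_linear B.e_linear A.d_G B.e_G GA_sub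
            GB_sub GA_sub GB_sub S_bidegree_0[OF b a]])
      then show ?thesis using A.d_G[OF a] unfolding Q by simp
    qed
    fix q r a a' assume a: "a \<in> ?Q q" and a': "a' \<in> ?Q r"
    then have cl: "a \<in> carrier A" "a' \<in> carrier A" using A.G_closed by blast+
    have "S (pure k B A b (a \<otimes>\<^bsub>A\<^esub> a')) \<in> ?H (q + r) p" if b: "b \<in> GB p" for b p
      unfolding twist_mult_right[OF B.G_closed[OF b] cl]
    proof (rule lift_tensor_span[OF mod_A mod_B mod_T _ H _ GA_sub GB_sub])
      note ints = cl B.G_closed[OF b] linear_intros
      show "S (pure k B A b a) \<in> ?H q p" using a b unfolding Q by blast
      show "bilinear k A B (tensor k A B) (\<lambda>x y. tensor_lift k (tensor k A B) (\<lambda>u v.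
        pure k A B (x \<otimes>\<^bsub>A\<^esub> u) v) (S (pure k B A y a')))" by (rule ints | assumption)+
      fix x y assume x: "x \<in> GA q" and y: "y \<in> GB p"
      show "tensor_lift k (tensor k A B) (\<lambda>u v. pure k A B (x \<otimes>\<^bsub>A\<^esub> u) v) (S (pure k B A y a')) \<in> ?H
          (q + r) p"
      proof (rule lift_tensor_span[OF mod_A mod_B mod_T _ H _ GA_sub GB_sub])
        show "S (pure k B A y a') \<in> ?H r p" using a' y unfolding Q by blast
        show "bilinear k A B (tensor k A B) (\<lambda>u v. pure k A B (x \<otimes>\<^bsub>A\<^esub> u) v)"
          by (rule linear_intros A.G_closed[OF x] | assumption)+
        show "pure k A B (x \<otimes>\<^bsub>A\<^esub> u) v \<in> ?H (q + r) p" if "u \<in> GA r" "v \<in> GB p" for u v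
          by (rule tensor_span_pure[OF mod_A mod_B A.mult_G[OF x that(1)] that(2)])
      qed
    qed
    then show "a \<otimes>\<^bsub>A\<^esub> a' \<in> ?Q (q + r)" using a a' A.mult_G unfolding Q by blast
  qed
  with assms(1) show ?thesis unfolding Q by blast
qed

end

sublocale generated_twist \<subseteq> dga_twist k A GA \<pi>A dA eA B GB \<pi>B dB eB S
  by (intro dga_twist.intro dga_twist_axioms.intro unital_twist.intro unital_twist_axioms.intro)
    (rule A.dga_axioms B.dga_axioms twist_axioms S_one_left S_one_right S_bidegree S_d_left
        S_d_right; assumption?)+

section \<open>Transport of the hexagon equation along linear maps\<close>

lemma hexL_map:
  assumes "triple_twist k A B C R1 R2 R3" and "triple_twist k A' B' C' S1 S2 S3"
    and i1: "intertwines k A B A' B' R1 S1 \<beta>\<^sub>0 \<alpha>\<^sub>0 \<alpha>\<^sub>1 \<beta>\<^sub>1"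
    and i3: "intertwines k A C A' C' R3 S3 \<gamma>\<^sub>0 \<alpha>\<^sub>1 \<alpha>\<^sub>2 \<gamma>\<^sub>1"
    and i2: "intertwines k B C B' C' R2 S2 \<gamma>\<^sub>1 \<beta>\<^sub>1 \<beta>\<^sub>2 \<gamma>\<^sub>2"
    and \<alpha>: "linear_map k A A' \<alpha>\<^sub>0" "linear_map k A A' \<alpha>\<^sub>1" "linear_map k A A' \<alpha>\<^sub>2"
    and \<beta>: "linear_map k B B' \<beta>\<^sub>0" "linear_map k B B' \<beta>\<^sub>1" "linear_map k B B' \<beta>\<^sub>2"
    and \<gamma>: "linear_map k C C' \<gamma>\<^sub>0" "linear_map k C C' \<gamma>\<^sub>1" "linear_map k C C' \<gamma>\<^sub>2"
    and g: "trilinear k A' B' C' P g" and P: "module k P"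
    and abc: "c \<in> carrier C" "b \<in> carrier B" "a \<in> carrier A"
  shows "triple_twist.hexL k A' B' C' S1 S2 S3 P g (\<gamma>\<^sub>0 c) (\<beta>\<^sub>0 b) (\<alpha>\<^sub>0 a) =
    triple_twist.hexL k A B C R1 R2 R3 P (\<lambda>x y z. g (\<alpha>\<^sub>2 x) (\<beta>\<^sub>2 y) (\<gamma>\<^sub>2 z)) c b a"
proof -
  interpret R: triple_twist k A B C R1 R2 R3 by fact
  interpret S: triple_twist k A' B' C' S1 S2 S3 by fact
  note cl = \<alpha>[THEN linear_mapD(1)] \<beta>[THEN linear_mapD(1)] \<gamma>[THEN linear_mapD(1)]
    \<alpha>[THEN linear_map_comp] \<beta>[THEN linear_map_comp] \<gamma>[THEN linear_map_comp]
  note ints = abc cl \<alpha> \<beta> \<gamma> trilinear_linear[OF g] P linear_intros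
  have "S.hexL P g (\<gamma>\<^sub>0 c) (\<beta>\<^sub>0 b) (\<alpha>\<^sub>0 a) = R.l1 P b a (\<lambda>x b1. S.l3 P (\<gamma>\<^sub>0 c) (\<alpha>\<^sub>1 x) (\<lambda>x1 c1. S.l2
      P c1 (\<beta>\<^sub>1 b1) (\<lambda>b2 c2. g x1 b2 c2)))"
    unfolding S.hexL_def
    by (rule lift_intertwines[OF i1 R.ab.twist_axioms S.ab.twist_axioms \<alpha>(2) \<beta>(2)]) (rule ints |
        assumption)+
  also have "\<dots> = R.l1 P b a (\<lambda>x b1. R.l3 P c x (\<lambda>x1 c1. S.l2 P (\<gamma>\<^sub>1 c1) (\<beta>\<^sub>1 b1) (\<lambda>b2 c2. g (\<alpha>\<^sub>2 x1)
      b2 c2)))"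
    by (rule lift_cong, (rule ints | assumption)+,
        rule lift_intertwines[OF i3 R.ac.twist_axioms S.ac.twist_axioms \<alpha>(3) \<gamma>(2)],
            (rule ints | assumption)+)
  also have "\<dots> = R.hexL P (\<lambda>x y z. g (\<alpha>\<^sub>2 x) (\<beta>\<^sub>2 y) (\<gamma>\<^sub>2 z)) c b a"
    unfolding R.hexL_def
    by (rule lift_cong, (rule ints | assumption)+, rule lift_cong, (rule ints | assumption)+,
        rule lift_intertwines[OF i2 R.bc.twist_axioms S.bc.twist_axioms \<beta>(3) \<gamma>(3)],
            (rule ints | assumption)+)
  finally show ?thesis .
qed

lemma hexR_map:
  assumes "triple_twist k A B C R1 R2 R3" and "triple_twist k A' B' C' S1 S2 S3"
    and i2: "intertwines k B C B' C' R2 S2 \<gamma>\<^sub>0 \<beta>\<^sub>0 \<beta>\<^sub>1 \<gamma>\<^sub>1"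
    and i3: "intertwines k A C A' C' R3 S3 \<gamma>\<^sub>1 \<alpha>\<^sub>0 \<alpha>\<^sub>1 \<gamma>\<^sub>2"
    and i1: "intertwines k A B A' B' R1 S1 \<beta>\<^sub>1 \<alpha>\<^sub>1 \<alpha>\<^sub>2 \<beta>\<^sub>2"
    and \<alpha>: "linear_map k A A' \<alpha>\<^sub>0" "linear_map k A A' \<alpha>\<^sub>1" "linear_map k A A' \<alpha>\<^sub>2"
    and \<beta>: "linear_map k B B' \<beta>\<^sub>0" "linear_map k B B' \<beta>\<^sub>1" "linear_map k B B' \<beta>\<^sub>2"
    and \<gamma>: "linear_map k C C' \<gamma>\<^sub>0" "linear_map k C C' \<gamma>\<^sub>1" "linear_map k C C' \<gamma>\<^sub>2"
    and g: "trilinear k A' B' C' P g" and P: "module k P"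
    and abc: "c \<in> carrier C" "b \<in> carrier B" "a \<in> carrier A"
  shows "triple_twist.hexR k A' B' C' S1 S2 S3 P g (\<gamma>\<^sub>0 c) (\<beta>\<^sub>0 b) (\<alpha>\<^sub>0 a) =
    triple_twist.hexR k A B C R1 R2 R3 P (\<lambda>x y z. g (\<alpha>\<^sub>2 x) (\<beta>\<^sub>2 y) (\<gamma>\<^sub>2 z)) c b a"
proof -
  interpret R: triple_twist k A B C R1 R2 R3 by fact
  interpret S: triple_twist k A' B' C' S1 S2 S3 by fact
  note cl = \<alpha>[THEN linear_mapD(1)] \<beta>[THEN linear_mapD(1)] \<gamma>[THEN linear_mapD(1)]
    \<alpha>[THEN linear_map_comp] \<beta>[THEN linear_map_comp] \<gamma>[THEN linear_map_comp]
  note ints = abc cl \<alpha> \<beta> \<gamma> trilinear_linear[OF g] P linear_intros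
  have "S.hexR P g (\<gamma>\<^sub>0 c) (\<beta>\<^sub>0 b) (\<alpha>\<^sub>0 a) = R.l2 P c b (\<lambda>b1 c1. S.l3 P (\<gamma>\<^sub>1 c1) (\<alpha>\<^sub>0 a) (\<lambda>x c2.
      S.l1 P (\<beta>\<^sub>1 b1) x (\<lambda>x1 b2. g x1 b2 c2)))"
    unfolding S.hexR_def
    by (rule lift_intertwines[OF i2 R.bc.twist_axioms S.bc.twist_axioms \<beta>(2) \<gamma>(2)]) (rule ints |
        assumption)+
  also have "\<dots> = R.l2 P c b (\<lambda>b1 c1. R.l3 P c1 a (\<lambda>x c2. S.l1 P (\<beta>\<^sub>1 b1) (\<alpha>\<^sub>1 x) (\<lambda>x1 b2. g x1 b2
      (\<gamma>\<^sub>2 c2))))"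
    by (rule lift_cong, (rule ints | assumption)+,
        rule lift_intertwines[OF i3 R.ac.twist_axioms S.ac.twist_axioms \<alpha>(2) \<gamma>(3)],
            (rule ints | assumption)+)
  also have "\<dots> = R.hexR P (\<lambda>x y z. g (\<alpha>\<^sub>2 x) (\<beta>\<^sub>2 y) (\<gamma>\<^sub>2 z)) c b a"
    unfolding R.hexR_def
    by (rule lift_cong, (rule ints | assumption)+, rule lift_cong, (rule ints | assumption)+,
        rule lift_intertwines[OF i1 R.ab.twist_axioms S.ab.twist_axioms \<alpha>(3) \<beta>(3)],
            (rule ints | assumption)+)
  finally show ?thesis .
qed

text \<open>The maps on the arguments may change at every twist they cross. The two sides cross the
  twists in opposite orders, so the intermediate maps may differ, as the primes indicate, but the
  final ones have to coincide. The lemma serves both the differentials and the passage from the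
  given maps to the extended ones in degree zero.\<close>

lemma hex_map:
  assumes R: "triple_twist k A B C R1 R2 R3" and S: "triple_twist k A' B' C' S1 S2 S3"
    and "intertwines k A B A' B' R1 S1 \<beta>\<^sub>0 \<alpha>\<^sub>0 \<alpha>\<^sub>1 \<beta>\<^sub>1"
    and "intertwines k A C A' C' R3 S3 \<gamma>\<^sub>0 \<alpha>\<^sub>1 \<alpha>\<^sub>2 \<gamma>\<^sub>1"
    and "intertwines k B C B' C' R2 S2 \<gamma>\<^sub>1 \<beta>\<^sub>1 \<beta>\<^sub>2 \<gamma>\<^sub>2"
    and "intertwines k B C B' C' R2 S2 \<gamma>\<^sub>0 \<beta>\<^sub>0 \<beta>\<^sub>1' \<gamma>\<^sub>1'"
    and "intertwines k A C A' C' R3 S3 \<gamma>\<^sub>1' \<alpha>\<^sub>0 \<alpha>\<^sub>1' \<gamma>\<^sub>2"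
    and "intertwines k A B A' B' R1 S1 \<beta>\<^sub>1' \<alpha>\<^sub>1' \<alpha>\<^sub>2 \<beta>\<^sub>2"
    and \<alpha>: "linear_map k A A' \<alpha>\<^sub>0" "linear_map k A A' \<alpha>\<^sub>1" "linear_map k A A' \<alpha>\<^sub>1'" "linear_map k A
        A' \<alpha>\<^sub>2"
    and \<beta>: "linear_map k B B' \<beta>\<^sub>0" "linear_map k B B' \<beta>\<^sub>1" "linear_map k B B' \<beta>\<^sub>1'" "linear_map k B
        B' \<beta>\<^sub>2"
    and \<gamma>: "linear_map k C C' \<gamma>\<^sub>0" "linear_map k C C' \<gamma>\<^sub>1" "linear_map k C C' \<gamma>\<^sub>1'" "linear_map k C
        C' \<gamma>\<^sub>2"
    and abc: "c \<in> carrier C" "b \<in> carrier B" "a \<in> carrier A"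
    and hex: "triple_twist.hex k A B C R1 R2 R3 c b a"
  shows "triple_twist.hex k A' B' C' S1 S2 S3 (\<gamma>\<^sub>0 c) (\<beta>\<^sub>0 b) (\<alpha>\<^sub>0 a)"
proof -
  interpret R: triple_twist k A B C R1 R2 R3 by fact
  interpret S: triple_twist k A' B' C' S1 S2 S3 by fact
  note cl = \<alpha>[THEN linear_mapD(1)] \<beta>[THEN linear_mapD(1)] \<gamma>[THEN linear_mapD(1)]
  have g: "trilinear k A' B' C' S.U S.pureU" by (rule trilinearI linear_intros | assumption)+
  have g': "trilinear k A B C S.U (\<lambda>x y z. S.pureU (\<alpha>\<^sub>2 x) (\<beta>\<^sub>2 y) (\<gamma>\<^sub>2 z))"
    by (rule trilinearI cl \<alpha>(4) \<beta>(4) \<gamma>(4) linear_intros | assumption)+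
  show ?thesis
    unfolding S.hex_def
      hexL_map[OF assms(1-5) \<alpha>(1,2,4) \<beta>(1,2,4) \<gamma>(1,2,4) g S.mod_U abc]
      hexR_map[OF assms(1,2,6-8) \<alpha>(1,3,4) \<beta>(1,3,4) \<gamma>(1,3,4) g S.mod_U abc]
    by (rule R.hex_lift[OF hex g' S.mod_U abc])
qed

section \<open>The hexagon equation for three generated differential graded algebras\<close>

locale dga_triple =
  ab: dga_twist k A GA \<pi>A dA eA B GB \<pi>B dB eB S1 +
  bc: dga_twist k B GB \<pi>B dB eB C GC \<pi>C dC eC S2 +
  ac: dga_twist k A GA \<pi>A dA eA C GC \<pi>C dC eC S3 + triple_twist k A B C S1 S2 S3
  for k :: "'k ring" and A :: "('k, 'a) module" and GA \<pi>A dA eA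
    and B :: "('k, 'b) module" and GB \<pi>B dB eB
    and C :: "('k, 'c) module" and GC \<pi>C dC eC and S1 S2 S3
begin

lemmas lins = ab.dga_intros bc.dga_intros linear_intros

text \<open>Both sides end with \<open>dA\<close>, \<open>eB\<close> and \<open>eC\<close> on the
  three components. On the left the two signs arise before \<open>S2\<close> acts, so they have to
  pass through it together.\<close>

lemma hex_dA:
  assumes "c \<in> carrier C" and "b \<in> carrier B" and "a \<in> carrier A" and "hex c b a"
  shows "hex c b (dA a)"
proof -
  have "hex (id c) (id b) (dA a)"
    by (rule hex_map[OF triple_twist_axioms triple_twist_axioms ab.S_d_right ac.S_d_right
        bc.S_e_both
          bc.S_id ac.S_d_right ab.S_d_right]) (rule linear_map_id' lins assms)+
  then show ?thesis by simp
qed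

text \<open>A differential on the middle argument leaves a sign on each outer one: both sides end
  with \<open>eA\<close>, \<open>dB\<close> and \<open>eC\<close>. On the left \<open>eA\<close>
  crosses \<open>S3\<close> by itself, on the right \<open>eC\<close> does, which calls for the
  one-sided sign rules.\<close>

lemma hex_dB:
  assumes "c \<in> carrier C" and "b \<in> carrier B" and "a \<in> carrier A" and "hex c b a"
  shows "hex c (dB b) a"
proof -
  have "hex (id c) (dB b) (id a)"
    by (rule hex_map[OF triple_twist_axioms triple_twist_axioms ab.S_d_left ac.S_e_right
        bc.S_d_right
          bc.S_d_right ac.S_e_left ab.S_d_left]) (rule linear_map_id' lins assms)+
  then show ?thesis by simp
qed

lemma hex_dC:
  assumes "c \<in> carrier C" and "b \<in> carrier B" and "a \<in> carrier A" and "hex c b a"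
  shows "hex (dC c) b a"
proof -
  have "hex (dC c) (id b) (id a)"
    by (rule hex_map[OF triple_twist_axioms triple_twist_axioms ab.S_id ac.S_d_left bc.S_d_left
          bc.S_d_left ac.S_d_left ab.S_e_both]) (rule linear_map_id' lins assms)+
  then show ?thesis by simp
qed

lemma hex_submodule_A: "c \<in> carrier C \<Longrightarrow> b \<in> carrier B \<Longrightarrow> submodule {a \<in> carrier A. hex c b a} k A"
  unfolding hex_def hexL_def hexR_def
  by (rule submodule_equalizer[OF ab.mod_A mod_U]) (rule linear_intros | assumption)+

lemma hex_submodule_B: "c \<in> carrier C \<Longrightarrow> a \<in> carrier A \<Longrightarrow> submodule {b \<in> carrier B. hex c b a} k B"
  unfolding hex_def hexL_def hexR_def
  by (rule submodule_equalizer[OF ab.mod_B mod_U]) (rule linear_intros | assumption)+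

lemma hex_submodule_C: "b \<in> carrier B \<Longrightarrow> a \<in> carrier A \<Longrightarrow> submodule {c \<in> carrier C. hex c b a} k C"
  unfolding hex_def hexL_def hexR_def
  by (rule submodule_equalizer[OF bc.mod_B mod_U]) (rule linear_intros | assumption)+

text \<open>The set of arguments satisfying the hexagon equation is closed under the differentials and,
  one argument at a time, under products.  So the three arguments are freed successively.\<close>

lemma hex_generated:
  assumes A: "generated_dga k A GA \<pi>A dA eA" and B: "generated_dga k B GB \<pi>B dB eB"
    and C: "generated_dga k C GC \<pi>C dC eC"
    and hex_0: "\<And>c b a. \<lbrakk>c \<in> GC 0; b \<in> GB 0; a \<in> GA 0\<rbrakk> \<Longrightarrow> hex c b a"
    and abc: "c \<in> carrier C" "b \<in> carrier B" "a \<in> carrier A"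
  shows "hex c b a"
proof -
  interpret A: generated_dga k A GA \<pi>A dA eA by fact
  interpret B: generated_dga k B GB \<pi>B dB eB by fact
  interpret C: generated_dga k C GC \<pi>C dC eC by fact
  note mult = ab.A bc.A bc.B mult_closed
  \<comment> \<open>With \<open>b\<close> and \<open>c\<close> of degree zero, \<open>S_span\<close>
    keeps the components that replace them in degree zero, so the condition \<open>?Q\<close>
    reproduces itself under products.\<close>
  have hex_A: "hex c b a" if c: "c \<in> GC 0" and b: "b \<in> GB 0" and a: "a \<in> carrier A" for c b a
  proof -
    let ?Q = "{a \<in> carrier A. \<forall>i\<in>GC 0 \<times> GB 0. hex (fst i) (snd i) a}"
    have Q: "a \<in> ?Q \<longleftrightarrow> a \<in> carrier A \<and> (\<forall>c\<in>GC 0. \<forall>b\<in>GB 0. hex c b a)" for a by auto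
    have "a \<in> ?Q"
    proof (rule A.generated_carrier[OF submodule_Collect_ball[OF ab.mod_A hex_submodule_A] _ _ _ a])
      show "a \<in> ?Q" if "a \<in> GA 0" for a using hex_0 that ab.A.G_closed unfolding Q by blast
      show "dA a \<in> ?Q" if "a \<in> GA 0" for a
        using hex_0 hex_dA that ab.A.G_closed ab.B.G_closed bc.B.G_closed ab.A.d_closed unfolding Q
            by blast
      fix a a' assume a: "a \<in> ?Q" and a': "a' \<in> ?Q"
      have "hex c b (a \<otimes>\<^bsub>A\<^esub> a')" if c: "c \<in> GC 0" and b: "b \<in> GB 0" for c b
        by (rule hex_mult_A[OF bc.B.G_closed[OF c] ab.B.G_closed[OF b] _ _ ac.GB_sub ab.GB_sub
            ab.S_span[OF b] ac.S_span[OF c]])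
          (use a a' b c in \<open>unfold Q, blast+\<close>)
      then show "a \<otimes>\<^bsub>A\<^esub> a' \<in> ?Q" using a a' mult(4)[OF mult(1)] unfolding Q by blast
    qed (use ab.B.G_closed bc.B.G_closed in auto)
    then show ?thesis using c b unfolding Q by blast
  qed
  \<comment> \<open>In a product of elements of \<open>B\<close> the argument \<open>a\<close> is
    replaced by arbitrary elements, for which \<open>hex_A\<close> has prepared the ground, while
    the components of \<open>C\<close> stay in degree zero.\<close>
  have hex_B: "hex c b a" if c: "c \<in> GC 0" and b: "b \<in> carrier B" and a: "a \<in> carrier A" for c b a
  proof -
    let ?Q = "{b \<in> carrier B. \<forall>i\<in>GC 0 \<times> carrier A. hex (fst i) b (snd i)}"
    have Q: "b \<in> ?Q \<longleftrightarrow> b \<in> carrier B \<and> (\<forall>c\<in>GC 0. \<forall>a\<in>carrier A. hex c b a)" for b by auto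
    have "b \<in> ?Q"
    proof (rule B.generated_carrier[OF submodule_Collect_ball[OF ab.mod_B hex_submodule_B] _ _ _ b])
      show "b \<in> ?Q" if "b \<in> GB 0" for b using hex_A that ab.B.G_closed unfolding Q by blast
      show "dB b \<in> ?Q" if "b \<in> GB 0" for b
        using hex_A hex_dB that ab.B.G_closed bc.B.G_closed ab.B.d_closed unfolding Q by blast
      fix b b' assume b: "b \<in> ?Q" and b': "b' \<in> ?Q"
      have "hex c (b \<otimes>\<^bsub>B\<^esub> b') a" if c: "c \<in> GC 0" and a: "a \<in> carrier A" for c a
        by (rule hex_mult_B[OF bc.B.G_closed[OF c] _ _ a ac.GB_sub bc.S_span[OF c]])
          (use a b b' c in \<open>unfold Q, blast+\<close>)
      then show "b \<otimes>\<^bsub>B\<^esub> b' \<in> ?Q" using b b' mult(4)[OF mult(2)] unfolding Q by blast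
    qed (use bc.B.G_closed in auto)
    then show ?thesis using c a unfolding Q by blast
  qed
  let ?Q = "{c \<in> carrier C. \<forall>i\<in>carrier B \<times> carrier A. hex c (fst i) (snd i)}"
  have Q: "c \<in> ?Q \<longleftrightarrow> c \<in> carrier C \<and> (\<forall>b\<in>carrier B. \<forall>a\<in>carrier A. hex c b a)" for c by auto
  have "c \<in> ?Q"
  proof (rule C.generated_carrier[OF submodule_Collect_ball[OF bc.mod_B hex_submodule_C]
      _ _ _ abc(1)])
    show "c \<in> ?Q" if "c \<in> GC 0" for c using hex_B that bc.B.G_closed unfolding Q by blast
    show "dC c \<in> ?Q" if "c \<in> GC 0" for c
      using hex_B hex_dC that bc.B.G_closed bc.B.d_closed unfolding Q by blast
    fix c c' assume c: "c \<in> ?Q" and c': "c' \<in> ?Q"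
    have "hex (c \<otimes>\<^bsub>C\<^esub> c') b a" if b: "b \<in> carrier B" and a: "a \<in> carrier A" for b a
      by (rule hex_mult_C[OF _ _ b a]) (use a b c c' in \<open>unfold Q, blast+\<close>)
    then show "c \<otimes>\<^bsub>C\<^esub> c' \<in> ?Q" using c c' mult(4)[OF mult(3)] unfolding Q by blast
  qed auto
  with abc show ?thesis unfolding Q by blast
qed

text \<open>Since \<open>T1\<close> moves \<open>c\<close> past \<open>a\<close> and then past
  \<open>b\<close>, each condition is obtained by crossing \<open>S3\<close> and then
  \<open>S2\<close>. For the differential on A \<otimes> B there are two terms: \<open>dA\<close>
  leaves a sign \<open>eC\<close> that must cross \<open>S2\<close>, and in the other term
  \<open>eA\<close> crosses \<open>S3\<close> before \<open>dB\<close> crosses \<open>S2\<close>;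
  both end with \<open>eC\<close> on the third component.\<close>

lemma dga_twist_iterated:
  assumes hex: "\<And>c b a. \<lbrakk>c \<in> carrier C; b \<in> carrier B; a \<in> carrier A\<rbrakk> \<Longrightarrow> hex c b a"
  shows "dga_twist k AB ab.GT ab.\<pi>T ab.dT ab.eT C GC \<pi>C dC eC T1"
proof (intro dga_twist.intro dga_twist_axioms.intro ab.dga_T bc.B.dga_axioms
    unital_twist_iterated[OF ab.unital_twist_axioms bc.unital_twist_axioms ac.unital_twist_axioms
        hex])
  note T1_closed = linear_mapD(1)[OF linear_T1] and T1_comp = linear_map_comp[OF linear_T1]
  note eT_comp = linear_map_comp[OF ab.eT_linear] and dT_comp = linear_map_comp[OF ab.dT_linear]
  note ints0 = T1_closed T1_comp eT_comp dT_comp ab.eT_linear ab.dT_linear lins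
  have sub: "ab.GT q \<subseteq> carrier (tensor k A B)" for q using ab.GT_closed by blast
  show "T1 (pure k C AB c w) \<in> tensor_span k AB C (ab.GT q) (GC p)" if c: "c \<in> GC p" and w: "w \<in>
      ab.GT q" for c w p q
  proof -
    let ?H = "tensor_span k (tensor k A B) C (ab.GT q) (GC p)"
    note H = tensor_span_submodule[OF ab.mod_T bc.mod_B sub ac.GB_sub]
    have c': "c \<in> carrier C" by (rule bc.B.G_closed[OF c])
    have "w \<in> {w \<in> carrier (tensor k A B). T1 (pure k C (tensor k A B) c w) \<in> ?H}"
    proof (rule ab.GT_minimal[OF submodule_vimage[OF ab.mod_T mod_V _ H] _ w])
      show "linear_map k (tensor k A B) V (\<lambda>w. T1 (pure k C (tensor k A B) c w))" by (rule ints0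
          c')+
      fix a b r s assume *: "a \<in> GA r" "b \<in> GB s" "r + s = q"
      note cl = ab.A.G_closed[OF *(1)] ab.B.G_closed[OF *(2)]
      have "T1 (pure k C (tensor k A B) c (pure k A B a b)) \<in> ?H"
        unfolding T1_pure[OF c' cl]
      proof (rule lift_tensor_span[OF ac.mod_A ac.mod_B mod_V _ H _ ac.GA_sub ac.GB_sub ac.S_G[OF c
          *(1)]])
        fix a1 c1 assume 1: "a1 \<in> GA r" "c1 \<in> GC p"
        show "l2 V c1 b (\<lambda>b1 c2. pureV a1 b1 c2) \<in> ?H"
        proof (rule lift_tensor_span[OF bc.mod_A bc.mod_B mod_V _ H _ bc.GA_sub bc.GB_sub bc.S_G[OF
            1(2) *(2)]])
          show "pureV a1 b1 c2 \<in> ?H" if "b1 \<in> GB s" "c2 \<in> GC p" for b1 c2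
            by (rule tensor_span_pure[OF ab.mod_T bc.mod_B ab.GT_pure[OF 1(1) that(1) *(3)]
                that(2)])
        qed (rule ints0 ab.A.G_closed[OF 1(1)] | assumption)+
      qed (rule ints0 cl | assumption)+
      then show "pure k A B a b \<in> {w \<in> carrier (tensor k A B). T1 (pure k C (tensor k A B) c w) \<in>
          ?H}"
        using pure_closed[OF ab.mod_A ab.mod_B cl] by simp
    qed
    then show ?thesis by simp
  qed
  show "intertwines k AB C AB C T1 T1 dC id ab.eT dC"
    unfolding intertwines_def twisted_tensor_simps pure_twisted_tensor tensor_map_twisted_tensor
        id_apply
  proof (intro ballI)
    fix c w assume c: "c \<in> carrier C" and w: "w \<in> carrier (tensor k A B)"
    let ?h = "tensor_map k (tensor k A B) C ab.eT dC"
    have h: "linear_map k V V ?h" by (rule ints0)+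
    note ints = c h linear_map_comp[OF h] ints0
    show "T1 (pure k C (tensor k A B) (dC c) w) = ?h (T1 (pure k C (tensor k A B) c w))"
    proof (rule tensor_ext[OF ab.mod_A ab.mod_B mod_V _ _ _ w])
      fix a b assume a: "a \<in> carrier A" and b: "b \<in> carrier B"
      note ints = a b ints
      have "T1 (pure k C (tensor k A B) (dC c) (pure k A B a b)) = l3 V (dC c) a (\<lambda>a1 c1. l2 V c1 b
          (\<lambda>b1 c2. pureV a1 b1 c2))"
        by (rule T1_pure) (rule ints)+
      also have "\<dots> = l3 V c a (\<lambda>a1 c1. l2 V (dC c1) b (\<lambda>b1 c2. pureV (eA a1) b1 c2))"
        by (rule ac.lift_d_left) (rule ints | assumption)+
      also have "\<dots> = l3 V c a (\<lambda>a1 c1. l2 V c1 b (\<lambda>b1 c2. pureV (eA a1) (eB b1) (dC c2)))"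
        by (rule lift_cong, (rule ints | assumption)+, rule bc.lift_d_left,
            (rule ints | assumption)+)
      also have "\<dots> = ?h (T1 (pure k C (tensor k A B) c (pure k A B a b)))"
        unfolding T1_pure[OF c a b]
        by (rule sym, rule lift_push[where h = ?h], (rule ints | assumption)+,
            rule lift_push[where h = ?h], (rule ints | assumption)+,
            subst tensor_map_pure, (rule ints | assumption)+,
                subst ab.eT_pure, (assumption | rule refl)+)
      finally show "T1 (pure k C (tensor k A B) (dC c) (pure k A B a b)) = \<dots>" .
    qed (rule ints | assumption)+
  qed
  show "intertwines k AB C AB C T1 T1 id ab.dT ab.dT eC"
    unfolding intertwines_def twisted_tensor_simps pure_twisted_tensor tensor_map_twisted_tensor
        id_apply
  proof (intro ballI)
    fix c w assume c: "c \<in> carrier C" and w: "w \<in> carrier (tensor k A B)"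
    let ?h = "tensor_map k (tensor k A B) C ab.dT eC"
    have h: "linear_map k V V ?h" by (rule ints0)+
    note ints = c h linear_map_comp[OF h] ints0
    show "T1 (pure k C (tensor k A B) c (ab.dT w)) = ?h (T1 (pure k C (tensor k A B) c w))"
    proof (rule tensor_ext[OF ab.mod_A ab.mod_B mod_V _ _ _ w])
      fix a b assume a: "a \<in> carrier A" and b: "b \<in> carrier B"
      note ints = a b ints
      let ?f = "\<lambda>a1 b1 c2. pureV (dA a1) b1 (eC c2)" and ?g = "\<lambda>a1 b1 c2. pureV (eA a1) (dB b1) (eC
          c2)"
      have "T1 (pure k C (tensor k A B) c (pure k A B (dA a) b)) = l3 V c (dA a) (\<lambda>a1 c1. l2 V c1 b
          (\<lambda>b1 c2. pureV a1 b1 c2))"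
        by (rule T1_pure) (rule ints)+
      also have "\<dots> = l3 V c a (\<lambda>a1 c1. l2 V (eC c1) b (\<lambda>b1 c2. pureV (dA a1) b1 c2))"
        by (rule ac.lift_d_right) (rule ints | assumption)+
      also have "\<dots> = l3 V c a (\<lambda>a1 c1. l2 V c1 b (\<lambda>b1 c2. ?f a1 b1 c2))"
        by (rule lift_cong, (rule ints | assumption)+, rule bc.lift_e_left,
            (rule ints | assumption)+)
      finally have f: "T1 (pure k C (tensor k A B) c (pure k A B (dA a) b)) = \<dots>" .
      have "T1 (pure k C (tensor k A B) c (pure k A B (eA a) (dB b))) =
          l3 V c (eA a) (\<lambda>a1 c1. l2 V c1 (dB b) (\<lambda>b1 c2. pureV a1 b1 c2))"
        by (rule T1_pure) (rule ints)+
      also have "\<dots> = l3 V c a (\<lambda>a1 c1. l2 V c1 (dB b) (\<lambda>b1 c2. pureV (eA a1) b1 c2))"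
        by (rule ac.lift_e_right) (rule ints | assumption)+
      also have "\<dots> = l3 V c a (\<lambda>a1 c1. l2 V c1 b (\<lambda>b1 c2. ?g a1 b1 c2))"
        by (rule lift_cong, (rule ints | assumption)+, rule bc.lift_d_right,
            (rule ints | assumption)+)
      finally have g: "T1 (pure k C (tensor k A B) c (pure k A B (eA a) (dB b))) = \<dots>" .
      have "T1 (pure k C (tensor k A B) c (ab.dT (pure k A B a b))) =
          T1 (pure k C (tensor k A B) c (pure k A B (dA a) b)) \<oplus>\<^bsub>V\<^esub> T1 (pure k C (tensor k A B) c
              (pure k A B (eA a) (dB b)))"
        unfolding ab.dT_pure[OF a b]
        by (rule linear_mapD(2)[where f = "\<lambda>w. T1 (pure k C (tensor k A B) c w)"], (rule ints)+)
      also have "\<dots> = l3 V c a (\<lambda>a1 c1. l2 V c1 b (\<lambda>b1 c2. ?f a1 b1 c2) \<oplus>\<^bsub>V\<^esub> l2 V c1 b (\<lambda>b1 c2. ?g a1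
          b1 c2))"
        unfolding f g by (rule lift_add[symmetric]) (rule ints | assumption)+
      also have "\<dots> = ?h (T1 (pure k C (tensor k A B) c (pure k A B a b)))"
        unfolding T1_pure[OF c a b]
      proof (rule sym, rule lift_push[where h = ?h], (rule ints | assumption)+)
        fix a1 c1 assume 1: "a1 \<in> carrier A" "c1 \<in> carrier C"
        have s: "S2 (pure k C B c1 b) \<in> carrier (tensor k B C)" by (rule ints 1)+
        have "?h (l2 V c1 b (\<lambda>b1 c2. pureV a1 b1 c2)) = l2 V c1 b (\<lambda>b1 c2. ?f a1 b1 c2 \<oplus>\<^bsub>V\<^esub> ?g a1 b1
            c2)"
        proof (rule lift_push[where h = ?h], (rule ints 1 | assumption)+)
          fix b1 c2 assume 2: "b1 \<in> carrier B" "c2 \<in> carrier C"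
          have "?h (pureV a1 b1 c2) = pure k (tensor k A B) C (ab.dT (pure k A B a1 b1)) (eC c2)"
            by (rule tensor_map_pure) (rule ints 1 2)+
          also have "\<dots> = ?f a1 b1 c2 \<oplus>\<^bsub>V\<^esub> ?g a1 b1 c2"
            unfolding ab.dT_pure[OF 1(1) 2(1)]
            by (rule linear_mapD(2)[where f = "\<lambda>w. pure k (tensor k A B) C w (eC c2)"],
                (rule ints 1 2)+)
          finally show "?h (pureV a1 b1 c2) = ?f a1 b1 c2 \<oplus>\<^bsub>V\<^esub> ?g a1 b1 c2" .
        qed
        also have "\<dots> = l2 V c1 b (\<lambda>b1 c2. ?f a1 b1 c2) \<oplus>\<^bsub>V\<^esub> l2 V c1 b (\<lambda>b1 c2. ?g a1 b1 c2)"
          by (rule lift_add[OF bc.mod_A bc.mod_B mod_V _ _ s]) (rule ints 1 | assumption)+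
        finally show "?h (l2 V c1 b (\<lambda>b1 c2. pureV a1 b1 c2)) = \<dots>" .
      qed
      finally show "T1 (pure k C (tensor k A B) c (ab.dT (pure k A B a b))) = \<dots>" .
    qed (rule ints | assumption)+
  qed
qed

end

section \<open>Free algebras and quotient algebras\<close>

lemma free_algebra_simps [simp]:
  "carrier (free_algebra k X) = carrier (free_module k (lists X))"
  "zero (free_algebra k X) = zero (free_module k (lists X))"
  "add (free_algebra k X) = add (free_module k (lists X))"
  "smult (free_algebra k X) = smult (free_module k (lists X))"
  "one (free_algebra k X) = basis k []"
  by (simp_all add: free_algebra_def)

lemma free_algebra_mult:
  "(f \<otimes>\<^bsub>free_algebra k X\<^esub> g) w = (\<Oplus>\<^bsub>k\<^esub>i\<in>{..length w}. f (take i w) \<otimes>\<^bsub>k\<^esub> g (drop i w))"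
  by (simp add: free_algebra_def)

lemma linear_map_free_algebra [simp]:
  "linear_map k (free_algebra k X) N f \<longleftrightarrow> linear_map k (free_module k (lists X)) N f"
  "linear_map k N (free_algebra k X) g \<longleftrightarrow> linear_map k N (free_module k (lists X)) g"
  by (simp_all add: linear_map_def)

lemma module_equal_fields:
  assumes "carrier M = carrier N" and "add M = add N" and "zero M = zero N" and "smult M = smult N"
    and "module k M"
  shows "module k N"
proof -
  interpret M: module k M by fact
  note eq = assms(1-4)[symmetric]
  show ?thesis
  proof (rule moduleI)
    show "abelian_group N"
      by (rule abelian_groupI) (auto simp: eq M.a_ac intro: M.l_neg)
  qed (use M.R.cring_axioms in \<open>auto simp: eq M.smult_l_distr M.smult_r_distr M.smult_assoc1\<close>)
qed

text \<open>Distributivity and both scalar laws are contained in bilinearity, the form in which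
  products are obtained here for free algebras and quotients.\<close>

lemma unital_algebraI_bilinear:
  assumes M: "module k M" and mult: "bilinear k M M M (\<lambda>x y. x \<otimes>\<^bsub>M\<^esub> y)"
    and one: "\<one>\<^bsub>M\<^esub> \<in> carrier M" "\<And>x. x \<in> carrier M \<Longrightarrow> \<one>\<^bsub>M\<^esub> \<otimes>\<^bsub>M\<^esub> x = x" "\<And>x. x \<in> carrier M \<Longrightarrow>
        x \<otimes>\<^bsub>M\<^esub> \<one>\<^bsub>M\<^esub> = x"
    and assoc: "\<And>x y z. \<lbrakk>x \<in> carrier M; y \<in> carrier M; z \<in> carrier M\<rbrakk> \<Longrightarrow>
      (x \<otimes>\<^bsub>M\<^esub> y) \<otimes>\<^bsub>M\<^esub> z = x \<otimes>\<^bsub>M\<^esub> (y \<otimes>\<^bsub>M\<^esub> z)"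
  shows "unital_algebra k M"
proof -
  interpret M: module k M by fact
  note D = bilinearD(1,2)[OF mult, THEN linear_mapD(2)] bilinearD(1,2)[OF mult, THEN linear_mapD(3)]
  have "ring M"
  proof (rule ringI)
    show "Group.monoid M"
      by (rule monoidI) (use one assoc bilinearD(3)[OF mult] in auto)
  qed (use D M.abelian_group_axioms in auto)
  then show ?thesis
    by (intro unital_algebra.intro unital_algebra_axioms.intro M) (use D in auto)
qed

context
  fixes k :: "'k ring" and X :: "'x set"
  assumes k: "cring k"
begin

interpretation k: cring k by (rule k)

private abbreviation "FA \<equiv> free_algebra k X"

private lemma F_mod: "module k (free_module k (lists X))"
  by (rule module_free_module[OF k])

lemma module_free_algebra: "module k FA"
  by (rule module_equal_fields[OF _ _ _ _ F_mod]) simp_all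

private lemma val: "f \<in> carrier FA \<Longrightarrow> f w \<in> carrier k"
  by (simp add: free_module_simps)

lemma free_algebra_mult_closed:
  assumes f: "f \<in> carrier FA" and g: "g \<in> carrier FA"
  shows "f \<otimes>\<^bsub>FA\<^esub> g \<in> carrier FA"
proof -
  \<comment> \<open>The concatenations of words from the two supports. A word outside this finite
    set has a zero factor at every cut, so its coefficient in the product vanishes.\<close>
  let ?S = "(\<lambda>(u, v). u @ v) ` ({u. f u \<noteq> \<zero>\<^bsub>k\<^esub>} \<times> {v. g v \<noteq> \<zero>\<^bsub>k\<^esub>})"
  have 0: "(f \<otimes>\<^bsub>FA\<^esub> g) w = \<zero>\<^bsub>k\<^esub>" if "w \<notin> ?S" for w
    unfolding free_algebra_mult
  proof (rule k.add.finprod_one_eqI)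
    fix i
    have "f (take i w) = \<zero>\<^bsub>k\<^esub> \<or> g (drop i w) = \<zero>\<^bsub>k\<^esub>"
    proof (rule ccontr)
      assume "\<not> ?thesis"
      then have "(take i w, drop i w) \<in> {u. f u \<noteq> \<zero>\<^bsub>k\<^esub>} \<times> {v. g v \<noteq> \<zero>\<^bsub>k\<^esub>}" by simp
      from imageI[OF this, of "\<lambda>(u, v). u @ v"] that show False by simp
    qed
    then show "f (take i w) \<otimes>\<^bsub>k\<^esub> g (drop i w) = \<zero>\<^bsub>k\<^esub>" using val[OF f] val[OF g] by auto
  qed
  have "u \<in> lists X" if "f u \<noteq> \<zero>\<^bsub>k\<^esub>" for u using f that by (auto simp only: free_algebra_simps
      free_module_simps)
  moreover have "v \<in> lists X" if "g v \<noteq> \<zero>\<^bsub>k\<^esub>" for v using g that by (auto simp only: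
      free_algebra_simps free_module_simps)
  ultimately have "u @ v \<in> lists X" if "f u \<noteq> \<zero>\<^bsub>k\<^esub>" "g v \<noteq> \<zero>\<^bsub>k\<^esub>" for u v
    using that unfolding append_in_lists_conv by blast
  note uv = this
  have S: "?S \<subseteq> lists X"
  proof (rule image_subsetI)
    fix p assume "p \<in> {u. f u \<noteq> \<zero>\<^bsub>k\<^esub>} \<times> {v. g v \<noteq> \<zero>\<^bsub>k\<^esub>}"
    then show "(case p of (u, v) \<Rightarrow> u @ v) \<in> lists X" using uv[of "fst p" "snd p"] by (cases p) simp
  qed
  have "(f \<otimes>\<^bsub>FA\<^esub> g) w = \<zero>\<^bsub>k\<^esub>" if "w \<notin> lists X" for w
    by (rule 0) (use S that in blast)
  moreover have "finite {w. (f \<otimes>\<^bsub>FA\<^esub> g) w \<noteq> \<zero>\<^bsub>k\<^esub>}"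
    by (rule finite_subset[of _ ?S]) (use 0 f g in \<open>auto simp: free_module_simps\<close>)
  moreover have "(f \<otimes>\<^bsub>FA\<^esub> g) w \<in> carrier k" for w
    unfolding free_algebra_mult by (rule k.finsum_closed) (use val[OF f] val[OF g] in auto)
  ultimately show ?thesis unfolding free_algebra_simps free_module_simps by blast
qed

lemma bilinear_free_algebra_mult: "bilinear k FA FA FA (\<lambda>f g. f \<otimes>\<^bsub>FA\<^esub> g)"
proof (rule bilinearI; rule linear_mapI)
  show "f \<otimes>\<^bsub>FA\<^esub> g \<in> carrier FA" if "f \<in> carrier FA" "g \<in> carrier FA" for f g
    by (rule free_algebra_mult_closed[OF that])
  show "f \<otimes>\<^bsub>FA\<^esub> g \<in> carrier FA" if "g \<in> carrier FA" "f \<in> carrier FA" for f g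
    by (rule free_algebra_mult_closed[OF that(2,1)])
  fix f g h r assume f: "f \<in> carrier FA" and g: "g \<in> carrier FA"
  note v = val[OF f] val[OF g]
  show "f \<otimes>\<^bsub>FA\<^esub> (g \<oplus>\<^bsub>FA\<^esub> h) = f \<otimes>\<^bsub>FA\<^esub> g \<oplus>\<^bsub>FA\<^esub> f \<otimes>\<^bsub>FA\<^esub> h" if h: "h \<in> carrier FA"
    by (rule ext) (simp add: free_algebra_mult free_module_simps(3) k.r_distr v val[OF h]
        k.finsum_addf Pi_def)
  show "(g \<oplus>\<^bsub>FA\<^esub> h) \<otimes>\<^bsub>FA\<^esub> f = g \<otimes>\<^bsub>FA\<^esub> f \<oplus>\<^bsub>FA\<^esub> h \<otimes>\<^bsub>FA\<^esub> f" if h: "h \<in> carrier FA"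
    by (rule ext) (simp add: free_algebra_mult free_module_simps(3) k.l_distr v val[OF h]
        k.finsum_addf Pi_def)
  assume r: "r \<in> carrier k"
  show "f \<otimes>\<^bsub>FA\<^esub> (r \<odot>\<^bsub>FA\<^esub> g) = r \<odot>\<^bsub>FA\<^esub> (f \<otimes>\<^bsub>FA\<^esub> g)"
    by (rule ext) (simp add: free_algebra_mult free_module_simps(4) v r k.finsum_rdistr Pi_def
        k.m_lcomm)
  show "(r \<odot>\<^bsub>FA\<^esub> g) \<otimes>\<^bsub>FA\<^esub> f = r \<odot>\<^bsub>FA\<^esub> (g \<otimes>\<^bsub>FA\<^esub> f)"
    by (rule ext) (simp add: free_algebra_mult free_module_simps(4) v r k.finsum_rdistr Pi_def
        k.m_assoc)
qed

text \<open>In the sum over all cuts of \<open>w\<close>, the cut after \<open>length u\<close>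
  letters is the only one that can contribute.\<close>

lemma basis_mult: "basis k u \<otimes>\<^bsub>FA\<^esub> basis k v = basis k (u @ v)"
proof
  fix w
  have "(basis k u \<otimes>\<^bsub>FA\<^esub> basis k v) w =
      (\<Oplus>\<^bsub>k\<^esub>i\<in>{..length w}. if length u = i then basis k (u @ v) w else \<zero>\<^bsub>k\<^esub>)"
    unfolding free_algebra_mult
  proof (rule k.finsum_cong')
    fix i assume i: "i \<in> {..length w}"
    have "take i w = u \<and> drop i w = v \<longleftrightarrow> length u = i \<and> w = u @ v"
      using i by (metis append_eq_conv_conj append_take_drop_id atMost_iff length_take min.absorb2)
    then show "basis k u (take i w) \<otimes>\<^bsub>k\<^esub> basis k v (drop i w) = (if length u =
        i then basis k (u @ v) w else \<zero>\<^bsub>k\<^esub>)"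
      unfolding basis_def by (cases "take i w = u"; cases "drop i w = v") auto
  qed (auto simp: basis_def)
  also have "\<dots> = basis k (u @ v) w"
  proof (cases "length u \<le> length w")
    case True
    then show ?thesis by (intro k.add.finprod_singleton) (auto simp: basis_def)
  next
    case False
    then show ?thesis by (auto intro!: k.add.finprod_one_eqI simp: basis_def)
  qed
  finally show "(basis k u \<otimes>\<^bsub>FA\<^esub> basis k v) w = basis k (u @ v) w" .
qed

lemma free_algebra_ext:
  assumes "module k P" and "linear_map k FA P f" and "linear_map k FA P g"
    and "\<And>w. w \<in> lists X \<Longrightarrow> f (basis k w) = g (basis k w)" and "c \<in> carrier FA"
  shows "f c = g c"
  using free_module_ext[OF assms(1), of "lists X" f g c] assms(2-5) by simp

lemma basis_word_closed: "w \<in> lists X \<Longrightarrow> basis k w \<in> carrier FA"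
  using basis_closed[OF k] by simp

lemma unital_algebra_free_algebra: "unital_algebra k FA"
proof (rule unital_algebraI_bilinear[OF module_free_algebra bilinear_free_algebra_mult])
  note M = module_free_algebra
  note bil = linear_map_bilinear[OF bilinear_free_algebra_mult] linear_map_bilinear'[OF
      bilinear_free_algebra_mult]
  note ints = bil linear_map_id free_algebra_mult_closed basis_word_closed
  show one: "\<one>\<^bsub>FA\<^esub> \<in> carrier FA" using basis_word_closed[of "[]"] by simp
  show "\<one>\<^bsub>FA\<^esub> \<otimes>\<^bsub>FA\<^esub> f = f" if "f \<in> carrier FA" for f
    by (rule free_algebra_ext[OF M _ _ _ that], (rule ints one)+) (simp add: basis_mult)
  show "f \<otimes>\<^bsub>FA\<^esub> \<one>\<^bsub>FA\<^esub> = f" if "f \<in> carrier FA" for f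
    by (rule free_algebra_ext[OF M _ _ _ that], (rule ints one)+) (simp add: basis_mult)
  show "(f \<otimes>\<^bsub>FA\<^esub> g) \<otimes>\<^bsub>FA\<^esub> h = f \<otimes>\<^bsub>FA\<^esub> (g \<otimes>\<^bsub>FA\<^esub> h)" if f: "f \<in> carrier FA" and g: "g \<in> carrier FA"
      and h: "h \<in> carrier FA" for f g h
    by (rule free_algebra_ext[OF M _ _ _ f], (rule ints g h)+, rule free_algebra_ext[OF M _ _ _ g],
        (rule ints h | assumption)+,
        rule free_algebra_ext[OF M _ _ _ h], (rule ints | assumption)+) (simp add: basis_mult)
qed

end

section \<open>Quotients by a two-sided ideal\<close>

context
  fixes k :: "'k ring" and M :: "('k, 'a) module" and I
  assumes M: "unital_algebra k M" and I: "ideal I M"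
begin

interpretation M: unital_algebra k M by (rule M)
interpretation I: ideal I M by (rule I)

text \<open>A scalar acts as multiplication by the corresponding multiple of the unit, and an ideal
  absorbs such multiplications.\<close>

lemma ideal_submodule: "submodule I k M"
proof (rule submoduleI')
  show "module k M" by (rule M.module_axioms)
  show "r \<odot>\<^bsub>M\<^esub> x \<in> I" if "r \<in> carrier k" "x \<in> I" for r x
  proof -
    have "x \<in> carrier M" using that(2) I.a_subset by blast
    then have "r \<odot>\<^bsub>M\<^esub> x = (r \<odot>\<^bsub>M\<^esub> \<one>\<^bsub>M\<^esub>) \<otimes>\<^bsub>M\<^esub> x" using that(1) by (simp add: M.smult_mult_left)
    then show ?thesis using that by (simp add: I.I_l_closed)
  qed
qed (use I.a_subset in auto)

lemma quotient_mult:
  assumes "x \<in> carrier M" and "y \<in> carrier M"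
  shows "(I +>\<^bsub>M\<^esub> x) \<otimes>\<^bsub>quotient_algebra M I\<^esub> (I +>\<^bsub>M\<^esub> y) = I +>\<^bsub>M\<^esub> (x \<otimes>\<^bsub>M\<^esub> y)"
  using I.rcoset_mult_add[OF assms] by (simp add: quotient_algebra_def FactRing_def)

lemma quotient_one: "\<one>\<^bsub>quotient_algebra M I\<^esub> = I +>\<^bsub>M\<^esub> \<one>\<^bsub>M\<^esub>"
  by (simp add: quotient_algebra_def FactRing_def)

lemma unital_algebra_quotient: "unital_algebra k (quotient_algebra M I)"
proof (rule unital_algebraI_bilinear)
  note Q = quotient_carrier[OF M.module_axioms ideal_submodule] quotient_add[OF M.module_axioms
      ideal_submodule]
    quotient_smult[OF M.module_axioms ideal_submodule] quotient_mult quotient_one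
  show "module k (quotient_algebra M I)" by (rule module_quotient[OF M.module_axioms
      ideal_submodule])
  show "bilinear k (quotient_algebra M I) (quotient_algebra M I) (quotient_algebra M I) (\<lambda>x y. x
      \<otimes>\<^bsub>quotient_algebra M I\<^esub> y)"
    by (rule bilinearI; rule linear_mapI) (auto simp: Q M.l_distr M.r_distr M.smult_mult_left
        M.smult_mult_right)
qed (auto simp: quotient_carrier[OF M.module_axioms ideal_submodule] quotient_mult quotient_one
    M.m_assoc)

end

lemma idealI_submodule:
  assumes "unital_algebra k M" and "submodule J k M"
    and "\<And>x y. \<lbrakk>x \<in> J; y \<in> carrier M\<rbrakk> \<Longrightarrow> y \<otimes>\<^bsub>M\<^esub> x \<in> J" and "\<And>x y. \<lbrakk>x \<in> J; y \<in> carrier M\<rbrakk> \<Longrightarrow>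
        x \<otimes>\<^bsub>M\<^esub> y \<in> J"
  shows "ideal J M"
proof -
  interpret M: unital_algebra k M by fact
  show ?thesis
    by (rule idealI[OF M.ring_axioms]) (use assms in \<open>simp_all add: submodule_def\<close>)
qed

section \<open>Universal differential forms\<close>

lemma word_degree_append: "word_degree (u @ v) = word_degree u + word_degree v"
  by (induction u rule: word_degree.induct) auto

locale forms_algebra =
  fixes k :: "'k ring" and A :: "('k, 'a) module"
  assumes A: "unital_algebra k A"
begin

interpretation A: unital_algebra k A by (rule A)

lemma cring_k: "cring k"
  by (rule A.R.cring_axioms)

abbreviation "X \<equiv> Elt ` carrier A \<union> Dif ` carrier A"
abbreviation "F \<equiv> form_words_algebra k A"
abbreviation "FM \<equiv> free_module k (lists X)"
abbreviation "I \<equiv> form_ideal k A"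
abbreviation "\<Omega> \<equiv> forms k A"
abbreviation "q x \<equiv> I +>\<^bsub>F\<^esub> x"
abbreviation "elt a \<equiv> basis k [Elt a]"
abbreviation "dif a \<equiv> basis k [Dif a]"

lemma F_def: "F = free_algebra k X"
  by (rule form_words_algebra_def)

lemma alg_F: "unital_algebra k F"
  unfolding F_def by (rule unital_algebra_free_algebra[OF cring_k])

lemma mod_F: "module k F"
  by (rule unital_algebra_module[OF alg_F])

interpretation F: unital_algebra k F by (rule alg_F)

lemma basis_F: "w \<in> lists X \<Longrightarrow> basis k w \<in> carrier F"
  unfolding F_def by (rule basis_word_closed[OF cring_k])

lemma elt_F: "a \<in> carrier A \<Longrightarrow> elt a \<in> carrier F" and dif_F: "a \<in> carrier A \<Longrightarrow> dif a \<in> carrier F"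
  by (rule basis_F, simp)+

lemma basis_mult_F: "basis k u \<otimes>\<^bsub>F\<^esub> basis k v = basis k (u @ v)"
  unfolding F_def by (rule basis_mult[OF cring_k])

lemma one_F: "\<one>\<^bsub>F\<^esub> = basis k []"
  by (simp add: F_def)

lemma F_ext:
  assumes "module k P" and "linear_map k F P f" and "linear_map k F P g"
    and "\<And>w. w \<in> lists X \<Longrightarrow> f (basis k w) = g (basis k w)" and "c \<in> carrier F"
  shows "f c = g c"
  using assms unfolding F_def by (rule free_algebra_ext[OF cring_k])

lemma F_subset_submodule:
  assumes "submodule H k F" and "\<And>w. \<lbrakk>w \<in> lists X; P w\<rbrakk> \<Longrightarrow> basis k w \<in> H"
    and "c \<in> carrier F" and "\<And>w. c w \<noteq> \<zero>\<^bsub>k\<^esub> \<Longrightarrow> P w"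
  shows "c \<in> H"
proof (rule free_module_subset_submodule[OF cring_k])
  show "submodule H k FM"
    by (rule submodule_cong[OF _ _ _ _ module_free_module[OF cring_k] assms(1)]) (simp_all add:
        F_def)
  show "c \<in> carrier FM" using assms(3) by (simp add: F_def)
  show "basis k w \<in> H" if "w \<in> {w \<in> lists X. P w}" for w using assms(2) that by blast
  show "w \<in> {w \<in> lists X. P w}" if "c w \<noteq> \<zero>\<^bsub>k\<^esub>" for w
    using assms(3,4) that by (auto simp only: F_def free_algebra_simps free_module_simps)
qed

lemmas F_ints = alg_F mod_F F.m_closed linear_map_mult_left linear_map_mult_right linear_map_id

subsection \<open>The maps on words\<close>

definition "homogeneous p = {f \<in> carrier F. \<forall>w. f w \<noteq> \<zero>\<^bsub>k\<^esub> \<longrightarrow> word_degree w = p}"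
text \<open>Sign and projections act on the coefficients of words, so their linearity is pointwise.
  They descend to forms because the ideal is generated by homogeneous relations.\<close>

definition "eps f = (\<lambda>w. signed k (word_degree w) (f w))"
definition "proj p f = (\<lambda>w. if word_degree w = p then f w else \<zero>\<^bsub>k\<^esub>)"
abbreviation "diff \<equiv> linear_extension k F (word_diff k A)"

lemma F_carrier: "f \<in> carrier F \<longleftrightarrow>
     (\<forall>x. f x \<in> carrier k) \<and> (\<forall>x. x \<notin> lists X \<longrightarrow> f x = \<zero>\<^bsub>k\<^esub>) \<and> finite {x. f x \<noteq> \<zero>\<^bsub>k\<^esub>}"
  by (simp only: F_def free_algebra_simps free_module_simps)

lemma F_pointwise:
  "f \<oplus>\<^bsub>F\<^esub> g = (\<lambda>w. f w \<oplus>\<^bsub>k\<^esub> g w)" "r \<odot>\<^bsub>F\<^esub> f = (\<lambda>w. r \<otimes>\<^bsub>k\<^esub> f w)" "\<zero>\<^bsub>F\<^esub> = (\<lambda>w. \<zero>\<^bsub>k\<^esub>)"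
  by (simp_all add: F_def free_module_simps)

lemma F_neg: "f \<in> carrier F \<Longrightarrow> (\<ominus>\<^bsub>F\<^esub> f) w = \<ominus>\<^bsub>k\<^esub> f w"
proof -
  assume f: "f \<in> carrier F"
  have "(\<ominus>\<^bsub>F\<^esub> f \<oplus>\<^bsub>F\<^esub> f) w = \<zero>\<^bsub>k\<^esub>" using f F.l_neg by (simp add: F_pointwise(3))
  then have "(\<ominus>\<^bsub>F\<^esub> f) w \<oplus>\<^bsub>k\<^esub> f w = \<zero>\<^bsub>k\<^esub>" by (simp add: F_pointwise(1))
  moreover have "(\<ominus>\<^bsub>F\<^esub> f) w \<in> carrier k" "f w \<in> carrier k" using f F.a_inv_closed F_carrier
      by blast+
  ultimately show ?thesis using A.R.minus_equality by simp
qed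

lemma F_val: "f \<in> carrier F \<Longrightarrow> f w \<in> carrier k"
  by (simp add: F_carrier)

lemma eps_linear: "linear_map k F F eps"
proof (rule linear_mapI)
  fix f assume f: "f \<in> carrier F"
  have s: "(signed k p x = \<zero>\<^bsub>k\<^esub>) = (x = \<zero>\<^bsub>k\<^esub>)" if "x \<in> carrier k" for p x
    using that by (auto simp: signed_def)
  show "eps f \<in> carrier F" using f unfolding F_carrier eps_def
    by (simp add: s) (simp add: signed_def)
  show "eps (f \<oplus>\<^bsub>F\<^esub> g) = eps f \<oplus>\<^bsub>F\<^esub> eps g" if "g \<in> carrier F" for g
    using F_val[OF f] F_val[OF that] by (auto simp: F_pointwise eps_def fun_eq_iff signed_def
        A.R.minus_add)
  show "eps (r \<odot>\<^bsub>F\<^esub> f) = r \<odot>\<^bsub>F\<^esub> eps f" if "r \<in> carrier k" for r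
    using F_val[OF f] that by (auto simp: F_pointwise eps_def fun_eq_iff signed_def A.R.r_minus)
qed

lemma proj_linear: "linear_map k F F (proj p)"
proof (rule linear_mapI)
  fix f assume f: "f \<in> carrier F"
  have "finite {w. proj p f w \<noteq> \<zero>\<^bsub>k\<^esub>}"
    by (rule finite_subset[of _ "{w. f w \<noteq> \<zero>\<^bsub>k\<^esub>}"]) (use f in \<open>auto simp: proj_def F_carrier\<close>)
  then show "proj p f \<in> carrier F" using f by (simp add: F_carrier) (simp add: proj_def)
qed (auto simp: F_pointwise proj_def fun_eq_iff)

lemma homogeneous_eq_proj: "homogeneous p = {f \<in> carrier F. proj p f = f}"
proof -
  have "(\<forall>w. f w \<noteq> \<zero>\<^bsub>k\<^esub> \<longrightarrow> word_degree w = p) \<longleftrightarrow> proj p f = f" for f :: "'a form_symbol list \<Rightarrow> 'k"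
    unfolding proj_def fun_eq_iff by (metis (full_types))
  then show ?thesis by (simp add: homogeneous_def)
qed

lemma homogeneous_submodule: "submodule (homogeneous p) k F"
  unfolding homogeneous_eq_proj by (rule submodule_equalizer[OF mod_F mod_F proj_linear
      linear_map_id])

lemma homogeneous_basis: "w \<in> lists X \<Longrightarrow> basis k w \<in> homogeneous (word_degree w)"
  using basis_F by (auto simp: homogeneous_def basis_def)

lemma homogeneous_closed: "f \<in> homogeneous p \<Longrightarrow> f \<in> carrier F"
  by (simp add: homogeneous_def)

lemma homogeneous_minimal:
  assumes "submodule H k F" and "\<And>w. \<lbrakk>w \<in> lists X; word_degree w = p\<rbrakk> \<Longrightarrow>
      basis k w \<in> H" and "f \<in> homogeneous p"
  shows "f \<in> H"
  by (rule F_subset_submodule[where P = "\<lambda>w. word_degree w = p", OF assms(1,2)])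
    (use assms(3) in \<open>auto simp: homogeneous_def\<close>)

lemma homogeneous_mult:
  assumes f: "f \<in> homogeneous p" and g: "g \<in> homogeneous r"
  shows "f \<otimes>\<^bsub>F\<^esub> g \<in> homogeneous (p + r)"
proof -
  note H = homogeneous_submodule
  have *: "basis k u \<otimes>\<^bsub>F\<^esub> g \<in> homogeneous (p + r)" if u: "u \<in> lists X" "word_degree u = p" for u
  proof -
    have "g \<in> {g \<in> carrier F. basis k u \<otimes>\<^bsub>F\<^esub> g \<in> homogeneous (p + r)}"
    proof (rule homogeneous_minimal[OF submodule_vimage[OF mod_F mod_F _ H] _ g])
      show "linear_map k F F (\<lambda>g. basis k u \<otimes>\<^bsub>F\<^esub> g)" by (rule F_ints basis_F u)+
      show "basis k w \<in> {g \<in> carrier F. basis k u \<otimes>\<^bsub>F\<^esub> g \<in> homogeneous (p + r)}" if "w \<in> lists X"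
          "word_degree w = r" for w
        using homogeneous_basis[of "u @ w"] u that basis_F by (simp add: basis_mult_F
            word_degree_append)
    qed
    then show ?thesis by simp
  qed
  note g' = homogeneous_closed[OF g]
  have "f \<in> {f \<in> carrier F. f \<otimes>\<^bsub>F\<^esub> g \<in> homogeneous (p + r)}"
  proof (rule homogeneous_minimal[OF submodule_vimage[OF mod_F mod_F _ H] _ f])
    show "linear_map k F F (\<lambda>f. f \<otimes>\<^bsub>F\<^esub> g)" by (rule F_ints g')+
  qed (use * basis_F in auto)
  then show ?thesis by simp
qed

lemma eps_homogeneous: "f \<in> homogeneous p \<Longrightarrow> eps f = signed F p f"
  by (auto simp: homogeneous_def eps_def signed_def fun_eq_iff F_neg) (metis A.R.minus_zero)+

lemma proj_homogeneous: "f \<in> homogeneous p \<Longrightarrow> proj r f = (if r = p then f else \<zero>\<^bsub>F\<^esub>)"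
  by (auto simp: homogeneous_def proj_def fun_eq_iff F_pointwise) metis

lemma eps_basis: "w \<in> lists X \<Longrightarrow> eps (basis k w) = signed F (word_degree w) (basis k w)"
  by (rule eps_homogeneous[OF homogeneous_basis])

lemma word_diff_homogeneous: "w \<in> lists X \<Longrightarrow> word_diff k A w \<in> homogeneous (Suc (word_degree w))"
proof (induction w rule: word_degree.induct)
  case 1
  then show ?case using submoduleD(2)[OF homogeneous_submodule] by simp
next
  case (2 a w)
  then have a: "a \<in> carrier A" and w: "w \<in> lists X" by auto
  have "basis k (Dif a # w) \<in> homogeneous (Suc (word_degree w))" using homogeneous_basis[of "Dif a #
      w"] a w by simp
  moreover have "elt a \<otimes>\<^bsub>F\<^esub> word_diff k A w \<in> homogeneous (Suc (word_degree w))"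
    using homogeneous_mult[OF homogeneous_basis[of "[Elt a]"] 2(1)[OF w]] a by simp
  ultimately show ?case using submoduleD(3)[OF homogeneous_submodule] by simp
next
  case (3 a w)
  then have a: "a \<in> carrier A" and w: "w \<in> lists X" by auto
  have "dif a \<otimes>\<^bsub>F\<^esub> word_diff k A w \<in> homogeneous (Suc (Suc (word_degree w)))"
    using homogeneous_mult[OF homogeneous_basis[of "[Dif a]"] 3(1)[OF w]] a by simp
  then show ?case using F.submoduleE(3)[OF homogeneous_submodule] by simp
qed

lemma word_diff_F: "w \<in> lists X \<Longrightarrow> word_diff k A w \<in> carrier F"
  by (rule homogeneous_closed[OF word_diff_homogeneous])

lemma diff_linear: "linear_map k F F diff"
  using linear_map_linear_extension[OF mod_F, of "lists X" "word_diff k A"] word_diff_F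
      by (simp add: F_def)

lemma diff_basis: "w \<in> lists X \<Longrightarrow> diff (basis k w) = word_diff k A w"
  by (rule linear_extension_basis[OF mod_F]) (use word_diff_F in auto)

lemmas eps_closed = linear_mapD(1)[OF eps_linear] and diff_closed = linear_mapD(1)[OF diff_linear]
lemmas eps_comp = linear_map_comp[OF eps_linear] and diff_comp = linear_map_comp[OF diff_linear]

lemma basis_Cons: "basis k (x # w) = basis k [x] \<otimes>\<^bsub>F\<^esub> basis k w"
  by (simp add: basis_mult_F)

text \<open>The recursion of \<open>word_diff\<close> is the Leibniz rule for a cut after the first
  letter. Induction on \<open>u\<close> moves the cut to any position, each symbol
  \<open>Dif\<close> passed on the way contributing one change of sign.\<close>

lemma word_diff_append:
  assumes "u \<in> lists X" and v: "v \<in> lists X"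
  shows "word_diff k A (u @ v) =
    word_diff k A u \<otimes>\<^bsub>F\<^esub> basis k v \<oplus>\<^bsub>F\<^esub> signed F (word_degree u) (basis k u \<otimes>\<^bsub>F\<^esub> word_diff k A v)"
  using assms(1)
proof (induction u rule: word_degree.induct)
  case 1
  show ?case using word_diff_F[OF v] basis_F[OF v] by (simp add: signed_def one_F[symmetric])
next
  case (2 a w)
  then have a: "a \<in> carrier A" and w: "w \<in> lists X" by auto
  note cl = elt_F[OF a] dif_F[OF a] basis_F[OF w] basis_F[OF v] word_diff_F[OF w] word_diff_F[OF v]
  show ?case
    using cl by (simp add: 2(1)[OF w] basis_Cons[of _ "w @ v"] basis_Cons[of _ w]
        basis_mult_F[symmetric, of w v]
        F.l_distr F.r_distr F.r_minus F.m_assoc F.a_assoc signed_def)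
next
  case (3 a w)
  then have a: "a \<in> carrier A" and w: "w \<in> lists X" by auto
  note cl = elt_F[OF a] dif_F[OF a] basis_F[OF w] basis_F[OF v] word_diff_F[OF w] word_diff_F[OF v]
  show ?case
    using cl by (simp add: 3(1)[OF w] basis_Cons[of _ "w @ v"] basis_Cons[of _ w]
        basis_mult_F[symmetric, of w v]
        F.l_distr F.r_distr F.r_minus F.l_minus F.m_assoc F.a_assoc signed_def F.minus_add)
qed

lemma diff_mult:
  assumes f: "f \<in> carrier F" and g: "g \<in> carrier F"
  shows "diff (f \<otimes>\<^bsub>F\<^esub> g) = diff f \<otimes>\<^bsub>F\<^esub> g \<oplus>\<^bsub>F\<^esub> eps f \<otimes>\<^bsub>F\<^esub> diff g"
proof -
  note ints = linear_map_add[OF mod_F mod_F] F_ints eps_closed diff_closed eps_comp diff_comp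
      eps_linear diff_linear basis_F
  show ?thesis
  proof (rule F_ext[OF mod_F _ _ _ f])
    fix u assume u: "u \<in> lists X"
    show "diff (basis k u \<otimes>\<^bsub>F\<^esub> g) = diff (basis k u) \<otimes>\<^bsub>F\<^esub> g \<oplus>\<^bsub>F\<^esub> eps (basis k u) \<otimes>\<^bsub>F\<^esub> diff g"
    proof (rule F_ext[OF mod_F _ _ _ g])
      fix v assume v: "v \<in> lists X"
      have "diff (basis k u \<otimes>\<^bsub>F\<^esub> basis k v) = word_diff k A (u @ v)"
        using diff_basis[of "u @ v"] u v by (simp add: basis_mult_F)
      then show "diff (basis k u \<otimes>\<^bsub>F\<^esub> basis k v) =
          diff (basis k u) \<otimes>\<^bsub>F\<^esub> basis k v \<oplus>\<^bsub>F\<^esub> eps (basis k u) \<otimes>\<^bsub>F\<^esub> diff (basis k v)"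
        using u v basis_F word_diff_F
        by (simp add: diff_basis eps_basis word_diff_append) (simp add: signed_def F.l_minus)
    qed (rule ints u)+
  qed (rule ints g)+
qed

lemma eps_mult:
  assumes f: "f \<in> carrier F" and g: "g \<in> carrier F"
  shows "eps (f \<otimes>\<^bsub>F\<^esub> g) = eps f \<otimes>\<^bsub>F\<^esub> eps g"
proof -
  note ints = F_ints eps_closed eps_comp eps_linear basis_F
  show ?thesis
  proof (rule F_ext[OF mod_F _ _ _ f])
    fix u assume u: "u \<in> lists X"
    show "eps (basis k u \<otimes>\<^bsub>F\<^esub> g) = eps (basis k u) \<otimes>\<^bsub>F\<^esub> eps g"
    proof (rule F_ext[OF mod_F _ _ _ g])
      fix v assume v: "v \<in> lists X"
      have "eps (basis k u \<otimes>\<^bsub>F\<^esub> basis k v) = signed F (word_degree u + word_degree v) (basis k u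
          \<otimes>\<^bsub>F\<^esub> basis k v)"
        using eps_basis[of "u @ v"] u v by (simp add: basis_mult_F word_degree_append)
      then show "eps (basis k u \<otimes>\<^bsub>F\<^esub> basis k v) = eps (basis k u) \<otimes>\<^bsub>F\<^esub> eps (basis k v)"
        using basis_F[OF u] basis_F[OF v] by (simp add: eps_basis u v) (auto simp: signed_def
            F.l_minus F.r_minus)
    qed (rule ints u)+
  qed (rule ints g)+
qed

lemma eps_gen: "a \<in> carrier A \<Longrightarrow> eps (elt a) = elt a" "a \<in> carrier A \<Longrightarrow> eps (dif a) = \<ominus>\<^bsub>F\<^esub> dif a"
  using eps_basis[of "[Elt a]"] eps_basis[of "[Dif a]"] by (simp_all add: signed_def)

lemma diff_gen: "a \<in> carrier A \<Longrightarrow> diff (elt a) = dif a" "a \<in> carrier A \<Longrightarrow> diff (dif a) = \<zero>\<^bsub>F\<^esub>"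
  using diff_basis[of "[Elt a]"] diff_basis[of "[Dif a]"] elt_F dif_F by simp_all

text \<open>For a leading symbol \<open>Elt a\<close> followed by \<open>w\<close>, the second
  derivative leaves two terms, \<open>dif a\<close> times the derivative of \<open>w\<close> with
  opposite signs, besides one that vanishes by induction. A leading \<open>Dif a\<close> produces
  only terms that vanish.\<close>

lemma diff_diff: "f \<in> carrier F \<Longrightarrow> diff (diff f) = \<zero>\<^bsub>F\<^esub>"
proof (rule F_ext[OF mod_F diff_comp[OF diff_linear] linear_map_zero[OF mod_F]])
  fix w assume "w \<in> lists X"
  then have "diff (word_diff k A w) = \<zero>\<^bsub>F\<^esub>"
  proof (induction w rule: word_degree.induct)
    case 1
    show ?case using linear_map_0[OF mod_F mod_F diff_linear] by simp
  next
    case (2 a w)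
    then have a: "a \<in> carrier A" and w: "w \<in> lists X" by auto
    note cl = elt_F[OF a] dif_F[OF a] basis_F[OF w] word_diff_F[OF w]
    show ?case
      using cl a w by (simp add: linear_mapD(2)[OF diff_linear] basis_Cons[of _ w] diff_mult
          diff_gen eps_gen 2(1)[OF w] diff_basis
          F.l_minus F.l_neg)
  next
    case (3 a w)
    then have a: "a \<in> carrier A" and w: "w \<in> lists X" by auto
    note cl = elt_F[OF a] dif_F[OF a] basis_F[OF w] word_diff_F[OF w]
    show ?case
      using cl a w by (simp add: linear_map_uminus[OF mod_F mod_F diff_linear] diff_mult diff_gen
          eps_gen 3(1)[OF w])
  qed
  then show "diff (diff (basis k w)) = \<zero>\<^bsub>F\<^esub>" using \<open>w \<in> lists X\<close> by (simp add: diff_basis)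
qed

subsection \<open>The ideal of relations\<close>

lemma homogeneous_elt: "a \<in> carrier A \<Longrightarrow> elt a \<in> homogeneous 0"
  and homogeneous_dif: "a \<in> carrier A \<Longrightarrow> dif a \<in> homogeneous (Suc 0)"
  using homogeneous_basis[of "[Elt a]"] homogeneous_basis[of "[Dif a]"] by simp_all

text \<open>The relations for the algebra structure have degree zero and those for the symbols
  \<open>Dif\<close> have degree one. This is the reason why forms inherit a grading.\<close>

lemma relations_homogeneous:
  assumes "r \<in> form_relations k A"
  shows "\<exists>p. r \<in> homogeneous p"
proof -
  note D = submoduleD(3,4)[OF homogeneous_submodule]
  have minus: "f \<ominus>\<^bsub>F\<^esub> g \<in> homogeneous p" if "f \<in> homogeneous p" "g \<in> homogeneous p" for f g p
    unfolding a_minus_def by (rule D(1)[OF that(1) F.submoduleE(3)[OF homogeneous_submodule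
        that(2)]])
  have one: "\<one>\<^bsub>F\<^esub> \<in> homogeneous 0" using homogeneous_basis[of "[]"] by (simp add: one_F)
  have mult: "elt a \<otimes>\<^bsub>F\<^esub> elt b \<in> homogeneous 0" "dif a \<otimes>\<^bsub>F\<^esub> elt b \<in> homogeneous (Suc 0)"
    "elt a \<otimes>\<^bsub>F\<^esub> dif b \<in> homogeneous (Suc 0)" if "a \<in> carrier A" "b \<in> carrier A" for a b
    using homogeneous_mult[OF homogeneous_elt[OF that(1)] homogeneous_elt[OF that(2)]]
      homogeneous_mult[OF homogeneous_dif[OF that(1)] homogeneous_elt[OF that(2)]]
      homogeneous_mult[OF homogeneous_elt[OF that(1)] homogeneous_dif[OF that(2)]] by simp_all
  have "r \<in> homogeneous 0 \<union> homogeneous (Suc 0)"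
    using assms unfolding form_relations_def Let_def
    by (elim UnE) (auto intro!: minus D one mult homogeneous_elt homogeneous_dif)
  then show ?thesis by blast
qed

lemma relations_F: "form_relations k A \<subseteq> carrier F"
  using relations_homogeneous homogeneous_closed by blast

lemma I_ideal: "ideal I F"
  unfolding form_ideal_def by (rule F.genideal_ideal[OF relations_F])

lemma I_submodule: "submodule I k F"
  by (rule ideal_submodule[OF alg_F I_ideal])

lemmas I_closed = submoduleD(1)[OF I_submodule]

lemma I_mult: "x \<in> I \<Longrightarrow> y \<in> carrier F \<Longrightarrow> y \<otimes>\<^bsub>F\<^esub> x \<in> I" "x \<in> I \<Longrightarrow> y \<in> carrier F \<Longrightarrow> x \<otimes>\<^bsub>F\<^esub> y \<in> I"
  using ideal.I_l_closed[OF I_ideal] ideal.I_r_closed[OF I_ideal] by auto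

lemma relations_I: "form_relations k A \<subseteq> I"
  unfolding form_ideal_def by (rule F.genideal_self[OF relations_F])

text \<open>Induction over the ideal. Membership in \<open>I\<close> is available in the product
  steps, so \<open>P\<close> itself does not have to imply it.\<close>

lemma I_minimal:
  assumes "submodule {f \<in> I. P f} k F"
    and "\<And>x y. \<lbrakk>x \<in> I; P x; y \<in> carrier F\<rbrakk> \<Longrightarrow> P (y \<otimes>\<^bsub>F\<^esub> x)" and "\<And>x y. \<lbrakk>x \<in> I; P x; y \<in> carrier F\<rbrakk> \<Longrightarrow>
        P (x \<otimes>\<^bsub>F\<^esub> y)"
    and "\<And>r. r \<in> form_relations k A \<Longrightarrow> P r" and "f \<in> I"
  shows "P f"
proof -
  have "ideal {f \<in> I. P f} F"
    by (rule idealI_submodule[OF alg_F assms(1)]) (simp_all add: assms(2,3) I_mult)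
  moreover have "form_relations k A \<subseteq> {f \<in> I. P f}" using relations_I assms(4) by blast
  ultimately have "I \<subseteq> {f \<in> I. P f}" unfolding form_ideal_def by (rule F.genideal_minimal)
  with assms(5) show ?thesis by blast
qed

lemma eps_I: "f \<in> I \<Longrightarrow> eps f \<in> I"
proof (rule I_minimal[where P = "\<lambda>f. eps f \<in> I"])
  show "submodule {f \<in> I. eps f \<in> I} k F"
    by (rule submodule_Collect_conj[OF mod_F I_submodule submodule_vimage[OF mod_F mod_F eps_linear
        I_submodule]])
  show "eps r \<in> I" if r: "r \<in> form_relations k A" for r
    using relations_homogeneous[OF r] eps_homogeneous submodule_signed[OF mod_F I_submodule]
        relations_I r by fastforce
qed (auto simp: eps_mult I_closed eps_closed I_mult)

text \<open>A projection is not multiplicative, but multiplication by a word only shifts the degree.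
  Above degree \<open>p\<close> nothing can be hit, which accounts for the zero case and makes the
  subtraction exact in the other.\<close>

lemma proj_basis_mult:
  assumes u: "u \<in> lists X" and f: "f \<in> carrier F"
  shows "proj p (basis k u \<otimes>\<^bsub>F\<^esub> f) = (if word_degree u \<le> p then basis k u \<otimes>\<^bsub>F\<^esub> proj (p - word_degree
      u) f else \<zero>\<^bsub>F\<^esub>)"
    and "proj p (f \<otimes>\<^bsub>F\<^esub> basis k u) = (if word_degree u \<le> p then proj (p - word_degree u) f \<otimes>\<^bsub>F\<^esub>
        basis k u else \<zero>\<^bsub>F\<^esub>)"
proof -
  note ints = linear_map_comp[OF proj_linear] F_ints proj_linear basis_F u
  have l: "linear_map k F F (\<lambda>f. if word_degree u \<le> p then basis k u \<otimes>\<^bsub>F\<^esub> proj (p - word_degree u) f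
      else \<zero>\<^bsub>F\<^esub>)"
    and r: "linear_map k F F (\<lambda>f. if word_degree u \<le> p then proj (p - word_degree u) f \<otimes>\<^bsub>F\<^esub> basis k
        u else \<zero>\<^bsub>F\<^esub>)"
    by (cases "word_degree u \<le> p"; simp only: if_True if_False;
        rule linear_map_mult_right[OF alg_F proj_linear basis_F[OF u]] linear_map_mult_left[OF alg_F
            proj_linear basis_F[OF u]]
          linear_map_zero[OF mod_F])+
  have pb: "proj n (basis k w) = (if n = word_degree w then basis k w else \<zero>\<^bsub>F\<^esub>)" if "w \<in> lists X"
      for w n
    by (rule proj_homogeneous[OF homogeneous_basis[OF that]])
  show "proj p (basis k u \<otimes>\<^bsub>F\<^esub> f) = (if word_degree u \<le> p then basis k u \<otimes>\<^bsub>F\<^esub> proj (p - word_degree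
      u) f else \<zero>\<^bsub>F\<^esub>)"
  proof (rule F_ext[OF mod_F _ l _ f])
    show "linear_map k F F (\<lambda>f. proj p (basis k u \<otimes>\<^bsub>F\<^esub> f))" by (rule ints)+
    show "proj p (basis k u \<otimes>\<^bsub>F\<^esub> basis k v) = (if word_degree u \<le> p then basis k u \<otimes>\<^bsub>F\<^esub> proj (p -
        word_degree u) (basis k v) else \<zero>\<^bsub>F\<^esub>)"
      if v: "v \<in> lists X" for v
      using pb[of "u @ v" p] pb[OF v] u v basis_F[OF u] by (auto simp: basis_mult_F
          word_degree_append)
  qed
  show "proj p (f \<otimes>\<^bsub>F\<^esub> basis k u) = (if word_degree u \<le> p then proj (p - word_degree u) f \<otimes>\<^bsub>F\<^esub> basis
      k u else \<zero>\<^bsub>F\<^esub>)"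
  proof (rule F_ext[OF mod_F _ r _ f])
    show "linear_map k F F (\<lambda>f. proj p (f \<otimes>\<^bsub>F\<^esub> basis k u))" by (rule ints)+
    show "proj p (basis k v \<otimes>\<^bsub>F\<^esub> basis k u) = (if word_degree u \<le> p then proj (p - word_degree u)
        (basis k v) \<otimes>\<^bsub>F\<^esub> basis k u else \<zero>\<^bsub>F\<^esub>)"
      if v: "v \<in> lists X" for v
      using pb[of "v @ u" p] pb[OF v] u v basis_F[OF u] by (auto simp: basis_mult_F
          word_degree_append)
  qed
qed

lemma proj_I: "f \<in> I \<Longrightarrow> proj p f \<in> I"
proof -
  have "\<forall>p\<in>UNIV. proj p f \<in> I" if "f \<in> I"
  \<comment> \<open>The claim is made for all degrees at once, because multiplication by a word
    shifts the degree of the projection that is needed. The multiplier \<open>y\<close> is reduced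
    to words by linearity.\<close>
  proof (rule I_minimal[where P = "\<lambda>f. \<forall>p\<in>UNIV. proj p f \<in> I", OF _ _ _ _ that])
    show "submodule {f \<in> I. \<forall>p\<in>UNIV. proj p f \<in> I} k F"
      by (rule submodule_Collect_conj[OF mod_F I_submodule submodule_Collect_ball[OF mod_F
          submodule_vimage[OF mod_F mod_F proj_linear I_submodule]]])
    show "\<forall>p\<in>UNIV. proj p r \<in> I" if r: "r \<in> form_relations k A" for r
      using relations_homogeneous[OF r] proj_homogeneous submoduleD(2)[OF I_submodule] relations_I r
          by fastforce
    fix x y assume x: "x \<in> I" and p: "\<forall>p\<in>UNIV. proj p x \<in> I" and y: "y \<in> carrier F"
    note ints = linear_map_comp[OF proj_linear] F_ints I_closed[OF x]
    have "y \<in> {y \<in> carrier F. proj p (y \<otimes>\<^bsub>F\<^esub> x) \<in> I}" for p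
      by (rule F_subset_submodule[where P = "\<lambda>_. True", OF submodule_vimage[OF mod_F mod_F _
          I_submodule] _ y])
        ((rule ints)+, use p submoduleD(2)[OF I_submodule] in \<open>auto simp: basis_F proj_basis_mult
            I_closed[OF x] I_mult\<close>)
    then show "\<forall>p\<in>UNIV. proj p (y \<otimes>\<^bsub>F\<^esub> x) \<in> I" by blast
    have "y \<in> {y \<in> carrier F. proj p (x \<otimes>\<^bsub>F\<^esub> y) \<in> I}" for p
      by (rule F_subset_submodule[where P = "\<lambda>_. True", OF submodule_vimage[OF mod_F mod_F _
          I_submodule] _ y])
        ((rule ints)+, use p submoduleD(2)[OF I_submodule] in \<open>auto simp: basis_F proj_basis_mult
            I_closed[OF x] I_mult\<close>)
    then show "\<forall>p\<in>UNIV. proj p (x \<otimes>\<^bsub>F\<^esub> y) \<in> I" by blast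
  qed
  then show "f \<in> I \<Longrightarrow> proj p f \<in> I" by blast
qed

lemma alg_\<Omega>: "unital_algebra k \<Omega>"
  unfolding forms_def by (rule unital_algebra_quotient[OF alg_F I_ideal])

lemma mod_\<Omega>: "module k \<Omega>"
  by (rule unital_algebra_module[OF alg_\<Omega>])

interpretation \<Omega>: unital_algebra k \<Omega> by (rule alg_\<Omega>)

lemma q_linear: "linear_map k F \<Omega> (\<lambda>x. q x)"
  unfolding forms_def by (rule linear_map_coset[OF mod_F I_submodule])

lemmas q_closed = linear_mapD(1)[OF q_linear] and q_add = linear_mapD(2)[OF q_linear]
  and q_smult = linear_mapD(3)[OF q_linear] and q_minus = linear_map_minus[OF mod_F mod_\<Omega> q_linear]
  and q_uminus = linear_map_uminus[OF mod_F mod_\<Omega> q_linear]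

lemma q_mult: "x \<in> carrier F \<Longrightarrow> y \<in> carrier F \<Longrightarrow> q (x \<otimes>\<^bsub>F\<^esub> y) = q x \<otimes>\<^bsub>\<Omega>\<^esub> q y"
  unfolding forms_def by (rule quotient_mult[OF alg_F I_ideal, symmetric])

lemma q_one: "q \<one>\<^bsub>F\<^esub> = \<one>\<^bsub>\<Omega>\<^esub>"
  unfolding forms_def by (rule quotient_one[OF alg_F I_ideal, symmetric])

lemma q_0_iff: "x \<in> carrier F \<Longrightarrow> q x = \<zero>\<^bsub>\<Omega>\<^esub> \<longleftrightarrow> x \<in> I"
  using coset_zero_iff[OF mod_F I_submodule] quotient_zero[OF mod_F I_submodule] by (simp add:
      forms_def)

lemma q_eqI: "x \<ominus>\<^bsub>F\<^esub> y \<in> form_relations k A \<Longrightarrow> x \<in> carrier F \<Longrightarrow> y \<in> carrier F \<Longrightarrow> q x = q y"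
  using coset_eq_iff[OF mod_F I_submodule] relations_I by blast

lemma \<Omega>_carrier: "carrier \<Omega> = (\<lambda>x. q x) ` carrier F"
  unfolding forms_def by (rule quotient_carrier[OF mod_F I_submodule])

lemma relations_intros:
  "elt \<one>\<^bsub>A\<^esub> \<ominus>\<^bsub>F\<^esub> \<one>\<^bsub>F\<^esub> \<in> form_relations k A"
  "\<lbrakk>a \<in> carrier A; b \<in> carrier A\<rbrakk> \<Longrightarrow> elt (a \<oplus>\<^bsub>A\<^esub> b) \<ominus>\<^bsub>F\<^esub> (elt a \<oplus>\<^bsub>F\<^esub> elt b) \<in> form_relations k A"
  "\<lbrakk>r \<in> carrier k; a \<in> carrier A\<rbrakk> \<Longrightarrow> elt (r \<odot>\<^bsub>A\<^esub> a) \<ominus>\<^bsub>F\<^esub> r \<odot>\<^bsub>F\<^esub> elt a \<in> form_relations k A"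
  "\<lbrakk>a \<in> carrier A; b \<in> carrier A\<rbrakk> \<Longrightarrow> elt (a \<otimes>\<^bsub>A\<^esub> b) \<ominus>\<^bsub>F\<^esub> elt a \<otimes>\<^bsub>F\<^esub> elt b \<in> form_relations k A"
  "\<lbrakk>a \<in> carrier A; b \<in> carrier A\<rbrakk> \<Longrightarrow> dif (a \<oplus>\<^bsub>A\<^esub> b) \<ominus>\<^bsub>F\<^esub> (dif a \<oplus>\<^bsub>F\<^esub> dif b) \<in> form_relations k A"
  "\<lbrakk>r \<in> carrier k; a \<in> carrier A\<rbrakk> \<Longrightarrow> dif (r \<odot>\<^bsub>A\<^esub> a) \<ominus>\<^bsub>F\<^esub> r \<odot>\<^bsub>F\<^esub> dif a \<in> form_relations k A"
  "\<lbrakk>a \<in> carrier A; b \<in> carrier A\<rbrakk> \<Longrightarrow>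
    dif (a \<otimes>\<^bsub>A\<^esub> b) \<ominus>\<^bsub>F\<^esub> (dif a \<otimes>\<^bsub>F\<^esub> elt b \<oplus>\<^bsub>F\<^esub> elt a \<otimes>\<^bsub>F\<^esub> dif b) \<in> form_relations k A"
  unfolding form_relations_def Let_def by blast+

lemma form_of_one: "q (elt \<one>\<^bsub>A\<^esub>) = \<one>\<^bsub>\<Omega>\<^esub>"
  using q_eqI[OF relations_intros(1)] elt_F by (simp add: q_one)

lemma form_of_add: "\<lbrakk>a \<in> carrier A; b \<in> carrier A\<rbrakk> \<Longrightarrow> q (elt (a \<oplus>\<^bsub>A\<^esub> b)) = q (elt a) \<oplus>\<^bsub>\<Omega>\<^esub> q (elt b)"
  using q_eqI[OF relations_intros(2)] elt_F by (simp add: q_add)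

lemma form_of_smult: "\<lbrakk>r \<in> carrier k; a \<in> carrier A\<rbrakk> \<Longrightarrow> q (elt (r \<odot>\<^bsub>A\<^esub> a)) = r \<odot>\<^bsub>\<Omega>\<^esub> q (elt a)"
  using q_eqI[OF relations_intros(3)] elt_F by (simp add: q_smult)

lemma form_of_mult: "\<lbrakk>a \<in> carrier A; b \<in> carrier A\<rbrakk> \<Longrightarrow> q (elt (a \<otimes>\<^bsub>A\<^esub> b)) = q (elt a) \<otimes>\<^bsub>\<Omega>\<^esub> q (elt b)"
  using q_eqI[OF relations_intros(4)] elt_F by (simp add: q_mult)

lemma dif_add: "\<lbrakk>a \<in> carrier A; b \<in> carrier A\<rbrakk> \<Longrightarrow> q (dif (a \<oplus>\<^bsub>A\<^esub> b)) = q (dif a) \<oplus>\<^bsub>\<Omega>\<^esub> q (dif b)"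
  using q_eqI[OF relations_intros(5)] dif_F by (simp add: q_add)

lemma dif_smult: "\<lbrakk>r \<in> carrier k; a \<in> carrier A\<rbrakk> \<Longrightarrow> q (dif (r \<odot>\<^bsub>A\<^esub> a)) = r \<odot>\<^bsub>\<Omega>\<^esub> q (dif a)"
  using q_eqI[OF relations_intros(6)] dif_F by (simp add: q_smult)

lemma dif_mult: "\<lbrakk>a \<in> carrier A; b \<in> carrier A\<rbrakk> \<Longrightarrow>
    q (dif (a \<otimes>\<^bsub>A\<^esub> b)) = q (dif a) \<otimes>\<^bsub>\<Omega>\<^esub> q (elt b) \<oplus>\<^bsub>\<Omega>\<^esub> q (elt a) \<otimes>\<^bsub>\<Omega>\<^esub> q (dif b)"
  using q_eqI[OF relations_intros(7)] elt_F dif_F by (simp add: q_add q_mult)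

text \<open>The Leibniz rule for \<one> \<otimes> \<one> doubles the differential of the unit. The
  fact is needed for the relation that identifies the two units to be preserved by
  \<open>diff\<close>.\<close>

lemma dif_one: "q (dif \<one>\<^bsub>A\<^esub>) = \<zero>\<^bsub>\<Omega>\<^esub>"
proof -
  have cl: "q (dif \<one>\<^bsub>A\<^esub>) \<in> carrier \<Omega>" by (rule q_closed[OF dif_F]) simp
  have "q (dif \<one>\<^bsub>A\<^esub>) = q (dif \<one>\<^bsub>A\<^esub>) \<oplus>\<^bsub>\<Omega>\<^esub> q (dif \<one>\<^bsub>A\<^esub>)"
    using dif_mult[of "\<one>\<^bsub>A\<^esub>" "\<one>\<^bsub>A\<^esub>"] cl by (simp add: form_of_one)
  then show ?thesis using cl by (metis \<Omega>.add.l_cancel_one' )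
qed

text \<open>In the quotient, relations of degree zero are turned into relations of degree one, the
  unit relation into \<open>dif_one\<close>. The linear relations of degree one are killed, and for
  the Leibniz relation the two products of differentials cancel by the sign of
  \<open>dif a\<close>.\<close>

lemma diff_relations: "r \<in> form_relations k A \<Longrightarrow> diff r \<in> I"
proof -
  assume r: "r \<in> form_relations k A"
  note D = linear_mapD(2,3)[OF diff_linear] linear_map_minus[OF mod_F mod_F diff_linear]
  note Q = q_minus q_add q_smult q_mult q_uminus
  have one: "diff \<one>\<^bsub>F\<^esub> = \<zero>\<^bsub>F\<^esub>" using diff_basis[of "[]"] by (simp add: one_F)
  have z: "x \<ominus>\<^bsub>\<Omega>\<^esub> x = \<zero>\<^bsub>\<Omega>\<^esub>" if "x \<in> carrier \<Omega>" for x using that by (simp add: a_minus_def \<Omega>.r_neg)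
  have q0: "q \<zero>\<^bsub>F\<^esub> = \<zero>\<^bsub>\<Omega>\<^esub>" by (rule linear_map_0[OF mod_F mod_\<Omega> q_linear])
  have "q (diff r) = \<zero>\<^bsub>\<Omega>\<^esub>"
    using r unfolding form_relations_def Let_def
    by (elim UnE CollectE exE conjE singletonE)
      (simp_all add: D Q elt_F dif_F diff_mult diff_gen eps_gen one q0 dif_one z q_closed
        form_of_add form_of_smult form_of_mult dif_add dif_smult dif_mult F.l_minus F.l_neg)
  then show ?thesis using q_0_iff[OF diff_closed] relations_F r by blast
qed

text \<open>In the Leibniz rule for a product with an element of the ideal on the left, the second
  summand contains its image under \<open>eps\<close>; hence \<open>eps_I\<close> is required
  beforehand.\<close>

lemma diff_I: "f \<in> I \<Longrightarrow> diff f \<in> I"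
proof (rule I_minimal[where P = "\<lambda>f. diff f \<in> I"])
  show "submodule {f \<in> I. diff f \<in> I} k F"
    by (rule submodule_Collect_conj[OF mod_F I_submodule submodule_vimage[OF mod_F mod_F diff_linear
        I_submodule]])
qed (auto simp: diff_mult I_closed eps_closed diff_closed I_mult eps_I diff_relations
    submoduleD(3)[OF I_submodule])

end

context forms_algebra
begin

interpretation A: unital_algebra k A by (rule A)
interpretation F: unital_algebra k F by (rule alg_F)
interpretation \<Omega>: unital_algebra k \<Omega> by (rule alg_\<Omega>)

subsection \<open>The differential graded algebra of forms\<close>

abbreviation "form_proj p \<equiv> quotient_map F I (proj p)"

lemma form_of_eq: "form_of k A a = q (elt a)"
  by (rule form_of_def)

lemma forms_grading_eq: "forms_grading k A p = (\<lambda>x. q x) ` homogeneous p"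
  unfolding forms_grading_def homogeneous_def by blast

lemma forms_sign_eq: "forms_sign k A = quotient_map F I eps"
  unfolding forms_sign_def eps_def[abs_def] by (rule refl)

lemma forms_diff_q: "x \<in> carrier F \<Longrightarrow> forms_diff k A (q x) = q (diff x)"
  unfolding forms_diff_def by (rule quotient_map_coset[OF mod_F I_submodule diff_linear diff_I])

lemma forms_sign_q: "x \<in> carrier F \<Longrightarrow> forms_sign k A (q x) = q (eps x)"
  unfolding forms_sign_eq by (rule quotient_map_coset[OF mod_F I_submodule eps_linear eps_I])

lemma form_proj_q: "x \<in> carrier F \<Longrightarrow> form_proj p (q x) = q (proj p x)"
  by (rule quotient_map_coset[OF mod_F I_submodule proj_linear proj_I])

lemma forms_maps_linear:
  "linear_map k \<Omega> \<Omega> (forms_diff k A)" "linear_map k \<Omega> \<Omega> (forms_sign k A)" "linear_map k \<Omega> \<Omega>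
      (form_proj p)"
  unfolding forms_def forms_diff_def forms_sign_eq
  by - (rule linear_map_quotient_map[OF mod_F I_submodule diff_linear diff_I]
      linear_map_quotient_map[OF mod_F I_submodule eps_linear eps_I]
      linear_map_quotient_map[OF mod_F I_submodule proj_linear proj_I], assumption?)+

lemma forms_grading_submodule: "submodule (forms_grading k A p) k \<Omega>"
proof (rule submoduleI'[OF mod_\<Omega>])
  note H = submoduleD[OF homogeneous_submodule[of p]]
  show "forms_grading k A p \<subseteq> carrier \<Omega>" using q_closed homogeneous_closed by (auto simp:
      forms_grading_eq)
  show "\<zero>\<^bsub>\<Omega>\<^esub> \<in> forms_grading k A p"
    using H(2) linear_map_0[OF mod_F mod_\<Omega> q_linear] unfolding forms_grading_eq by (metis imageI)
  show "x \<oplus>\<^bsub>\<Omega>\<^esub> y \<in> forms_grading k A p" if "x \<in> forms_grading k A p" "y \<in> forms_grading k A p" for x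
      y
    using that H(1,3) unfolding forms_grading_eq by (auto simp: q_add[symmetric])
  show "r \<odot>\<^bsub>\<Omega>\<^esub> x \<in> forms_grading k A p" if "r \<in> carrier k" "x \<in> forms_grading k A p" for r x
    using that H(1,4) unfolding forms_grading_eq by (auto simp: q_smult[symmetric])
qed

lemma q_grading: "f \<in> homogeneous p \<Longrightarrow> q f \<in> forms_grading k A p"
  unfolding forms_grading_eq by (rule imageI)

lemma forms_gradingE:
  assumes "x \<in> forms_grading k A p"
  obtains f where "f \<in> homogeneous p" and "f \<in> carrier F" and "x = q f"
  using assms homogeneous_closed unfolding forms_grading_eq by blast

lemma diff_homogeneous: "f \<in> homogeneous p \<Longrightarrow> diff f \<in> homogeneous (Suc p)"
proof -
  assume f: "f \<in> homogeneous p"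
  have "f \<in> {f \<in> carrier F. diff f \<in> homogeneous (Suc p)}"
    by (rule homogeneous_minimal[OF submodule_vimage[OF mod_F mod_F diff_linear
        homogeneous_submodule] _ f])
      (use word_diff_homogeneous in \<open>simp add: basis_F diff_basis, blast\<close>)
  then show ?thesis by simp
qed

text \<open>The projections of the free algebra preserve the ideal and so descend to forms, where
  they separate the images of the homogeneous parts.\<close>

lemma graded_forms: "graded_module k \<Omega> (forms_grading k A) form_proj"
proof (rule graded_module.intro[OF mod_\<Omega> forms_grading_submodule forms_maps_linear(3)])
  have pr: "proj p f = f" if "f \<in> homogeneous p" for p f using proj_homogeneous[OF that, of p]
      by simp
  show "form_proj p x = x" if "x \<in> forms_grading k A p" for x p
    using that by (elim forms_gradingE) (simp add: form_proj_q pr)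
  show "form_proj p x = \<zero>\<^bsub>\<Omega>\<^esub>" if "x \<in> forms_grading k A r" "r \<noteq> p" for x p r
    using that by (elim forms_gradingE)
      (simp add: form_proj_q proj_homogeneous linear_map_0[OF mod_F mod_\<Omega> q_linear])
  show "carrier \<Omega> \<subseteq> H" if H: "submodule H k \<Omega>" and G: "\<And>p. forms_grading k A p \<subseteq> H" for H
  proof
    fix x assume "x \<in> carrier \<Omega>"
    then obtain f where f: "f \<in> carrier F" "x = q f" unfolding \<Omega>_carrier by blast
    have "f \<in> {f \<in> carrier F. q f \<in> H}"
    proof (rule F_subset_submodule[where P = "\<lambda>_. True", OF submodule_vimage[OF mod_F mod_\<Omega> q_linear
        H] _ f(1)])
      show "basis k w \<in> {f \<in> carrier F. q f \<in> H}" if "w \<in> lists X" for w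
        using G q_grading[OF homogeneous_basis[OF that]] basis_F[OF that] by blast
    qed simp
    with f show "x \<in> H" by simp
  qed
qed

text \<open>A word is the product of its letters. The guard on the degree in the assumption about
  \<open>dif\<close> lets the same induction cover words of degree zero for a \<open>Q\<close> that
  contains no differentials.\<close>

lemma generated_words:
  assumes one: "\<one>\<^bsub>\<Omega>\<^esub> \<in> Q 0" and elt: "\<And>a. a \<in> carrier A \<Longrightarrow> q (elt a) \<in> Q 0"
    and dif: "\<And>a. a \<in> carrier A \<Longrightarrow> word_degree w \<noteq> 0 \<Longrightarrow> q (dif a) \<in> Q (Suc 0)"
    and mult: "\<And>p r x y. \<lbrakk>x \<in> Q p; y \<in> Q r\<rbrakk> \<Longrightarrow> x \<otimes>\<^bsub>\<Omega>\<^esub> y \<in> Q (p + r)" and w: "w \<in> lists X"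
  shows "q (basis k w) \<in> Q (word_degree w)"
  using w dif
proof (induction w rule: word_degree.induct)
  case 1
  show ?case using one by (simp add: q_one[symmetric] one_F)
next
  case (2 a w)
  then have a: "a \<in> carrier A" and w: "w \<in> lists X" by auto
  have "q (elt a) \<otimes>\<^bsub>\<Omega>\<^esub> q (basis k w) \<in> Q (0 + word_degree w)"
    by (rule mult[OF elt[OF a] 2(1)[OF w]]) (use 2(3) in simp)
  then show ?case using elt_F[OF a] basis_F[OF w] by (simp add: q_mult[symmetric] basis_mult_F)
next
  case (3 a w)
  then have a: "a \<in> carrier A" and w: "w \<in> lists X" by auto
  have d: "q (dif a) \<in> Q (Suc 0)" if "a \<in> carrier A" for a using 3(3)[OF that] by simp
  have "q (dif a) \<otimes>\<^bsub>\<Omega>\<^esub> q (basis k w) \<in> Q (Suc 0 + word_degree w)"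
    by (rule mult[OF d[OF a] 3(1)[OF w d]])
  then show ?case using dif_F[OF a] basis_F[OF w] by (simp add: q_mult[symmetric] basis_mult_F)
qed

lemma homogeneous_q_subset:
  assumes H: "submodule H k \<Omega>" and "\<And>w. \<lbrakk>w \<in> lists X; word_degree w = p\<rbrakk> \<Longrightarrow> q (basis k w) \<in> H"
    and "x \<in> forms_grading k A p"
  shows "x \<in> H"
proof -
  obtain f where f: "f \<in> homogeneous p" "x = q f" using assms(3) unfolding forms_grading_eq by blast
  have "f \<in> {f \<in> carrier F. q f \<in> H}"
    by (rule homogeneous_minimal[OF submodule_vimage[OF mod_F mod_\<Omega> q_linear H] _ f(1)])
      (use assms(2) basis_F in simp)
  with f show ?thesis by simp
qed

lemma form_of_G0: "a \<in> carrier A \<Longrightarrow> form_of k A a \<in> forms_grading k A 0"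
  unfolding form_of_eq by (rule q_grading[OF homogeneous_elt])

lemma diff_form_of: "a \<in> carrier A \<Longrightarrow> forms_diff k A (form_of k A a) = q (dif a)"
  by (simp add: form_of_eq forms_diff_q elt_F diff_gen)

lemma form_of_linear: "linear_map k A \<Omega> (form_of k A)"
  unfolding form_of_eq[abs_def]
  by (rule linear_mapI) (simp_all add: q_closed elt_F form_of_add form_of_smult)

lemma form_of_one': "form_of k A \<one>\<^bsub>A\<^esub> = \<one>\<^bsub>\<Omega>\<^esub>"
  unfolding form_of_eq by (rule form_of_one)

text \<open>A word of degree zero consists of symbols \<open>Elt\<close>, whose product is again
  given by a single such symbol modulo the relations. Combinations of these stay in the image of
  \<open>A\<close> by linearity of \<open>form_of\<close>.\<close>

lemma grading_0_form_of:
  assumes "x \<in> forms_grading k A 0"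
  obtains a where "a \<in> carrier A" and "x = form_of k A a"
proof -
  let ?H = "form_of k A ` carrier A"
  note D = linear_mapD[OF form_of_linear]
  have "x \<in> ?H"
  proof (rule homogeneous_q_subset[OF _ _ assms])
    show "submodule ?H k \<Omega>"
    proof (rule submoduleI'[OF mod_\<Omega>])
      show "\<zero>\<^bsub>\<Omega>\<^esub> \<in> ?H" using linear_map_0[OF A.module_axioms mod_\<Omega> form_of_linear] by (metis
          A.zero_closed imageI)
    qed (auto simp: D(1) D(2,3)[symmetric])
    show "q (basis k w) \<in> ?H" if "w \<in> lists X" "word_degree w = 0" for w
    proof -
      have "q (basis k w) \<in> (\<lambda>_. ?H) (word_degree w)"
      proof (rule generated_words[OF _ _ _ _ that(1)])
        show "\<one>\<^bsub>\<Omega>\<^esub> \<in> ?H" using form_of_one' by (metis A.one_closed imageI)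
        show "q (elt a) \<in> ?H" if "a \<in> carrier A" for a using that by (simp add:
            form_of_eq[symmetric])
        show "x \<otimes>\<^bsub>\<Omega>\<^esub> y \<in> ?H" if "x \<in> ?H" "y \<in> ?H" for x y
          using that by (auto simp: form_of_eq form_of_mult[symmetric])
      qed (use that in simp)
      then show ?thesis .
    qed
  qed
  then show ?thesis using that by blast
qed

lemma generated_dga_forms:
  "generated_dga k \<Omega> (forms_grading k A) form_proj (forms_diff k A) (forms_sign k A)"
proof (intro generated_dga.intro dga.intro dga_axioms.intro generated_dga_axioms.intro graded_forms
    alg_\<Omega> forms_maps_linear)
  show "\<one>\<^bsub>\<Omega>\<^esub> \<in> forms_grading k A 0" using form_of_G0[of "\<one>\<^bsub>A\<^esub>"] by (simp add: form_of_one')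
  show "x \<otimes>\<^bsub>\<Omega>\<^esub> y \<in> forms_grading k A (p + r)" if x: "x \<in> forms_grading k A p" and y: "y \<in>
      forms_grading k A r" for x y p r
  proof -
    obtain f g where f: "f \<in> homogeneous p" "f \<in> carrier F" "x = q f" and g: "g \<in> homogeneous r" "g
        \<in> carrier F" "y = q g"
      using forms_gradingE[OF x] forms_gradingE[OF y] by metis
    show ?thesis using q_grading[OF homogeneous_mult[OF f(1) g(1)]] f g by (simp add: q_mult)
  qed
  show "forms_diff k A x \<in> forms_grading k A (Suc p)" if "x \<in> forms_grading k A p" for x p
    using that by (elim forms_gradingE) (simp add: forms_diff_q q_grading diff_homogeneous)
  show "forms_diff k A (forms_diff k A x) = \<zero>\<^bsub>\<Omega>\<^esub>" if "x \<in> carrier \<Omega>" for x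
    using that unfolding \<Omega>_carrier
    by (auto simp: forms_diff_q diff_closed diff_diff linear_map_0[OF mod_F mod_\<Omega> q_linear])
  show "forms_sign k A x = signed \<Omega> p x" if "x \<in> forms_grading k A p" for x p
    using that
  proof (rule forms_gradingE)
    fix f assume f: "f \<in> homogeneous p" "f \<in> carrier F" "x = q f"
    show ?thesis unfolding f(3) forms_sign_q[OF f(2)] eps_homogeneous[OF f(1)]
      by (rule signed_linear_map[OF mod_F mod_\<Omega> q_linear f(2)])
  qed
  show "forms_diff k A (x \<otimes>\<^bsub>\<Omega>\<^esub> y) = forms_diff k A x \<otimes>\<^bsub>\<Omega>\<^esub> y \<oplus>\<^bsub>\<Omega>\<^esub> forms_sign k A x \<otimes>\<^bsub>\<Omega>\<^esub> forms_diff k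
      A y"
    if x: "x \<in> carrier \<Omega>" and y: "y \<in> carrier \<Omega>" for x y
  proof -
    obtain f where f: "f \<in> carrier F" "x = q f" using x unfolding \<Omega>_carrier by blast
    obtain g where g: "g \<in> carrier F" "y = q g" using y unfolding \<Omega>_carrier by blast
    note cl = f(1) g(1) diff_closed[OF f(1)] diff_closed[OF g(1)] eps_closed[OF f(1)]
    have "forms_diff k A (x \<otimes>\<^bsub>\<Omega>\<^esub> y) = q (diff (f \<otimes>\<^bsub>F\<^esub> g))"
      unfolding f(2) g(2) q_mult[OF cl(1,2), symmetric] by (rule forms_diff_q[OF F.m_closed[OF
          cl(1,2)]])
    also have "\<dots> = q (diff f) \<otimes>\<^bsub>\<Omega>\<^esub> q g \<oplus>\<^bsub>\<Omega>\<^esub> q (eps f) \<otimes>\<^bsub>\<Omega>\<^esub> q (diff g)"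
      unfolding diff_mult[OF cl(1,2)] using cl by (simp add: q_add q_mult)
    finally show ?thesis unfolding f(2) g(2) forms_diff_q[OF cl(1)] forms_diff_q[OF cl(2)]
        forms_sign_q[OF cl(1)] .
  qed
  \<comment> \<open>A form of degree \<open>p\<close> is a combination of words of that degree, and
    each letter is either an element of degree zero or the differential of one.\<close>
  show "x \<in> Q p"
    if Q: "\<And>p. submodule (Q p) k \<Omega>" and 0: "\<And>x. x \<in> forms_grading k A 0 \<Longrightarrow> x \<in> Q 0"
      and 1: "\<And>x. x \<in> forms_grading k A 0 \<Longrightarrow> forms_diff k A x \<in> Q (Suc 0)"
      and mult: "\<And>p r x y. \<lbrakk>x \<in> Q p; y \<in> Q r\<rbrakk> \<Longrightarrow> x \<otimes>\<^bsub>\<Omega>\<^esub> y \<in> Q (p + r)"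
      and x: "x \<in> forms_grading k A p" for Q x p
  proof (rule homogeneous_q_subset[OF Q _ x])
    fix w assume w: "w \<in> lists X" "word_degree w = p"
    have "q (basis k w) \<in> Q (word_degree w)"
    proof (rule generated_words[where Q = Q, OF _ _ _ mult w(1)])
      show "\<one>\<^bsub>\<Omega>\<^esub> \<in> Q 0" using 0[OF form_of_G0[of "\<one>\<^bsub>A\<^esub>"]] by (simp add: form_of_one')
      show "q (elt a) \<in> Q 0" if "a \<in> carrier A" for a using 0[OF form_of_G0[OF that]] by (simp add:
          form_of_eq)
      show "q (dif a) \<in> Q (Suc 0)" if "a \<in> carrier A" for a
        using 1[OF form_of_G0[OF that]] by (simp add: diff_form_of that)
    qed
    then show "q (basis k w) \<in> Q p" using w by simp
  qed
qed

end

section \<open>Extended twisting maps\<close>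

lemma forms_twist_intertwines:
  assumes "forms_twisting_map k A B R S" and A: "unital_algebra k A" and B: "unital_algebra k B"
  shows "intertwines k A B (forms k A) (forms k B) R S (form_of k B) (form_of k A) (form_of k A)
      (form_of k B)"
  unfolding intertwines_def
proof (intro ballI)
  interpret A: forms_algebra k A by (rule forms_algebra.intro[OF A])
  interpret B: forms_algebra k B by (rule forms_algebra.intro[OF B])
  note mods = unital_algebra_module[OF A] unital_algebra_module[OF B] A.mod_\<Omega> B.mod_\<Omega>
  fix b a assume b: "b \<in> carrier B" and a: "a \<in> carrier A"
  have "tensor_map k (forms k B) (forms k A) (form_of k B) (form_of k A) (pure k B A b a) =
      pure k (forms k B) (forms k A) (form_of k B b) (form_of k A a)"
    by (rule tensor_map_pure[OF mods(2,1,4,3) B.form_of_linear A.form_of_linear b a])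
  then show "S (pure k (forms k B) (forms k A) (form_of k B b) (form_of k A a)) =
      tensor_map k (forms k A) (forms k B) (form_of k A) (form_of k B) (R (pure k B A b a))"
    using assms(1) pure_closed[OF mods(2,1) b a] by (auto simp: forms_twisting_map_def)
qed

text \<open>Forms of degree zero come from the algebra, and on them \<open>S\<close> is determined
  by \<open>R\<close>. So the bidegree condition in degree zero is the extension property, and the
  unit conditions there are those of \<open>R\<close>.\<close>

lemma generated_twist_forms:
  assumes A: "unital_algebra k A" and B: "unital_algebra k B"
    and R: "unital_twisting_map k A B R" and S: "forms_twisting_map k A B R S"
  shows "generated_twist k (forms k A) (forms_grading k A) (forms_algebra.form_proj k A) (forms_diff
      k A) (forms_sign k A)
    (forms k B) (forms_grading k B) (forms_algebra.form_proj k B) (forms_diff k B) (forms_sign k B)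
        S"
proof -
  interpret A: forms_algebra k A by (rule forms_algebra.intro[OF A])
  interpret B: forms_algebra k B by (rule forms_algebra.intro[OF B])
  interpret A': generated_dga k "forms k A" "forms_grading k A" A.form_proj "forms_diff k A"
      "forms_sign k A"
    by (rule A.generated_dga_forms)
  interpret B': generated_dga k "forms k B" "forms_grading k B" B.form_proj "forms_diff k B"
      "forms_sign k B"
    by (rule B.generated_dga_forms)
  interpret R: twist k A B R
    by (rule twist_of_twisting_map[OF A B]) (use R in \<open>simp add: unital_twisting_map_def\<close>)
  interpret S: twist k "forms k A" "forms k B" S
    by (rule twist_of_twisting_map[OF A.alg_\<Omega> B.alg_\<Omega>]) (use S in \<open>simp add:
        forms_twisting_map_def\<close>)
  have form: "S (pure k (forms k B) (forms k A) (form_of k B b) (form_of k A a)) =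
      tensor_map k (forms k A) (forms k B) (form_of k A) (form_of k B) (R (pure k B A b a))"
    if "b \<in> carrier B" "a \<in> carrier A" for a b
    using forms_twist_intertwines[OF S A B] that by (simp add: intertwines_def)
  have map_pure: "tensor_map k (forms k A) (forms k B) (form_of k A) (form_of k B) (pure k A B a b)
      =
      pure k (forms k A) (forms k B) (form_of k A a) (form_of k B b)" if "b \<in> carrier B" "a \<in>
          carrier A" for a b
    by (rule tensor_map_pure[OF R.mod_A R.mod_B S.mod_A S.mod_B A.form_of_linear B.form_of_linear
        that(2,1)])
  have R1: "R (pure k B A \<one>\<^bsub>B\<^esub> a) = pure k A B a \<one>\<^bsub>B\<^esub>" if "a \<in> carrier A" for a
    using R that by (simp add: unital_twisting_map_def)
  have R2: "R (pure k B A b \<one>\<^bsub>A\<^esub>) = pure k A B \<one>\<^bsub>A\<^esub> b" if "b \<in> carrier B" for b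
    using R that by (simp add: unital_twisting_map_def)
  have ones: "\<one>\<^bsub>A\<^esub> \<in> carrier A" "\<one>\<^bsub>B\<^esub> \<in> carrier B"
    using A B by (auto simp: unital_algebra_def intro: monoid.one_closed ring.is_monoid)
  show ?thesis
  proof (intro generated_twist.intro generated_twist_axioms.intro A'.generated_dga_axioms
      B'.generated_dga_axioms S.twist_axioms)
    show "S (pure k (forms k B) (forms k A) b a) \<in> tensor_span k (forms k A) (forms k B)
        (forms_grading k A 0) (forms_grading k B 0)"
      if b: "b \<in> forms_grading k B 0" and a: "a \<in> forms_grading k A 0" for a b
    proof -
      obtain a' where a': "a' \<in> carrier A" "a = form_of k A a'" by (rule A.grading_0_form_of[OF a])
      obtain b' where b': "b' \<in> carrier B" "b = form_of k B b'" by (rule B.grading_0_form_of[OF b])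
      have "R (pure k B A b' a') \<in> tensor_span k A B (carrier A) (carrier B)"
        using R.S_closed pure_closed[OF R.mod_B R.mod_A b'(1) a'(1)] tensor_span_carrier[OF R.mod_A
            R.mod_B] by simp
      then show ?thesis unfolding a'(2) b'(2) form[OF b'(1) a'(1)]
        by (intro tensor_map_span[OF R.mod_A R.mod_B S.mod_A S.mod_B A.form_of_linear
            B.form_of_linear
              A.form_of_G0 B.form_of_G0 subset_refl subset_refl])
          (use A'.G_closed B'.G_closed in auto)
    qed
    show "S (pure k (forms k B) (forms k A) \<one>\<^bsub>forms k B\<^esub> a) = pure k (forms k A) (forms k B) a
        \<one>\<^bsub>forms k B\<^esub>"
      if a: "a \<in> forms_grading k A 0" for a
    proof -
      obtain a' where a': "a' \<in> carrier A" "a = form_of k A a'" by (rule A.grading_0_form_of[OF a])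
      show ?thesis using form[OF ones(2) a'(1)] ones a' by (simp add: B.form_of_one' R1 map_pure)
    qed
    show "S (pure k (forms k B) (forms k A) b \<one>\<^bsub>forms k A\<^esub>) = pure k (forms k A) (forms k B) \<one>\<^bsub>forms
        k A\<^esub> b"
      if b: "b \<in> forms_grading k B 0" for b
    proof -
      obtain b' where b': "b' \<in> carrier B" "b = form_of k B b'" by (rule B.grading_0_form_of[OF b])
      show ?thesis using form[OF b'(1) ones(1)] ones b' by (simp add: A.form_of_one' R2 map_pure)
    qed
    note cl = pure_closed[OF S.mod_B S.mod_A]
    show "intertwines k (forms k A) (forms k B) (forms k A) (forms k B) S S (forms_diff k B) id
        (forms_sign k A) (forms_diff k B)"
      unfolding intertwines_def
    proof (intro ballI)
      fix b a assume b: "b \<in> carrier (forms k B)" and a: "a \<in> carrier (forms k A)"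
      have "tensor_map k (forms k B) (forms k A) (forms_diff k B) id (pure k (forms k B) (forms k A)
          b a) =
          pure k (forms k B) (forms k A) (forms_diff k B b) (id a)"
        by (rule tensor_map_pure[OF S.mod_B S.mod_A S.mod_B S.mod_A B'.d_linear linear_map_id' b a])
      then show "S (pure k (forms k B) (forms k A) (forms_diff k B b) (id a)) =
          tensor_map k (forms k A) (forms k B) (forms_sign k A) (forms_diff k B) (S (pure k (forms k
              B) (forms k A) b a))"
        using S cl[OF b a] by (auto simp: forms_twisting_map_def)
    qed
    show "intertwines k (forms k A) (forms k B) (forms k A) (forms k B) S S id (forms_diff k A)
        (forms_diff k A) (forms_sign k B)"
      unfolding intertwines_def
    proof (intro ballI)
      fix b a assume b: "b \<in> carrier (forms k B)" and a: "a \<in> carrier (forms k A)"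
      have "tensor_map k (forms k B) (forms k A) id (forms_diff k A) (pure k (forms k B) (forms k A)
          b a) =
          pure k (forms k B) (forms k A) (id b) (forms_diff k A a)"
        by (rule tensor_map_pure[OF S.mod_B S.mod_A S.mod_B S.mod_A linear_map_id' A'.d_linear b a])
      then show "S (pure k (forms k B) (forms k A) (id b) (forms_diff k A a)) =
          tensor_map k (forms k A) (forms k B) (forms_diff k A) (forms_sign k B) (S (pure k (forms k
              B) (forms k A) b a))"
        using S cl[OF b a] by (auto simp: forms_twisting_map_def)
    qed
  qed
qed

lemma tensor_grading_twisted_tensor [simp]:
  "tensor_grading k (twisted_tensor k A B S) C = tensor_grading k (tensor k A B) C"
  by (simp add: fun_eq_iff tensor_grading_def)

theorem theorem2p16:
  fixes k :: "'k ring"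
    and A :: "('k, 'a) module" and B :: "('k, 'b) module" and C :: "('k, 'c) module"
  assumes "unital_algebra k A" and "unital_algebra k B" and "unital_algebra k C"
    and "unital_twisting_map k A B R1"
    and "unital_twisting_map k B C R2"
    and "unital_twisting_map k A C R3"
    and "hexagon k A B C R1 R2 R3"
    and "forms_twisting_map k A B R1 S1"
    and "forms_twisting_map k B C R2 S2"
    and "forms_twisting_map k A C R3 S3"
  shows "hexagon k (forms k A) (forms k B) (forms k C) S1 S2 S3 \<and>
    dg_algebra k
      (iterated_twisted_tensor k (forms k A) (forms k B) (forms k C) S1 S2 S3)
      (triple_forms_grading k A B C)
      (triple_forms_diff k A B C)"
proof -
  interpret A: forms_algebra k A by (rule forms_algebra.intro[OF assms(1)])
  interpret B: forms_algebra k B by (rule forms_algebra.intro[OF assms(2)])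
  interpret C: forms_algebra k C by (rule forms_algebra.intro[OF assms(3)])
  let ?A = "forms k A" and ?B = "forms k B" and ?C = "forms k C"
  interpret R: triple_twist k A B C R1 R2 R3
    by (intro triple_twist.intro twist_of_twisting_map)
      (use assms in \<open>simp_all add: unital_twisting_map_def\<close>)
  interpret gab: generated_twist k ?A "forms_grading k A" A.form_proj "forms_diff k A" "forms_sign k
      A"
    ?B "forms_grading k B" B.form_proj "forms_diff k B" "forms_sign k B" S1
    by (rule generated_twist_forms[OF assms(1,2,4,8)])
  interpret gbc: generated_twist k ?B "forms_grading k B" B.form_proj "forms_diff k B" "forms_sign k
      B"
    ?C "forms_grading k C" C.form_proj "forms_diff k C" "forms_sign k C" S2
    by (rule generated_twist_forms[OF assms(2,3,5,9)])
  interpret gac: generated_twist k ?A "forms_grading k A" A.form_proj "forms_diff k A" "forms_sign k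
      A"
    ?C "forms_grading k C" C.form_proj "forms_diff k C" "forms_sign k C" S3
    by (rule generated_twist_forms[OF assms(1,3,6,10)])
  interpret S: dga_triple k ?A "forms_grading k A" A.form_proj "forms_diff k A" "forms_sign k A"
    ?B "forms_grading k B" B.form_proj "forms_diff k B" "forms_sign k B"
    ?C "forms_grading k C" C.form_proj "forms_diff k C" "forms_sign k C" S1 S2 S3
    by (intro dga_triple.intro triple_twist.intro gab.dga_twist_axioms gbc.dga_twist_axioms
        gac.dga_twist_axioms
        gab.twist_axioms gbc.twist_axioms gac.twist_axioms)
  note i = forms_twist_intertwines[OF assms(8,1,2)] forms_twist_intertwines[OF assms(9,2,3)]
    forms_twist_intertwines[OF assms(10,1,3)]
  have hex_0: "S.hex c b a"
    if c: "c \<in> forms_grading k C 0" and b: "b \<in> forms_grading k B 0" and a: "a \<in> forms_grading k A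
        0" for a b c
  proof -
    obtain a' where a': "a' \<in> carrier A" "a = form_of k A a'" by (rule A.grading_0_form_of[OF a])
    obtain b' where b': "b' \<in> carrier B" "b = form_of k B b'" by (rule B.grading_0_form_of[OF b])
    obtain c' where c': "c' \<in> carrier C" "c = form_of k C c'" by (rule C.grading_0_form_of[OF c])
    \<comment> \<open>All maps fed into \<open>hex_map\<close> are the inclusions
      \<open>form_of\<close>: in degree zero the equation is the image of the given one.\<close>
    have "R.hex c' b' a'" using assms(7) a' b' c' by (simp add: R.hexagon_iff)
    then show ?thesis unfolding a'(2) b'(2) c'(2)
      by (intro hex_map[OF R.triple_twist_axioms S.triple_twist_axioms i(1,3,2,2,3,1)])
        (rule A.form_of_linear B.form_of_linear C.form_of_linear a' b' c' | assumption)+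
  qed
  have hex: "S.hex c b a" if "c \<in> carrier ?C" "b \<in> carrier ?B" "a \<in> carrier ?A" for a b c
    by (rule S.hex_generated[OF A.generated_dga_forms B.generated_dga_forms C.generated_dga_forms
        hex_0 that])
  \<comment> \<open>The construction is repeated with the twisted product of the first two algebras
    of forms in place of the first factor.\<close>
  interpret T: dga_twist k S.AB gab.GT gab.\<pi>T gab.dT gab.eT
    ?C "forms_grading k C" C.form_proj "forms_diff k C" "forms_sign k C" S.T1
    by (rule S.dga_twist_iterated[OF hex])
  interpret D: dga k T.AB T.GT T.\<pi>T T.dT T.eT
    by (rule T.dga_T)
  have "dg_algebra k T.AB T.GT (triple_forms_diff k A B C)"
  proof (rule D.dg_algebra_dga)
    fix t assume "t \<in> carrier T.AB"
    then have t: "t \<in> carrier S.V" by simp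
    note ints = linear_map_add[OF S.mod_V S.mod_V] linear_map_tensor_map gab.dT_linear S.lins
        linear_map_id'
    let ?d1 = "tensor_map k ?A ?B (forms_diff k A) id" and ?d2 = "tensor_map k ?A ?B (forms_sign k
        A) (forms_diff k B)"
    let ?m = "\<lambda>f. tensor_map k (tensor k ?A ?B) ?C f id"
    have d: "linear_map k (tensor k ?A ?B) (tensor k ?A ?B) ?d1" "linear_map k (tensor k ?A ?B)
        (tensor k ?A ?B) ?d2"
      by (rule ints)+
    \<comment> \<open>The iterated differential has two terms, with \<open>gab.dT\<close> on the
      first two factors and with \<open>dC\<close> on the third. Splitting the former gives the
      three terms of the claimed formula; the sign \<open>gab.eT\<close> already is the product of
      the two signs.\<close>
    have "?m gab.dT t = ?m ?d1 t \<oplus>\<^bsub>S.V\<^esub> ?m ?d2 t"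
    proof (rule tensor_ext[OF gab.mod_T gbc.mod_B S.mod_V _ _ _ t])
      show "linear_map k S.V S.V (?m gab.dT)" "linear_map k S.V S.V (\<lambda>t. ?m ?d1 t \<oplus>\<^bsub>S.V\<^esub> ?m ?d2 t)"
        by (rule ints)+
      fix u z assume u: "u \<in> carrier (tensor k ?A ?B)" and z: "z \<in> carrier ?C"
      have m: "?m f (pure k (tensor k ?A ?B) ?C u z) = pure k (tensor k ?A ?B) ?C (f u) z"
        if "linear_map k (tensor k ?A ?B) (tensor k ?A ?B) f" for f
        using tensor_map_pure[OF gab.mod_T gbc.mod_B gab.mod_T gbc.mod_B that linear_map_id' u z]
            by simp
      show "?m gab.dT (pure k (tensor k ?A ?B) ?C u z) =
          ?m ?d1 (pure k (tensor k ?A ?B) ?C u z) \<oplus>\<^bsub>S.V\<^esub> ?m ?d2 (pure k (tensor k ?A ?B) ?C u z)"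
        unfolding m[OF d(1)] m[OF d(2)] m[OF gab.dT_linear] gab.dT_def
        by (rule linear_mapD(2)[OF bilinearD(2)[OF bilinear_pure[OF gab.mod_T gbc.mod_B] z]])
          (rule linear_mapD(1)[OF d(1) u] linear_mapD(1)[OF d(2) u])+
    qed
    then show "triple_forms_diff k A B C t = T.dT t"
      by (simp add: triple_forms_diff_def T.dT_def Let_def)
  qed
  moreover have "T.GT = triple_forms_grading k A B C"
    by (simp add: triple_forms_grading_def)
  ultimately show ?thesis
    using hex by (simp add: S.hexagon_iff iterated_twisted_tensor_def)
qed

end
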